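(* Fix a line $L_\infty\subset\mathbb{P}^2_{\mathbb{R}}$ defined over $\mathbb{R}$. Let $Q\subset\mathbb{P}^2_{\mathbb{R}}$ be a smooth plane quartic curve defined over $\mathbb{R}$ that does not meet $L_\infty$ over $\mathbb{R}$, i.e. $Q(\mathbb{R})\cap L_\infty(\mathbb{R})=\varnothing$. Then \[\#\{\text{real bitangents } L \text{ of } Q \text{ with } \operatorname{Qtype}_{L_\infty}(L)=\langle 1\rangle\}-\#\{\text{real bitangents } L \text{ of } Q \text{ with } \operatorname{Qtype}_{L_\infty}(L)=\langle -1\rangle\}=4.\] Therefore \[\sum_{\text{lines } L \text{ bitangent to } Q}\operatorname{Tr}_{k(L)/\mathbb{R}}\operatorname{Qtype}_{L_\infty}(L)=16\langle 1\rangle+12\langle -1\rangle\in \mathrm{GW}(\mathbb{R}).\]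
   Context: Let $k$ be a field of characteristic different from $2$ (here $k=\mathbb{R}$). $\mathrm{GW}(K)$ is the Grothendieck-Witt ring of a field $K$, and for $a\in K^*$, $\langle a\rangle\in\mathrm{GW}(K)$ is the class of the rank one form $(x,y)\mapsto axy$. For a finite separable extension $K/k$, $\operatorname{Tr}_{K/k}:\mathrm{GW}(K)\to\mathrm{GW}(k)$ is the transfer obtained by composing a form with the field trace $K\to k$. A line in $\mathbb{P}^2_k$ means a closed point $[L]$ of the dual plane $(\mathbb{P}^2_k)^\vee$, with residue field $k(L)$. When $k(L)=K$, one regards $L$ as a line in $\mathbb{P}^2_K$ defined over $K$, by choosing one line in the Galois orbit. A line $L$ over $K$ is bitangent to a smooth quartic $Q=V(f)$ if $Q_K\cap L=2Z$ for a degree $2$ divisor $Z=z_1+z_2$ on $L$ (the case $z_1=z_2$, a hyperflex, is allowed). Over $\bar k$ there are exactly $28$ bitangents. Sums over bitangent lines are over closed points of $(\mathbb{P}^2_k)^\vee$. A real bitangent is a bitangent line defined over $\mathbb{R}$. Type of a bitangent: fix a line $L_\infty$ over $k$, and suppose $L$ (with residue field $K$) is bitangent to $Q=V(f)$ with $2Z=V(f)\cap L$ and $Z\cap L_\infty=\varnothing$. Choose linear forms $\ell$ over $K$ defining $L$ and $\ell_\infty$ over $k$ defining $L_\infty$. On $\mathbb{A}^2_K=\mathbb{P}^2_K\smallsetminus L_\infty$ consider the functions $\tilde f=f/\ell_\infty^4$ and $\tilde\ell=\ell/\ell_\infty$. Since $\tilde f|_L$ vanishes to order at least $2$ at $z_i$,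 there is a unique scalar $\partial_Lf(z_i)$ in the field of definition of $z_i$ with $d\tilde f=\partial_Lf(z_i)\,d\tilde\ell$ at $z_i$. Set \[\operatorname{Qtype}_{L_\infty}(L)=\langle\partial_Lf(z_1)\cdot\partial_Lf(z_2)\rangle\in\mathrm{GW}(K);\] the product is a nonzero element of $K$ well-defined up to $(K^* )^2$. Conventions when $Z\cap L_\infty\neq\varnothing$: if $L_\infty$ is itself a real bitangent (its two tangency points are then complex conjugate, since $Q$ has no real points on $L_\infty$), it is counted with type $\langle 1\rangle$; a bitangent with residue field $\mathbb{C}$ is always given the type $\langle 1\rangle$, the only rank one class in $\mathrm{GW}(\mathbb{C})$. *)

theory Defs
  imports "Jordan_Normal_Form.Matrix" "HOL-Analysis.Analysis" "HOL-Library.Poly_Mapping"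
begin

no_notation Matrix.vec_index (infixl "$" 100)
no_notation Matrix.scalar_prod (infix "\<bullet>" 70)

section \<open>Grothendieck-Witt rings\<close>

text \<open>A nondegenerate symmetric bilinear form on \<open>K\<^sup>n\<close> is given by its Gram matrix. The zero form is
  the \<open>0 \<times> 0\<close> matrix.\<close>

definition nondeg_form :: "'a::field Matrix.mat \<Rightarrow> bool" where
  "nondeg_form A \<longleftrightarrow> square_mat A \<and> transpose_mat A = A \<and> invertible_mat A"

definition isometric :: "'a::field Matrix.mat \<Rightarrow> 'a Matrix.mat \<Rightarrow> bool" where
  "isometric A B \<longleftrightarrow> nondeg_form A \<and> nondeg_form B \<and> dim_row A = dim_row B \<and>
     (\<exists>P \<in> carrier_mat (dim_row A) (dim_row A). invertible_mat P \<and> A = transpose_mat P * B * P)"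

lemma invertible_matI:
  assumes "P \<in> carrier_mat n n" "Q \<in> carrier_mat n n" "P * Q = 1\<^sub>m n" "Q * P = 1\<^sub>m n"
  shows "invertible_mat P"
  using assms unfolding invertible_mat_def inverts_mat_def by (auto simp: square_mat.simps)

lemma invertible_matE:
  assumes "invertible_mat P" "P \<in> carrier_mat n n"
  obtains Q where "Q \<in> carrier_mat n n" "P * Q = 1\<^sub>m n" "Q * P = 1\<^sub>m n"
proof -
  from assms obtain Q where Q: "P * Q = 1\<^sub>m (dim_row P)" "Q * P = 1\<^sub>m (dim_row Q)"
    unfolding invertible_mat_def inverts_mat_def by auto
  have "dim_col Q = n" using arg_cong[OF Q(1), of dim_col] assms(2) by simp
  moreover have "dim_row Q = n" using arg_cong[OF Q(2), of dim_col] assms(2) by simp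
  ultimately show ?thesis using that Q assms(2) by auto
qed

lemma nondeg_form_carrier: "nondeg_form A \<Longrightarrow> A \<in> carrier_mat (dim_row A) (dim_row A)"
  by (auto simp: nondeg_form_def square_mat.simps)

lemma nondeg_formE:
  assumes "nondeg_form A"
  obtains n B where "A \<in> carrier_mat n n" "B \<in> carrier_mat n n" "A * B = 1\<^sub>m n" "B * A = 1\<^sub>m n"
    "transpose_mat A = A" "dim_row A = n"
proof -
  have c: "A \<in> carrier_mat (dim_row A) (dim_row A)" using nondeg_form_carrier[OF assms] .
  have "invertible_mat A" "transpose_mat A = A" using assms by (auto simp: nondeg_form_def)
  from invertible_matE[OF this(1) c] this(2) c show ?thesis using that by blast
qed

lemma nondeg_formI:
  assumes "A \<in> carrier_mat n n" "B \<in> carrier_mat n n" "A * B = 1\<^sub>m n" "B * A = 1\<^sub>m n" "transpose_mat A = A"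
  shows "nondeg_form A"
  using assms invertible_matI[OF assms(1-4)] by (auto simp: nondeg_form_def square_mat.simps)

lemma isometricE:
  assumes "isometric A B"
  obtains n P Q where "A \<in> carrier_mat n n" "B \<in> carrier_mat n n" "P \<in> carrier_mat n n" "Q \<in> carrier_mat n n"
    "P * Q = 1\<^sub>m n" "Q * P = 1\<^sub>m n" "A = transpose_mat P * B * P" "nondeg_form A" "nondeg_form B"
proof -
  obtain P where *: "nondeg_form A" "nondeg_form B" "dim_row A = dim_row B"
     "P \<in> carrier_mat (dim_row A) (dim_row A)" "invertible_mat P" "A = transpose_mat P * B * P"
    using assms unfolding isometric_def by blast
  from invertible_matE[OF *(5,4)] obtain Q where "Q \<in> carrier_mat (dim_row A) (dim_row A)"
    "P * Q = 1\<^sub>m (dim_row A)" "Q * P = 1\<^sub>m (dim_row A)" .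
  moreover have "A \<in> carrier_mat (dim_row A) (dim_row A)" "B \<in> carrier_mat (dim_row A) (dim_row A)"
    using nondeg_form_carrier[OF *(1)] nondeg_form_carrier[OF *(2)] unfolding *(3) by blast+
  ultimately show ?thesis using that[of "dim_row A" P Q] * by blast
qed

lemma isometricI:
  assumes "A \<in> carrier_mat n n" "B \<in> carrier_mat n n" "P \<in> carrier_mat n n" "Q \<in> carrier_mat n n"
    "P * Q = 1\<^sub>m n" "Q * P = 1\<^sub>m n" "A = transpose_mat P * B * P" "nondeg_form A" "nondeg_form B"
  shows "isometric A B"
  using assms invertible_matI[OF assms(3-6)] unfolding isometric_def by auto

lemma isometric_refl:
  assumes "nondeg_form A" shows "isometric A A"
proof -
  from nondeg_formE[OF assms] obtain n where "A \<in> carrier_mat n n" by metis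
  then show ?thesis using assms by (intro isometricI[of A n A "1\<^sub>m n" "1\<^sub>m n"]) auto
qed

lemma isometric_sym:
  assumes "isometric A B" shows "isometric B A"
proof -
  from isometricE[OF assms] obtain n P Q where *:
    "A \<in> carrier_mat n n" "B \<in> carrier_mat n n" "P \<in> carrier_mat n n" "Q \<in> carrier_mat n n"
    "P * Q = 1\<^sub>m n" "Q * P = 1\<^sub>m n" "A = transpose_mat P * B * P" "nondeg_form A" "nondeg_form B" .
  have t: "transpose_mat Q * transpose_mat P = 1\<^sub>m n"
    using transpose_mult[OF *(3,4)] *(5) by simp
  have "transpose_mat Q * A * Q = transpose_mat Q * (transpose_mat P * B * P) * Q" using *(7) by simp
  also have "\<dots> = (transpose_mat Q * transpose_mat P) * B * (P * Q)"
    using *(2-4) by (simp add: assoc_mult_mat[of _ n n _ n _ n])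
  also have "\<dots> = B" unfolding t *(5) using *(2) by simp
  finally show ?thesis using *(1-6,8,9) by (intro isometricI[of B n A Q P]) auto
qed

lemma isometric_trans:
  assumes "isometric A B" "isometric B C" shows "isometric A C"
proof -
  from isometricE[OF assms(1)] obtain n P Q where *:
    "A \<in> carrier_mat n n" "B \<in> carrier_mat n n" "P \<in> carrier_mat n n" "Q \<in> carrier_mat n n"
    "P * Q = 1\<^sub>m n" "Q * P = 1\<^sub>m n" "A = transpose_mat P * B * P" "nondeg_form A" "nondeg_form B" .
  from isometricE[OF assms(2)] obtain m R S where **:
    "B \<in> carrier_mat m m" "C \<in> carrier_mat m m" "R \<in> carrier_mat m m" "S \<in> carrier_mat m m"
    "R * S = 1\<^sub>m m" "S * R = 1\<^sub>m m" "B = transpose_mat R * C * R" "nondeg_form B" "nondeg_form C" .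
  have m: "m = n" using * ** by auto
  note ** = **[unfolded m]
  have "R * P * (Q * S) = R * (P * Q) * S" 
    using *(3,4) **(3,4) by (simp add: assoc_mult_mat[of _ n n _ n _ n])
  then have 1: "R * P * (Q * S) = 1\<^sub>m n" unfolding *(5) using **(3-5) by simp
  have "Q * S * (R * P) = Q * (S * R) * P" 
    using *(3,4) **(3,4) by (simp add: assoc_mult_mat[of _ n n _ n _ n])
  then have 2: "Q * S * (R * P) = 1\<^sub>m n" unfolding **(6) using *(3,4,6) by simp
  have "A = transpose_mat P * (transpose_mat R * C * R) * P" using *(7) **(7) by simp
  also have "\<dots> = transpose_mat (R * P) * C * (R * P)"
    using *(3) **(2,3) by (simp add: assoc_mult_mat[of _ n n _ n _ n] transpose_mult[of _ n n _ n])
  finally show ?thesis using *(1,3,4,8) **(2,3,4,9) by (intro isometricI[of A n C "R * P" "Q * S"] 1 2) auto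
qed

definition osum :: "'a::field Matrix.mat \<Rightarrow> 'a Matrix.mat \<Rightarrow> 'a Matrix.mat" where
  "osum A B = four_block_mat A (0\<^sub>m (dim_row A) (dim_col B)) (0\<^sub>m (dim_row B) (dim_col A)) B"

lemma osum_carrier[simp]:
  "A \<in> carrier_mat n n \<Longrightarrow> B \<in> carrier_mat m m \<Longrightarrow> osum A B \<in> carrier_mat (n + m) (n + m)"
  by (auto simp: osum_def)

lemma osum_mult:
  assumes "A \<in> carrier_mat n n" "A' \<in> carrier_mat n n" "B \<in> carrier_mat m m" "B' \<in> carrier_mat m m"
  shows "osum A B * osum A' B' = osum (A * A') (B * B')"
  unfolding osum_def using assms by (subst mult_four_block_mat[of _ n n _ m _ m]) auto

lemma osum_transpose:
  assumes "A \<in> carrier_mat n n" "B \<in> carrier_mat m m"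
  shows "transpose_mat (osum A B) = osum (transpose_mat A) (transpose_mat B)"
  unfolding osum_def using assms 
  by (subst transpose_four_block_mat[of _ n n _ m _ m]) auto

lemma osum_one: "osum (1\<^sub>m n) (1\<^sub>m m) = 1\<^sub>m (n + m)"
  by (intro eq_matI) (auto simp: osum_def)

lemma nondeg_osum:
  assumes "nondeg_form A" "nondeg_form B" shows "nondeg_form (osum A B)"
proof -
  from nondeg_formE[OF assms(1)] obtain n A' where a: "A \<in> carrier_mat n n" "A' \<in> carrier_mat n n"
    "A * A' = 1\<^sub>m n" "A' * A = 1\<^sub>m n" "transpose_mat A = A" .
  from nondeg_formE[OF assms(2)] obtain m B' where b: "B \<in> carrier_mat m m" "B' \<in> carrier_mat m m"
    "B * B' = 1\<^sub>m m" "B' * B = 1\<^sub>m m" "transpose_mat B = B" .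
  show ?thesis
    by (rule nondeg_formI[of _ "n+m" "osum A' B'"])
       (use a b in \<open>simp_all add: osum_mult[of _ n _ _ m] osum_transpose[of _ n _ m] osum_one\<close>)
qed

lemma isometric_osum:
  assumes "isometric A A'" "isometric B B'" shows "isometric (osum A B) (osum A' B')"
proof -
  from isometricE[OF assms(1)] obtain n P Q where *:
    "A \<in> carrier_mat n n" "A' \<in> carrier_mat n n" "P \<in> carrier_mat n n" "Q \<in> carrier_mat n n"
    "P * Q = 1\<^sub>m n" "Q * P = 1\<^sub>m n" "A = transpose_mat P * A' * P" "nondeg_form A" "nondeg_form A'" .
  from isometricE[OF assms(2)] obtain m R S where **:
    "B \<in> carrier_mat m m" "B' \<in> carrier_mat m m" "R \<in> carrier_mat m m" "S \<in> carrier_mat m m"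
    "R * S = 1\<^sub>m m" "S * R = 1\<^sub>m m" "B = transpose_mat R * B' * R" "nondeg_form B" "nondeg_form B'" .
  have "osum A B = transpose_mat (osum P R) * osum A' B' * osum P R"
    unfolding *(7) **(7) using *(2-4) **(2-4)
    by (simp add: osum_transpose[of _ n _ m] osum_mult[of _ n _ _ m])
  from isometricI[OF _ _ _ _ _ _ this, of "n+m" "osum Q S"] show ?thesis using *(1-6,8,9) **(1-6,8,9)
    by (simp add: osum_mult[of _ n _ _ m] osum_one nondeg_osum)
qed

lemma index_mult_sum:
  assumes "A \<in> carrier_mat n k" "B \<in> carrier_mat k m" "i < n" "j < m"
  shows "(A * B) $$ (i,j) = (\<Sum>l<k. A $$ (i,l) * B $$ (l,j))"
  using assms by (simp add: scalar_prod_def atLeast0LessThan)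

lemma isometric_permute:
  assumes A: "nondeg_form A" "A \<in> carrier_mat n n" and s: "bij_betw s {..<n} {..<n}"
  shows "isometric (Matrix.mat n n (\<lambda>(i,j). A $$ (s i, s j))) A" (is "isometric ?B A")
proof -
  define P where "P = Matrix.mat n n (\<lambda>(i,j). if i = s j then 1 else 0 :: 'a)"
  have Pc: "P \<in> carrier_mat n n" by (simp add: P_def)
  have sl: "s i < n" if "i < n" for i using s that by (auto simp: bij_betw_def)
  have inj: "s i = s j \<longleftrightarrow> i = j" if "i < n" "j < n" for i j 
    using s that by (auto simp: bij_betw_def inj_on_def)
  have TP: "transpose_mat P * P = 1\<^sub>m n"
  proof (rule eq_matI)
    fix i j assume ij: "i < dim_row (1\<^sub>m n :: 'a Matrix.mat)" "j < dim_col (1\<^sub>m n :: 'a Matrix.mat)"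
    have "(transpose_mat P * P) $$ (i,j) = (\<Sum>l<n. (if l = s i then 1 else 0) * (if l = s j then 1 else 0))"
      using ij Pc by (subst index_mult_sum[of _ n n _ n]) (auto simp: P_def)
    also have "\<dots> = (if s i = s j then 1 else 0)" using ij sl 
      by (simp add: if_distrib[of "\<lambda>x. x * _"] sum.delta cong: if_cong)
    finally show "(transpose_mat P * P) $$ (i,j) = 1\<^sub>m n $$ (i,j)" using ij inj by auto
  qed (auto simp: P_def)
  have PT: "P * transpose_mat P = 1\<^sub>m n"
  proof (rule eq_matI)
    fix i j assume ij: "i < dim_row (1\<^sub>m n :: 'a Matrix.mat)" "j < dim_col (1\<^sub>m n :: 'a Matrix.mat)"
    have "(P * transpose_mat P) $$ (i,j) = (\<Sum>l<n. (if i = s l then 1 else 0) * (if j = s l then 1 else 0))"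
      using ij Pc by (subst index_mult_sum[of _ n n _ n]) (auto simp: P_def)
    also have "\<dots> = (\<Sum>l<n. (if i = l then 1 else 0) * (if j = l then 1 else 0))"
      using sum.reindex_bij_betw[OF s, of "\<lambda>l. (if i = l then 1 else 0) * (if j = l then 1 else (0::'a))"] .
    also have "\<dots> = (if i = j then 1 else 0)" using ij 
      by (simp add: if_distrib[of "\<lambda>x. x * _"] sum.delta cong: if_cong)
    finally show "(P * transpose_mat P) $$ (i,j) = 1\<^sub>m n $$ (i,j)" using ij by auto
  qed (auto simp: P_def)
  have B: "?B = transpose_mat P * A * P"
  proof (rule eq_matI)
    fix i j assume "i < dim_row (transpose_mat P * A * P)" "j < dim_col (transpose_mat P * A * P)"
    then have ij: "i < n" "j < n" using Pc by auto
    have 1: "(transpose_mat P * A) $$ (i,l) = A $$ (s i, l)" if "l < n" for l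
    proof -
      have "(transpose_mat P * A) $$ (i,l) = (\<Sum>k<n. (if k = s i then 1 else 0) * A $$ (k,l))"
        using ij Pc A that by (subst index_mult_sum[of _ n n _ n]) (auto simp: P_def intro!: sum.cong)
      also have "\<dots> = A $$ (s i, l)" using ij sl
        by (simp add: if_distrib[of "\<lambda>x. x * _"] sum.delta cong: if_cong)
      finally show ?thesis .
    qed
    have "(transpose_mat P * A * P) $$ (i,j) = (\<Sum>l<n. A $$ (s i, l) * (if l = s j then 1 else 0))"
    proof -
      have "(transpose_mat P * A * P) $$ (i,j) = (\<Sum>l<n. (transpose_mat P * A) $$ (i,l) * P $$ (l,j))"
        using ij Pc A by (subst index_mult_sum[of _ n n _ n]) auto
      also have "\<dots> = (\<Sum>l<n. A $$ (s i, l) * (if l = s j then 1 else 0))"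
      proof (rule sum.cong)
        fix l assume l: "l \<in> {..<n}"
        then have "P $$ (l,j) = (if l = s j then 1 else 0)" using ij by (simp add: P_def)
        with 1[of l] l show "(transpose_mat P * A) $$ (i,l) * P $$ (l,j) = A $$ (s i, l) * (if l = s j then 1 else 0)"
          by (simp only: lessThan_iff)
      qed simp
      finally show ?thesis .
    qed
    also have "\<dots> = A $$ (s i, s j)" using ij sl
      by (simp add: if_distrib sum.delta cong: if_cong)
    finally show "?B $$ (i,j) = (transpose_mat P * A * P) $$ (i,j)" using ij by simp
  qed (auto simp: P_def)
  have "invertible_mat A" and TA: "transpose_mat A = A" using A(1) by (auto simp: nondeg_form_def)
  from invertible_matE[OF this(1) A(2)] obtain A' where 
    A': "A' \<in> carrier_mat n n" "A * A' = 1\<^sub>m n" "A' * A = 1\<^sub>m n" .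
  have "nondeg_form ?B"
  proof (rule nondeg_formI[of _ n "transpose_mat P * A' * P"])
    have "?B * (transpose_mat P * A' * P) = transpose_mat P * A * (P * transpose_mat P) * A' * P"
      unfolding B using Pc A(2) A'(1) by (simp add: assoc_mult_mat[of _ n n _ n _ n])
    also have "\<dots> = transpose_mat P * (A * A') * P"
      using Pc A(2) A'(1) by (simp add: PT assoc_mult_mat[of _ n n _ n _ n])
    also have "\<dots> = 1\<^sub>m n" using Pc by (simp add: A' TP)
    finally show "?B * (transpose_mat P * A' * P) = 1\<^sub>m n" .
    have "(transpose_mat P * A' * P) * ?B = transpose_mat P * A' * (P * transpose_mat P) * A * P"
      unfolding B using Pc A(2) A'(1) by (simp add: assoc_mult_mat[of _ n n _ n _ n])
    also have "\<dots> = transpose_mat P * (A' * A) * P"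
      using Pc A(2) A'(1) by (simp add: PT assoc_mult_mat[of _ n n _ n _ n])
    also have "\<dots> = 1\<^sub>m n" using Pc by (simp add: A' TP)
    finally show "(transpose_mat P * A' * P) * ?B = 1\<^sub>m n" .
    show "transpose_mat ?B = ?B"
    proof (rule eq_matI, goal_cases)
      case (1 i j)
      then have "A $$ (s j, s i) = transpose_mat A $$ (s i, s j)" using A(2) sl by simp
      then show ?case using 1 by (simp add: TA)
    qed auto
  qed (use Pc A' in auto)
  then show ?thesis using A B Pc TP PT by (intro isometricI[of _ n _ P "transpose_mat P"]) auto
qed

lemma osum_index:
  assumes "A \<in> carrier_mat n n" "B \<in> carrier_mat m m" "i < n + m" "j < n + m"
  shows "osum A B $$ (i,j) = (if i < n then if j < n then A $$ (i,j) else 0 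
     else if j < n then 0 else B $$ (i - n, j - n))"
  using assms by (auto simp: osum_def)

lemma osum_assoc:
  assumes "A \<in> carrier_mat n n" "B \<in> carrier_mat m m" "C \<in> carrier_mat k k"
  shows "osum (osum A B) C = osum A (osum B C)"
proof (rule eq_matI, goal_cases)
  case (1 i j)
  then have "i < n + m + k" "j < n + m + k" using assms by (auto simp: osum_def)
  then show ?case using assms osum_carrier[OF assms(1,2)] osum_carrier[OF assms(2,3)]
    by (auto simp: osum_index[of _ "n+m" _ k] osum_index[of _ n _ "m+k"] osum_index[of _ n _ m] osum_index[of _ m _ k])
qed (use assms in \<open>auto simp: osum_def\<close>)

lemma osum_comm:
  assumes "nondeg_form A" "nondeg_form B" shows "isometric (osum A B) (osum B A)"
proof -
  obtain n m where c: "A \<in> carrier_mat n n" "B \<in> carrier_mat m m" using nondeg_form_carrier[OF assms(1)] nondeg_form_carrier[OF assms(2)] by blast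
  define s where "s i = (if i < n then i + m else i - n)" for i
  have s: "bij_betw s {..<n+m} {..<n+m}"
    by (rule bij_betwI[where g="\<lambda>i. if i < m then i + n else i - m"]) (auto simp: s_def)
  have "osum A B = Matrix.mat (n+m) (n+m) (\<lambda>(i,j). osum B A $$ (s i, s j))"
  proof (rule eq_matI, goal_cases)
    case (1 i j)
    then have "i < n + m" "j < n + m" by auto
    moreover from this have "s i < m + n" "s j < m + n" by (auto simp: s_def)
    ultimately show ?case using c by (auto simp: osum_index[of _ n _ m] osum_index[of _ m _ n]) (auto simp: s_def)
  qed (use c in \<open>auto simp: osum_def\<close>)
  moreover have "isometric (Matrix.mat (n+m) (n+m) (\<lambda>(i,j). osum B A $$ (s i, s j))) (osum B A)"
    using nondeg_osum[OF assms(2,1)] osum_carrier[OF c(2,1)] s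
    by (intro isometric_permute) (auto simp: add.commute)
  ultimately show ?thesis by simp
qed


text \<open>Tensor product of forms: the Gram matrix in the basis \<open>e\<^sub>a \<otimes> f\<^sub>b\<close>, ordered lexicographically, so
  that index \<open>i\<close> stands for the pair \<open>(i div m, i mod m)\<close>.\<close>

definition kron :: "'a::field Matrix.mat \<Rightarrow> 'a Matrix.mat \<Rightarrow> 'a Matrix.mat" where
  "kron A B = Matrix.mat (dim_row A * dim_row B) (dim_col A * dim_col B)
     (\<lambda>(i,j). A $$ (i div dim_row B, j div dim_col B) * B $$ (i mod dim_row B, j mod dim_col B))"

lemma sum_divmod:
  fixes f :: "nat \<Rightarrow> nat \<Rightarrow> 'b::comm_monoid_add"
  shows "(\<Sum>l<n*m. f (l div m) (l mod m)) = (\<Sum>a<n. \<Sum>b<m. f a b)"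
proof (induction n)
  case (Suc n)
  have "{..<Suc n * m} = {..<n*m} \<union> {n*m..<n*m+m}" by auto
  then have "(\<Sum>l<Suc n*m. f (l div m) (l mod m)) = 
     (\<Sum>l<n*m. f (l div m) (l mod m)) + (\<Sum>l=n*m..<n*m+m. f (l div m) (l mod m))"
    by (simp add: sum.union_disjoint ivl_disj_int)
  also have "(\<Sum>l=n*m..<n*m+m. f (l div m) (l mod m)) = (\<Sum>b<m. f n b)"
    by (rule sum.reindex_bij_witness[where i="\<lambda>b. n*m+b" and j="\<lambda>l. l - n*m"]) 
       (auto simp: div_add1_eq mod_mult_self3 elim!: nat_le_iff_add[THEN iffD1, THEN exE])
  finally show ?case using Suc by simp
qed simp

lemma divmod_less:
  fixes i :: nat assumes "i < n * m" shows "i div m < n" "i mod m < m"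
proof -
  have "0 < m" using assms by (cases m) auto
  then show "i mod m < m" by simp
  show "i div m < n" using assms by (simp add: less_mult_imp_div_less)
qed

lemma kron_carrier[simp]:
  "A \<in> carrier_mat n n \<Longrightarrow> B \<in> carrier_mat m m \<Longrightarrow> kron A B \<in> carrier_mat (n * m) (n * m)"
  by (auto simp: kron_def)

lemma kron_index:
  assumes "A \<in> carrier_mat n n" "B \<in> carrier_mat m m" "i < n * m" "j < n * m"
  shows "kron A B $$ (i,j) = A $$ (i div m, j div m) * B $$ (i mod m, j mod m)"
  using assms by (auto simp: kron_def)

lemma kron_mult:
  assumes c: "A \<in> carrier_mat n n" "A' \<in> carrier_mat n n" "B \<in> carrier_mat m m" "B' \<in> carrier_mat m m"
  shows "kron A B * kron A' B' = kron (A * A') (B * B')"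
proof (rule eq_matI, goal_cases)
  case (1 i j)
  then have ij: "i < n * m" "j < n * m" using c by (auto simp: kron_def)
  note l = divmod_less[OF ij(1)] divmod_less[OF ij(2)]
  have AA: "A * A' \<in> carrier_mat n n" "B * B' \<in> carrier_mat m m" using c by auto
  have "(kron A B * kron A' B') $$ (i,j) = (\<Sum>l<n*m. kron A B $$ (i,l) * kron A' B' $$ (l,j))"
    using ij kron_carrier[OF c(1,3)] kron_carrier[OF c(2,4)] by (intro index_mult_sum) auto
  also have "\<dots> = (\<Sum>l<n*m. (A $$ (i div m, l div m) * B $$ (i mod m, l mod m)) * 
       (A' $$ (l div m, j div m) * B' $$ (l mod m, j mod m)))"
    using ij c by (intro sum.cong) (auto simp: kron_index[of _ n _ m])
  also have "\<dots> = (\<Sum>a<n. \<Sum>b<m. (A $$ (i div m, a) * B $$ (i mod m, b)) * 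
       (A' $$ (a, j div m) * B' $$ (b, j mod m)))"
    by (rule sum_divmod)
  also have "\<dots> = (\<Sum>a<n. A $$ (i div m, a) * A' $$ (a, j div m)) * (\<Sum>b<m. B $$ (i mod m, b) * B' $$ (b, j mod m))"
    by (simp add: sum_product algebra_simps)
  also have "\<dots> = (A * A') $$ (i div m, j div m) * (B * B') $$ (i mod m, j mod m)"
    using c l by (simp only: index_mult_sum[of _ n n _ n] index_mult_sum[of _ m m _ m])
  also have "\<dots> = kron (A * A') (B * B') $$ (i,j)"
    using AA ij by (rule kron_index[symmetric])
  finally show ?case .
qed (use c in \<open>auto simp: kron_def\<close>)

lemma kron_transpose:
  assumes "A \<in> carrier_mat n n" "B \<in> carrier_mat m m"
  shows "transpose_mat (kron A B) = kron (transpose_mat A) (transpose_mat B)"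
  using assms by (intro eq_matI) (auto simp: kron_def divmod_less)

lemma kron_one: "kron (1\<^sub>m n) (1\<^sub>m m) = 1\<^sub>m (n * m)"
proof (rule eq_matI, goal_cases)
  case (1 i j)
  then have ij: "i < n * m" "j < n * m" by auto
  have "i = j \<longleftrightarrow> i div m = j div m \<and> i mod m = j mod m" by (metis div_mult_mod_eq)
  then show ?case using ij divmod_less[OF ij(1)] divmod_less[OF ij(2)] 
    by (auto simp: kron_index[of _ n _ m])
qed (auto simp: kron_def)

lemma nondeg_kron:
  assumes "nondeg_form A" "nondeg_form B" shows "nondeg_form (kron A B)"
proof -
  from nondeg_formE[OF assms(1)] obtain n A' where a: "A \<in> carrier_mat n n" "A' \<in> carrier_mat n n"
    "A * A' = 1\<^sub>m n" "A' * A = 1\<^sub>m n" "transpose_mat A = A" .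
  from nondeg_formE[OF assms(2)] obtain m B' where b: "B \<in> carrier_mat m m" "B' \<in> carrier_mat m m"
    "B * B' = 1\<^sub>m m" "B' * B = 1\<^sub>m m" "transpose_mat B = B" .
  show ?thesis
    by (rule nondeg_formI[of _ "n*m" "kron A' B'"])
       (use a b in \<open>simp_all add: kron_mult[of _ n _ _ m] kron_transpose[of _ n _ m] kron_one\<close>)
qed

lemma isometric_kron:
  assumes "isometric A A'" "isometric B B'" shows "isometric (kron A B) (kron A' B')"
proof -
  from isometricE[OF assms(1)] obtain n P Q where *:
    "A \<in> carrier_mat n n" "A' \<in> carrier_mat n n" "P \<in> carrier_mat n n" "Q \<in> carrier_mat n n"
    "P * Q = 1\<^sub>m n" "Q * P = 1\<^sub>m n" "A = transpose_mat P * A' * P" "nondeg_form A" "nondeg_form A'" .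
  from isometricE[OF assms(2)] obtain m R S where **:
    "B \<in> carrier_mat m m" "B' \<in> carrier_mat m m" "R \<in> carrier_mat m m" "S \<in> carrier_mat m m"
    "R * S = 1\<^sub>m m" "S * R = 1\<^sub>m m" "B = transpose_mat R * B' * R" "nondeg_form B" "nondeg_form B'" .
  have "kron A B = transpose_mat (kron P R) * kron A' B' * kron P R"
    unfolding *(7) **(7) using *(2-4) **(2-4)
    by (simp add: kron_transpose[of _ n _ m] kron_mult[of _ n _ _ m])
  from isometricI[OF _ _ _ _ _ _ this, of "n*m" "kron Q S"] show ?thesis using *(1-6,8,9) **(1-6,8,9)
    by (simp add: kron_mult[of _ n _ _ m] kron_one nondeg_kron)
qed

lemma kron_assoc:
  assumes "A \<in> carrier_mat n n" "B \<in> carrier_mat m m" "C \<in> carrier_mat k k"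
  shows "kron (kron A B) C = kron A (kron B C)"
proof (rule eq_matI, goal_cases)
  case (1 i j)
  have c: "dim_row A = n" "dim_col A = n" "dim_row B = m" "dim_col B = m" "dim_row C = k" "dim_col C = k"
    using assms by auto
  from 1 have ij: "i < n * (m * k)" "j < n * (m * k)" by (auto simp: kron_def c)
  have e: "i div k div m = i div (m * k)" "i div k mod m = i mod (m * k) div k"
      "i mod (m * k) mod k = i mod k" if "i < n * (m * k)" for i
  proof -
    have k: "k > 0" using that by (cases k) auto
    have m: "i mod (m * k) = k * (i div k mod m) + i mod k"
      by (simp add: mult.commute[of m k] mod_mult2_eq)
    show "i div k div m = i div (m * k)" by (simp add: div_mult2_eq mult.commute[of m k])
    show "i div k mod m = i mod (m * k) div k" unfolding m using k by simp
    show "i mod (m * k) mod k = i mod k" unfolding m by simp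
  qed
  note l = divmod_less[OF ij(1)] divmod_less[OF ij(2)]
  have l2: "i div k < n * m" "j div k < n * m" using ij by (auto simp: less_mult_imp_div_less mult.assoc)
  show ?case using ij l l2 by (simp add: kron_def c e mult.assoc)
qed (use assms in \<open>auto simp: kron_def\<close>)

lemma kron_comm:
  assumes "nondeg_form A" "nondeg_form B" shows "isometric (kron A B) (kron B A)"
proof -
  obtain n m where c: "A \<in> carrier_mat n n" "B \<in> carrier_mat m m" 
    using nondeg_form_carrier[OF assms(1)] nondeg_form_carrier[OF assms(2)] by blast
  define s where "s i = (i mod m) * n + i div m" for i
  have lt: "x * n + y < m * n" if "x < m" "y < n" for x y n m :: nat
  proof -
    have "x * n + y < Suc x * n" using that by simp
    also have "\<dots> \<le> m * n" using that by (intro mult_right_mono) auto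
    finally show ?thesis .
  qed
  have s1: "s i < m * n" if "i < n * m" for i
    unfolding s_def using divmod_less[OF that] by (intro lt) auto
  have s2: "s i div n = i mod m" "s i mod n = i div m" if "i < n * m" for i
    using divmod_less[OF that] by (auto simp: s_def)
  have s: "bij_betw s {..<n*m} {..<n*m}"
  proof (rule bij_betwI[where g="\<lambda>i. (i mod n) * m + i div n"])
    show "s \<in> {..<n*m} \<rightarrow> {..<n*m}" using s1 by (auto simp: mult.commute)
    show "(\<lambda>i. (i mod n) * m + i div n) \<in> {..<n*m} \<rightarrow> {..<n*m}"
    proof
      fix i assume "i \<in> {..<n*m}"
      then have "i < m * n" by (simp add: mult.commute)
      from divmod_less[OF this] show "(i mod n) * m + i div n \<in> {..<n*m}" by (auto intro: lt)
    qed
    show "s i mod n * m + s i div n = i" if "i \<in> {..<n*m}" for i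
      using s2[of i] that by simp
    show "s (i mod n * m + i div n) = i" if "i \<in> {..<n*m}" for i
    proof -
      from that have "i < m * n" by (simp add: mult.commute)
      from divmod_less[OF this] show ?thesis by (simp add: s_def)
    qed
  qed
  have "kron A B = Matrix.mat (n*m) (n*m) (\<lambda>(i,j). kron B A $$ (s i, s j))"
  proof (rule eq_matI, goal_cases)
    case (1 i j)
    then have "i < n * m" "j < n * m" by auto
    then show ?case using c s1 s2 by (simp add: kron_index[of _ n _ m] kron_index[of _ m _ n] mult.commute)
  qed (use c in \<open>auto simp: kron_def\<close>)
  moreover have "isometric (Matrix.mat (n*m) (n*m) (\<lambda>(i,j). kron B A $$ (s i, s j))) (kron B A)"
    using nondeg_kron[OF assms(2,1)] kron_carrier[OF c(2,1)] s
    by (intro isometric_permute) (auto simp: mult.commute)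
  ultimately show ?thesis by simp
qed

lemma kron_osum:
  assumes "A \<in> carrier_mat n n" "B \<in> carrier_mat m m" "C \<in> carrier_mat k k"
  shows "kron (osum A B) C = osum (kron A C) (kron B C)"
proof (rule eq_matI, goal_cases)
  case (1 i j)
  have c: "dim_row A = n" "dim_col A = n" "dim_row B = m" "dim_col B = m" "dim_row C = k" "dim_col C = k"
    using assms by auto
  from 1 have ij: "i < (n + m) * k" "j < (n + m) * k" by (auto simp: kron_def osum_def c add_mult_distrib)
  have e: "i div k < n \<longleftrightarrow> i < n * k" "i div k < n + m"
     "\<not> i < n * k \<Longrightarrow> (i - n * k) div k = i div k - n" 
     "\<not> i < n * k \<Longrightarrow> (i - n * k) mod k = i mod k" 
     "\<not> i < n * k \<Longrightarrow> (i - n * k) < m * k" if "i < (n + m) * k" for i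
  proof -
    have k: "k > 0" using that by (cases k) auto
    show "i div k < n \<longleftrightarrow> i < n * k" using k by (simp add: div_less_iff_less_mult)
    show "i div k < n + m" using that by (simp add: less_mult_imp_div_less)
    assume "\<not> i < n * k"
    then have i: "i = n * k + (i - n * k)" by simp
    show "(i - n * k) div k = i div k - n" by (subst (2) i) (use k in simp)
    show "(i - n * k) mod k = i mod k" by (subst (2) i) (use k in simp)
    show "(i - n * k) < m * k" using that \<open>\<not> i < n * k\<close> by (simp add: add_mult_distrib)
  qed
  have ij': "i < n * k + m * k" "j < n * k + m * k" using ij by (auto simp: add_mult_distrib)
  have "osum (kron A C) (kron B C) $$ (i,j) = (if i < n * k then if j < n * k then kron A C $$ (i,j) else 0 
     else if j < n * k then 0 else kron B C $$ (i - n * k, j - n * k))"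
    using ij' assms by (intro osum_index) auto
  also have "\<dots> = osum A B $$ (i div k, j div k) * C $$ (i mod k, j mod k)"
    using ij e[OF ij(1)] e[OF ij(2)] assms
    by (simp add: osum_index[of _ n _ m] kron_index[of _ n _ k] kron_index[of _ m _ k])
  also have "\<dots> = kron (osum A B) C $$ (i,j)"
    using ij assms by (intro kron_index[symmetric]) auto
  finally show ?case by simp
qed (use assms in \<open>auto simp: kron_def osum_def add_mult_distrib\<close>)


text \<open>The semiring of isometry classes under orthogonal sum and tensor product; the type
  \<open>'a gw\<close> is its Grothendieck ring.\<close>

quotient_type (overloaded) 'a form_class = "'a::field Matrix.mat" / partial: isometric
proof (rule part_equivpI)
  have "nondeg_form (0\<^sub>m 0 0 :: 'a Matrix.mat)"
    by (rule nondeg_formI[of _ 0 "0\<^sub>m 0 0"]) auto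
  then show "\<exists>x :: 'a Matrix.mat. isometric x x" using isometric_refl by blast
  show "symp (isometric :: 'a Matrix.mat \<Rightarrow> _)" by (rule sympI) (rule isometric_sym)
  show "transp (isometric :: 'a Matrix.mat \<Rightarrow> _)" by (rule transpI) (rule isometric_trans)
qed

lemma isometric_nondeg: "isometric A B \<Longrightarrow> nondeg_form A" "isometric A B \<Longrightarrow> nondeg_form B"
  by (auto simp: isometric_def)

definition diag1 :: "'a::field \<Rightarrow> 'a Matrix.mat" where
  "diag1 a = Matrix.mat 1 1 (\<lambda>_. a)"

lemma nondeg_diag1: "a \<noteq> 0 \<Longrightarrow> nondeg_form (diag1 a)"
  by (rule nondeg_formI[of _ 1 "diag1 (inverse a)"])
     (auto simp: diag1_def scalar_prod_def intro!: eq_matI)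

lemma nondeg_zero: "nondeg_form (0\<^sub>m 0 0)"
  by (rule nondeg_formI[of _ 0 "0\<^sub>m 0 0"]) auto

lemma nondeg_carrierE:
  assumes "nondeg_form A" obtains n where "A \<in> carrier_mat n n"
  using nondeg_form_carrier[OF assms] by blast

instantiation form_class :: (field) comm_semiring_1
begin

lift_definition zero_form_class :: "'a form_class" is "0\<^sub>m 0 0"
  by (rule isometric_refl[OF nondeg_zero])
lift_definition one_form_class :: "'a form_class" is "diag1 1"
  by (rule isometric_refl[OF nondeg_diag1]) simp
lift_definition plus_form_class :: "'a form_class \<Rightarrow> 'a form_class \<Rightarrow> 'a form_class" is osum
  by (rule isometric_osum)
lift_definition times_form_class :: "'a form_class \<Rightarrow> 'a form_class \<Rightarrow> 'a form_class" is kron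
  by (rule isometric_kron)

instance
proof
  fix a b c :: "'a form_class"
  show "a + b + c = a + (b + c)"
  proof (transfer, goal_cases)
    case (1 a b c)
    from nondeg_carrierE[OF isometric_nondeg(1)[OF 1(1)]] obtain n where "a \<in> carrier_mat n n" .
    moreover from nondeg_carrierE[OF isometric_nondeg(1)[OF 1(2)]] obtain m where "b \<in> carrier_mat m m" .
    moreover from nondeg_carrierE[OF isometric_nondeg(1)[OF 1(3)]] obtain k where "c \<in> carrier_mat k k" .
    ultimately show ?case
      using isometric_osum[OF 1(1) isometric_osum[OF 1(2,3)]] by (simp only: osum_assoc)
  qed
  show "a + b = b + a"
    by transfer (rule osum_comm[OF isometric_nondeg(1) isometric_nondeg(1)])
  show "0 + a = a"
  proof (transfer, goal_cases)
    case (1 a)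
    have "osum (0\<^sub>m 0 0) a = a" by (intro eq_matI) (auto simp: osum_def)
    then show ?case using 1 by (simp only:)
  qed
  show "a * b * c = a * (b * c)"
  proof (transfer, goal_cases)
    case (1 a b c)
    from nondeg_carrierE[OF isometric_nondeg(1)[OF 1(1)]] obtain n where "a \<in> carrier_mat n n" .
    moreover from nondeg_carrierE[OF isometric_nondeg(1)[OF 1(2)]] obtain m where "b \<in> carrier_mat m m" .
    moreover from nondeg_carrierE[OF isometric_nondeg(1)[OF 1(3)]] obtain k where "c \<in> carrier_mat k k" .
    ultimately show ?case
      using isometric_kron[OF 1(1) isometric_kron[OF 1(2,3)]] by (simp only: kron_assoc)
  qed
  show "a * b = b * a"
    by transfer (rule kron_comm[OF isometric_nondeg(1) isometric_nondeg(1)])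
  show "1 * a = a"
  proof (transfer, goal_cases)
    case (1 a)
    have "kron (diag1 1) a = a" by (intro eq_matI) (auto simp: kron_def diag1_def)
    then show ?case using 1 by (simp only:)
  qed
  show "(a + b) * c = a * c + b * c"
  proof (transfer, goal_cases)
    case (1 a b c)
    from nondeg_carrierE[OF isometric_nondeg(1)[OF 1(1)]] obtain n where "a \<in> carrier_mat n n" .
    moreover from nondeg_carrierE[OF isometric_nondeg(1)[OF 1(2)]] obtain m where "b \<in> carrier_mat m m" .
    moreover from nondeg_carrierE[OF isometric_nondeg(1)[OF 1(3)]] obtain k where "c \<in> carrier_mat k k" .
    ultimately show ?case
      using isometric_kron[OF isometric_osum[OF 1(1,2)] 1(3)] by (simp only: kron_osum)
  qed
  show "0 * a = 0"
  proof (transfer, goal_cases)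
    case (1 a)
    have "kron (0\<^sub>m 0 0) a = 0\<^sub>m 0 0" by (intro eq_matI) (auto simp: kron_def)
    then show ?case using isometric_refl[OF nondeg_zero] by simp
  qed
  show "a * 0 = 0"
  proof (transfer, goal_cases)
    case (1 a)
    have "kron a (0\<^sub>m 0 0) = 0\<^sub>m 0 0" by (intro eq_matI) (auto simp: kron_def)
    then show ?case using isometric_refl[OF nondeg_zero] by simp
  qed
  show "0 \<noteq> (1 :: 'a form_class)"
    by transfer (auto simp: isometric_def diag1_def)
qed

end

lift_definition form_rank :: "'a::field form_class \<Rightarrow> nat" is dim_row
  by (auto simp: isometric_def)

lemma form_rank_simps: "form_rank (a + b) = form_rank a + form_rank b" "form_rank 0 = 0" "form_rank 1 = 1"
  by (transfer; simp add: osum_def diag1_def)+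

definition gw_rel :: "'a::field form_class \<times> 'a form_class \<Rightarrow> 'a form_class \<times> 'a form_class \<Rightarrow> bool" where
  "gw_rel x y \<longleftrightarrow> (\<exists>c. fst x + snd y + c = fst y + snd x + c)"

lemma gw_rel_refl: "gw_rel x x"
  by (auto simp: gw_rel_def)

lemma gw_rel_eqI: "fst x = fst y \<Longrightarrow> snd x = snd y \<Longrightarrow> gw_rel x y"
  by (auto simp: gw_rel_def)

lemma gw_rel_sym: "gw_rel x y \<Longrightarrow> gw_rel y x"
  unfolding gw_rel_def by (metis add.commute)

lemma gw_rel_trans:
  assumes "gw_rel x y" "gw_rel y z" shows "gw_rel x z"
proof -
  obtain c d where *: "fst x + snd y + c = fst y + snd x + c" "fst y + snd z + d = fst z + snd y + d"
    using assms by (auto simp: gw_rel_def)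
  have "fst x + snd z + (snd y + c + d) = (fst x + snd y + c) + (snd z + d)" by (simp add: ac_simps)
  also have "\<dots> = (fst y + snd x + c) + (snd z + d)" unfolding *(1) ..
  also have "\<dots> = (fst y + snd z + d) + (snd x + c)" by (simp add: ac_simps)
  also have "\<dots> = (fst z + snd y + d) + (snd x + c)" unfolding *(2) ..
  also have "\<dots> = fst z + snd x + (snd y + c + d)" by (simp add: ac_simps)
  finally show ?thesis by (auto simp: gw_rel_def)
qed

quotient_type (overloaded) 'a gw = "'a::field form_class \<times> 'a form_class" / gw_rel
proof (rule equivpI)
  show "reflp (gw_rel :: 'a form_class \<times> _ \<Rightarrow> _)" by (rule reflpI) (auto simp: gw_rel_def)
  show "symp (gw_rel :: 'a form_class \<times> _ \<Rightarrow> _)" by (rule sympI) (rule gw_rel_sym)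
  show "transp (gw_rel :: 'a form_class \<times> _ \<Rightarrow> _)" by (rule transpI) (rule gw_rel_trans)
qed

lemma gw_rel_mult1:
  assumes "gw_rel x x'"
  shows "gw_rel (fst x * c + snd x * d, fst x * d + snd x * c) (fst x' * c + snd x' * d, fst x' * d + snd x' * c)"
proof -
  obtain e where e: "fst x + snd x' + e = fst x' + snd x + e" using assms by (auto simp: gw_rel_def)
  have "fst x * c + snd x * d + (fst x' * d + snd x' * c) + (e * c + e * d) = 
     (fst x + snd x' + e) * c + (fst x' + snd x + e) * d" by (simp add: algebra_simps)
  also have "\<dots> = (fst x' + snd x + e) * c + (fst x + snd x' + e) * d" unfolding e ..
  also have "\<dots> = fst x' * c + snd x' * d + (fst x * d + snd x * c) + (e * c + e * d)" by (simp add: algebra_simps)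
  finally show ?thesis by (auto simp: gw_rel_def)
qed

instantiation gw :: (field) comm_ring_1
begin

lift_definition zero_gw :: "'a gw" is "(0, 0)" .
lift_definition one_gw :: "'a gw" is "(1, 0)" .
lift_definition plus_gw :: "'a gw \<Rightarrow> 'a gw \<Rightarrow> 'a gw" is "\<lambda>(a,b) (c,d). (a + c, b + d)"
proof (clarsimp simp: gw_rel_def)
  fix a b a' b' c d c' d' e f :: "'a form_class"
  assume *: "a + b' + e = a' + b + e" "c + d' + f = c' + d + f"
  have "a + c + (b' + d') + (e + f) = (a + b' + e) + (c + d' + f)" by (simp add: ac_simps)
  also have "\<dots> = a' + c' + (b + d) + (e + f)" unfolding * by (simp add: ac_simps)
  finally show "\<exists>e. a + c + (b' + d') + e = a' + c' + (b + d) + e" by blast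
qed
lift_definition uminus_gw :: "'a gw \<Rightarrow> 'a gw" is "\<lambda>(a,b). (b, a)"
  by (clarsimp simp: gw_rel_def) (metis add.commute)
definition minus_gw :: "'a gw \<Rightarrow> 'a gw \<Rightarrow> 'a gw" where "minus_gw x y = x + (- y)"
lift_definition times_gw :: "'a gw \<Rightarrow> 'a gw \<Rightarrow> 'a gw" is "\<lambda>(a,b) (c,d). (a * c + b * d, a * d + b * c)"
proof (clarify)
  fix a b a' b' c d c' d' :: "'a form_class"
  assume 1: "gw_rel (a,b) (a',b')" and 2: "gw_rel (c,d) (c',d')"
  have "gw_rel (a * c + b * d, a * d + b * c) (a' * c + b' * d, a' * d + b' * c)"
    using gw_rel_mult1[OF 1, of c d] by simp
  moreover have "gw_rel (a' * c + b' * d, a' * d + b' * c) (a' * c' + b' * d', a' * d' + b' * c')"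
    using gw_rel_mult1[OF 2, of a' b'] by (simp add: ac_simps)
  ultimately show "gw_rel (a * c + b * d, a * d + b * c) (a' * c' + b' * d', a' * d' + b' * c')"
    by (rule gw_rel_trans)
qed

instance
proof
  fix a b c :: "'a gw"
  show "a + b + c = a + (b + c)" by transfer (clarsimp simp only: split_paired_all prod.case add.assoc gw_rel_refl)
  show "a + b = b + a" by transfer (clarsimp simp only: split_paired_all prod.case add.commute gw_rel_refl)
  show "0 + a = a" by transfer (clarsimp simp only: split_paired_all prod.case add_0_left gw_rel_refl)
  show "- a + a = 0" by transfer (clarsimp simp: gw_rel_def add.commute)
  show "a - b = a + - b" by (simp add: minus_gw_def)
  show "a * b * c = a * (b * c)" 
    by transfer (clarsimp, rule gw_rel_eqI; simp add: algebra_simps)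
  show "a * b = b * a" 
    by transfer (clarsimp, rule gw_rel_eqI; simp add: algebra_simps)
  show "1 * a = a" 
    by transfer (clarsimp, rule gw_rel_eqI; simp)
  show "(a + b) * c = a * c + b * c"
    by transfer (clarsimp, rule gw_rel_eqI; simp add: algebra_simps)
  show "0 \<noteq> (1 :: 'a gw)"
  proof (transfer, clarsimp simp: gw_rel_def)
    fix c :: "'a form_class" assume "c = 1 + c"
    from arg_cong[OF this, of form_rank] show False by (simp add: form_rank_simps)
  qed
qed

end


text \<open>The class \<open>\<langle>a\<rangle>\<close> of the form \<open>(x, y) \<mapsto> a x y\<close>, for \<open>a \<noteq> 0\<close>. Matrices that are not Gram matrices of a
  nondegenerate symmetric form are sent to the zero class.\<close>

lift_definition form_of_mat :: "'a::field Matrix.mat \<Rightarrow> 'a form_class" 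
  is "\<lambda>A. if nondeg_form A then A else 0\<^sub>m 0 0"
  by (auto intro: isometric_refl nondeg_zero)

definition gw_of_form :: "'a::field form_class \<Rightarrow> 'a gw" where
  "gw_of_form a = abs_gw (a, 0)"

definition gw_rank1 :: "'a::field \<Rightarrow> 'a gw"  ("\<langle>_\<rangle>") where
  "\<langle>a\<rangle> = gw_of_form (form_of_mat (diag1 a))"

lemma gw_rank1_one: "\<langle>1\<rangle> = (1 :: 'a::field gw)"
proof -
  have "form_of_mat (diag1 1) = (1 :: 'a form_class)"
    by transfer (auto intro: isometric_refl nondeg_diag1 simp: nondeg_diag1)
  then have "gw_of_form (form_of_mat (diag1 1)) = gw_of_form (1 :: 'a form_class)" by simp
  also have "\<dots> = 1" by (simp add: gw_of_form_def one_gw.abs_eq)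
  finally show ?thesis by (simp add: gw_rank1_def)
qed

lemma gw_rank1_square:
  assumes "a \<noteq> 0" "c \<noteq> 0" shows "\<langle>c^2 * a\<rangle> = \<langle>a :: 'a::field\<rangle>"
proof -
  have "isometric (diag1 (c^2 * a)) (diag1 a)"
  proof (rule isometricI[of _ 1 _ "diag1 c" "diag1 (inverse c)"])
    show "nondeg_form (diag1 (c^2 * a))" "nondeg_form (diag1 a)"
      using assms by (auto intro!: nondeg_diag1)
  qed (use assms in \<open>auto simp: diag1_def scalar_prod_def power2_eq_square intro!: eq_matI\<close>)
  then have "form_of_mat (diag1 (c^2 * a)) = form_of_mat (diag1 a)"
    using assms by transfer (simp add: nondeg_diag1)
  then show ?thesis by (simp add: gw_rank1_def)
qed

lemma gw_rank1_complex: "a \<noteq> 0 \<Longrightarrow> \<langle>a :: complex\<rangle> = \<langle>1\<rangle>"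
  using gw_rank1_square[of 1 "csqrt a"] by simp

section \<open>The transfer from the complex to the real numbers\<close>

text \<open>The trace of the real-linear endomorphism \<open>w \<mapsto> z w\<close>, computed in the orthonormal basis \<open>1, \<i>\<close>.\<close>

definition field_trace :: "complex \<Rightarrow> real" where
  "field_trace z = (\<Sum>b\<in>Basis. inner (z * b) b)"

lemma field_trace_eq: "field_trace z = 2 * Re z"
  by (simp add: field_trace_def Basis_complex_def inner_complex_def)

definition real_basis :: "nat \<Rightarrow> complex" where
  "real_basis a = [1, \<i>] ! a"

text \<open>The Gram matrix of \<open>(x, y) \<mapsto> Tr (x\<^sup>T A y)\<close> on \<open>\<complex>\<^sup>n\<close> regarded as a real vector space, in the basis
  \<open>e\<^sub>1, \<i> e\<^sub>1, e\<^sub>2, \<i> e\<^sub>2, \<dots>\<close>.\<close>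

definition trace_form :: "complex Matrix.mat \<Rightarrow> real Matrix.mat" where
  "trace_form A = Matrix.mat (dim_row A * 2) (dim_col A * 2)
     (\<lambda>(i,j). field_trace (real_basis (i mod 2) * real_basis (j mod 2) * A $$ (i div 2, j div 2)))"

definition coord2 :: "nat \<Rightarrow> complex \<Rightarrow> real" where
  "coord2 a z = (if a = 0 then Re z else Im z)"

text \<open>The matrix of the real-linear map underlying \<open>A\<close>, in the same basis.\<close>

definition realify :: "complex Matrix.mat \<Rightarrow> real Matrix.mat" where
  "realify A = Matrix.mat (dim_row A * 2) (dim_col A * 2)
     (\<lambda>(i,j). coord2 (i mod 2) (real_basis (j mod 2) * A $$ (i div 2, j div 2)))"

lemma sum_lessThan_2: "(\<Sum>b<(2::nat). f b) = f 0 + f (1::nat)"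
  by (simp add: eval_nat_numeral)

lemma coord2_expand: "(\<Sum>b<2. of_real (coord2 b z) * real_basis b) = z"
  by (simp add: sum_lessThan_2 coord2_def real_basis_def complex_eq_iff)

lemma trace_form_index:
  assumes "A \<in> carrier_mat n n" "i < n * 2" "j < n * 2"
  shows "trace_form A $$ (i,j) = field_trace (real_basis (i mod 2) * real_basis (j mod 2) * A $$ (i div 2, j div 2))"
  using assms by (simp add: trace_form_def)

lemma realify_index:
  assumes "A \<in> carrier_mat n n" "i < n * 2" "j < n * 2"
  shows "realify A $$ (i,j) = coord2 (i mod 2) (real_basis (j mod 2) * A $$ (i div 2, j div 2))"
  using assms by (simp add: realify_def)

lemma trace_form_carrier[simp]: "A \<in> carrier_mat n n \<Longrightarrow> trace_form A \<in> carrier_mat (n * 2) (n * 2)"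
  by (auto simp: trace_form_def)

lemma realify_carrier[simp]: "A \<in> carrier_mat n n \<Longrightarrow> realify A \<in> carrier_mat (n * 2) (n * 2)"
  by (auto simp: realify_def)

lemma field_trace_linear:
  "field_trace (x + y) = field_trace x + field_trace y"
  "field_trace (of_real r * x) = r * field_trace x"
  "field_trace 0 = 0"
  by (simp_all add: field_trace_eq algebra_simps)

lemma field_trace_sum: "field_trace (sum f A) = (\<Sum>a\<in>A. field_trace (f a))"
  by (induction A rule: infinite_finite_induct) (auto simp: field_trace_linear)

lemma coord2_linear:
  "coord2 k (x + y) = coord2 k x + coord2 k y" "coord2 k (of_real r * x) = r * coord2 k x" "coord2 k 0 = 0"
  by (simp_all add: coord2_def)

lemma coord2_sum: "coord2 k (sum f A) = (\<Sum>a\<in>A. coord2 k (f a))"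
  by (induction A rule: infinite_finite_induct) (auto simp: coord2_linear)

lemma trace_form_mult_realify:
  assumes c: "A \<in> carrier_mat n n" "P \<in> carrier_mat n n"
  shows "trace_form A * realify P = trace_form (A * P)"
proof (rule eq_matI, goal_cases)
  case (1 i j)
  then have ij: "i < n * 2" "j < n * 2" using c by (auto simp: trace_form_def)
  note l = divmod_less[OF ij(1)] divmod_less[OF ij(2)]
  let ?u = "real_basis (i mod 2)" and ?v = "real_basis (j mod 2)"
  have "(trace_form A * realify P) $$ (i,j) = (\<Sum>l<n*2. trace_form A $$ (i,l) * realify P $$ (l,j))"
    using ij trace_form_carrier[OF c(1)] realify_carrier[OF c(2)] by (intro index_mult_sum)
  also have "\<dots> = (\<Sum>l<n*2. field_trace (?u * real_basis (l mod 2) * A $$ (i div 2, l div 2)) *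
      coord2 (l mod 2) (?v * P $$ (l div 2, j div 2)))"
    using ij c by (intro sum.cong) (simp_all only: trace_form_index[of _ n] realify_index[of _ n] lessThan_iff)
  also have "\<dots> = (\<Sum>a<n. \<Sum>b<2. field_trace (?u * real_basis b * A $$ (i div 2, a)) *
      coord2 b (?v * P $$ (a, j div 2)))" by (rule sum_divmod)
  also have "\<dots> = (\<Sum>a<n. field_trace (?u * A $$ (i div 2, a) * 
      (\<Sum>b<2. of_real (coord2 b (?v * P $$ (a, j div 2))) * real_basis b)))"
    by (simp add: field_trace_eq sum_lessThan_2 algebra_simps)
  also have "\<dots> = field_trace (?u * ?v * (\<Sum>a<n. A $$ (i div 2, a) * P $$ (a, j div 2)))"
    unfolding coord2_expand by (simp add: field_trace_sum sum_distrib_left mult_ac)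
  also have "(\<Sum>a<n. A $$ (i div 2, a) * P $$ (a, j div 2)) = (A * P) $$ (i div 2, j div 2)"
    using c l by (intro index_mult_sum[symmetric])
  also have "field_trace (?u * ?v * (A * P) $$ (i div 2, j div 2)) = trace_form (A * P) $$ (i,j)"
    using c ij by (intro trace_form_index[symmetric, of _ n]) auto
  finally show ?case .
qed (use c in \<open>auto simp: trace_form_def realify_def\<close>)

lemma realify_mult:
  assumes c: "A \<in> carrier_mat n n" "P \<in> carrier_mat n n"
  shows "realify A * realify P = realify (A * P)"
proof (rule eq_matI, goal_cases)
  case (1 i j)
  then have ij: "i < n * 2" "j < n * 2" using c by (auto simp: realify_def)
  note l = divmod_less[OF ij(1)] divmod_less[OF ij(2)]
  let ?k = "i mod 2" and ?v = "real_basis (j mod 2)"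
  have "(realify A * realify P) $$ (i,j) = (\<Sum>l<n*2. realify A $$ (i,l) * realify P $$ (l,j))"
    using ij realify_carrier[OF c(1)] realify_carrier[OF c(2)] by (intro index_mult_sum)
  also have "\<dots> = (\<Sum>l<n*2. coord2 ?k (real_basis (l mod 2) * A $$ (i div 2, l div 2)) *
      coord2 (l mod 2) (?v * P $$ (l div 2, j div 2)))"
    using ij c by (intro sum.cong) (simp_all only: realify_index[of _ n] lessThan_iff)
  also have "\<dots> = (\<Sum>a<n. \<Sum>b<2. coord2 ?k (real_basis b * A $$ (i div 2, a)) *
      coord2 b (?v * P $$ (a, j div 2)))" by (rule sum_divmod)
  also have "\<dots> = (\<Sum>a<n. coord2 ?k (A $$ (i div 2, a) * 
      (\<Sum>b<2. of_real (coord2 b (?v * P $$ (a, j div 2))) * real_basis b)))"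
  proof (rule sum.cong, goal_cases)
    case (2 a)
    have "coord2 ?k (A $$ (i div 2, a) * (\<Sum>b<2. of_real (r b) * real_basis b)) =
        (\<Sum>b<2. coord2 ?k (real_basis b * A $$ (i div 2, a)) * r b)" for r
      unfolding sum_lessThan_2 distrib_left coord2_linear mult.left_commute[of _ "of_real _"]
      by (simp only: mult.commute)
    then show ?case by (rule sym)
  qed simp
  also have "\<dots> = coord2 ?k (?v * (\<Sum>a<n. A $$ (i div 2, a) * P $$ (a, j div 2)))"
    unfolding coord2_expand by (simp add: coord2_sum sum_distrib_left mult_ac)
  also have "(\<Sum>a<n. A $$ (i div 2, a) * P $$ (a, j div 2)) = (A * P) $$ (i div 2, j div 2)"
    using c l by (intro index_mult_sum[symmetric])
  also have "coord2 ?k (?v * (A * P) $$ (i div 2, j div 2)) = realify (A * P) $$ (i,j)"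
    using c ij by (intro realify_index[symmetric, of _ n]) auto
  finally show ?case .
qed (use c in \<open>auto simp: realify_def\<close>)

lemma trace_form_transpose:
  "A \<in> carrier_mat n n \<Longrightarrow> transpose_mat (trace_form A) = trace_form (transpose_mat A)"
  by (intro eq_matI) (auto simp: trace_form_def mult_ac divmod_less)

lemma less_2_cases': "a < (2::nat) \<Longrightarrow> a = 0 \<or> a = 1" by auto

lemma realify_one: "realify (1\<^sub>m n) = 1\<^sub>m (n * 2)"
proof (rule eq_matI, goal_cases)
  case (1 i j)
  then have ij: "i < n * 2" "j < n * 2" by auto
  have eq: "i = j \<longleftrightarrow> i div 2 = j div 2 \<and> i mod 2 = j mod 2" by (metis div_mult_mod_eq)
  have "i mod 2 = 0 \<or> i mod 2 = 1" "j mod 2 = 0 \<or> j mod 2 = 1" by auto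
  then show ?case unfolding realify_index[OF one_carrier_mat ij]
    using ij divmod_less[OF ij(1)] divmod_less[OF ij(2)] eq by (auto simp: coord2_def real_basis_def)
qed (auto simp: realify_def)

lemma trace_form_one_square:
  "trace_form (1\<^sub>m n) * ((1/4) \<cdot>\<^sub>m trace_form (1\<^sub>m n)) = 1\<^sub>m (n * 2)"
proof (rule eq_matI, goal_cases)
  case (1 i j)
  then have ij: "i < n * 2" "j < n * 2" by auto
  note l = divmod_less[OF ij(1)] divmod_less[OF ij(2)]
  have eq: "i = j \<longleftrightarrow> i div 2 = j div 2 \<and> i mod 2 = j mod 2" by (metis div_mult_mod_eq)
  have m: "i mod 2 = 0 \<or> i mod 2 = 1" "j mod 2 = 0 \<or> j mod 2 = 1" by auto
  have "(trace_form (1\<^sub>m n) * ((1/4) \<cdot>\<^sub>m trace_form (1\<^sub>m n))) $$ (i,j) = 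
      (\<Sum>l<n*2. trace_form (1\<^sub>m n) $$ (i,l) * ((1/4) \<cdot>\<^sub>m trace_form (1\<^sub>m n)) $$ (l,j))"
    using ij by (intro index_mult_sum) auto
  also have "\<dots> = (\<Sum>l<n*2. field_trace (real_basis (i mod 2) * real_basis (l mod 2) * (if i div 2 = l div 2 then 1 else 0)) *
     (1/4 * field_trace (real_basis (l mod 2) * real_basis (j mod 2) * (if l div 2 = j div 2 then 1 else 0))))"
  proof (rule sum.cong, goal_cases)
    case (2 x)
    then have x: "x < n * 2" by simp
    have "((1/4) \<cdot>\<^sub>m trace_form (1\<^sub>m n)) $$ (x,j) = 1/4 * trace_form (1\<^sub>m n) $$ (x,j)"
      using x ij by (intro index_smult_mat) (auto simp: trace_form_def)
    then show ?case unfolding trace_form_index[OF one_carrier_mat ij(1) x] trace_form_index[OF one_carrier_mat x ij(2)]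
      using l divmod_less[OF x] by simp
  qed simp
  also have "\<dots> = (\<Sum>a<n. \<Sum>b<2. field_trace (real_basis (i mod 2) * real_basis b * (if i div 2 = a then 1 else 0)) *
     (1/4 * field_trace (real_basis b * real_basis (j mod 2) * (if a = j div 2 then 1 else 0))))"
    by (rule sum_divmod)
  also have "\<dots> = (\<Sum>a<n. if a = i div 2 then (if i = j then 1 else 0) else 0)"
  proof (rule sum.cong, goal_cases)
    case (2 a)
    have "(\<Sum>b<2. field_trace (real_basis p * real_basis b * (if x = a then 1 else 0)) *
       (1/4 * field_trace (real_basis b * real_basis q * (if a = y then 1 else 0)))) =
       (if a = x then (if x = y \<and> p = q then 1 else 0) else 0)" 
      if "p = 0 \<or> p = 1" "q = 0 \<or> q = 1" for p q x y :: nat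
      using that by (elim disjE) (simp_all add: field_trace_eq sum_lessThan_2 real_basis_def)
    from this[OF m, of "i div 2" "j div 2"] show ?case unfolding eq by simp
  qed simp
  also have "\<dots> = 1\<^sub>m (n * 2) $$ (i,j)" using ij l by (simp add: sum.delta)
  finally show ?case .
qed (auto simp: trace_form_def)

lemma nondeg_trace_form:
  assumes "nondeg_form A" shows "nondeg_form (trace_form A)"
proof -
  from nondeg_formE[OF assms] obtain n A' where a: "A \<in> carrier_mat n n" "A' \<in> carrier_mat n n"
    "A * A' = 1\<^sub>m n" "A' * A = 1\<^sub>m n" "transpose_mat A = A" .
  define T where "T = trace_form (1\<^sub>m n)"
  define G where "G = (1/4) \<cdot>\<^sub>m T"
  have c: "T \<in> carrier_mat (n*2) (n*2)" "G \<in> carrier_mat (n*2) (n*2)" by (auto simp: T_def G_def)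
  have TG: "T * G = 1\<^sub>m (n*2)" using trace_form_one_square by (simp add: T_def G_def)
  have GT: "G * T = 1\<^sub>m (n*2)" using TG c unfolding G_def by (metis mult_smult_assoc_mat mult_smult_distrib)
  have TA: "trace_form A = T * realify A" 
    using trace_form_mult_realify[of "1\<^sub>m n" n A] a by (simp add: T_def)
  have R: "realify A * realify A' = 1\<^sub>m (n*2)" "realify A' * realify A = 1\<^sub>m (n*2)"
    using a by (simp_all add: realify_mult[of _ n] realify_one)
  show ?thesis
  proof (rule nondeg_formI[of _ "n*2" "realify A' * G"])
    have "trace_form A * (realify A' * G) = T * (realify A * realify A') * G"
      unfolding TA using c realify_carrier[OF a(1)] realify_carrier[OF a(2)] 
      by (simp add: assoc_mult_mat[of _ "n*2" "n*2" _ "n*2" _ "n*2"])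
    then show "trace_form A * (realify A' * G) = 1\<^sub>m (n*2)" unfolding R using c TG by simp
    have "realify A' * G * trace_form A = realify A' * (G * T) * realify A"
      unfolding TA using c realify_carrier[OF a(1)] realify_carrier[OF a(2)] 
      by (simp add: assoc_mult_mat[of _ "n*2" "n*2" _ "n*2" _ "n*2"])
    then show "realify A' * G * trace_form A = 1\<^sub>m (n*2)" 
      unfolding GT using R realify_carrier[OF a(2)] by simp
    show "transpose_mat (trace_form A) = trace_form A"
      using trace_form_transpose[OF a(1)] a(5) by simp
    show "realify A' * G \<in> carrier_mat (n*2) (n*2)" using realify_carrier[OF a(2)] c by simp
  qed (use a in simp)
qed

lemma isometric_trace_form:
  assumes "isometric A B" shows "isometric (trace_form A) (trace_form B)"
proof -
  from isometricE[OF assms(1)] obtain n P Q where *: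
    "A \<in> carrier_mat n n" "B \<in> carrier_mat n n" "P \<in> carrier_mat n n" "Q \<in> carrier_mat n n"
    "P * Q = 1\<^sub>m n" "Q * P = 1\<^sub>m n" "A = transpose_mat P * B * P" "nondeg_form A" "nondeg_form B" .
  have PT: "transpose_mat P \<in> carrier_mat n n" and BT: "transpose_mat B \<in> carrier_mat n n" using *(2,3) by auto
  have "transpose_mat (realify P) * trace_form B = transpose_mat (transpose_mat (trace_form B) * realify P)"
    using transpose_mult[OF _ realify_carrier[OF *(3)], of "transpose_mat (trace_form B)" "n*2"] trace_form_carrier[OF *(2)]
    by (simp add: transpose_transpose)
  also have "\<dots> = trace_form (transpose_mat (transpose_mat B * P))"
    unfolding trace_form_transpose[OF *(2)] trace_form_mult_realify[OF BT *(3)]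
    by (rule trace_form_transpose[of _ n]) (use BT *(3) in simp)
  also have "transpose_mat (transpose_mat B * P) = transpose_mat P * B"
    using transpose_mult[OF BT *(3)] by simp
  finally have "transpose_mat (realify P) * trace_form B = trace_form (transpose_mat P * B)" .
  then have "transpose_mat (realify P) * trace_form B * realify P = trace_form (transpose_mat P * B * P)"
    using trace_form_mult_realify[OF _ *(3), of "transpose_mat P * B"] PT *(2) by simp
  then have eq: "trace_form A = transpose_mat (realify P) * trace_form B * realify P" unfolding *(7) ..
  have "realify P * realify Q = 1\<^sub>m (n*2)" "realify Q * realify P = 1\<^sub>m (n*2)"
    using *(3-6) by (simp_all add: realify_mult[of _ n] realify_one)
  from isometricI[OF _ _ _ _ this eq] show ?thesis using *(1-4,8,9) by (simp add: nondeg_trace_form)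
qed

lemma trace_form_osum:
  assumes "A \<in> carrier_mat n n" "B \<in> carrier_mat m m"
  shows "trace_form (osum A B) = osum (trace_form A) (trace_form B)"
proof (rule eq_matI, goal_cases)
  case (1 i j)
  moreover have "osum (trace_form A) (trace_form B) \<in> carrier_mat (n * 2 + m * 2) (n * 2 + m * 2)"
    using assms by simp
  ultimately have ij: "i < n * 2 + m * 2" "j < n * 2 + m * 2" by (simp_all only: carrier_matD)
  have e: "i div 2 < n \<longleftrightarrow> i < n * 2" "i div 2 < n + m"
     "\<not> i < n * 2 \<Longrightarrow> (i - n * 2) div 2 = i div 2 - n" 
     "\<not> i < n * 2 \<Longrightarrow> (i - n * 2) mod 2 = i mod 2" 
     "\<not> i < n * 2 \<Longrightarrow> (i - n * 2) < m * 2" if "i < n * 2 + m * 2" for i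
  proof -
    show "i div 2 < n \<longleftrightarrow> i < n * 2" by (simp add: div_less_iff_less_mult)
    show "i div 2 < n + m" using that by (simp add: div_less_iff_less_mult)
    assume "\<not> i < n * 2"
    then have i: "i = n * 2 + (i - n * 2)" by simp
    show "(i - n * 2) div 2 = i div 2 - n" by (subst (2) i) simp
    show "(i - n * 2) mod 2 = i mod 2" by (subst (2) i) simp
    show "(i - n * 2) < m * 2" using that \<open>\<not> i < n * 2\<close> by simp
  qed
  have "osum (trace_form A) (trace_form B) $$ (i,j) = 
     (if i < n * 2 then if j < n * 2 then trace_form A $$ (i,j) else 0 
      else if j < n * 2 then 0 else trace_form B $$ (i - n * 2, j - n * 2))"
    using ij assms by (intro osum_index) auto
  also have "\<dots> = field_trace (real_basis (i mod 2) * real_basis (j mod 2) * osum A B $$ (i div 2, j div 2))"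
    using ij e[OF ij(1)] e[OF ij(2)] assms
    by (simp add: osum_index[of _ n _ m] trace_form_index[of _ n] trace_form_index[of _ m] field_trace_linear)
  also have "\<dots> = trace_form (osum A B) $$ (i,j)"
    using ij osum_carrier[OF assms] by (intro trace_form_index[symmetric, of _ "n+m"]) auto
  finally show ?case by simp
qed (use assms in \<open>auto simp: trace_form_def osum_def\<close>)

lift_definition trace_class :: "complex form_class \<Rightarrow> real form_class" is trace_form
  by (rule isometric_trace_form)

lemma trace_class_add: "trace_class (a + b) = trace_class a + trace_class b"
proof (transfer, goal_cases)
  case (1 a b)
  from nondeg_carrierE[OF isometric_nondeg(1)[OF 1(1)]] obtain n where a: "a \<in> carrier_mat n n" .
  from nondeg_carrierE[OF isometric_nondeg(1)[OF 1(2)]] obtain m where b: "b \<in> carrier_mat m m" .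
  from isometric_trace_form[OF isometric_osum[OF 1]] show ?case by (simp only: trace_form_osum[OF a b])
qed

lift_definition gw_transfer :: "complex gw \<Rightarrow> real gw" is "\<lambda>(a, b). (trace_class a, trace_class b)"
  by (clarsimp simp: gw_rel_def) (metis trace_class_add)


section \<open>Points and lines of the projective plane\<close>

text \<open>Nonzero vectors up to scalars. The same type serves for the points of the plane and for the
  points of the dual plane: \<open>[a : b : c]\<close> in the dual plane is the line \<open>a x + b y + c z = 0\<close>.\<close>

definition proj_rel :: "'a::field ^ 3 \<Rightarrow> 'a ^ 3 \<Rightarrow> bool" where
  "proj_rel u v \<longleftrightarrow> u \<noteq> 0 \<and> v \<noteq> 0 \<and> (\<exists>c. c \<noteq> 0 \<and> v = c *s u)"

lemma proj_rel_symp: "symp (proj_rel :: 'a::field^3 \<Rightarrow> _)"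
proof (rule sympI)
    fix u v :: "'a^3" assume "proj_rel u v"
    then obtain c where "u \<noteq> 0" "v \<noteq> 0" "c \<noteq> 0" "v = c *s u" by (auto simp: proj_rel_def)
    moreover from this have "u = inverse c *s v" "inverse c \<noteq> 0" by (simp_all add: vector_smult_assoc)
    ultimately show "proj_rel v u" unfolding proj_rel_def by blast
qed

quotient_type (overloaded) 'a proj_plane = "'a::field ^ 3" / partial: proj_rel
proof (rule part_equivpI)
  have "(1 :: 'a^3) \<noteq> 0" by (simp add: vec_eq_iff)
  moreover have "1 = 1 *s (1 :: 'a^3)" by simp
  ultimately have "proj_rel (1 :: 'a^3) 1"
    unfolding proj_rel_def using one_neq_zero by blast
  then show "\<exists>x :: 'a^3. proj_rel x x" by blast
  show "symp (proj_rel :: 'a^3 \<Rightarrow> _)" by (rule proj_rel_symp)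
  show "transp (proj_rel :: 'a^3 \<Rightarrow> _)"
  proof (rule transpI)
    fix u v w :: "'a^3" assume "proj_rel u v" "proj_rel v w"
    then obtain c d where "u \<noteq> 0" "w \<noteq> 0" "c \<noteq> 0" "d \<noteq> 0" "v = c *s u" "w = d *s v" by (auto simp: proj_rel_def)
    moreover from this have "w = (d * c) *s u" "d * c \<noteq> 0" by (simp_all add: vector_smult_assoc)
    ultimately show "proj_rel u w" unfolding proj_rel_def by blast
  qed
qed

definition proj_point :: "'a::field ^ 3 \<Rightarrow> 'a proj_plane" where
  "proj_point v = abs_proj_plane v"

text \<open>A choice of homogeneous coordinates of a point, or of a linear form defining a line.\<close>

definition homvec :: "'a::field proj_plane \<Rightarrow> 'a ^ 3" where
  "homvec p = rep_proj_plane p"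

lemma homvec: "homvec p \<noteq> 0" "proj_point (homvec p) = p"
proof -
  have "proj_rel (rep_proj_plane p) (rep_proj_plane p)"
    using Quotient3_proj_plane by (rule Quotient3_rep_reflp)
  then show "homvec p \<noteq> 0" by (simp add: proj_rel_def homvec_def)
  show "proj_point (homvec p) = p" unfolding proj_point_def homvec_def
    using Quotient3_proj_plane by (rule Quotient3_abs_rep)
qed

lemma homvec_proj_point:
  assumes "v \<noteq> 0" obtains c where "c \<noteq> 0" "homvec (proj_point v) = c *s v"
proof -
  have "proj_rel v v" unfolding proj_rel_def
    using assms by (intro conjI exI[of _ 1]) simp_all
  then have "proj_rel (homvec (proj_point v)) v" unfolding homvec_def proj_point_def
    by (rule Quotient3_rep_abs[OF Quotient3_proj_plane])
  then have "proj_rel v (homvec (proj_point v))"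
    by (rule sympE[OF proj_rel_symp])
  then show ?thesis using that unfolding proj_rel_def by blast
qed

lemma proj_point_scale: "c \<noteq> 0 \<Longrightarrow> v \<noteq> 0 \<Longrightarrow> proj_point (c *s v) = proj_point v"
proof -
  assume "c \<noteq> 0" "v \<noteq> 0"
  then have "proj_rel v (c *s v)" unfolding proj_rel_def by auto
  then show ?thesis unfolding proj_point_def 
    by (intro Quotient3_rel_abs[OF Quotient3_proj_plane, symmetric])
qed

definition linear_form :: "'a::field ^ 3 \<Rightarrow> 'a ^ 3 \<Rightarrow> 'a" where
  "linear_form a x = (\<Sum>i\<in>UNIV. a $ i * x $ i)"

definition on_line :: "'a::field proj_plane \<Rightarrow> 'a proj_plane \<Rightarrow> bool" where
  "on_line p L \<longleftrightarrow> linear_form (homvec L) (homvec p) = 0"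

definition map_vec3 :: "('a \<Rightarrow> 'b) \<Rightarrow> 'a ^ 3 \<Rightarrow> 'b ^ 3" where
  "map_vec3 h v = (\<chi> i. h (v $ i))"

definition base_change :: "('a::field \<Rightarrow> 'b::field) \<Rightarrow> 'a proj_plane \<Rightarrow> 'b proj_plane" where
  "base_change h p = proj_point (map_vec3 h (homvec p))"

section \<open>Plane quartics and their bitangents\<close>

text \<open>Polynomials in variables indexed by \<open>'n\<close> are finitely supported functions on exponent vectors;
  coefficients are mapped by \<open>h\<close> into the ring in which the polynomial is evaluated.\<close>

definition poly_eval ::
  "('a::zero \<Rightarrow> 'b::comm_semiring_1) \<Rightarrow> ((nat ^ 'n) \<Rightarrow>\<^sub>0 'a) \<Rightarrow> 'b ^ ('n::finite) \<Rightarrow> 'b" where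
  "poly_eval h f x = (\<Sum>e\<in>Poly_Mapping.keys f. h (Poly_Mapping.lookup f e) * (\<Prod>i\<in>UNIV. (x $ i) ^ (e $ i)))"

definition homogeneous :: "nat \<Rightarrow> ((nat ^ 'n::finite) \<Rightarrow>\<^sub>0 'a::zero) \<Rightarrow> bool" where
  "homogeneous d f \<longleftrightarrow> (\<forall>e\<in>Poly_Mapping.keys f. (\<Sum>i\<in>UNIV. e $ i) = d)"

type_synonym ternary = "(nat ^ 3) \<Rightarrow>\<^sub>0 real"

definition on_curve :: "ternary \<Rightarrow> 'a::real_field proj_plane \<Rightarrow> bool" where
  "on_curve f p \<longleftrightarrow> poly_eval of_real f (homvec p) = 0"

text \<open>Smoothness of \<open>V(f)\<close> is tested at the complex points: the differential of \<open>f\<close> does not vanish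
  at any of them.\<close>

definition smooth_plane_curve :: "nat \<Rightarrow> ternary \<Rightarrow> bool" where
  "smooth_plane_curve d f \<longleftrightarrow> f \<noteq> 0 \<and> homogeneous d f \<and>
     (\<forall>p :: complex proj_plane. on_curve f p \<longrightarrow>
        \<not> (poly_eval complex_of_real f has_derivative (\<lambda>_. 0)) (at (homvec p)))"

text \<open>The univariate polynomial \<open>f(v + t w)\<close> in \<open>t\<close>; for independent \<open>v, w\<close> on a line, \<open>t\<close> is a local
  parameter of the line at the point \<open>[v]\<close>, and the order at \<open>0\<close> does not depend on the choice of \<open>w\<close>.\<close>

definition pullback_to_line :: "ternary \<Rightarrow> complex ^ 3 \<Rightarrow> complex ^ 3 \<Rightarrow> complex poly" where
  "pullback_to_line f v w = poly_eval (\<lambda>c. [:of_real c:]) f (\<chi> i. [:v $ i, w $ i:])"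

definition intersection_mult :: "ternary \<Rightarrow> complex proj_plane \<Rightarrow> complex proj_plane \<Rightarrow> nat" where
  "intersection_mult f L p = (if on_line p L 
     then order 0 (pullback_to_line f (homvec p) (homvec (SOME q. on_line q L \<and> q \<noteq> p))) else 0)"

text \<open>The intersection divisor of \<open>V(f)\<close> with the line \<open>L\<close> is \<open>2 Z\<close>, where \<open>Z\<close> is a multiset of two points of \<open>L\<close>
  (equal for a hyperflex). The first conjunct says that \<open>L\<close> is not a component of \<open>V(f)\<close>. The points of \<open>Z\<close>
  are geometric; if \<open>L\<close> is real, then \<open>Z\<close>, being determined by \<open>2 Z\<close>, is stable under conjugation, i.e. it is
  a divisor over the real numbers.\<close>

definition tangency_divisor :: "ternary \<Rightarrow> complex proj_plane \<Rightarrow> complex proj_plane multiset \<Rightarrow> bool" where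
  "tangency_divisor f L Z \<longleftrightarrow> (\<exists>p. on_line p L \<and> \<not> on_curve f p) \<and> size Z = 2 \<and>
     (\<forall>p. intersection_mult f L p = 2 * count Z p)"

definition bitangent :: "ternary \<Rightarrow> complex proj_plane \<Rightarrow> bool" where
  "bitangent f L \<longleftrightarrow> (\<exists>Z. tangency_divisor f L Z)"

definition tangency :: "ternary \<Rightarrow> complex proj_plane \<Rightarrow> complex proj_plane multiset" where
  "tangency f L = (THE Z. tangency_divisor f L Z)"

lemma tangency_divisor_unique:
  assumes "tangency_divisor f L Z" "tangency_divisor f L Z'" shows "Z = Z'"
  using assms by (intro multiset_eqI) (metis tangency_divisor_def nat_mult_eq_cancel1 zero_less_numeral)

text \<open>The scalar \<open>c\<close> with \<open>d(f/\<ell>\<^sub>\<infinity>\<^sup>4) = c d(\<ell>/\<ell>\<^sub>\<infinity>)\<close> at the point \<open>[v]\<close>. The functions on the affine plane \<open>\<ell>\<^sub>\<infinity> \<noteq> 0\<close>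
  are expressed as functions of homogeneous coordinates that are homogeneous of degree \<open>0\<close>. Pulling
  differentials back along \<open>v \<mapsto> [v]\<close> is injective, so the equation may be tested upstairs, and both sides scale
  in the same way when \<open>v\<close> is replaced by a multiple.\<close>

definition tangent_scalar :: "ternary \<Rightarrow> complex ^ 3 \<Rightarrow> complex ^ 3 \<Rightarrow> complex ^ 3 \<Rightarrow> complex" where
  "tangent_scalar f linf l v = (THE c. \<exists>D E.
     ((\<lambda>x. poly_eval of_real f x / linear_form linf x ^ 4) has_derivative D) (at v) \<and>
     ((\<lambda>x. linear_form l x / linear_form linf x) has_derivative E) (at v) \<and>
     (\<forall>w. D w = c * E w))"

text \<open>The type of a bitangent over \<open>'k\<close>, where \<open>h\<close> is the embedding of \<open>'k\<close> into the complex numbers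
  (\<open>of_real\<close> or \<open>id\<close>). The linear forms are chosen over \<open>'k\<close> and over the real numbers, respectively; the
  product over \<open>Z\<close> then lies in the image of \<open>h\<close>. If \<open>Z\<close> meets the line at infinity, the type is \<open>\<langle>1\<rangle>\<close> by
  convention. For \<open>'k = complex\<close> this agrees with always taking \<open>\<langle>1\<rangle>\<close>, see \<open>gw_rank1_complex\<close>.\<close>

definition Qtype :: "('k::field \<Rightarrow> complex) \<Rightarrow> ternary \<Rightarrow> real proj_plane \<Rightarrow> 'k proj_plane \<Rightarrow> 'k gw" where
  "Qtype h f Linf L = (let Z = tangency f (base_change h L) in
     if \<forall>z\<in>#Z. \<not> on_line z (base_change of_real Linf)
     then \<langle>the_inv h (\<Prod>z\<in>#Z. tangent_scalar f (map_vec3 of_real (homvec Linf)) (map_vec3 h (homvec L)) (homvec z))\<rangle>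
     else \<langle>1\<rangle>)"

section \<open>Closed points of the dual plane over the real numbers\<close>

text \<open>A closed point is a Galois orbit of complex points of the dual plane. Its residue field is the
  field of real numbers if the orbit is a single real line, and the field of complex numbers otherwise.\<close>

definition galois_orbit :: "complex proj_plane \<Rightarrow> complex proj_plane set" where
  "galois_orbit L = {L, base_change cnj L}"

lemma galois_orbit_singleton_iff:
  "galois_orbit L = {L} \<longleftrightarrow> (\<exists>L0 :: real proj_plane. L = base_change of_real L0)"
proof
  assume "galois_orbit L = {L}"
  then have cL: "base_change cnj L = L" by (auto simp: galois_orbit_def)
  obtain k where k: "homvec L $ k \<noteq> 0" using homvec(1)[of L] by (auto simp: vec_eq_iff)
  define v where "v = inverse (homvec L $ k) *s homvec L"
  have vk: "v $ k = 1" using k by (simp add: v_def)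
  then have v0: "v \<noteq> 0" by (auto simp: vec_eq_iff intro!: exI[of _ k])
  have pv: "proj_point v = L" unfolding v_def using k homvec[of L] by (subst proj_point_scale) auto
  have "map_vec3 cnj (homvec L) = cnj (homvec L $ k) *s map_vec3 cnj v"
    using k by (simp add: v_def map_vec3_def vec_eq_iff)
  moreover have "map_vec3 cnj v \<noteq> 0" using v0 by (auto simp: map_vec3_def vec_eq_iff)
  ultimately have "proj_point (map_vec3 cnj v) = L" 
    using cL k by (simp add: base_change_def proj_point_scale)
  then obtain a b where ab: "a \<noteq> 0" "b \<noteq> 0" "homvec L = a *s map_vec3 cnj v" "homvec L = b *s v"
    using homvec_proj_point[OF \<open>map_vec3 cnj v \<noteq> 0\<close>] homvec_proj_point[OF v0] pv by metis
  have "a = b" using arg_cong[OF ab(3), of "\<lambda>x. x $ k"] arg_cong[OF ab(4), of "\<lambda>x. x $ k"] vk 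
    by (simp add: map_vec3_def)
  then have cv: "cnj (v $ i) = v $ i" for i
  proof -
    have "homvec L $ i = a * cnj (v $ i)" by (subst ab(3)) (simp add: map_vec3_def)
    moreover have "homvec L $ i = b * v $ i" by (subst ab(4)) simp
    ultimately show ?thesis using \<open>a = b\<close> ab(1) by simp
  qed
  define u where "u = map_vec3 Re v"
  have vu: "v = map_vec3 of_real u" using cv by (auto simp: u_def map_vec3_def vec_eq_iff complex_eq_iff)
  have u0: "u \<noteq> 0" using v0 vu by (auto simp: map_vec3_def vec_eq_iff)
  obtain c where c: "c \<noteq> 0" "homvec (proj_point u) = c *s u" using homvec_proj_point[OF u0] .
  have "map_vec3 of_real (homvec (proj_point u)) = complex_of_real c *s v"
    unfolding vu c(2) by (simp add: map_vec3_def vec_eq_iff)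
  then have "base_change of_real (proj_point u) = L" using c(1) v0 pv
    by (simp add: base_change_def proj_point_scale)
  then show "\<exists>L0 :: real proj_plane. L = base_change of_real L0" by metis
next
  assume "\<exists>L0 :: real proj_plane. L = base_change of_real L0"
  then obtain L0 :: "real proj_plane" where L: "L = base_change of_real L0" by blast
  let ?v = "map_vec3 complex_of_real (homvec L0)"
  have "?v \<noteq> 0" using homvec(1)[of L0] by (auto simp: map_vec3_def vec_eq_iff)
  from homvec_proj_point[OF this] obtain c where c: "c \<noteq> 0" "homvec (proj_point ?v) = c *s ?v" .
  have "map_vec3 cnj (homvec L) = cnj c *s ?v"
    using c(2) unfolding L base_change_def by (simp add: map_vec3_def vec_eq_iff)
  then have "base_change cnj L = L" using c(1) \<open>?v \<noteq> 0\<close> unfolding L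
    by (subst base_change_def) (simp add: proj_point_scale, simp add: base_change_def)
  then show "galois_orbit L = {L}" by (simp add: galois_orbit_def)
qed

text \<open>\<open>Tr\<^bsub>k(L)/\<real>\<^esub> Qtype(L)\<close> for the closed point \<open>x\<close>. The transfer for the trivial extension is the identity.\<close>

definition transferred_Qtype :: "ternary \<Rightarrow> real proj_plane \<Rightarrow> complex proj_plane set \<Rightarrow> real gw" where
  "transferred_Qtype f Linf x =
     (if \<exists>L :: real proj_plane. x = {base_change of_real L}
      then Qtype of_real f Linf (THE L. x = {base_change of_real L})
      else gw_transfer (Qtype id f Linf (SOME L. L \<in> x)))"

end

theory Submission
  imports Defs "Jordan_Normal_Form.Determinant" "HOL-Complex_Analysis.Complex_Analysis"
begin

text \<open>
  The theorem combines a complex count (there are 28 bitangents) with a real count (the signed number is 4); the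
  Grothendieck-Witt ring of the reals only records rank and signature.

  \<^bold>\<open>Complex count.\<close> Near a line, the pairs of a bitangent and a square root of the quartic restricted to it
  are the zeros of a map between complex spaces of dimension five. For a smooth quartic this map has an
  injective derivative at its zeros (\<open>bitangent_transversal\<close>): to first order, the square changes by a multiple of its root, which
  vanishes at both tangency points, whereas a motion of the line that does not fix both points changes the quartic at one of them. Hence, in a family of smooth quartics, bitangents are isolated,
  they persist by invariance of domain, and by compactness none escapes: their number is constant along a segment of smooth
  quartics (\<open>card_bitangents_segment\<close>). Any two smooth quartics are joined by two such segments through a
  generic third quartic (\<open>card_bitangents_constant\<close>), and the bitangents of the Fermat quartic can be listed.

  \<^bold>\<open>Signed real count.\<close> Send \<open>Linf\<close> to infinity. An oriented real line in the affine plane is given by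
  a direction \<open>e\<close> on the unit circle and a signed distance \<open>r\<close>, hence by the point \<open>exp r e\<close> of the punctured complex
  plane. As \<open>Q\<close> has no real point at infinity, the quartic restricted to the line can be divided by its leading
  coefficient; the result is uniquely \<open>(t\<^sup>2 + p t + q)\<^sup>2 + G\<^sub>1 t + G\<^sub>0\<close>, and the line is bitangent iff its defect
  \<open>G\<^sub>0 + \<i> G\<^sub>1\<close> vanishes. The defect is thus a map from the punctured plane to the plane, whose zeros are
  the oriented real bitangents other than \<open>Linf\<close>. At a zero its Jacobian determinant is, up to a positive factor,
  the product of the derivatives of the quartic normal to the line at the two tangency points, so that the local index of
  the zero is the sign of the type of the bitangent (\<open>Qtype_line\<close>).

  By the argument principle on an annulus (\<open>annulus_degree\<close>), the sum of all indices is the winding number of the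
  defect along a large circle minus the one along a small circle. Reversing the orientation of lines replaces
  \<open>(e, r)\<close> by \<open>(- e, - r)\<close> and conjugates the defect. So the two winding numbers are opposite, while each line is counted
  twice, and the signed number of bitangents other than \<open>Linf\<close> is the winding number of the defect along a large
  circle. There the lines are close to \<open>Linf\<close>, and the defect can be deformed to the square of the difference
  of the two roots that the quartic has on \<open>Linf\<close> in the upper half plane, in a coordinate rotating with \<open>e\<close>. That
  square turns 4 times. If the two roots coincide, then \<open>Linf\<close> is itself a bitangent, the first order term of the
  defect decides and turns 3 times, and \<open>Linf\<close>, of type \<open>\<langle>1\<rangle>\<close> by convention, makes up for the difference
  (\<open>turns_at_infinity\<close>).

  \<^bold>\<open>Conclusion.\<close> A pair of conjugate bitangents contributes the hyperbolic form \<open>\<langle>1\<rangle> + \<langle>-1\<rangle>\<close>. With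
  \<open>n\<^sub>+\<close>, \<open>n\<^sub>-\<close> real bitangents of the two types and \<open>m\<close> pairs, \<open>n\<^sub>+ - n\<^sub>- = 4\<close> and \<open>n\<^sub>+ + n\<^sub>- + 2 m = 28\<close> give
  \<open>n\<^sub>+ + m = 16\<close> and \<open>n\<^sub>- + m = 12\<close>.
\<close>

(* keep the dollar sign for components of vectors, and the bullet for inner products *)
no_notation fps_nth (infixl "$" 75)
no_notation Matrix.vec_index (infixl "$" 100)
no_notation Matrix.scalar_prod (infix "\<bullet>" 70)

section \<open>Quartic forms as symmetric four-linear forms\<close>

type_synonym complex_form = "complex^3 \<Rightarrow> complex^3 \<Rightarrow> complex^3 \<Rightarrow> complex^3 \<Rightarrow> complex"

abbreviation quartic_at where "quartic_at \<Phi> x \<equiv> \<Phi> x x x x"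

text \<open>A quarter of the derivative of \<open>quartic_at \<Phi>\<close> at \<open>x\<close> in the direction \<open>w\<close>.\<close>

abbreviation polar_at where "polar_at \<Phi> x w \<equiv> \<Phi> x x x w"

text \<open>A form of degree four is kept together with its polarization: the derivatives of the form and its restrictions
  to lines are then values of one and the same symmetric four-linear form.\<close>

locale quartic_form =
  fixes \<Phi> :: "'a::real_normed_field ^ 3 \<Rightarrow> 'a ^ 3 \<Rightarrow> 'a ^ 3 \<Rightarrow> 'a ^ 3 \<Rightarrow> 'a"
  assumes swap12: "\<Phi> x y z w = \<Phi> y x z w"
    and swap23: "\<Phi> x y z w = \<Phi> x z y w"
    and swap34: "\<Phi> x y z w = \<Phi> x y w z"
    and add1: "\<Phi> (x + x') y z w = \<Phi> x y z w + \<Phi> x' y z w"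
    and scale1: "\<Phi> (c *s x) y z w = c * \<Phi> x y z w"
begin

lemma add2: "\<Phi> x (y + y') z w = \<Phi> x y z w + \<Phi> x y' z w"
  by (metis add1 swap12)
lemma add3: "\<Phi> x y (z + z') w = \<Phi> x y z w + \<Phi> x y z' w"
  by (metis add2 swap23)
lemma add4: "\<Phi> x y z (w + w') = \<Phi> x y z w + \<Phi> x y z w'"
  by (metis add3 swap34)
lemma scale2: "\<Phi> x (c *s y) z w = c * \<Phi> x y z w"
  by (metis scale1 swap12)
lemma scale3: "\<Phi> x y (c *s z) w = c * \<Phi> x y z w"
  by (metis scale2 swap23)
lemma scale4: "\<Phi> x y z (c *s w) = c * \<Phi> x y z w"
  by (metis scale3 swap34)

lemmas multilinear = add1 add2 add3 add4 scale1 scale2 scale3 scale4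

lemma swap13: "\<Phi> x y z w = \<Phi> z y x w"
  by (metis swap12 swap23)
lemma swap14: "\<Phi> x y z w = \<Phi> w y z x"
  by (metis swap13 swap34)
lemma swap24: "\<Phi> x y z w = \<Phi> x w z y"
  by (metis swap34 swap23)

lemmas swaps = swap12 swap23 swap34 swap13 swap14 swap24

lemma diff1: "\<Phi> (x - x') y z w = \<Phi> x y z w - \<Phi> x' y z w"
  using add1[of "x - x'" x'] by (simp add: algebra_simps)

lemma zero1: "\<Phi> 0 y z w = 0"
  using diff1[of 0 0] by simp

lemma quartic_scale: "quartic_at \<Phi> (c *s x) = c ^ 4 * \<Phi> x x x x"
  by (simp add: multilinear eval_nat_numeral)

lemma quartic_on_line:
  "quartic_at \<Phi> (x *s u + y *s v) =
     \<Phi> u u u u * x ^ 4 + 4 * \<Phi> u u u v * x ^ 3 * y + 6 * \<Phi> u u v v * x ^ 2 * y ^ 2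
     + 4 * \<Phi> u v v v * x * y ^ 3 + \<Phi> v v v v * y ^ 4"
proof -
  have e: "\<Phi> v u u u = \<Phi> u u u v" "\<Phi> u v u u = \<Phi> u u u v" "\<Phi> u u v u = \<Phi> u u u v"
    "\<Phi> v v u u = \<Phi> u u v v" "\<Phi> v u v u = \<Phi> u u v v" "\<Phi> v u u v = \<Phi> u u v v"
    "\<Phi> u v v u = \<Phi> u u v v" "\<Phi> u v u v = \<Phi> u u v v"
    "\<Phi> v v v u = \<Phi> u v v v" "\<Phi> v v u v = \<Phi> u v v v" "\<Phi> v u v v = \<Phi> u v v v"
    by (metis swap12 swap23 swap34)+
  show ?thesis
    by (simp only: multilinear e) (simp add: algebra_simps power2_eq_square power3_eq_cube power4_eq_xxxx)
qed

lemma cubic_on_line: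
  "polar_at \<Phi> (x *s u + y *s v) d =
     \<Phi> u u u d * x ^ 3 + 3 * \<Phi> u u v d * x ^ 2 * y + 3 * \<Phi> u v v d * x * y ^ 2 + \<Phi> v v v d * y ^ 3"
proof -
  have e: "\<Phi> v u u d = \<Phi> u u v d" "\<Phi> u v u d = \<Phi> u u v d" "\<Phi> v u v d = \<Phi> u v v d" "\<Phi> v v u d = \<Phi> u v v d"
    by (metis swap12 swap23)+
  show ?thesis
    by (simp add: multilinear e) (simp add: algebra_simps power2_eq_square power3_eq_cube power4_eq_xxxx)
qed

text \<open>Telescoping: the symmetric form makes \<open>F(x) - F(y)\<close> a multiple of \<open>x - y\<close>.\<close>

lemma quartic_diff:
  "\<Phi> x x x x - \<Phi> y y y y = \<Phi> (x - y) x x x + \<Phi> (x - y) x x y + \<Phi> (x - y) x y y + \<Phi> (x - y) y y y"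
proof -
  have "\<Phi> y x x x = \<Phi> x x x y" by (rule swap14)
  moreover have "\<Phi> y x x y = \<Phi> x x y y" by (rule swap13)
  moreover have "\<Phi> y x y y = \<Phi> x y y y" by (rule swap12)
  ultimately show ?thesis by (simp add: diff1)
qed

lemma vec_axis_expand: "x = (\<Sum>i\<in>UNIV. x $ i *s axis i (1::'a))" for x :: "'a^3"
  by (simp add: vec_eq_iff axis_def if_distrib cong: if_cong)

lemma sum1: "\<Phi> (\<Sum>i\<in>A. f i) y z w = (\<Sum>i\<in>A. \<Phi> (f i) y z w)"
  by (induction A rule: infinite_finite_induct) (auto simp: zero1 add1)
lemma sum2: "\<Phi> x (\<Sum>i\<in>A. f i) z w = (\<Sum>i\<in>A. \<Phi> x (f i) z w)"
  by (subst swap12, subst sum1, rule sum.cong[OF refl swap12])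
lemma sum3: "\<Phi> x y (\<Sum>i\<in>A. f i) w = (\<Sum>i\<in>A. \<Phi> x y (f i) w)"
  by (subst swap23, subst sum2, rule sum.cong[OF refl swap23])
lemma sum4: "\<Phi> x y z (\<Sum>i\<in>A. f i) = (\<Sum>i\<in>A. \<Phi> x y z (f i))"
  by (subst swap34, subst sum3, rule sum.cong[OF refl swap34])

lemma coordinate_expansion:
  "\<Phi> x y z w = (\<Sum>i\<in>UNIV. \<Sum>j\<in>UNIV. \<Sum>k\<in>UNIV. \<Sum>l\<in>UNIV.
     x $ i * y $ j * z $ k * w $ l * \<Phi> (axis i 1) (axis j 1) (axis k 1) (axis l 1))"
proof -
  have 1: "\<Phi> x y z w = (\<Sum>i\<in>UNIV. x $ i * \<Phi> (axis i 1) y z w)" for x y z w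
    by (subst vec_axis_expand[of x]) (simp only: sum1 scale1)
  have 2: "\<Phi> x y z w = (\<Sum>i\<in>UNIV. y $ i * \<Phi> x (axis i 1) z w)" for x y z w
    by (subst vec_axis_expand[of y]) (simp only: sum2 scale2)
  have 3: "\<Phi> x y z w = (\<Sum>i\<in>UNIV. z $ i * \<Phi> x y (axis i 1) w)" for x y z w
    by (subst vec_axis_expand[of z]) (simp only: sum3 scale3)
  have 4: "\<Phi> x y z w = (\<Sum>i\<in>UNIV. w $ i * \<Phi> x y z (axis i 1))" for x y z w
    by (subst vec_axis_expand[of w]) (simp only: sum4 scale4)
  show ?thesis
    by (unfold 1[of x y z w], unfold 2[of _ y z w], unfold 3[of _ _ z w], unfold 4[of _ _ _ w])
       (simp only: sum_distrib_left mult.assoc)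
qed

lemma tendsto_form:
  assumes "(f \<longlongrightarrow> x) F" "(g \<longlongrightarrow> y) F" "(h \<longlongrightarrow> z) F" "(k \<longlongrightarrow> w) F"
  shows "((\<lambda>t. \<Phi> (f t) (g t) (h t) (k t)) \<longlongrightarrow> \<Phi> x y z w) F"
  unfolding coordinate_expansion[of "f _"] coordinate_expansion[of x]
  by (intro tendsto_intros assms)

lemma continuous_on_form:
  assumes "continuous_on S f" "continuous_on S g" "continuous_on S h" "continuous_on S k"
  shows "continuous_on S (\<lambda>t. \<Phi> (f t) (g t) (h t) (k t))"
  using assms unfolding continuous_on_def by (auto intro: tendsto_form)

lemma has_derivative_form:
  assumes "(f has_derivative f') (at a within S)" "(g has_derivative g') (at a within S)"
    "(h has_derivative h') (at a within S)" "(k has_derivative k') (at a within S)"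
  shows "((\<lambda>t. \<Phi> (f t) (g t) (h t) (k t)) has_derivative
     (\<lambda>d. \<Phi> (f' d) (g a) (h a) (k a) + \<Phi> (f a) (g' d) (h a) (k a) + \<Phi> (f a) (g a) (h' d) (k a)
        + \<Phi> (f a) (g a) (h a) (k' d))) (at a within S)"
proof -
  have c: "((\<lambda>t. f t $ i) has_derivative (\<lambda>d. f' d $ i)) (at a within S)"
    if "(f has_derivative f') (at a within S)" for f f' and i :: 3
    using bounded_linear.has_derivative[OF bounded_linear_vec_nth that] .
  note ci = assms[THEN c]
  show ?thesis
    unfolding coordinate_expansion[of "f _"] coordinate_expansion[of "f' _"]
    by (rule has_derivative_eq_rhs, (rule derivative_intros ci)+)
       (simp add: fun_eq_iff algebra_simps sum.distrib)
qed

end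

section \<open>Lines in the plane and binary forms\<close>

definition indep2 :: "'a::field ^ 3 \<Rightarrow> 'a ^ 3 \<Rightarrow> bool" where
  "indep2 u v \<longleftrightarrow> (\<forall>x y. x *s u + y *s v = 0 \<longrightarrow> x = 0 \<and> y = 0)"

lemma linear_form_add [simp]: "linear_form l (u + v) = linear_form l u + linear_form l v"
  by (simp add: linear_form_def algebra_simps sum.distrib)

lemma linear_form_diff [simp]: "linear_form l (u - v) = linear_form l u - linear_form l v"
  by (simp add: linear_form_def algebra_simps sum_subtractf)

lemma linear_form_scale [simp]: "linear_form l (c *s u) = c * linear_form l u"
  by (simp add: linear_form_def algebra_simps sum_distrib_left)

lemma linear_form_scale_left [simp]: "linear_form (c *s l) u = c * linear_form l u"
  by (simp add: linear_form_def algebra_simps sum_distrib_left)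

lemma linear_form_zero [simp]: "linear_form l 0 = 0"
  by (simp add: linear_form_def)

lemma linear_form_add_left: "linear_form (l + m) u = linear_form l u + linear_form m u"
  by (simp add: linear_form_def algebra_simps sum.distrib)

lemma linear_form_expand:
  fixes i j k :: 3
  assumes "(UNIV :: 3 set) = {i, j, k}" "i \<noteq> j" "i \<noteq> k" "j \<noteq> k"
  shows "linear_form l w = l $ i * w $ i + l $ j * w $ j + l $ k * w $ k"
  unfolding linear_form_def assms(1) using assms(2-4) by (simp add: add.assoc)

lemma linear_form_axis: "linear_form (axis i 1) x = x $ i" "linear_form l (axis i 1) = l $ i"
  by (simp_all add: linear_form_def axis_def mult_delta_left mult_delta_right)

lemma kernel_span_aux:
  fixes u v w l :: "'a::field ^ 3"
  assumes ijk: "(UNIV :: 3 set) = {i, j, k}" "i \<noteq> j" "i \<noteq> k" "j \<noteq> k"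
    and m: "u $ i * v $ j - u $ j * v $ i \<noteq> 0"
    and l: "l \<noteq> 0" "linear_form l u = 0" "linear_form l v = 0" "linear_form l w = 0"
  shows "\<exists>x y. w = x *s u + y *s v"
proof -
  define D where "D = u $ i * v $ j - u $ j * v $ i"
  define x where "x = (w $ i * v $ j - w $ j * v $ i) / D"
  define y where "y = (u $ i * w $ j - u $ j * w $ i) / D"
  define z where "z = w - (x *s u + y *s v)"
  have D: "D \<noteq> 0" using m by (simp add: D_def)
  have zi: "z $ i = 0"
  proof -
    have "D * (x * u $ i + y * v $ i) = D * w $ i" using D
      by (simp add: x_def y_def distrib_left) (simp add: D_def algebra_simps)
    then show ?thesis using D by (simp add: z_def)
  qed
  have zj: "z $ j = 0"
  proof -
    have "D * (x * u $ j + y * v $ j) = D * w $ j" using D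
      by (simp add: x_def y_def distrib_left) (simp add: D_def algebra_simps)
    then show ?thesis using D by (simp add: z_def)
  qed
  note lf = linear_form_expand[OF ijk]
  have "linear_form l z = 0" using l by (simp add: z_def)
  then have "l $ k * z $ k = 0" using zi zj by (simp add: lf)
  moreover have "l $ k \<noteq> 0"
  proof
    assume lk: "l $ k = 0"
    have 1: "l $ i * u $ i + l $ j * u $ j = 0" "l $ i * v $ i + l $ j * v $ j = 0"
      using l(2,3) lk by (simp_all add: lf)
    have "l $ i * D = v $ j * (l $ i * u $ i + l $ j * u $ j) - u $ j * (l $ i * v $ i + l $ j * v $ j)"
      by (simp add: D_def algebra_simps)
    also have "\<dots> = 0" unfolding 1 by simp
    finally have li: "l $ i = 0" using D by simp
    have "l $ j * D = u $ i * (l $ i * v $ i + l $ j * v $ j) - v $ i * (l $ i * u $ i + l $ j * u $ j)"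
      by (simp add: D_def algebra_simps)
    also have "\<dots> = 0" unfolding 1 by simp
    finally have lj: "l $ j = 0" using D by simp
    then have "\<forall>a\<in>{i,j,k}. l $ a = 0" using li lj lk by simp
    then have "l = 0" unfolding ijk(1)[symmetric] by (simp add: vec_eq_iff)
    then show False using l(1) by blast
  qed
  ultimately have "\<forall>a\<in>{i,j,k}. z $ a = 0" using zi zj by simp
  then have "z = 0" unfolding ijk(1)[symmetric] by (simp add: vec_eq_iff)
  then show ?thesis by (auto simp: z_def)
qed

text \<open>The kernel of a nonzero linear form in three variables is two-dimensional; Cramer's rule gives the coefficients,
  once the two-by-two minor that does not vanish is known.\<close>

lemma kernel_span:
  fixes u v w l :: "'a::field ^ 3"
  assumes uv: "indep2 u v"
    and l: "l \<noteq> 0" "linear_form l u = 0" "linear_form l v = 0" "linear_form l w = 0"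
  shows "\<exists>x y. w = x *s u + y *s v"
proof (rule ccontr)
  assume n: "\<not> ?thesis"
  have U: "(UNIV :: 3 set) = {1,2,3}" "(UNIV :: 3 set) = {1,3,2}" "(UNIV :: 3 set) = {2,3,1}"
    using UNIV_3 by auto
  have "u $ i * v $ j - u $ j * v $ i = 0" if "(UNIV :: 3 set) = {i, j, k}" "i \<noteq> j" "i \<noteq> k" "j \<noteq> k" for i j k
    using kernel_span_aux[OF that _ l] n by blast
  from this[OF U(1)] this[OF U(2)] this[OF U(3)]
  have m: "u $ 1 * v $ 2 - u $ 2 * v $ 1 = 0" "u $ 1 * v $ 3 - u $ 3 * v $ 1 = 0" "u $ 2 * v $ 3 - u $ 3 * v $ 2 = 0"
    by simp_all
  have z: "(- (v $ a)) *s u + (u $ a) *s v = 0" for a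
    using exhaust_3[of a] m by (auto simp: vec_eq_iff forall_3 algebra_simps)
  have "u = 0" using z uv unfolding indep2_def by (metis vec_eq_iff zero_index)
  then have "1 *s u + 0 *s v = 0" by simp
  then show False using uv unfolding indep2_def by (metis zero_neq_one)
qed

definition binary_quadratic :: "'a::comm_ring_1 \<times> 'a \<times> 'a \<Rightarrow> 'a \<Rightarrow> 'a \<Rightarrow> 'a" where
  "binary_quadratic q x y = fst q * x ^ 2 + fst (snd q) * x * y + snd (snd q) * y ^ 2"

lemma binary_quadratic_factor:
  fixes q :: "complex \<times> complex \<times> complex"
  obtains \<alpha> \<beta> \<gamma> \<delta> where "\<And>x y. binary_quadratic q x y = (\<alpha> * x + \<beta> * y) * (\<gamma> * x + \<delta> * y)"
proof -
  obtain a b c where q: "q = (a, b, c)" by (cases q) auto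
  show ?thesis
  proof (cases "a = 0")
    case True
    show ?thesis by (rule that[of 0 1 b c]) (simp add: q True binary_quadratic_def algebra_simps power2_eq_square)
  next
    case False
    define s where "s = csqrt (b ^ 2 - 4 * a * c)"
    have s: "s * s = b * b - 4 * a * c" using power2_csqrt[of "b ^ 2 - 4 * a * c"]
      unfolding s_def by (simp add: power2_eq_square)
    have "4 * a * binary_quadratic q x y = 4 * a * ((a * x + (b - s) / 2 * y) * (1 * x + (b + s) / (2 * a) * y))" for x y
    proof -
      have "4 * a * ((a * x + (b - s) / 2 * y) * (1 * x + (b + s) / (2 * a) * y)) =
        (2 * a * x + (b - s) * y) * (2 * a * x + (b + s) * y)" using False by (simp add: field_simps)
      also have "\<dots> = 4 * a * a * x * x + 4 * a * b * x * y + (b * b - s * s) * y * y" by (simp add: algebra_simps)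
      finally show ?thesis unfolding s by (simp add: q binary_quadratic_def algebra_simps power2_eq_square)
    qed
    moreover have "4 * a \<noteq> 0" using False by simp
    ultimately have "binary_quadratic q x y = (a * x + (b - s) / 2 * y) * (1 * x + (b + s) / (2 * a) * y)" for x y
      using mult_left_cancel by blast
    then show ?thesis by (rule that)
  qed
qed

lemma quartic_poly_zero:
  fixes c0 c1 c2 c3 c4 :: "'a::{comm_ring_1,ring_no_zero_divisors,ring_char_0}"
  assumes "\<And>t. c0 + c1 * t + c2 * t ^ 2 + c3 * t ^ 3 + c4 * t ^ 4 = 0"
  shows "c0 = 0" "c1 = 0" "c2 = 0" "c3 = 0" "c4 = 0"
proof -
  have "poly [:c0, c1, c2, c3, c4:] t = 0" for t
    using assms[of t] by (simp add: algebra_simps eval_nat_numeral)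
  then have "[:c0, c1, c2, c3, c4:] = 0" using poly_all_0_iff_0 by blast
  then show "c0 = 0" "c1 = 0" "c2 = 0" "c3 = 0" "c4 = 0" by simp_all
qed

lemma binary_quadratic_mult_zero:
  fixes q r :: "'a::{idom,ring_char_0} \<times> 'a \<times> 'a"
  assumes "\<And>x y. binary_quadratic q x y * binary_quadratic r x y = 0"
  shows "q = 0 \<or> r = 0"
proof -
  obtain a b c where q: "q = (a, b, c)" by (cases q) auto
  obtain a' b' c' where r: "r = (a', b', c')" by (cases r) auto
  have "poly ([:a, b, c:] * [:a', b', c':]) t = 0" for t
    using assms[of 1 t] by (simp add: q r binary_quadratic_def algebra_simps power2_eq_square)
  then have "[:a, b, c:] * [:a', b', c':] = 0" using poly_all_0_iff_0 by blast
  then show ?thesis by (auto simp: q r zero_prod_def)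
qed

definition binary_quartic :: "('a::comm_ring_1 \<Rightarrow> 'a \<Rightarrow> 'a) \<Rightarrow> bool" where
  "binary_quartic H \<longleftrightarrow> (\<exists>c0 c1 c2 c3 c4. \<forall>x y. H x y = c0 * x ^ 4 + c1 * x ^ 3 * y + c2 * x ^ 2 * y ^ 2 + c3 * x * y ^ 3 + c4 * y ^ 4)"

text \<open>A binary quartic has five coefficients and vanishes identically if it does at five points of the projective line. This makes
  equality of binary quartics a finite-dimensional condition, to which invariance of domain can be applied.\<close>

lemma binary_quartic_five_points:
  fixes H :: "'a::{idom,ring_char_0} \<Rightarrow> 'a \<Rightarrow> 'a"
  assumes "binary_quartic H" "H 1 0 = 0" "H 0 1 = 0" "H 1 1 = 0" "H 1 (-1) = 0" "H 1 2 = 0"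
  shows "H x y = 0"
proof -
  obtain c0 c1 c2 c3 c4 where H: "\<And>x y. H x y = c0 * x ^ 4 + c1 * x ^ 3 * y + c2 * x ^ 2 * y ^ 2 + c3 * x * y ^ 3 + c4 * y ^ 4"
    using assms(1) unfolding binary_quartic_def by blast
  have 0: "c0 = 0" "c4 = 0" using assms(2,3) by (simp_all add: H)
  have 1: "c1 + c2 + c3 = 0" "- c1 + c2 - c3 = 0" "2 * c1 + 4 * c2 + 8 * c3 = 0"
    using assms(4-6) by (simp_all add: H 0 algebra_simps)
  have "2 * c2 = (c1 + c2 + c3) + (- c1 + c2 - c3)" by (simp add: algebra_simps)
  then have c2: "c2 = 0" unfolding 1 by simp
  have c13: "c1 = - c3" using 1(1) c2 by (simp add: eq_neg_iff_add_eq_0)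
  have "6 * c3 = 0" using 1(3) unfolding c2 c13 by (simp add: algebra_simps)
  then have c3: "c3 = 0" by simp
  have "c1 = 0" using 1(1) c2 c3 by simp
  then show ?thesis using 0 c2 c3 by (simp add: H)
qed

lemma binary_quartic_diff:
  assumes "binary_quartic H" "binary_quartic K" shows "binary_quartic (\<lambda>x y. H x y - K x y)"
proof -
  obtain c0 c1 c2 c3 c4 d0 d1 d2 d3 d4 where
    HK: "\<And>x y. H x y = c0 * x ^ 4 + c1 * x ^ 3 * y + c2 * x ^ 2 * y ^ 2 + c3 * x * y ^ 3 + c4 * y ^ 4"
    "\<And>x y. K x y = d0 * x ^ 4 + d1 * x ^ 3 * y + d2 * x ^ 2 * y ^ 2 + d3 * x * y ^ 3 + d4 * y ^ 4"
    using assms unfolding binary_quartic_def by metis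
  show ?thesis unfolding binary_quartic_def
    by (rule exI[of _ "c0 - d0"], rule exI[of _ "c1 - d1"], rule exI[of _ "c2 - d2"], rule exI[of _ "c3 - d3"],
        rule exI[of _ "c4 - d4"]) (simp add: HK algebra_simps)
qed

lemma binary_quartic_mult:
  "binary_quartic (\<lambda>x y. c * binary_quadratic q x y * binary_quadratic r x y)"
proof -
  obtain a b d where q: "q = (a, b, d)" by (cases q) auto
  obtain a' b' d' where r: "r = (a', b', d')" by (cases r) auto
  show ?thesis unfolding binary_quartic_def binary_quadratic_def q r
    by (rule exI[of _ "c * a * a'"], rule exI[of _ "c * (a * b' + b * a')"], rule exI[of _ "c * (a * d' + b * b' + d * a')"],
        rule exI[of _ "c * (b * d' + d * b')"], rule exI[of _ "c * d * d'"])
       (simp add: power2_eq_square power3_eq_cube power4_eq_xxxx algebra_simps)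
qed

lemma (in quartic_form) binary_quartic_restrict:
  "binary_quartic (\<lambda>x y. quartic_at \<Phi> (x *s u + y *s v))"
  unfolding binary_quartic_def quartic_on_line by blast

section \<open>Transversality at a bitangent of a smooth quartic\<close>

text \<open>The restriction of the quartic to the line through \<open>u\<close> and \<open>v\<close> is the square of the binary quadratic form \<open>q\<close>.
  For a smooth quartic this is bitangency, hyperflexes included.\<close>

definition square_on :: "complex_form \<Rightarrow> complex^3 \<Rightarrow> complex^3 \<Rightarrow> complex \<times> complex \<times> complex \<Rightarrow> bool" where
  "square_on \<Phi> u v q \<longleftrightarrow> (\<forall>x y. quartic_at \<Phi> (x *s u + y *s v) = binary_quadratic q x y ^ 2)"

locale smooth_quartic = quartic_form \<Phi> for \<Phi> :: complex_form +
  assumes smooth: "x \<noteq> 0 \<Longrightarrow> \<exists>w. \<Phi> x x x w \<noteq> 0"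

definition basis3 :: "'a::field^3 \<Rightarrow> 'a^3 \<Rightarrow> 'a^3 \<Rightarrow> bool" where
  "basis3 u v d \<longleftrightarrow> indep2 u v \<and> (\<forall>w. \<exists>a b c. w = a *s u + b *s v + c *s d)"

lemma basis3_of_kernel:
  fixes l :: "'a::field^3"
  assumes uv: "indep2 u v" "linear_form l u = 0" "linear_form l v = 0" and d: "linear_form l d \<noteq> 0"
  shows "basis3 u v d"
  unfolding basis3_def
proof (intro conjI allI uv(1))
  fix w
  have l: "l \<noteq> 0" using d by (auto simp: linear_form_def)
  define c where "c = linear_form l w / linear_form l d"
  have "linear_form l (w - c *s d) = 0" using d by (simp add: c_def)
  then obtain a b where "w - c *s d = a *s u + b *s v" using kernel_span[OF uv(1) l uv(2,3)] by blast
  then have "w = a *s u + b *s v + c *s d" by (simp add: algebra_simps)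
  then show "\<exists>a b c. w = a *s u + b *s v + c *s d" by blast
qed

context quartic_form begin

text \<open>A square vanishes to second order at a zero of its root.\<close>

lemma polar_zero_at_root:
  assumes "\<And>t. quartic_at \<Phi> (X + t *s u) = (a * t + b * t ^ 2) ^ 2"
  shows "\<Phi> X X X u = 0"
proof -
  have "0 + 4 * \<Phi> X X X u * t + (6 * \<Phi> X X u u - a ^ 2) * t ^ 2 + (4 * \<Phi> X u u u - 2 * a * b) * t ^ 3
     + (\<Phi> u u u u - b ^ 2) * t ^ 4 = 0" for t
  proof -
    have "\<Phi> X X X X = 0" using assms[of 0] by simp
    moreover have "quartic_at \<Phi> (1 *s X + t *s u) = (a * t + b * t ^ 2) ^ 2"
      using assms[of t] by simp
    ultimately show ?thesis unfolding quartic_on_line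
      by (simp add: algebra_simps eval_nat_numeral)
  qed
  from quartic_poly_zero(2)[OF this] show ?thesis by simp
qed

lemma gradient_at_square_root:
  assumes q: "\<And>x y. quartic_at \<Phi> (x *s u + y *s v) = binary_quadratic q x y ^ 2"
    and r: "binary_quadratic q x y = 0"
  shows "polar_at \<Phi> (x *s u + y *s v) u = 0" "polar_at \<Phi> (x *s u + y *s v) v = 0"
proof -
  obtain q0 q1 q2 where qq: "q = (q0, q1, q2)" by (cases q) auto
  have r': "q0 * x\<^sup>2 + q1 * x * y + q2 * y\<^sup>2 = 0" using r by (simp add: qq binary_quadratic_def)
  let ?X = "x *s u + y *s v"
  have "quartic_at \<Phi> (?X + t *s u) = ((2 * q0 * x + q1 * y) * t + q0 * t\<^sup>2)\<^sup>2" for t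
  proof -
    have X: "?X + t *s u = (x + t) *s u + y *s v" by (simp add: vec_eq_iff algebra_simps)
    have "binary_quadratic q (x + t) y = (q0 * x\<^sup>2 + q1 * x * y + q2 * y\<^sup>2) + ((2 * q0 * x + q1 * y) * t + q0 * t\<^sup>2)"
      by (simp add: binary_quadratic_def qq algebra_simps power2_eq_square)
    then show ?thesis unfolding X q r' by simp
  qed
  then show "\<Phi> ?X ?X ?X u = 0" by (rule polar_zero_at_root)
  have "quartic_at \<Phi> (?X + t *s v) = ((2 * q2 * y + q1 * x) * t + q2 * t\<^sup>2)\<^sup>2" for t
  proof -
    have X: "?X + t *s v = x *s u + (y + t) *s v" by (simp add: vec_eq_iff algebra_simps)
    have "binary_quadratic q x (y + t) = (q0 * x\<^sup>2 + q1 * x * y + q2 * y\<^sup>2) + ((2 * q2 * y + q1 * x) * t + q2 * t\<^sup>2)"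
      by (simp add: binary_quadratic_def qq algebra_simps power2_eq_square)
    then show ?thesis unfolding X q r' by simp
  qed
  then show "\<Phi> ?X ?X ?X v = 0" by (rule polar_zero_at_root)
qed

end

context smooth_quartic begin

text \<open>At a tangency point the differential of the quartic kills the line; by smoothness it cannot kill a third direction
  as well.\<close>

lemma polar_nonzero_at_tangency:
  assumes b: "basis3 u v d" and q: "square_on \<Phi> u v q"
    and r: "binary_quadratic q x y = 0" "(x, y) \<noteq> (0, 0)"
  shows "polar_at \<Phi> (x *s u + y *s v) d \<noteq> 0"
proof
  define X where "X = x *s u + y *s v"
  assume "polar_at \<Phi> (x *s u + y *s v) d = 0"
  then have d: "\<Phi> X X X d = 0" by (simp add: X_def)
  have "\<Phi> X X X u = 0" "\<Phi> X X X v = 0"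
    using gradient_at_square_root[OF _ r(1)] q unfolding square_on_def X_def by blast+
  moreover have "X \<noteq> 0" using b r(2) by (auto simp: basis3_def indep2_def X_def)
  then obtain w where "\<Phi> X X X w \<noteq> 0" using smooth by blast
  moreover obtain a c e where "w = a *s u + c *s v + e *s d" using b unfolding basis3_def by blast
  ultimately show False using d by (simp add: multilinear)
qed

text \<open>A smooth quartic does not contain a line: otherwise every point of the line would be a tangency point, but the cubic
  form \<open>polar_at \<Phi> z d\<close> has a zero on the line.\<close>

lemma square_on_nonzero:
  assumes b: "basis3 u v d" and q: "square_on \<Phi> u v q"
  shows "q \<noteq> 0"
proof
  assume 0: "q = 0"
  define p where "p = [:\<Phi> u u u d, 3 * \<Phi> u u v d, 3 * \<Phi> u v v d, \<Phi> v v v d:]"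
  have nz: "polar_at \<Phi> (x *s u + y *s v) d \<noteq> 0" if "(x, y) \<noteq> (0, 0)" for x y
    by (rule polar_nonzero_at_tangency[OF b q _ that]) (simp add: 0 binary_quadratic_def)
  have "coeff p 3 \<noteq> 0" using nz[of 0 1] by (simp add: p_def eval_nat_numeral)
  then have "\<exists>i\<in>{1..3::nat}. coeff p i \<noteq> 0" by (intro bexI[of _ 3]) auto
  then obtain y where "(\<Sum>i\<le>3. coeff p i * y ^ i) = 0"
    using fundamental_theorem_of_algebra[of "coeff p" 3] by blast
  then have "poly p y = 0" by (simp add: p_def eval_nat_numeral algebra_simps)
  then have "polar_at \<Phi> (1 *s u + y *s v) d = 0"
    unfolding cubic_on_line by (simp add: p_def algebra_simps eval_nat_numeral)
  then show False using nz[of 1 y] by simp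
qed

text \<open>The infinitesimal form of the statement that bitangents of smooth quartics are isolated. The left hand side is the variation of
  the restricted quartic when the line moves in the direction of the linear form \<open>x da + y db\<close>, and the right hand side is the
  variation of the square \<open>q\<^sup>2\<close>. At a zero of \<open>q\<close> the factor \<open>polar_at\<close> does not vanish, so that \<open>x da + y db\<close> is zero
  there; two different zeros force it to be zero. At a hyperflex \<open>q\<close> is a multiple of the square of a linear form, which
  divides \<open>x da + y db\<close>; dividing both sides by it and returning to the hyperflex shows that the quotient vanishes.\<close>

lemma bitangent_transversal:
  assumes b: "basis3 u v d" and q: "square_on \<Phi> u v q"
    and T: "\<And>x y. 4 * (x * da + y * db) * polar_at \<Phi> (x *s u + y *s v) d =
        2 * binary_quadratic q x y * binary_quadratic q' x y"
  shows "da = 0 \<and> db = 0 \<and> q' = 0"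
proof -
  have q0: "q \<noteq> 0" using square_on_nonzero[OF b q] .
  obtain \<alpha> \<beta> \<gamma> \<delta> where fac: "\<And>x y. binary_quadratic q x y = (\<alpha> * x + \<beta> * y) * (\<gamma> * x + \<delta> * y)"
    using binary_quadratic_factor[of q] by blast
  have nz: "(\<alpha>, \<beta>) \<noteq> (0, 0)" "(\<gamma>, \<delta>) \<noteq> (0, 0)"
  proof -
    have "\<not> (\<forall>x y. binary_quadratic q x y = 0)"
      using binary_quadratic_mult_zero[of q q] q0 by auto
    then show "(\<alpha>, \<beta>) \<noteq> (0, 0)" "(\<gamma>, \<delta>) \<noteq> (0, 0)" by (auto simp: fac)
  qed
  have root: "x * da + y * db = 0" if "binary_quadratic q x y = 0" "(x, y) \<noteq> (0, 0)" for x y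
  proof -
    have "4 * (x * da + y * db) * polar_at \<Phi> (x *s u + y *s v) d = 0"
      unfolding T using that by simp
    then show ?thesis using polar_nonzero_at_tangency[OF b q that] by (simp only: mult_eq_0_iff) simp
  qed
  have r1: "- \<beta> * da + \<alpha> * db = 0" using nz by (intro root) (auto simp: fac algebra_simps)
  have r2: "- \<delta> * da + \<gamma> * db = 0" using nz by (intro root) (auto simp: fac algebra_simps)
  have "da = 0 \<and> db = 0"
  proof (cases "\<alpha> * \<delta> - \<beta> * \<gamma> = 0")
    case False
    have "(\<alpha> * \<delta> - \<beta> * \<gamma>) * da = \<gamma> * (- \<beta> * da + \<alpha> * db) - \<alpha> * (- \<delta> * da + \<gamma> * db)"
      by (simp add: algebra_simps)
    moreover have "(\<alpha> * \<delta> - \<beta> * \<gamma>) * db = \<delta> * (- \<beta> * da + \<alpha> * db) - \<beta> * (- \<delta> * da + \<gamma> * db)"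
      by (simp add: algebra_simps)
    ultimately show ?thesis unfolding r1 r2 using False by simp
  next
    case True
    \<comment> \<open>The hyperflex case: both linear factors of \<open>q\<close> are proportional to \<open>\<alpha> x + \<beta> y\<close>.\<close>
    obtain x1 y1 where xy1: "\<alpha> * x1 + \<beta> * y1 = 1"
    proof (cases "\<alpha> = 0")
      case True then show ?thesis using that[of 0 "1 / \<beta>"] nz by simp
    next
      case False then show ?thesis using that[of "1 / \<alpha>" 0] by simp
    qed
    define k where "k = \<gamma> * x1 + \<delta> * y1"
    define e where "e = da * x1 + db * y1"
    have ga: "\<gamma> = k * \<alpha>" "\<delta> = k * \<beta>"
    proof -
      have "\<gamma> = \<gamma> * (\<alpha> * x1 + \<beta> * y1)" by (simp add: xy1)
      also have "\<dots> = k * \<alpha> - y1 * (\<alpha> * \<delta> - \<beta> * \<gamma>)" by (simp add: k_def algebra_simps)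
      finally show "\<gamma> = k * \<alpha>" using True by simp
      have "\<delta> = \<delta> * (\<alpha> * x1 + \<beta> * y1)" by (simp add: xy1)
      also have "\<dots> = k * \<beta> + x1 * (\<alpha> * \<delta> - \<beta> * \<gamma>)" by (simp add: k_def algebra_simps)
      finally show "\<delta> = k * \<beta>" using True by simp
    qed
    have ea: "da = e * \<alpha>" "db = e * \<beta>"
    proof -
      have "da = da * (\<alpha> * x1 + \<beta> * y1)" by (simp add: xy1)
      also have "\<dots> = e * \<alpha> - y1 * (- \<beta> * da + \<alpha> * db)" by (simp add: e_def algebra_simps)
      finally show "da = e * \<alpha>" using r1 by simp
      have "db = db * (\<alpha> * x1 + \<beta> * y1)" by (simp add: xy1)
      also have "\<dots> = e * \<beta> + x1 * (- \<beta> * da + \<alpha> * db)" by (simp add: e_def algebra_simps)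
      finally show "db = e * \<beta>" using r1 by simp
    qed
    define X where "X t = (- \<beta> + t * x1) *s u + (\<alpha> + t * y1) *s v" for t
    \<comment> \<open>Both sides of the equation at the point \<open>X t\<close>, divided by \<open>t = \<alpha> x + \<beta> y\<close>.\<close>
    define g where "g t = 4 * e * polar_at \<Phi> (X t) d - 2 * k * t * binary_quadratic q' (- \<beta> + t * x1) (\<alpha> + t * y1)" for t
    have "g t = 0" if "t \<noteq> 0" for t
    proof -
      have m: "\<alpha> * (- \<beta> + t * x1) + \<beta> * (\<alpha> + t * y1) = t"
      proof -
        have "\<alpha> * (- \<beta> + t * x1) + \<beta> * (\<alpha> + t * y1) = t * (\<alpha> * x1 + \<beta> * y1)" by (simp add: algebra_simps)
        then show ?thesis by (simp add: xy1)
      qed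
      have 1: "binary_quadratic q (- \<beta> + t * x1) (\<alpha> + t * y1) = k * t * t"
      proof -
        have "binary_quadratic q (- \<beta> + t * x1) (\<alpha> + t * y1) = k * (\<alpha> * (- \<beta> + t * x1) + \<beta> * (\<alpha> + t * y1)) * (\<alpha> * (- \<beta> + t * x1) + \<beta> * (\<alpha> + t * y1))"
          unfolding fac ga by (simp add: algebra_simps)
        then show ?thesis unfolding m .
      qed
      have 2: "(- \<beta> + t * x1) * da + (\<alpha> + t * y1) * db = e * t"
      proof -
        have "(- \<beta> + t * x1) * da + (\<alpha> + t * y1) * db = e * (\<alpha> * (- \<beta> + t * x1) + \<beta> * (\<alpha> + t * y1))"
          unfolding ea by (simp add: algebra_simps)
        then show ?thesis unfolding m .
      qed
      have "4 * (e * t) * polar_at \<Phi> (X t) d = 2 * (k * t * t) * binary_quadratic q' (- \<beta> + t * x1) (\<alpha> + t * y1)"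
        using T[of "- \<beta> + t * x1" "\<alpha> + t * y1"] unfolding 1 2 X_def .
      then have "t * g t = 0" unfolding g_def by (simp add: algebra_simps)
      then show ?thesis using that by simp
    qed
    then have "eventually (\<lambda>t. g t = 0) (at 0)" by (simp add: eventually_at_filter)
    then have "(g \<longlongrightarrow> 0) (at 0)" by (rule tendsto_eventually)
    moreover have "(g \<longlongrightarrow> g 0) (at 0)"
    proof -
      have sc: "(f \<longlongrightarrow> f') F \<Longrightarrow> ((\<lambda>t. f t *s w) \<longlongrightarrow> f' *s w) F" for f :: "complex \<Rightarrow> complex" and w :: "complex^3" and f' F
        by (rule vec_tendstoI) (auto intro!: tendsto_intros)
      show ?thesis unfolding g_def X_def binary_quadratic_def
        by (intro tendsto_intros tendsto_form sc)
    qed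
    ultimately have "g 0 = 0" using tendsto_unique[OF at_neq_bot] by blast
    moreover have "polar_at \<Phi> (X 0) d \<noteq> 0"
      using polar_nonzero_at_tangency[OF b q, of "- \<beta>" \<alpha>] nz by (auto simp: X_def fac)
    ultimately have "e = 0" by (simp add: g_def)
    then show ?thesis using ea by simp
  qed
  moreover from this have "q = 0 \<or> q' = 0" using T by (intro binary_quadratic_mult_zero) simp
  ultimately show ?thesis using q0 by simp
qed

end

section \<open>Families of fibres of constant cardinality\<close>

text \<open>The sequential form of the fact that a proper local homeomorphism to an interval has fibres of constant size. The
  three hypotheses express properness, local injectivity and local surjectivity of the projection of the total space to the
  interval. The topology of the fibres comes from an embedding \<open>e\<close> into a metric space, so that the points of the fibres may belong to
  a type without a topology.\<close>

lemma card_fibres_constant: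
  fixes B :: "real \<Rightarrow> 'p set" and e :: "'p \<Rightarrow> 'e::metric_space"
  assumes inj: "inj e"
    and closed: "\<And>t T L. t \<longlonglongrightarrow> T \<Longrightarrow> T \<in> {0..1} \<Longrightarrow> (\<And>n. t n \<in> {0..1} \<and> L n \<in> B (t n)) \<Longrightarrow>
        \<exists>r l. strict_mono (r :: nat \<Rightarrow> nat) \<and> l \<in> B T \<and> (\<lambda>n. e (L (r n))) \<longlonglongrightarrow> e l"
    and uniq: "\<And>t T L L' l. t \<longlonglongrightarrow> T \<Longrightarrow> T \<in> {0..1} \<Longrightarrow> l \<in> B T \<Longrightarrow> (\<And>n. t n \<in> {0..1} \<and> L n \<in> B (t n) \<and> L' n \<in> B (t n)) \<Longrightarrow>
        (\<lambda>n. e (L n)) \<longlonglongrightarrow> e l \<Longrightarrow> (\<lambda>n. e (L' n)) \<longlonglongrightarrow> e l \<Longrightarrow> \<exists>n. L n = L' n"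
    and exist: "\<And>T l \<epsilon>. T \<in> {0..1} \<Longrightarrow> l \<in> B T \<Longrightarrow> \<epsilon> > 0 \<Longrightarrow> \<exists>\<delta>>0. \<forall>t\<in>{0..1}. \<bar>t - T\<bar> < \<delta> \<longrightarrow> (\<exists>l'\<in>B t. dist (e l') (e l) < \<epsilon>)"
  shows "finite (B 0) \<and> card (B 0) = card (B 1)"
proof -
  have fin: "finite (B T)" if T: "T \<in> {0..1}" for T
  proof (rule ccontr)
    assume "infinite (B T)"
    then obtain L :: "nat \<Rightarrow> 'p" where L: "inj L" "range L \<subseteq> B T" using infinite_countable_subset by blast
    have BT: "\<And>n. (\<lambda>_::nat. T) n \<in> {0..1} \<and> L n \<in> B ((\<lambda>_. T) n)" using T L by auto
    obtain r l where r: "strict_mono (r :: nat \<Rightarrow> nat)" "l \<in> B T" "(\<lambda>n. e (L (r n))) \<longlonglongrightarrow> e l"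
      using closed[of "\<lambda>_. T" T L, OF tendsto_const T BT] by auto
    have "\<exists>n. L (r n) = L (r (Suc n))"
    proof (rule uniq[of "\<lambda>_. T" T l])
      show "(\<lambda>n. e (L (r (Suc n)))) \<longlonglongrightarrow> e l" using LIMSEQ_Suc[OF r(3)] .
    qed (use r T L in auto)
    then show False using L(1) r(1) by (metis injD n_not_Suc_n strict_mono_eq)
  qed
  have loc: "eventually (\<lambda>t. card (B T) = card (B t)) (at T within {0..1})" if T: "T \<in> {0..1}" for T
  proof (rule ccontr)
    assume neg: "\<not> ?thesis"
    have fe: "finite (e ` B T)" using fin[OF T] by simp
    obtain d where d: "d > 0" "\<And>l l'. l \<in> B T \<Longrightarrow> l' \<in> B T \<Longrightarrow> l \<noteq> l' \<Longrightarrow> d \<le> dist (e l) (e l')"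
    proof -
      define D where "D = insert 1 {dist (e l) (e l') | l l'. l \<in> B T \<and> l' \<in> B T \<and> l \<noteq> l'}"
      have "finite D"
      proof -
        have "{dist (e l) (e l') | l l'. l \<in> B T \<and> l' \<in> B T \<and> l \<noteq> l'} \<subseteq> (\<lambda>(l,l'). dist (e l) (e l')) ` (B T \<times> B T)" by auto
        then show ?thesis unfolding D_def using fin[OF T] by (meson finite.insertI finite_SigmaI finite_imageI finite_subset)
      qed
      moreover have "\<forall>x\<in>D. x > 0" using inj by (auto simp: D_def inj_eq)
      ultimately have "Min D > 0" by (subst Min_gr_iff) (auto simp: D_def)
      moreover have "Min D \<le> dist (e l) (e l')" if "l \<in> B T" "l' \<in> B T" "l \<noteq> l'" for l l'
        by (rule Min_le) (use \<open>finite D\<close> that in \<open>auto simp: D_def\<close>)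
      ultimately show ?thesis using that by blast
    qed
    have "\<exists>\<delta>>0. \<forall>t\<in>{0..1}. \<bar>t - T\<bar> < \<delta> \<longrightarrow> (\<forall>l\<in>B T. \<exists>l'\<in>B t. dist (e l') (e l) < d / 2)"
    proof -
      have "\<forall>l\<in>B T. \<exists>\<delta>>0. \<forall>t\<in>{0..1}. \<bar>t - T\<bar> < \<delta> \<longrightarrow> (\<exists>l'\<in>B t. dist (e l') (e l) < d / 2)"
        using exist[OF T _ half_gt_zero[OF d(1)]] by blast
      then obtain \<delta> where \<delta>: "\<And>l. l \<in> B T \<Longrightarrow> \<delta> l > 0 \<and> (\<forall>t\<in>{0..1}. \<bar>t - T\<bar> < \<delta> l \<longrightarrow> (\<exists>l'\<in>B t. dist (e l') (e l) < d / 2))"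
        by metis
      define \<delta>0 where "\<delta>0 = Min (insert 1 (\<delta> ` B T))"
      have "\<delta>0 > 0" unfolding \<delta>0_def using fin[OF T] \<delta> by (subst Min_gr_iff) auto
      moreover have "\<delta>0 \<le> \<delta> l" if "l \<in> B T" for l unfolding \<delta>0_def using fin[OF T] that by (intro Min_le) auto
      ultimately show ?thesis using \<delta> by (intro exI[of _ \<delta>0]) force
    qed
    then obtain \<delta> where \<delta>: "\<delta> > 0" "\<And>t l. t \<in> {0..1} \<Longrightarrow> \<bar>t - T\<bar> < \<delta> \<Longrightarrow> l \<in> B T \<Longrightarrow> \<exists>l'\<in>B t. dist (e l') (e l) < d / 2"
      by blast
    \<comment> \<open>Near \<open>T\<close>, each point of the fibre over \<open>T\<close> has a companion in the fibre over \<open>t\<close>. If the cardinality is not locally constant,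
  then there are points arbitrarily near \<open>T\<close> that are nobody's companion; their limit contradicts local injectivity.\<close>
    define g where "g t l = (SOME l'. l' \<in> B t \<and> dist (e l') (e l) < d / 2)" for t l
    have g: "g t l \<in> B t" "dist (e (g t l)) (e l) < d / 2" if "t \<in> {0..1}" "\<bar>t - T\<bar> < \<delta>" "l \<in> B T" for t l
      using someI_ex[of "\<lambda>l'. l' \<in> B t \<and> dist (e l') (e l) < d / 2"] \<delta>(2)[OF that] unfolding g_def by blast+
    have ginj: "inj_on (g t) (B T)" if t: "t \<in> {0..1}" "\<bar>t - T\<bar> < \<delta>" for t
    proof (rule inj_onI, rule ccontr)
      fix l l' assume l: "l \<in> B T" "l' \<in> B T" "g t l = g t l'" "l \<noteq> l'"
      have "dist (e l) (e l') \<le> dist (e (g t l)) (e l) + dist (e (g t l)) (e l')"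
        by (metis dist_commute dist_triangle)
      also have "\<dots> < d" using g(2)[OF t l(1)] g(2)[OF t l(2)] l(3) by simp
      finally show False using d(2)[OF l(1,2,4)] by simp
    qed
    have "\<exists>t\<in>{0..1}. \<bar>t - T\<bar> < inverse (real (Suc n)) \<and> \<bar>t - T\<bar> < \<delta> \<and> (\<exists>L\<in>B t. L \<notin> g t ` B T)" for n
    proof (rule ccontr)
      assume c: "\<not> ?thesis"
      have "eventually (\<lambda>t. card (B T) = card (B t)) (at T within {0..1})"
        unfolding eventually_at
      proof (intro exI[of _ "min \<delta> (inverse (real (Suc n)))"] conjI ballI impI)
        show "0 < min \<delta> (inverse (real (Suc n)))" using \<delta>(1) by simp
        fix t assume t: "t \<in> {0..1}" "t \<noteq> T \<and> dist t T < min \<delta> (inverse (real (Suc n)))"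
        then have t': "\<bar>t - T\<bar> < \<delta>" "\<bar>t - T\<bar> < inverse (real (Suc n))" by (auto simp: dist_real_def)
        have "B t \<subseteq> g t ` B T" using c t(1) t' by blast
        moreover have "g t ` B T \<subseteq> B t" using g(1)[OF t(1) t'(1)] by auto
        ultimately have "B t = g t ` B T" by blast
        then show "card (B T) = card (B t)" using card_image[OF ginj[OF t(1) t'(1)]] by simp
      qed
      with neg show False by simp
    qed
    then obtain t L where t: "\<And>n. t n \<in> {0..1} \<and> \<bar>t n - T\<bar> < inverse (real (Suc n)) \<and> \<bar>t n - T\<bar> < \<delta>"
      and L: "\<And>n. L n \<in> B (t n) \<and> L n \<notin> g (t n) ` B T" by metis
    have "(\<lambda>n. t n - T) \<longlonglongrightarrow> 0"
      by (rule Lim_null_comparison[OF _ LIMSEQ_inverse_real_of_nat])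
         (use t in \<open>auto intro!: always_eventually less_imp_le\<close>)
    then have tT: "t \<longlonglongrightarrow> T" using LIM_zero_iff by blast
    obtain r l where r: "strict_mono (r :: nat \<Rightarrow> nat)" "l \<in> B T" "(\<lambda>n. e (L (r n))) \<longlonglongrightarrow> e l"
      using closed[OF tT T, of L] t L by blast
    have tr: "(\<lambda>n. t (r n)) \<longlonglongrightarrow> T" using LIMSEQ_subseq_LIMSEQ[OF tT r(1)] by (simp add: o_def)
    obtain s l'' where s: "strict_mono (s :: nat \<Rightarrow> nat)" "l'' \<in> B T" "(\<lambda>n. e (g (t (r (s n))) l)) \<longlonglongrightarrow> e l''"
      using closed[OF tr T, of "\<lambda>n. g (t (r n)) l"] t g(1) r(2) by blast
    have "dist (e l'') (e l) \<le> d / 2"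
    proof (rule tendsto_upperbound[OF tendsto_dist[OF s(3) tendsto_const]])
      show "\<forall>\<^sub>F n in sequentially. dist (e (g (t (r (s n))) l)) (e l) \<le> d / 2"
        using g(2) t r(2) by (auto intro!: always_eventually less_imp_le)
    qed simp
    then have "l'' = l" using d(2)[OF s(2) r(2)] d(1) by linarith
    have trs: "(\<lambda>n. t (r (s n))) \<longlonglongrightarrow> T" using LIMSEQ_subseq_LIMSEQ[OF tr s(1)] by (simp add: o_def)
    have "(\<lambda>n. e (L (r (s n)))) \<longlonglongrightarrow> e l" using LIMSEQ_subseq_LIMSEQ[OF r(3) s(1)] by (simp add: o_def)
    then have "\<exists>n. L (r (s n)) = g (t (r (s n))) l"
      by (intro uniq[OF trs T r(2)]) (use t L g(1) r(2) s(3) \<open>l'' = l\<close> in auto)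
    then show False using L r(2) by blast
  qed
  have "card (B 0) = card (B 1)"
    by (rule connected_local_const[of "{0..1::real}" 0 1 "\<lambda>t. card (B t)"]) (use loc in auto)
  then show ?thesis using fin by simp
qed

section \<open>The plane embedded as rank one projections\<close>

lemma index3_with_nonzero:
  assumes "(l :: 'a::zero^3) \<noteq> 0"
  obtains i j k :: 3 where "UNIV = {i, j, k}" "i \<noteq> j" "i \<noteq> k" "j \<noteq> k" "l $ k \<noteq> 0"
proof -
  have U: "(UNIV :: 3 set) = {1,2,3}" "(UNIV :: 3 set) = {1,3,2}" "(UNIV :: 3 set) = {2,3,1}"
    using UNIV_3 by auto
  obtain k where k: "l $ k \<noteq> 0" using assms by (auto simp: vec_eq_iff)
  consider "k = 1" | "k = 2" | "k = 3" using exhaust_3 by blast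
  then show ?thesis by cases (use k that[OF U(1)] that[OF U(2)] that[OF U(3)] in auto)
qed

text \<open>The orthogonal projection onto the line spanned by \<open>l\<close> depends on the class of \<open>l\<close> only, which embeds the projective
  plane into a Euclidean space without any choice of charts.\<close>

definition projection_of :: "complex^3 \<Rightarrow> complex^3^3" where
  "projection_of l = (\<chi> m n. l $ m * cnj (l $ n) / of_real ((norm l)\<^sup>2))"

lemma projection_of_scale: "c \<noteq> 0 \<Longrightarrow> projection_of (c *s l) = projection_of l"
proof -
  assume c: "c \<noteq> 0"
  have "norm (c *s l) = norm c * norm l"
    by (simp add: norm_vec_def norm_mult L2_set_right_distrib)
  moreover have "complex_of_real ((norm c)\<^sup>2) = c * cnj c" using complex_norm_square by metis
  ultimately show ?thesis using c by (simp add: projection_of_def vec_eq_iff power_mult_distrib)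
qed

definition proj_emb :: "complex proj_plane \<Rightarrow> complex^3^3" where
  "proj_emb L = projection_of (homvec L)"

lemma proj_emb_proj_point: "v \<noteq> 0 \<Longrightarrow> proj_emb (proj_point v) = projection_of v"
  using homvec_proj_point[of v] projection_of_scale unfolding proj_emb_def by metis

lemma projection_of_ratio:
  "l $ k \<noteq> 0 \<Longrightarrow> l $ m / l $ k = projection_of l $ m $ k / projection_of l $ k $ k"
  by (auto simp: projection_of_def)

lemma projection_of_diag_zero: "l \<noteq> 0 \<Longrightarrow> projection_of l $ k $ k = 0 \<longleftrightarrow> l $ k = 0"
  by (auto simp: projection_of_def)

lemma inj_proj_emb: "inj proj_emb"
proof (rule injI)
  fix L L' assume eq: "proj_emb L = proj_emb L'"
  let ?l = "homvec L" and ?m = "homvec L'"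
  obtain k where k: "?l $ k \<noteq> 0" using homvec(1)[of L] by (auto simp: vec_eq_iff)
  then have k': "?m $ k \<noteq> 0"
    using eq projection_of_diag_zero[OF homvec(1)] unfolding proj_emb_def by metis
  have "?m $ i / ?m $ k = ?l $ i / ?l $ k" for i
    using projection_of_ratio[OF k] projection_of_ratio[OF k'] eq unfolding proj_emb_def by simp
  then have "?m = (?m $ k / ?l $ k) *s ?l" using k k' by (simp add: vec_eq_iff field_simps)
  moreover have "?m $ k / ?l $ k \<noteq> 0" using k k' by simp
  ultimately have "proj_point ?m = proj_point ?l" using proj_point_scale[OF _ homvec(1)] by metis
  then show "L = L'" by (simp add: homvec(2))
qed

lemma proj_emb_ratio_tendsto:
  assumes "(\<lambda>n. proj_emb (L n)) \<longlonglongrightarrow> proj_emb l" "homvec l $ k \<noteq> 0"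
  shows "eventually (\<lambda>n. homvec (L n) $ k \<noteq> 0) sequentially"
    and "(\<lambda>n. homvec (L n) $ m / homvec (L n) $ k) \<longlonglongrightarrow> homvec l $ m / homvec l $ k"
proof -
  have c: "(\<lambda>n. proj_emb (L n) $ i $ j) \<longlonglongrightarrow> proj_emb l $ i $ j" for i j
    by (intro tendsto_vec_nth assms)
  have nz: "proj_emb l $ k $ k \<noteq> 0" using assms(2) projection_of_diag_zero[OF homvec(1)] by (simp add: proj_emb_def)
  show ev: "eventually (\<lambda>n. homvec (L n) $ k \<noteq> 0) sequentially"
    using tendsto_imp_eventually_ne[OF c nz]
    by (rule eventually_mono) (use projection_of_diag_zero[OF homvec(1)] in \<open>simp add: proj_emb_def\<close>)
  have "(\<lambda>n. proj_emb (L n) $ m $ k / proj_emb (L n) $ k $ k) \<longlonglongrightarrow> proj_emb l $ m $ k / proj_emb l $ k $ k"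
    by (intro tendsto_divide c nz)
  then have "(\<lambda>n. proj_emb (L n) $ m $ k / proj_emb (L n) $ k $ k) \<longlonglongrightarrow> homvec l $ m / homvec l $ k"
    using projection_of_ratio[OF assms(2)] by (simp add: proj_emb_def)
  then show "(\<lambda>n. homvec (L n) $ m / homvec (L n) $ k) \<longlonglongrightarrow> homvec l $ m / homvec l $ k"
    by (rule Lim_transform_eventually)
       (use ev in \<open>eventually_elim, simp add: projection_of_ratio proj_emb_def\<close>)
qed

lemma tendsto_projection_of:
  assumes "(f \<longlongrightarrow> v) F" "v \<noteq> 0"
  shows "((\<lambda>x. projection_of (f x)) \<longlongrightarrow> projection_of v) F"
  unfolding projection_of_def
  by (intro tendsto_vec_lambda tendsto_divide tendsto_mult tendsto_cnj tendsto_vec_nth assms tendsto_of_real tendsto_power tendsto_norm)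
     (use assms(2) in simp)

section \<open>The number of bitangents is constant along a family of smooth quartics\<close>

definition bitangent_line :: "complex_form \<Rightarrow> complex proj_plane \<Rightarrow> bool" where
  "bitangent_line \<Phi> L \<longleftrightarrow> (\<exists>u v q. indep2 u v \<and> linear_form (homvec L) u = 0 \<and> linear_form (homvec L) v = 0 \<and> square_on \<Phi> u v q)"

lemma square_on_change_basis:
  assumes "square_on \<Phi> u v q"
  shows "\<exists>q'. square_on \<Phi> (a *s u + b *s v) (c *s u + d *s v) q'"
proof -
  obtain q0 q1 q2 where q: "q = (q0, q1, q2)" by (cases q) auto
  define q' where "q' = (q0 * a\<^sup>2 + q1 * a * b + q2 * b\<^sup>2, 2 * q0 * a * c + q1 * (a * d + b * c) + 2 * q2 * b * d, q0 * c\<^sup>2 + q1 * c * d + q2 * d\<^sup>2)"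
  have "binary_quadratic q' x y = binary_quadratic q (x * a + y * c) (x * b + y * d)" for x y
    by (simp add: q q'_def binary_quadratic_def power2_eq_square algebra_simps)
  moreover have "x *s (a *s u + b *s v) + y *s (c *s u + d *s v) = (x * a + y * c) *s u + (x * b + y * d) *s v" for x y
    by (simp add: vec_eq_iff algebra_simps)
  ultimately show ?thesis using assms unfolding square_on_def by (intro exI[of _ q'] allI) (simp only:)
qed

text \<open>Whether the restriction is a square does not depend on the chosen basis of the line.\<close>

lemma bitangent_line_square_on:
  assumes "bitangent_line \<Phi> L" "linear_form (homvec L) u = 0" "linear_form (homvec L) v = 0"
  shows "\<exists>q. square_on \<Phi> u v q"
proof -
  obtain u' v' q where *: "indep2 u' v'" "linear_form (homvec L) u' = 0" "linear_form (homvec L) v' = 0" "square_on \<Phi> u' v' q"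
    using assms(1) unfolding bitangent_line_def by blast
  obtain a b where u: "u = a *s u' + b *s v'" using kernel_span[OF *(1) homvec(1) *(2,3) assms(2)] by blast
  obtain c d where v: "v = c *s u' + d *s v'" using kernel_span[OF *(1) homvec(1) *(2,3) assms(3)] by blast
  show ?thesis unfolding u v by (rule square_on_change_basis[OF *(4)])
qed

lemma tendsto_scale_vec:
  fixes f :: "'x \<Rightarrow> 'a::real_normed_field"
  assumes "(f \<longlongrightarrow> c) F" "(g \<longlongrightarrow> v) F"
  shows "((\<lambda>x. f x *s g x) \<longlongrightarrow> c *s v) F"
  by (rule vec_tendstoI) (auto intro!: tendsto_intros assms)

lemma indep2_chart:
  fixes i j k :: 3
  assumes "i \<noteq> j" "i \<noteq> k" "j \<noteq> k"
  shows "indep2 (axis i 1 + a *s axis k 1) (axis j 1 + b *s axis k (1::'a::field))"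
  unfolding indep2_def
proof (intro allI impI)
  fix x y assume z: "x *s (axis i 1 + a *s axis k 1) + y *s (axis j 1 + b *s axis k (1::'a)) = 0"
  show "x = 0 \<and> y = 0"
    using arg_cong[OF z, of "\<lambda>v. v $ i"] arg_cong[OF z, of "\<lambda>v. v $ j"] assms by (simp add: axis_def)
qed

lemma basis3_chart:
  fixes i j k :: 3
  assumes "(UNIV :: 3 set) = {i, j, k}" "i \<noteq> j" "i \<noteq> k" "j \<noteq> k"
  shows "basis3 (axis i 1 + a *s axis k 1) (axis j 1 + b *s axis k (1::'a::field)) (axis k 1)"
  unfolding basis3_def
proof (intro conjI allI indep2_chart assms)
  fix w :: "'a^3"
  have "\<forall>m\<in>{i,j,k}. w $ m = (w $ i *s (axis i 1 + a *s axis k 1) + w $ j *s (axis j 1 + b *s axis k (1::'a)) +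
      (w $ k - w $ i * a - w $ j * b) *s axis k 1) $ m"
    using assms(2-4) by (auto simp: axis_def)
  then show "\<exists>a' b' c. w = a' *s (axis i 1 + a *s axis k 1) + b' *s (axis j 1 + b *s axis k (1::'a)) + c *s axis k 1"
    unfolding assms(1)[symmetric] vec_eq_iff by blast
qed

lemma chart_in_kernel:
  fixes i j k :: 3 and l :: "'a::field^3"
  assumes "(UNIV :: 3 set) = {i, j, k}" "i \<noteq> j" "i \<noteq> k" "j \<noteq> k" "l $ k \<noteq> 0"
  shows "linear_form l (axis i 1 + (- (l $ i / l $ k)) *s axis k 1) = 0"
    "linear_form l (axis j 1 + (- (l $ j / l $ k)) *s axis k 1) = 0"
  using assms(2-5) by (simp_all add: linear_form_expand[OF assms(1-4)] axis_def del: linear_form_add linear_form_scale)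


definition segment_form :: "complex_form \<Rightarrow>
    complex_form \<Rightarrow> real \<Rightarrow> complex^3 \<Rightarrow> complex^3 \<Rightarrow> complex^3 \<Rightarrow> complex^3 \<Rightarrow> complex" where
  "segment_form A B t x y z w = (1 - of_real t) * A x y z w + of_real t * B x y z w"

locale smooth_segment = A: quartic_form A + B: quartic_form B
  for A B :: complex_form +
  assumes smooth: "t \<in> {0..1} \<Longrightarrow> x \<noteq> 0 \<Longrightarrow> \<exists>w. segment_form A B t x x x w \<noteq> 0"
begin

abbreviation "\<Phi> \<equiv> segment_form A B"

sublocale form: quartic_form "\<Phi> t" for t
proof
  fix x y z w x' c
  show "\<Phi> t x y z w = \<Phi> t y x z w" unfolding segment_form_def by (metis A.swap12 B.swap12)
  show "\<Phi> t x y z w = \<Phi> t x z y w" unfolding segment_form_def by (metis A.swap23 B.swap23)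
  show "\<Phi> t x y z w = \<Phi> t x y w z" unfolding segment_form_def by (metis A.swap34 B.swap34)
  show "\<Phi> t (x + x') y z w = \<Phi> t x y z w + \<Phi> t x' y z w"
    unfolding segment_form_def by (simp add: A.add1 B.add1 algebra_simps)
  show "\<Phi> t (c *s x) y z w = c * \<Phi> t x y z w"
    unfolding segment_form_def by (simp add: A.scale1 B.scale1 algebra_simps)
qed

lemma smooth_at: "t \<in> {0..1} \<Longrightarrow> smooth_quartic (\<Phi> t)"
  by unfold_locales (rule smooth)

lemma tendsto_family:
  assumes "(s \<longlongrightarrow> t) F" "(f \<longlongrightarrow> x) F" "(g \<longlongrightarrow> y) F" "(h \<longlongrightarrow> z) F" "(k \<longlongrightarrow> w) F"
  shows "((\<lambda>n. \<Phi> (s n) (f n) (g n) (h n) (k n)) \<longlongrightarrow> \<Phi> t x y z w) F"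
  unfolding segment_form_def by (intro tendsto_intros A.tendsto_form B.tendsto_form assms)

lemma tendsto_restricted_family:
  assumes "(s \<longlongrightarrow> t) F" "(f \<longlongrightarrow> u) F" "(g \<longlongrightarrow> v) F"
  shows "((\<lambda>n. quartic_at (\<Phi> (s n)) (x *s f n + y *s g n))
     \<longlongrightarrow> quartic_at (\<Phi> t) (x *s u + y *s v)) F"
  by (intro tendsto_family assms tendsto_add tendsto_scale_vec tendsto_const)

lemma binary_quadratic_tendsto:
  assumes "(q \<longlongrightarrow> (r :: complex \<times> complex \<times> complex)) F"
  shows "((\<lambda>n. binary_quadratic (q n) x y) \<longlongrightarrow> binary_quadratic r x y) F"
  unfolding binary_quadratic_def by (intro tendsto_intros assms)

text \<open>Square roots of convergent binary quartics are bounded, as their squares are, and so subconverge to a square root of the limit.\<close>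

lemma square_roots_subseq:
  fixes t :: "nat \<Rightarrow> real"
  assumes t: "t \<longlonglongrightarrow> T" "u \<longlonglongrightarrow> U" "v \<longlonglongrightarrow> V" and q: "\<And>n. square_on (\<Phi> (t n)) (u n) (v n) (q n)"
  shows "\<exists>r q'. strict_mono (r :: nat \<Rightarrow> nat) \<and> (\<lambda>n. q (r n)) \<longlonglongrightarrow> q' \<and> square_on (\<Phi> T) U V q'"
proof -
  have bq: "Bseq (\<lambda>n. binary_quadratic (q n) x y)" for x y
  proof -
    have "(\<lambda>n. binary_quadratic (q n) x y ^ 2) \<longlonglongrightarrow> quartic_at (\<Phi> T) (x *s U + y *s V)"
      using tendsto_restricted_family[OF t, of x y] q unfolding square_on_def by simp
    then have "Bseq (\<lambda>n. binary_quadratic (q n) x y ^ 2)" by (intro convergent_imp_Bseq convergentI)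
    then obtain K where K: "\<And>n. norm (binary_quadratic (q n) x y ^ 2) \<le> K" unfolding Bseq_def by blast
    show ?thesis
    proof (rule BseqI')
      fix n
      have "norm (binary_quadratic (q n) x y) \<le> 1 + norm (binary_quadratic (q n) x y) ^ 2"
      proof -
        have "z \<le> 1 + z\<^sup>2" for z :: real
        proof -
          have "0 \<le> (z - 1/2)\<^sup>2" by simp
          then show ?thesis unfolding power2_diff by (simp add: power2_eq_square del: zero_le_power2)
        qed
        then show ?thesis .
      qed
      then show "norm (binary_quadratic (q n) x y) \<le> 1 + K" using K[of n] by (simp add: norm_power)
    qed
  qed
  have "bounded (range q)"
  proof -
    from bq[of 1 0] bq[of 0 1] bq[of 1 1] obtain K0 K1 K2 where
      K: "\<And>n. norm (binary_quadratic (q n) 1 0) \<le> K0" "\<And>n. norm (binary_quadratic (q n) 0 1) \<le> K1" "\<And>n. norm (binary_quadratic (q n) 1 1) \<le> K2"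
      unfolding Bseq_def by blast
    have "norm (q n) \<le> K0 + ((K2 + K0 + K1) + K1)" for n
    proof -
      obtain a b c where abc: "q n = (a, b, c)" by (cases "q n") auto
      have *: "norm a \<le> K0" "norm c \<le> K1" "norm (a + b + c) \<le> K2" using K[of n] by (simp_all add: abc binary_quadratic_def)
      have "b = (a + b + c) - a - c" by simp
      then have "norm b \<le> norm (a + b + c) + norm a + norm c"
        by (metis (no_types, opaque_lifting) add_mono norm_triangle_ineq4 order_refl order_trans)
      then have "norm b \<le> K2 + K0 + K1" using * by linarith
      moreover have "norm (q n) \<le> norm a + (norm b + norm c)"
        unfolding abc using norm_Pair_le[of a "(b,c)"] norm_Pair_le[of b c] by linarith
      ultimately show ?thesis using * by linarith
    qed
    then show ?thesis unfolding bounded_iff by auto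
  qed
  then obtain q' r where r: "strict_mono (r :: nat \<Rightarrow> nat)" "(q \<circ> r) \<longlonglongrightarrow> q'"
    using bounded_imp_convergent_subsequence by blast
  have "square_on (\<Phi> T) U V q'" unfolding square_on_def
  proof (intro allI)
    fix x y
    have "(\<lambda>n. binary_quadratic (q (r n)) x y ^ 2) \<longlonglongrightarrow> binary_quadratic q' x y ^ 2"
      using r(2) by (intro tendsto_power binary_quadratic_tendsto) (simp add: o_def)
    moreover have "(\<lambda>n. binary_quadratic (q (r n)) x y ^ 2) \<longlonglongrightarrow> quartic_at (\<Phi> T) (x *s U + y *s V)"
      using LIMSEQ_subseq_LIMSEQ[OF tendsto_restricted_family[OF t, of x y] r(1)] q unfolding square_on_def by (simp add: o_def)
    ultimately show "quartic_at (\<Phi> T) (x *s U + y *s V) = binary_quadratic q' x y ^ 2"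
      using LIMSEQ_unique by metis
  qed
  moreover have "(\<lambda>n. q (r n)) \<longlonglongrightarrow> q'" using r(2) by (simp add: o_def)
  ultimately show ?thesis using r(1) by blast
qed

end

text \<open>Coordinates near a line: \<open>(a, b)\<close> are coordinates in the dual plane and \<open>q\<close> is the square root of the
  restricted quartic. The bitangents are the zeros of the following map, whose values are binary quartics. Recording these by their values
  at five points makes it a map from \<open>chart\<close> to itself, as invariance of domain requires.\<close>

definition chart_u :: "3 \<Rightarrow> 3 \<Rightarrow> complex \<Rightarrow> complex^3" where
  "chart_u i k a = axis i 1 + a *s axis k 1"

type_synonym chart = "complex \<times> complex \<times> (complex \<times> complex \<times> complex)"

definition defect :: "complex_form \<Rightarrow> 3 \<Rightarrow> 3 \<Rightarrow> 3 \<Rightarrow> chart \<Rightarrow> complex \<Rightarrow> complex \<Rightarrow> complex" where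
  "defect \<Phi> i j k X x y = (let w = x *s chart_u i k (fst X) + y *s chart_u j k (fst (snd X)) in
     \<Phi> w w w w - binary_quadratic (snd (snd X)) x y ^ 2)"

definition defects :: "complex_form \<Rightarrow> 3 \<Rightarrow> 3 \<Rightarrow> 3 \<Rightarrow> chart \<Rightarrow> chart" where
  "defects \<Phi> i j k X = (defect \<Phi> i j k X 1 0, defect \<Phi> i j k X 0 1, defect \<Phi> i j k X 1 1, defect \<Phi> i j k X 1 (-1), defect \<Phi> i j k X 1 2)"

lemma binary_quartic_defect:
  assumes "quartic_form \<Phi>" shows "binary_quartic (defect \<Phi> i j k X)"
proof -
  interpret quartic_form \<Phi> by fact
  have e: "defect \<Phi> i j k X = (\<lambda>x y. \<Phi> (x *s chart_u i k (fst X) + y *s chart_u j k (fst (snd X))) (x *s chart_u i k (fst X) + y *s chart_u j k (fst (snd X)))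
     (x *s chart_u i k (fst X) + y *s chart_u j k (fst (snd X))) (x *s chart_u i k (fst X) + y *s chart_u j k (fst (snd X)))
     - 1 * binary_quadratic (snd (snd X)) x y * binary_quadratic (snd (snd X)) x y)"
    by (simp add: defect_def Let_def power2_eq_square fun_eq_iff)
  show ?thesis unfolding e by (rule binary_quartic_diff[OF binary_quartic_restrict binary_quartic_mult])
qed

lemma defects_eq_iff:
  assumes "quartic_form \<Phi>"
  shows "defects \<Phi> i j k X = defects \<Phi> i j k X' \<longleftrightarrow> (\<forall>x y. defect \<Phi> i j k X x y = defect \<Phi> i j k X' x y)"
proof
  assume "defects \<Phi> i j k X = defects \<Phi> i j k X'"
  then have "defect \<Phi> i j k X x y - defect \<Phi> i j k X' x y = 0" for x y
    using binary_quartic_five_points[OF binary_quartic_diff[OF binary_quartic_defect[OF assms] binary_quartic_defect[OF assms]], of i j k X i j k X' x y]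
    by (simp add: defects_def)
  then show "\<forall>x y. defect \<Phi> i j k X x y = defect \<Phi> i j k X' x y" by simp
qed (simp add: defects_def)

lemma defects_zero_iff:
  assumes "quartic_form \<Phi>"
  shows "defects \<Phi> i j k X = 0 \<longleftrightarrow> square_on \<Phi> (chart_u i k (fst X)) (chart_u j k (fst (snd X))) (snd (snd X))"
proof -
  have "defects \<Phi> i j k X = 0 \<longleftrightarrow> (\<forall>x y. defect \<Phi> i j k X x y = 0)"
  proof
    assume "defects \<Phi> i j k X = 0"
    then show "\<forall>x y. defect \<Phi> i j k X x y = 0"
      using binary_quartic_five_points[OF binary_quartic_defect[OF assms], of i j k X] by (simp add: defects_def zero_prod_def)
  qed (simp add: defects_def zero_prod_def)
  then show ?thesis by (simp add: square_on_def defect_def Let_def)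
qed

lemma binary_quadratic_diff: "binary_quadratic (q - r) x y = binary_quadratic q x y - binary_quadratic r x y"
  by (simp add: binary_quadratic_def algebra_simps)

lemma binary_quadratic_scaleR: "binary_quadratic (c *\<^sub>R q) x y = of_real c * binary_quadratic (q :: complex \<times> complex \<times> complex) x y"
  by (simp add: binary_quadratic_def algebra_simps scaleR_conv_of_real)

lemma chart_u_diff: "x *s chart_u i k a + y *s chart_u j k b - (x *s chart_u i k a' + y *s chart_u j k b') = (x * (a - a') + y * (b - b')) *s axis k 1"
  by (simp add: chart_u_def vec_eq_iff algebra_simps)

lemma chart_u_tendsto:
  assumes "(a \<longlongrightarrow> a') F" shows "((\<lambda>n. chart_u i k (a n)) \<longlongrightarrow> chart_u i k a') F"
  unfolding chart_u_def by (intro tendsto_add tendsto_const tendsto_scale_vec assms)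

context smooth_segment begin

text \<open>If two sequences with equal values of \<open>defects\<close> approached a zero, then a limit of the normalized differences would be a nonzero
  tangent vector in the kernel of the derivative, in contradiction to \<open>bitangent_transversal\<close>. The difference quotient is exact,
  by \<open>quartic_diff\<close>, so no derivatives are taken.\<close>

lemma defects_locally_injective:
  fixes X X' :: "nat \<Rightarrow> chart"
  assumes ijk: "(UNIV :: 3 set) = {i, j, k}" "i \<noteq> j" "i \<noteq> k" "j \<noteq> k"
    and T: "T \<in> {0..1}" "t \<longlonglongrightarrow> T" "X \<longlonglongrightarrow> X0" "X' \<longlonglongrightarrow> X0"
    and zero: "defects (\<Phi> T) i j k X0 = 0" and eq: "\<And>n. defects (\<Phi> (t n)) i j k (X n) = defects (\<Phi> (t n)) i j k (X' n)"
  shows "\<exists>n. X n = X' n"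
proof (rule ccontr)
  assume "\<nexists>n. X n = X' n"
  then have ne: "X n \<noteq> X' n" for n by blast
  define D where "D n = inverse (norm (X n - X' n)) *\<^sub>R (X n - X' n)" for n
  have "norm (D n) = 1" for n using ne[of n] by (simp add: D_def)
  then have "D n \<in> sphere 0 1" for n by simp
  then obtain r d where r: "strict_mono (r :: nat \<Rightarrow> nat)" "d \<in> sphere 0 1" "(D \<circ> r) \<longlonglongrightarrow> d"
    using compact_sphere[of "0::chart" 1] unfolding compact_eq_seq_compact_metric seq_compact_def by metis
  define u v where "u = chart_u i k (fst X0)" and "v = chart_u j k (fst (snd X0))"
  interpret smooth_quartic "\<Phi> T" by (rule smooth_at[OF T(1)])
  have lim: "(\<lambda>n. t (r n)) \<longlonglongrightarrow> T" "(\<lambda>n. X (r n)) \<longlonglongrightarrow> X0" "(\<lambda>n. X' (r n)) \<longlonglongrightarrow> X0"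
    using LIMSEQ_subseq_LIMSEQ[OF T(2) r(1)] LIMSEQ_subseq_LIMSEQ[OF T(3) r(1)] LIMSEQ_subseq_LIMSEQ[OF T(4) r(1)]
    by (simp_all add: o_def)
  have "fst d = 0 \<and> fst (snd d) = 0 \<and> snd (snd d) = 0"
  proof (rule bitangent_transversal)
    show "basis3 u v (axis k 1)" unfolding u_def v_def chart_u_def by (rule basis3_chart[OF ijk])
    show sq: "square_on (\<Phi> T) u v (snd (snd X0))"
      using zero unfolding u_def v_def by (simp add: defects_zero_iff[OF form.quartic_form_axioms])
    fix x y
    define w where "w Y = x *s chart_u i k (fst Y) + y *s chart_u j k (fst (snd Y))" for Y :: chart
    \<comment> \<open>\<open>G\<close> and \<open>H\<close> are the cofactors of \<open>w (X n) - w (X' n)\<close> and of the difference of the square roots in the equal defects.\<close>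
    define c where "c n = inverse (norm (X (r n) - X' (r n)))" for n
    let ?a = "axis k 1 :: complex^3"
    define G where "G n = \<Phi> (t (r n)) ?a (w (X (r n))) (w (X (r n))) (w (X (r n))) + \<Phi> (t (r n)) ?a (w (X (r n))) (w (X (r n))) (w (X' (r n)))
       + \<Phi> (t (r n)) ?a (w (X (r n))) (w (X' (r n))) (w (X' (r n))) + \<Phi> (t (r n)) ?a (w (X' (r n))) (w (X' (r n))) (w (X' (r n)))" for n
    define H where "H n = binary_quadratic (snd (snd (X (r n)))) x y + binary_quadratic (snd (snd (X' (r n)))) x y" for n
    define W where "W n = w (X (r n))" for n
    have wl: "(\<lambda>n. w (X (r n))) \<longlonglongrightarrow> w X0" "(\<lambda>n. w (X' (r n))) \<longlonglongrightarrow> w X0"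
      unfolding w_def by (intro tendsto_add tendsto_scale_vec tendsto_const chart_u_tendsto tendsto_fst tendsto_snd lim)+
    have Glim: "G \<longlonglongrightarrow> \<Phi> T ?a (w X0) (w X0) (w X0) + \<Phi> T ?a (w X0) (w X0) (w X0) + \<Phi> T ?a (w X0) (w X0) (w X0) + \<Phi> T ?a (w X0) (w X0) (w X0)"
      unfolding G_def by (intro tendsto_add tendsto_family tendsto_const lim wl)
    have Hlim: "H \<longlonglongrightarrow> binary_quadratic (snd (snd X0)) x y + binary_quadratic (snd (snd X0)) x y"
      unfolding H_def by (intro tendsto_add binary_quadratic_tendsto tendsto_snd lim)
    have Dlim: "(\<lambda>n. D (r n)) \<longlonglongrightarrow> d" using r(3) by (simp add: o_def)
    have key: "(x * fst (D (r n)) + y * fst (snd (D (r n)))) * G n = binary_quadratic (snd (snd (D (r n)))) x y * H n" for n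
    proof -
      let ?X = "X (r n)" and ?Y = "X' (r n)"
      have "defect (\<Phi> (t (r n))) i j k ?X x y = defect (\<Phi> (t (r n))) i j k ?Y x y"
        using eq[of "r n"] defects_eq_iff[OF form.quartic_form_axioms] by blast
      then have e1: "quartic_at (\<Phi> (t (r n))) (w ?X) - quartic_at (\<Phi> (t (r n))) (w ?Y) =
          binary_quadratic (snd (snd ?X)) x y ^ 2 - binary_quadratic (snd (snd ?Y)) x y ^ 2"
        by (simp add: defect_def Let_def w_def algebra_simps)
      have wd: "w ?X - w ?Y = (x * (fst ?X - fst ?Y) + y * (fst (snd ?X) - fst (snd ?Y))) *s ?a"
        unfolding w_def by (rule chart_u_diff)
      have "quartic_at (\<Phi> (t (r n))) (w ?X) - quartic_at (\<Phi> (t (r n))) (w ?Y) =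
         (x * (fst ?X - fst ?Y) + y * (fst (snd ?X) - fst (snd ?Y))) * G n"
        unfolding form.quartic_diff wd form.scale1 G_def by (simp add: distrib_left)
      moreover have "binary_quadratic (snd (snd ?X)) x y ^ 2 - binary_quadratic (snd (snd ?Y)) x y ^ 2 =
         binary_quadratic (snd (snd (?X - ?Y))) x y * H n"
        by (simp add: H_def binary_quadratic_diff power2_eq_square algebra_simps)
      ultimately have e2: "(x * fst (?X - ?Y) + y * fst (snd (?X - ?Y))) * G n = binary_quadratic (snd (snd (?X - ?Y))) x y * H n"
        using e1 by simp
      have Dn: "D (r n) = c n *\<^sub>R (?X - ?Y)" by (simp add: D_def c_def)
      have "(x * fst (D (r n)) + y * fst (snd (D (r n)))) * G n = of_real (c n) * ((x * fst (?X - ?Y) + y * fst (snd (?X - ?Y))) * G n)"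
        unfolding Dn by (simp only: fst_scaleR snd_scaleR scaleR_conv_of_real) (simp add: algebra_simps)
      also have "\<dots> = binary_quadratic (snd (snd (D (r n)))) x y * H n"
        unfolding e2 Dn by (simp only: fst_scaleR snd_scaleR binary_quadratic_scaleR mult.assoc)
      finally show ?thesis .
    qed
    have "(\<lambda>n. (x * fst (D (r n)) + y * fst (snd (D (r n)))) * G n) \<longlonglongrightarrow> (x * fst d + y * fst (snd d)) *
        (\<Phi> T ?a (w X0) (w X0) (w X0) + \<Phi> T ?a (w X0) (w X0) (w X0) + \<Phi> T ?a (w X0) (w X0) (w X0) + \<Phi> T ?a (w X0) (w X0) (w X0))"
      by (intro tendsto_mult tendsto_add tendsto_fst tendsto_snd tendsto_const Dlim Glim)
    moreover have "(\<lambda>n. binary_quadratic (snd (snd (D (r n)))) x y * H n) \<longlonglongrightarrow> binary_quadratic (snd (snd d)) x y *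
        (binary_quadratic (snd (snd X0)) x y + binary_quadratic (snd (snd X0)) x y)"
      by (intro tendsto_mult binary_quadratic_tendsto tendsto_snd Dlim Hlim)
    ultimately have fin: "(x * fst d + y * fst (snd d)) *
        (\<Phi> T ?a (w X0) (w X0) (w X0) + \<Phi> T ?a (w X0) (w X0) (w X0) + \<Phi> T ?a (w X0) (w X0) (w X0) + \<Phi> T ?a (w X0) (w X0) (w X0))
        = binary_quadratic (snd (snd d)) x y * (binary_quadratic (snd (snd X0)) x y + binary_quadratic (snd (snd X0)) x y)"
      unfolding key using LIMSEQ_unique by blast
    have wX0: "w X0 = x *s u + y *s v" by (simp add: w_def u_def v_def)
    show "4 * (x * fst d + y * fst (snd d)) * polar_at (\<Phi> T) (x *s u + y *s v) ?a =
        2 * binary_quadratic (snd (snd X0)) x y * binary_quadratic (snd (snd d)) x y"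
      unfolding wX0[symmetric] form.swap14[of T "w X0" "w X0" "w X0" ?a] using fin by (simp add: algebra_simps)
  qed
  then have "d = 0" by (simp add: prod_eq_iff)
  then show False using r(2) by simp
qed

lemma isCont_defects: "continuous_on UNIV (\<lambda>(t, X). (t, defects (\<Phi> t) i j k X))"
proof -
  have "continuous_on UNIV (\<lambda>p. defect (\<Phi> (fst p)) i j k (snd p) x y)" for x y
    unfolding continuous_on_def defect_def Let_def
    by (intro ballI tendsto_diff tendsto_power binary_quadratic_tendsto tendsto_restricted_family chart_u_tendsto
        tendsto_fst tendsto_snd tendsto_ident_at)
  then show ?thesis unfolding defects_def case_prod_beta
    by (intro continuous_on_Pair continuous_on_fst continuous_on_id)
qed

text \<open>The map \<open>(t, X) \<mapsto> (t, defects X)\<close> is injective near the given zero, hence open by invariance of domain, and attains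
  \<open>(t, 0)\<close> for all \<open>t\<close> near \<open>T\<close>.\<close>

lemma defects_zero_persists:
  assumes ijk: "(UNIV :: 3 set) = {i, j, k}" "i \<noteq> j" "i \<noteq> k" "j \<noteq> k"
    and T: "T \<in> {0..1}" and zero: "defects (\<Phi> T) i j k X0 = 0" and e: "\<epsilon> > 0"
  shows "\<exists>\<delta>>0. \<forall>t. \<bar>t - T\<bar> < \<delta> \<longrightarrow> (\<exists>X. dist X X0 < \<epsilon> \<and> defects (\<Phi> t) i j k X = 0)"
proof -
  define P where "P = (\<lambda>(t, X). (t, defects (\<Phi> t) i j k X))"
  have "\<exists>n. inj_on P (ball (T, X0) (inverse (real (Suc n))))"
  proof (rule ccontr)
    assume "\<nexists>n. inj_on P (ball (T, X0) (inverse (real (Suc n))))"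
    then have "\<forall>n. \<exists>p p'. p \<in> ball (T, X0) (inverse (real (Suc n))) \<and> p' \<in> ball (T, X0) (inverse (real (Suc n))) \<and> P p = P p' \<and> p \<noteq> p'"
      unfolding inj_on_def by blast
    then obtain p p' where p: "\<And>n. p n \<in> ball (T, X0) (inverse (real (Suc n)))" "\<And>n. p' n \<in> ball (T, X0) (inverse (real (Suc n)))"
      "\<And>n. P (p n) = P (p' n)" "\<And>n. p n \<noteq> p' n" by metis
    have lim: "g \<longlonglongrightarrow> (T, X0)" if "\<And>n. g n \<in> ball (T, X0) (inverse (real (Suc n)))" for g
    proof (rule metric_LIMSEQ_I)
      fix r :: real assume "r > 0"
      then obtain N where N: "inverse (real (Suc N)) < r" using reals_Archimedean by blast
      show "\<exists>no. \<forall>n\<ge>no. dist (g n) (T, X0) < r"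
      proof (intro exI allI impI)
        fix n assume "n \<ge> N"
        then have "inverse (real (Suc n)) \<le> inverse (real (Suc N))" by (intro le_imp_inverse_le) auto
        then show "dist (g n) (T, X0) < r" using that[of n] N unfolding mem_ball dist_commute[of "(T, X0)"] by linarith
      qed
    qed
    have fe: "fst (p n) = fst (p' n)" for n using p(3)[of n] by (simp add: P_def case_prod_beta)
    have "\<exists>n. snd (p n) = snd (p' n)"
    proof (rule defects_locally_injective[OF ijk T _ _ _ zero])
      show "(\<lambda>n. fst (p n)) \<longlonglongrightarrow> T" using tendsto_fst[OF lim[of p, OF p(1)]] by simp
      show "(\<lambda>n. snd (p n)) \<longlonglongrightarrow> X0" using tendsto_snd[OF lim[of p, OF p(1)]] by simp
      show "(\<lambda>n. snd (p' n)) \<longlonglongrightarrow> X0" using tendsto_snd[OF lim[of p', OF p(2)]] by simp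
      show "defects (\<Phi> (fst (p n))) i j k (snd (p n)) = defects (\<Phi> (fst (p n))) i j k (snd (p' n))" for n
        using p(3)[of n] fe[of n] by (simp add: P_def case_prod_beta)
    qed
    then show False using fe p(4) by (metis prod_eq_iff)
  qed
  then obtain n where n: "inj_on P (ball (T, X0) (inverse (real (Suc n))))" by blast
  define \<rho> where "\<rho> = min \<epsilon> (inverse (real (Suc n)))"
  have \<rho>: "\<rho> > 0" using e by (simp add: \<rho>_def)
  have "open (P ` ball (T, X0) \<rho>)"
  proof (rule invariance_of_domain)
    show "continuous_on (ball (T, X0) \<rho>) P"
      unfolding P_def by (rule continuous_on_subset[OF isCont_defects]) simp
    show "inj_on P (ball (T, X0) \<rho>)" by (rule inj_on_subset[OF n]) (auto simp: \<rho>_def)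
  qed simp
  moreover have "(T, 0) \<in> P ` ball (T, X0) \<rho>"
    by (rule image_eqI[of _ _ "(T, X0)"]) (use zero \<rho> in \<open>simp_all add: P_def\<close>)
  ultimately obtain \<delta> where \<delta>: "\<delta> > 0" "ball (T, 0) \<delta> \<subseteq> P ` ball (T, X0) \<rho>" unfolding open_contains_ball by blast
  show ?thesis
  proof (intro exI[of _ \<delta>] conjI allI impI)
    fix t assume "\<bar>t - T\<bar> < \<delta>"
    then have "(t, 0) \<in> ball (T, 0 :: chart) \<delta>" by (simp add: dist_Pair_Pair dist_real_def abs_minus_commute)
    then obtain s X where X: "(t, 0) = P (s, X)" "(s, X) \<in> ball (T, X0) \<rho>" using \<delta>(2) by (metis (no_types, lifting) image_iff subsetD surj_pair)
    have "dist X X0 \<le> dist (s, X) (T, X0)" using dist_snd_le[of "(s, X)" "(T, X0)"] by simp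
    then have "dist X X0 < \<epsilon>" using X(2) by (simp add: \<rho>_def dist_commute)
    then show "\<exists>X. dist X X0 < \<epsilon> \<and> defects (\<Phi> t) i j k X = 0" using X(1) unfolding P_def by (intro exI[of _ X]) simp
  qed (rule \<delta>(1))
qed

end

definition chart_line :: "3 \<Rightarrow> 3 \<Rightarrow> complex \<Rightarrow> complex \<Rightarrow> complex^3" where
  "chart_line i j a b = (\<chi> m. if m = i then a else if m = j then b else - 1)"

lemma chart_line_nonzero:
  assumes "(UNIV :: 3 set) = {i, j, k}" "i \<noteq> j" "i \<noteq> k" "j \<noteq> k"
  shows "chart_line i j a b \<noteq> 0"
proof
  assume "chart_line i j a b = 0"
  from arg_cong[OF this, of "\<lambda>v. v $ k"] show False using assms by (auto simp: chart_line_def)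
qed

lemma tendsto_chart_line:
  assumes "(a \<longlongrightarrow> a') F" "(b \<longlongrightarrow> b') F"
  shows "((\<lambda>n. chart_line i j (a n) (b n)) \<longlongrightarrow> chart_line i j a' b') F"
  by (rule vec_tendstoI) (use assms in \<open>simp add: chart_line_def\<close>)

lemma proj_point_chart_line:
  assumes ijk: "(UNIV :: 3 set) = {i, j, k}" "i \<noteq> j" "i \<noteq> k" "j \<noteq> k" and l: "homvec L $ k \<noteq> 0"
  shows "L = proj_point (chart_line i j (- (homvec L $ i / homvec L $ k)) (- (homvec L $ j / homvec L $ k)))"
proof -
  let ?c = "- homvec L $ k" and ?w = "chart_line i j (- (homvec L $ i / homvec L $ k)) (- (homvec L $ j / homvec L $ k))"
  have "\<forall>m\<in>{i,j,k}. homvec L $ m = (?c *s ?w) $ m" using ijk(2-4) l by (auto simp: chart_line_def)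
  then have e: "homvec L = ?c *s ?w" unfolding ijk(1)[symmetric] vec_eq_iff by blast
  have "L = proj_point (?c *s ?w)" using homvec(2)[of L] unfolding e[symmetric] by simp
  also have "\<dots> = proj_point ?w" using l by (intro proj_point_scale chart_line_nonzero[OF ijk]) simp
  finally show ?thesis .
qed

lemma linear_form_homvec_proj_point:
  assumes "v \<noteq> 0" shows "linear_form (homvec (proj_point v)) w = 0 \<longleftrightarrow> linear_form v w = 0"
  by (rule homvec_proj_point[OF assms]) simp

lemma bitangent_line_proj_point:
  assumes "l \<noteq> 0" "indep2 u v" "linear_form l u = 0" "linear_form l v = 0" "square_on \<Phi> u v q"
  shows "bitangent_line \<Phi> (proj_point l)"
  unfolding bitangent_line_def linear_form_homvec_proj_point[OF assms(1)] using assms by blast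

lemma bitangent_chart_line:
  assumes ijk: "(UNIV :: 3 set) = {i, j, k}" "i \<noteq> j" "i \<noteq> k" "j \<noteq> k"
    and "square_on \<Phi> (chart_u i k a) (chart_u j k b) q"
  shows "bitangent_line \<Phi> (proj_point (chart_line i j a b))"
proof (rule bitangent_line_proj_point[OF chart_line_nonzero[OF ijk]])
  show "indep2 (chart_u i k a) (chart_u j k b)" unfolding chart_u_def by (rule indep2_chart[OF ijk(2-4)])
  show "linear_form (chart_line i j a b) (chart_u i k a) = 0" "linear_form (chart_line i j a b) (chart_u j k b) = 0"
    using ijk(2-4) unfolding linear_form_expand[OF ijk] chart_u_def chart_line_def by (auto simp: axis_def)
qed fact

lemma bitangent_square_on_chart:
  assumes ijk: "(UNIV :: 3 set) = {i, j, k}" "i \<noteq> j" "i \<noteq> k" "j \<noteq> k"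
    and "bitangent_line \<Phi> L" "homvec L $ k \<noteq> 0"
  shows "\<exists>q. square_on \<Phi> (chart_u i k (- (homvec L $ i / homvec L $ k))) (chart_u j k (- (homvec L $ j / homvec L $ k))) q"
  unfolding chart_u_def by (rule bitangent_line_square_on[OF assms(5)]; rule chart_in_kernel[OF ijk assms(6)])

lemma square_on_uminus: "square_on \<Phi> u v (- q) = square_on \<Phi> u v q"
proof -
  have "binary_quadratic (- q) x y = - binary_quadratic q x y" for x y
    by (simp add: binary_quadratic_def algebra_simps)
  then show ?thesis by (simp add: square_on_def)
qed

lemma square_on_unique:
  assumes "square_on \<Phi> u v q" "square_on \<Phi> u v r" shows "r = q \<or> r = - q"
proof -
  have "binary_quadratic (r - q) x y * binary_quadratic (r + q) x y = 0" for x y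
  proof -
    have "binary_quadratic (r - q) x y * binary_quadratic (r + q) x y = binary_quadratic r x y ^ 2 - binary_quadratic q x y ^ 2"
      by (simp add: binary_quadratic_def algebra_simps power2_eq_square)
    then show ?thesis using assms unfolding square_on_def by simp
  qed
  from binary_quadratic_mult_zero[OF this] show ?thesis by (auto simp: eq_neg_iff_add_eq_0)
qed

context smooth_segment begin

text \<open>The two square roots of the limit differ by a sign, so the sequence of roots can be chosen to converge to either of them.\<close>

lemma square_roots_subseq_to:
  fixes t :: "nat \<Rightarrow> real"
  assumes "t \<longlonglongrightarrow> T" "u \<longlonglongrightarrow> U" "v \<longlonglongrightarrow> V" "\<And>n. \<exists>q. square_on (\<Phi> (t n)) (u n) (v n) q" "square_on (\<Phi> T) U V q0"
  shows "\<exists>r q. strict_mono (r :: nat \<Rightarrow> nat) \<and> (\<lambda>n. q (r n)) \<longlonglongrightarrow> q0 \<and> (\<forall>n. square_on (\<Phi> (t n)) (u n) (v n) (q n))"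
proof -
  obtain q where q: "\<And>n. square_on (\<Phi> (t n)) (u n) (v n) (q n)" using assms(4) by metis
  obtain r q' where r: "strict_mono (r :: nat \<Rightarrow> nat)" "(\<lambda>n. q (r n)) \<longlonglongrightarrow> q'" "square_on (\<Phi> T) U V q'"
    using square_roots_subseq[OF assms(1-3) q] by blast
  from square_on_unique[OF assms(5) r(3)] show ?thesis
  proof
    assume "q' = q0" then show ?thesis using r q by blast
  next
    assume "q' = - q0"
    then have "(\<lambda>n. - q (r n)) \<longlonglongrightarrow> q0" using tendsto_minus[OF r(2)] by simp
    then show ?thesis using r(1) q by (intro exI[of _ r] exI[of _ "\<lambda>n. - q n"]) (simp add: square_on_uminus)
  qed
qed

text \<open>Properness: normalized linear forms defining the bitangents subconverge on the unit sphere.\<close>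

lemma bitangents_closed:
  assumes t: "t \<longlonglongrightarrow> T" and L: "\<And>n. bitangent_line (\<Phi> (t n)) (L n)"
  shows "\<exists>r l. strict_mono (r :: nat \<Rightarrow> nat) \<and> bitangent_line (\<Phi> T) l \<and> (\<lambda>n. proj_emb (L (r n))) \<longlonglongrightarrow> proj_emb l"
proof -
  \<comment> \<open>The vectors chosen by \<open>homvec\<close> are arbitrary multiples; normalizing them makes the sequence bounded.\<close>
  define w where "w n = of_real (inverse (norm (homvec (L n)))) *s homvec (L n)" for n
  have w: "proj_point (w n) = L n" "w n \<noteq> 0" "norm (w n) = 1" for n
  proof -
    have nz: "norm (homvec (L n)) \<noteq> 0" using homvec(1)[of "L n"] by simp
    show "proj_point (w n) = L n" unfolding w_def using nz by (subst proj_point_scale) (auto simp: homvec)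
    have "w n = inverse (norm (homvec (L n))) *\<^sub>R homvec (L n)" unfolding w_def vec_eq_iff vector_scaleR_component vector_smult_component by (simp add: scaleR_conv_of_real)
    then show "norm (w n) = 1" using nz by simp
    then show "w n \<noteq> 0" by auto
  qed
  have "w n \<in> sphere 0 1" for n using w by simp
  then obtain r l where r: "strict_mono (r :: nat \<Rightarrow> nat)" "l \<in> sphere 0 1" "(w \<circ> r) \<longlonglongrightarrow> l"
    using compact_sphere[of "0::complex^3" 1] unfolding compact_eq_seq_compact_metric seq_compact_def by metis
  have l0: "l \<noteq> 0" using r(2) by auto
  obtain i j k where ijk: "(UNIV :: 3 set) = {i, j, k}" "i \<noteq> j" "i \<noteq> k" "j \<noteq> k" and lk: "l $ k \<noteq> 0"
    using index3_with_nonzero[OF l0] .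
  have wl: "(\<lambda>n. w (r n) $ m) \<longlonglongrightarrow> l $ m" for m using r(3) by (intro tendsto_vec_nth) (simp add: o_def)
  obtain N where N: "\<And>n. n \<ge> N \<Longrightarrow> w (r n) $ k \<noteq> 0"
    using tendsto_imp_eventually_ne[OF wl lk] unfolding eventually_sequentially by blast
  define s where "s n = r (n + N)" for n
  have s: "strict_mono s" using r(1) by (auto simp: s_def strict_mono_def)
  have nz: "w (s n) $ k \<noteq> 0" for n using N by (simp add: s_def)
  have ws: "(\<lambda>n. w (s n) $ m) \<longlonglongrightarrow> l $ m" for m using LIMSEQ_ignore_initial_segment[OF wl, of N] by (simp add: s_def)
  define a where "a n = - (w (s n) $ i / w (s n) $ k)" for n
  define b where "b n = - (w (s n) $ j / w (s n) $ k)" for n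
  have sq: "\<exists>q. square_on (\<Phi> (t (s n))) (chart_u i k (a n)) (chart_u j k (b n)) q" for n
  proof -
    have "linear_form (homvec (L (s n))) x = 0 \<longleftrightarrow> linear_form (w (s n)) x = 0" for x
      using linear_form_homvec_proj_point[OF w(2)[of "s n"]] w(1)[of "s n"] by simp
    then show ?thesis unfolding a_def b_def chart_u_def
      using bitangent_line_square_on[OF L[of "s n"]] chart_in_kernel[OF ijk nz[of n]] by blast
  qed
  then obtain q where q: "\<And>n. square_on (\<Phi> (t (s n))) (chart_u i k (a n)) (chart_u j k (b n)) (q n)" by metis
  have lims: "(\<lambda>n. chart_u i k (a n)) \<longlonglongrightarrow> chart_u i k (- (l $ i / l $ k))" "(\<lambda>n. chart_u j k (b n)) \<longlonglongrightarrow> chart_u j k (- (l $ j / l $ k))"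
    unfolding a_def b_def by (intro chart_u_tendsto tendsto_minus tendsto_divide ws lk)+
  have ts: "(\<lambda>n. t (s n)) \<longlonglongrightarrow> T" using LIMSEQ_subseq_LIMSEQ[OF t s] by (simp add: o_def)
  obtain q' where "square_on (\<Phi> T) (chart_u i k (- (l $ i / l $ k))) (chart_u j k (- (l $ j / l $ k))) q'"
    using square_roots_subseq[OF ts lims q] by blast
  then have "bitangent_line (\<Phi> T) (proj_point l)"
    unfolding chart_u_def
    by (intro bitangent_line_proj_point[OF l0 indep2_chart[OF ijk(2-4)] chart_in_kernel[OF ijk lk]])
  moreover have "(\<lambda>n. proj_emb (L (s n))) \<longlonglongrightarrow> proj_emb (proj_point l)"
  proof -
    have "(\<lambda>n. w (s n)) \<longlonglongrightarrow> l" by (rule vec_tendstoI) (rule ws)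
    from tendsto_projection_of[OF this l0] have "(\<lambda>n. proj_emb (proj_point (w (s n)))) \<longlonglongrightarrow> proj_emb (proj_point l)"
      by (simp add: proj_emb_proj_point w(2) l0)
    then show ?thesis by (simp add: w(1))
  qed
  ultimately show ?thesis using s by blast
qed

text \<open>In the chart around the limit line, both sequences yield zeros of \<open>defects\<close> with the same limit, provided that the square roots are
  chosen with the same sign.\<close>

lemma bitangents_locally_unique:
  assumes t: "t \<longlonglongrightarrow> T" and T: "T \<in> {0..1}" and l: "bitangent_line (\<Phi> T) l"
    and L: "\<And>n. bitangent_line (\<Phi> (t n)) (L n)" "(\<lambda>n. proj_emb (L n)) \<longlonglongrightarrow> proj_emb l"
    and L': "\<And>n. bitangent_line (\<Phi> (t n)) (L' n)" "(\<lambda>n. proj_emb (L' n)) \<longlonglongrightarrow> proj_emb l"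
  shows "\<exists>n. L n = L' n"
proof -
  obtain i j k where ijk: "(UNIV :: 3 set) = {i, j, k}" "i \<noteq> j" "i \<noteq> k" "j \<noteq> k" and lk: "homvec l $ k \<noteq> 0"
    using index3_with_nonzero[OF homvec(1)[of l]] .
  have "eventually (\<lambda>n. homvec (L n) $ k \<noteq> 0 \<and> homvec (L' n) $ k \<noteq> 0) sequentially"
    using proj_emb_ratio_tendsto(1)[OF L(2) lk] proj_emb_ratio_tendsto(1)[OF L'(2) lk] by eventually_elim simp
  then obtain N where N: "\<And>n. n \<ge> N \<Longrightarrow> homvec (L n) $ k \<noteq> 0 \<and> homvec (L' n) $ k \<noteq> 0"
    unfolding eventually_sequentially by blast
  define c where "c M m n = - (homvec (M (n + N)) $ m / homvec (M (n + N)) $ k)" for M :: "nat \<Rightarrow> complex proj_plane" and m n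
  define c0 where "c0 m = - (homvec l $ m / homvec l $ k)" for m
  have cl: "c L m \<longlonglongrightarrow> c0 m" "c L' m \<longlonglongrightarrow> c0 m" for m
    using LIMSEQ_ignore_initial_segment[OF tendsto_minus[OF proj_emb_ratio_tendsto(2)[OF L(2) lk, of m]], of N]
      LIMSEQ_ignore_initial_segment[OF tendsto_minus[OF proj_emb_ratio_tendsto(2)[OF L'(2) lk, of m]], of N]
    unfolding c_def c0_def by simp_all
  have tN: "(\<lambda>n. t (n + N)) \<longlonglongrightarrow> T" by (rule LIMSEQ_ignore_initial_segment[OF t])
  obtain q0 where q0: "square_on (\<Phi> T) (chart_u i k (c0 i)) (chart_u j k (c0 j)) q0"
    using bitangent_square_on_chart[OF ijk l lk] unfolding c0_def by blast
  have "\<exists>q. square_on (\<Phi> (t (n + N))) (chart_u i k (c L i n)) (chart_u j k (c L j n)) q" for n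
    unfolding c_def using N[of "n + N"] by (intro bitangent_square_on_chart[OF ijk L(1)]) simp
  from square_roots_subseq_to[OF tN chart_u_tendsto[OF cl(1)] chart_u_tendsto[OF cl(1)] this q0]
  obtain r q where r: "strict_mono (r :: nat \<Rightarrow> nat)" "(\<lambda>n. q (r n)) \<longlonglongrightarrow> q0"
    "\<And>n. square_on (\<Phi> (t (n + N))) (chart_u i k (c L i n)) (chart_u j k (c L j n)) (q n)" by blast
  have sub: "f \<longlonglongrightarrow> x \<Longrightarrow> (\<lambda>n. f (r n)) \<longlonglongrightarrow> x" for f :: "nat \<Rightarrow> 'z::topological_space" and x
    using LIMSEQ_subseq_LIMSEQ[OF _ r(1)] by (simp add: o_def)
  have "\<exists>q. square_on (\<Phi> (t (r n + N))) (chart_u i k (c L' i (r n))) (chart_u j k (c L' j (r n))) q" for n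
    unfolding c_def using N[of "r n + N"] by (intro bitangent_square_on_chart[OF ijk L'(1)]) simp
  from square_roots_subseq_to[OF sub[OF tN] chart_u_tendsto[OF sub[OF cl(2)]] chart_u_tendsto[OF sub[OF cl(2)]] this q0]
  obtain s q' where s: "strict_mono (s :: nat \<Rightarrow> nat)" "(\<lambda>n. q' (s n)) \<longlonglongrightarrow> q0"
    "\<And>n. square_on (\<Phi> (t (r n + N))) (chart_u i k (c L' i (r n))) (chart_u j k (c L' j (r n))) (q' n)" by blast
  have sub2: "f \<longlonglongrightarrow> x \<Longrightarrow> (\<lambda>n. f (s n)) \<longlonglongrightarrow> x" for f :: "nat \<Rightarrow> 'z::topological_space" and x
    using LIMSEQ_subseq_LIMSEQ[OF _ s(1)] by (simp add: o_def)
  define X where "X n = (c L i (r (s n)), c L j (r (s n)), q (r (s n)))" for n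
  define X' where "X' n = (c L' i (r (s n)), c L' j (r (s n)), q' (s n))" for n
  have "\<exists>n. X n = X' n"
  proof (rule defects_locally_injective[OF ijk T, of "\<lambda>n. t (r (s n) + N)" X "(c0 i, c0 j, q0)" X'])
    show "(\<lambda>n. t (r (s n) + N)) \<longlonglongrightarrow> T" by (intro sub2 sub[of "\<lambda>n. t (n + N)"] tN)
    show "X \<longlonglongrightarrow> (c0 i, c0 j, q0)" unfolding X_def
      by (intro tendsto_Pair sub2[of "\<lambda>n. c L i (r n)"] sub2[of "\<lambda>n. c L j (r n)"] sub2[of "\<lambda>n. q (r n)"] sub cl r)
    show "X' \<longlonglongrightarrow> (c0 i, c0 j, q0)" unfolding X'_def
      by (intro tendsto_Pair sub2[of "\<lambda>n. c L' i (r n)"] sub2[of "\<lambda>n. c L' j (r n)"] sub cl s)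
    show "defects (\<Phi> T) i j k (c0 i, c0 j, q0) = 0"
      unfolding defects_zero_iff[OF form.quartic_form_axioms] using q0 by simp
    show "defects (\<Phi> (t (r (s n) + N))) i j k (X n) = defects (\<Phi> (t (r (s n) + N))) i j k (X' n)" for n
    proof -
      have "defects (\<Phi> (t (r (s n) + N))) i j k (X n) = 0"
        unfolding defects_zero_iff[OF form.quartic_form_axioms] X_def using r(3) by simp
      moreover have "defects (\<Phi> (t (r (s n) + N))) i j k (X' n) = 0"
        unfolding defects_zero_iff[OF form.quartic_form_axioms] X'_def using s(3) by simp
      ultimately show ?thesis by simp
    qed
  qed
  then obtain n where n: "X n = X' n" by blast
  define m where "m = r (s n) + N"
  have eq: "c L i (r (s n)) = c L' i (r (s n))" "c L j (r (s n)) = c L' j (r (s n))" using n by (simp_all add: X_def X'_def)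
  have "L m = L' m"
    using proj_point_chart_line[OF ijk, of "L m"] proj_point_chart_line[OF ijk, of "L' m"] N[of m] eq
    unfolding c_def m_def by simp
  then show ?thesis by blast
qed

lemma bitangents_persist:
  assumes T: "T \<in> {0..1}" and l: "bitangent_line (\<Phi> T) l" and e: "\<epsilon> > 0"
  shows "\<exists>\<delta>>0. \<forall>t. \<bar>t - T\<bar> < \<delta> \<longrightarrow> (\<exists>l'. bitangent_line (\<Phi> t) l' \<and> dist (proj_emb l') (proj_emb l) < \<epsilon>)"
proof -
  obtain i j k where ijk: "(UNIV :: 3 set) = {i, j, k}" "i \<noteq> j" "i \<noteq> k" "j \<noteq> k" and lk: "homvec l $ k \<noteq> 0"
    using index3_with_nonzero[OF homvec(1)[of l]] .
  define a0 where "a0 = - (homvec l $ i / homvec l $ k)"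
  define b0 where "b0 = - (homvec l $ j / homvec l $ k)"
  have l_eq: "l = proj_point (chart_line i j a0 b0)" unfolding a0_def b0_def by (rule proj_point_chart_line[OF ijk lk])
  obtain q0 where q0: "square_on (\<Phi> T) (chart_u i k a0) (chart_u j k b0) q0"
    using bitangent_square_on_chart[OF ijk l lk] unfolding a0_def b0_def by blast
  define X0 where "X0 = (a0, b0, q0)"
  define E where "E X = projection_of (chart_line i j (fst X) (fst (snd X)))" for X :: chart
  have "(E \<longlongrightarrow> E X0) (at X0)" unfolding E_def
    by (intro tendsto_projection_of tendsto_chart_line chart_line_nonzero[OF ijk] tendsto_fst tendsto_snd tendsto_ident_at)
  then obtain \<rho> where \<rho>: "\<rho> > 0" "\<And>X. dist X X0 < \<rho> \<Longrightarrow> dist (E X) (E X0) < \<epsilon>"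
    using e unfolding LIM_def by (metis dist_self)
  have z: "defects (\<Phi> T) i j k X0 = 0" unfolding defects_zero_iff[OF form.quartic_form_axioms] X0_def using q0 by simp
  obtain \<delta> where \<delta>: "\<delta> > 0" "\<And>t. \<bar>t - T\<bar> < \<delta> \<Longrightarrow> \<exists>X. dist X X0 < \<rho> \<and> defects (\<Phi> t) i j k X = 0"
    using defects_zero_persists[OF ijk T z \<rho>(1)] by blast
  show ?thesis
  proof (intro exI[of _ \<delta>] conjI allI impI)
    fix t assume "\<bar>t - T\<bar> < \<delta>"
    then obtain X where X: "dist X X0 < \<rho>" "defects (\<Phi> t) i j k X = 0" using \<delta>(2) by blast
    have "bitangent_line (\<Phi> t) (proj_point (chart_line i j (fst X) (fst (snd X))))"
      using X(2) unfolding defects_zero_iff[OF form.quartic_form_axioms] by (rule bitangent_chart_line[OF ijk])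
    moreover have "dist (proj_emb (proj_point (chart_line i j (fst X) (fst (snd X))))) (proj_emb l) < \<epsilon>"
      using \<rho>(2)[OF X(1)] unfolding l_eq E_def X0_def by (simp add: proj_emb_proj_point chart_line_nonzero[OF ijk])
    ultimately show "\<exists>l'. bitangent_line (\<Phi> t) l' \<and> dist (proj_emb l') (proj_emb l) < \<epsilon>" by blast
  qed (rule \<delta>(1))
qed

text \<open>The three preceding lemmas are the hypotheses of \<open>card_fibres_constant\<close>.\<close>

theorem card_bitangents_segment:
  "finite {L. bitangent_line A L} \<and> card {L. bitangent_line A L} = card {L. bitangent_line B L}"
proof -
  have "finite {L. bitangent_line (\<Phi> 0) L} \<and> card {L. bitangent_line (\<Phi> 0) L} = card {L. bitangent_line (\<Phi> 1) L}"
  proof (rule card_fibres_constant[OF inj_proj_emb])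
    fix t :: "nat \<Rightarrow> real" and T L assume a: "t \<longlonglongrightarrow> T" "T \<in> {0..1}" "\<And>n. t n \<in> {0..1} \<and> L n \<in> {L. bitangent_line (\<Phi> (t n)) L}"
    then show "\<exists>r l. strict_mono (r :: nat \<Rightarrow> nat) \<and> l \<in> {L. bitangent_line (\<Phi> T) L} \<and> (\<lambda>n. proj_emb (L (r n))) \<longlonglongrightarrow> proj_emb l"
      using bitangents_closed[OF a(1), of L] by simp
  next
    fix t :: "nat \<Rightarrow> real" and T L L' l assume a: "t \<longlonglongrightarrow> T" "T \<in> {0..1}" "l \<in> {L. bitangent_line (\<Phi> T) L}"
      "\<And>n. t n \<in> {0..1} \<and> L n \<in> {L. bitangent_line (\<Phi> (t n)) L} \<and> L' n \<in> {L. bitangent_line (\<Phi> (t n)) L}"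
      "(\<lambda>n. proj_emb (L n)) \<longlonglongrightarrow> proj_emb l" "(\<lambda>n. proj_emb (L' n)) \<longlonglongrightarrow> proj_emb l"
    then show "\<exists>n. L n = L' n" using bitangents_locally_unique[OF a(1,2), of l L L'] by simp
  next
    fix T l \<epsilon> assume a: "T \<in> {0..1::real}" "l \<in> {L. bitangent_line (\<Phi> T) L}" "(\<epsilon>::real) > 0"
    then show "\<exists>\<delta>>0. \<forall>t\<in>{0..1}. \<bar>t - T\<bar> < \<delta> \<longrightarrow> (\<exists>l'\<in>{L. bitangent_line (\<Phi> t) L}. dist (proj_emb l') (proj_emb l) < \<epsilon>)"
      using bitangents_persist[OF a(1) _ a(3), of l] by auto
  qed
  moreover have "\<Phi> 0 = A" "\<Phi> 1 = B" by (simp_all add: segment_form_def fun_eq_iff)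
  ultimately show ?thesis by simp
qed

end

section \<open>Joining two smooth quartics through a generic third one\<close>

text \<open>The polarization of four times \<open>\<Sum> x\<^sub>i\<^sup>3 l\<^sub>i(x)\<close>, with linear forms \<open>l\<^sub>i = v $ i\<close>. This is an 18-dimensional real family which
  can prescribe the gradient at any point.\<close>

definition perturbation :: "complex^3^3 \<Rightarrow> complex^3 \<Rightarrow> complex^3 \<Rightarrow> complex^3 \<Rightarrow> complex^3 \<Rightarrow> complex" where
  "perturbation v x y z w = (\<Sum>i\<in>UNIV. x $ i * y $ i * z $ i * linear_form (v $ i) w + x $ i * y $ i * linear_form (v $ i) z * w $ i
      + x $ i * linear_form (v $ i) y * z $ i * w $ i + linear_form (v $ i) x * y $ i * z $ i * w $ i)"

lemma quartic_form_perturbation: "quartic_form (perturbation v)"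
  by unfold_locales (simp_all add: perturbation_def sum_distrib_left sum.distrib[symmetric] algebra_simps)

lemma quartic_form_add:
  assumes "quartic_form A" "quartic_form B" shows "quartic_form (\<lambda>x y z w. A x y z w + B x y z w)"
proof -
  interpret A: quartic_form A by fact
  interpret B: quartic_form B by fact
  show ?thesis
  proof
    fix x y z w x' c
    show "A x y z w + B x y z w = A y x z w + B y x z w" by (metis A.swap12 B.swap12)
    show "A x y z w + B x y z w = A x z y w + B x z y w" by (metis A.swap23 B.swap23)
    show "A x y z w + B x y z w = A x y w z + B x y w z" by (metis A.swap34 B.swap34)
  qed (simp_all add: A.add1 B.add1 A.scale1 B.scale1 algebra_simps)
qed

lemma quartic_form_segment:
  assumes "quartic_form A" "quartic_form B" shows "quartic_form (segment_form A B t)"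
proof -
  interpret A: quartic_form A by fact
  interpret B: quartic_form B by fact
  show ?thesis
  proof
    fix x y z w x' c
    show "segment_form A B t x y z w = segment_form A B t y x z w" unfolding segment_form_def by (metis A.swap12 B.swap12)
    show "segment_form A B t x y z w = segment_form A B t x z y w" unfolding segment_form_def by (metis A.swap23 B.swap23)
    show "segment_form A B t x y z w = segment_form A B t x y w z" unfolding segment_form_def by (metis A.swap34 B.swap34)
  qed (simp_all add: segment_form_def A.add1 B.add1 A.scale1 B.scale1 algebra_simps)
qed

lemma differentiable_vecI:
  fixes f :: "'a::real_normed_vector \<Rightarrow> 'b::real_normed_vector ^ 'n::finite"
  assumes "\<And>i. (\<lambda>x. f x $ i) differentiable F"
  shows "f differentiable F"
proof -
  have bl: "bounded_linear (axis i :: 'b \<Rightarrow> 'b^'n)" for i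
  proof (rule bounded_linear_intro[of _ 1])
    fix x :: 'b
    have "(\<Sum>j\<in>UNIV. (norm (axis i x $ j))\<^sup>2) = (\<Sum>j\<in>UNIV. if j = i then (norm x)\<^sup>2 else 0)"
      by (intro sum.cong) (auto simp: axis_def)
    then show "norm (axis i x :: 'b^'n) \<le> norm x * 1" by (simp add: norm_vec_def L2_set_def)
  qed (auto simp: vec_eq_iff axis_def)
  have "(\<lambda>x. \<Sum>i\<in>UNIV. axis i (f x $ i)) differentiable F"
    by (intro differentiable_sum finite ballI) (use assms bounded_linear.has_derivative[OF bl] in \<open>unfold differentiable_def, blast\<close>)
  moreover have "(\<lambda>x. \<Sum>i\<in>UNIV. axis i (f x $ i)) = f"
    by (simp add: fun_eq_iff vec_eq_iff axis_def if_distrib cong: if_cong)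
  ultimately show ?thesis by simp
qed

lemma differentiable_vec_nth: "f differentiable F \<Longrightarrow> (\<lambda>x. f x $ i) differentiable F"
  unfolding differentiable_def using bounded_linear.has_derivative[OF bounded_linear_vec_nth] by blast

lemma (in quartic_form) differentiable_form:
  assumes "f differentiable (at a within S)" "g differentiable (at a within S)" "h differentiable (at a within S)" "k differentiable (at a within S)"
  shows "(\<lambda>t. \<Phi> (f t) (g t) (h t) (k t)) differentiable (at a within S)"
  using assms has_derivative_form unfolding differentiable_def by blast

lemma differentiable_linear_form:
  assumes "f differentiable (at a within S)" "g differentiable (at a within S)"
  shows "(\<lambda>t. linear_form (f t) (g t :: complex^3)) differentiable (at a within S)"
  unfolding linear_form_def by (intro differentiable_sum finite ballI differentiable_mult differentiable_vec_nth assms)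

lemma differentiable_fst: "f differentiable F \<Longrightarrow> (\<lambda>t. fst (f t)) differentiable F"
  unfolding differentiable_def by (blast intro: has_derivative_fst)
lemma differentiable_snd: "f differentiable F \<Longrightarrow> (\<lambda>t. snd (f t)) differentiable F"
  unfolding differentiable_def by (blast intro: has_derivative_snd)
lemma differentiable_of_real: "f differentiable F \<Longrightarrow> (\<lambda>t. complex_of_real (f t)) differentiable F"
  unfolding differentiable_def by (blast intro: has_derivative_of_real)

text \<open>The perturbations \<open>v\<close> for which the segment from \<open>A\<close> to \<open>B\<close> plus the perturbation contains a singular quartic.\<close>

definition singular_directions :: "complex_form \<Rightarrow>
    complex_form \<Rightarrow> (complex^3^3) set" where
  "singular_directions A B = {v. \<exists>t x. 0 < t \<and> x \<noteq> 0 \<and> (\<forall>w. segment_form A B t x x x w + of_real t * perturbation v x x x w = 0)}"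

text \<open>If \<open>x\<close>, normalized to \<open>x $ k = 1\<close>, is singular at time \<open>t\<close>, then the rows \<open>i\<close> and \<open>j\<close> of \<open>v\<close> are free and the row \<open>k\<close> can be solved
  for. So \<open>v\<close> depends smoothly on \<open>t\<close>, two coordinates of \<open>x\<close> and two rows: \<open>1 + 4 + 12 = 17\<close> real parameters.\<close>

type_synonym parameters = "real \<times> complex \<times> complex \<times> (complex^3) \<times> (complex^3)"

definition param_point :: "3 \<Rightarrow> 3 \<Rightarrow> parameters \<Rightarrow> complex^3" where
  "param_point i j p = (\<chi> m. if m = i then fst (snd p) else if m = j then fst (snd (snd p)) else 1)"

text \<open>The contribution of the row \<open>k\<close> to the gradient of the perturbation at \<open>x\<close>, as determined by the vanishing of the total gradient.\<close>

definition param_rest :: "(real \<Rightarrow> complex^3 \<Rightarrow> complex^3 \<Rightarrow> complex^3 \<Rightarrow> complex^3 \<Rightarrow> complex) \<Rightarrow> 3 \<Rightarrow> 3 \<Rightarrow> parameters \<Rightarrow> complex^3" where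
  "param_rest C i j p = (let t = fst p; x = param_point i j p; u = fst (snd (snd (snd p))); v = snd (snd (snd (snd p))) in
     (\<chi> m. - (C t x x x (axis m 1) / of_real t) - (x $ i ^ 3 * u $ m + (if m = i then 3 * x $ i ^ 2 * linear_form u x else 0))
        - (x $ j ^ 3 * v $ m + (if m = j then 3 * x $ j ^ 2 * linear_form v x else 0))))"

text \<open>With \<open>x $ k = 1\<close>, the row \<open>l = v $ k\<close> contributes the gradient \<open>R = l + 3 l(x) e\<^sub>k\<close>. Then \<open>R(x) = 4 l(x)\<close>, whence \<open>l = R - 3/4 R(x) e\<^sub>k\<close>.\<close>

definition param_direction :: "(real \<Rightarrow> complex^3 \<Rightarrow> complex^3 \<Rightarrow> complex^3 \<Rightarrow> complex^3 \<Rightarrow> complex) \<Rightarrow> 3 \<Rightarrow> 3 \<Rightarrow> 3 \<Rightarrow> parameters \<Rightarrow> complex^3^3" where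
  "param_direction C i j k p = (\<chi> m. if m = i then fst (snd (snd (snd p))) else if m = j then snd (snd (snd (snd p)))
     else (\<chi> n. param_rest C i j p $ n - (if n = k then 3 / 4 * linear_form (param_rest C i j p) (param_point i j p) else 0)))"

lemma differentiable_ifI: "(P \<Longrightarrow> f differentiable F) \<Longrightarrow> (\<not> P \<Longrightarrow> g differentiable F) \<Longrightarrow> (\<lambda>x. if P then f x else g x) differentiable F"
  by (cases P) simp_all

lemma differentiable_param_direction:
  assumes A: "quartic_form A" "quartic_form B"
  shows "param_direction (segment_form A B) i j k differentiable_on {p. fst p > 0}"
  unfolding differentiable_on_def
proof
  interpret A: quartic_form A by fact
  interpret B: quartic_form B by fact
  fix p :: parameters assume p: "p \<in> {p. fst p > 0}"
  let ?F = "at p within {p. fst p > 0}"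
  have id: "(\<lambda>p. p) differentiable ?F" by simp
  note pr = differentiable_fst[OF id] differentiable_fst[OF differentiable_snd[OF id]]
    differentiable_fst[OF differentiable_snd[OF differentiable_snd[OF id]]]
    differentiable_fst[OF differentiable_snd[OF differentiable_snd[OF differentiable_snd[OF id]]]]
    differentiable_snd[OF differentiable_snd[OF differentiable_snd[OF differentiable_snd[OF id]]]]
  have x: "param_point i j differentiable ?F"
    by (rule differentiable_vecI, unfold param_point_def vec_lambda_beta) (intro differentiable_ifI pr differentiable_const)
  have R: "param_rest (segment_form A B) i j differentiable ?F"
  proof (rule differentiable_vecI)
    fix m
    show "(\<lambda>q. param_rest (segment_form A B) i j q $ m) differentiable ?F"
      unfolding param_rest_def Let_def segment_form_def vec_lambda_beta
      by (intro differentiable_diff differentiable_minus differentiable_add differentiable_mult differentiable_divide differentiable_const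
          differentiable_power differentiable_ifI differentiable_vec_nth differentiable_linear_form A.differentiable_form B.differentiable_form
          differentiable_of_real x pr) (use p in auto)
  qed
  show "param_direction (segment_form A B) i j k differentiable ?F"
  proof (rule differentiable_vecI, rule differentiable_vecI)
    fix m n
    show "(\<lambda>q. param_direction (segment_form A B) i j k q $ m $ n) differentiable ?F"
      unfolding param_direction_def vec_lambda_beta if_distrib[of "\<lambda>v. v $ n"]
      by (intro differentiable_diff differentiable_mult differentiable_const
          differentiable_ifI differentiable_vec_nth differentiable_linear_form R x pr)
  qed
qed

lemma singular_direction_param:
  assumes ijk: "(UNIV :: 3 set) = {i, j, k}" "i \<noteq> j" "i \<noteq> k" "j \<noteq> k"
    and t: "t > 0" and xk: "x $ k = 1"
    and z: "\<And>w. segment_form A B t x x x w + of_real t * perturbation v x x x w = 0"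
  shows "v = param_direction (segment_form A B) i j k (t, x $ i, x $ j, v $ i, v $ j)"
proof -
  let ?p = "(t, x $ i, x $ j, v $ i, v $ j)"
  have x: "param_point i j ?p = x"
  proof -
    have "\<forall>m\<in>{i,j,k}. param_point i j ?p $ m = x $ m" using ijk(2-4) xk by (auto simp: param_point_def)
    then show ?thesis unfolding ijk(1)[symmetric] vec_eq_iff by blast
  qed
  define R where "R = param_rest (segment_form A B) i j ?p"
  have su: "(\<Sum>m\<in>UNIV. f m) = f i + f j + f k" for f :: "3 \<Rightarrow> complex"
    unfolding ijk(1) using ijk(2-4) by (simp add: add.assoc)
  have lf: "linear_form u (axis m 1) = u $ m" for u :: "complex^3" and m
    by (simp add: linear_form_def axis_def if_distrib cong: if_cong)
  have R: "R $ m = v $ k $ m + (if m = k then 3 * linear_form (v $ k) x else 0)" for m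
  proof -
    have pe: "perturbation v x x x (axis m 1) = (\<Sum>l\<in>UNIV. x $ l ^ 3 * v $ l $ m + (if m = l then 3 * x $ l ^ 2 * linear_form (v $ l) x else 0))"
      unfolding perturbation_def lf by (intro sum.cong) (auto simp: axis_def algebra_simps power2_eq_square power3_eq_cube)
    have "segment_form A B t x x x (axis m 1) / of_real t = - perturbation v x x x (axis m 1)"
      using z[of "axis m 1"] t by (simp add: field_simps eq_neg_iff_add_eq_0)
    then have "R $ m = perturbation v x x x (axis m 1) - (x $ i ^ 3 * v $ i $ m + (if m = i then 3 * x $ i ^ 2 * linear_form (v $ i) x else 0))
        - (x $ j ^ 3 * v $ j $ m + (if m = j then 3 * x $ j ^ 2 * linear_form (v $ j) x else 0))"
      unfolding R_def param_rest_def Let_def x by simp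
    then show ?thesis unfolding pe su xk by simp
  qed
  have "linear_form R x = 4 * linear_form (v $ k) x"
  proof -
    have "linear_form R x = (\<Sum>m\<in>UNIV. v $ k $ m * x $ m + (if m = k then 3 * linear_form (v $ k) x else 0))"
      unfolding linear_form_def[of R] R by (intro sum.cong) (auto simp: xk distrib_right)
    also have "\<dots> = linear_form (v $ k) x + 3 * linear_form (v $ k) x"
      by (simp add: sum.distrib linear_form_def)
    finally show ?thesis by simp
  qed
  then have "v $ k $ n = R $ n - (if n = k then 3 / 4 * linear_form R x else 0)" for n using R[of n] by simp
  then have "\<forall>m\<in>{i,j,k}. v $ m = param_direction (segment_form A B) i j k ?p $ m"
    using ijk(2-4) by (auto simp: param_direction_def x R_def[symmetric] vec_eq_iff)
  then show ?thesis unfolding ijk(1)[symmetric] vec_eq_iff by blast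
qed

text \<open>The image of a 17-dimensional space under a differentiable map to an 18-dimensional one has measure zero.\<close>

lemma negligible_singular_directions:
  assumes "quartic_form A" "quartic_form B"
  shows "negligible (singular_directions A B)"
proof -
  let ?I = "UNIV :: (3 \<times> 3 \<times> 3) set"
  have neg: "negligible (param_direction (segment_form A B) i j k ` {p. fst p > 0})" for i j k
    by (rule negligible_differentiable_image_lowdim) (auto intro!: differentiable_param_direction assms)
  interpret quartic_form "segment_form A B t" for t by (rule quartic_form_segment[OF assms])
  interpret P: quartic_form "perturbation v" for v by (rule quartic_form_perturbation)
  have "singular_directions A B \<subseteq> (\<Union>(i,j,k)\<in>?I. param_direction (segment_form A B) i j k ` {p. fst p > 0})"
  proof
    fix v assume "v \<in> singular_directions A B"
    then obtain t x where t: "0 < t" "x \<noteq> 0" and z: "\<And>w. segment_form A B t x x x w + of_real t * perturbation v x x x w = 0"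
      unfolding singular_directions_def by blast
    obtain i j k :: 3 where ijk: "(UNIV :: 3 set) = {i, j, k}" "i \<noteq> j" "i \<noteq> k" "j \<noteq> k" and xk: "x $ k \<noteq> 0"
      using index3_with_nonzero[OF t(2)] .
    define y where "y = inverse (x $ k) *s x"
    have "segment_form A B t y y y w + of_real t * perturbation v y y y w = inverse (x $ k) ^ 3 * (segment_form A B t x x x w + of_real t * perturbation v x x x w)" for w
      unfolding y_def multilinear P.multilinear by (simp add: algebra_simps power3_eq_cube)
    then have "segment_form A B t y y y w + of_real t * perturbation v y y y w = 0" for w using z by simp
    from singular_direction_param[OF ijk t(1) _ this] have "v = param_direction (segment_form A B) i j k (t, y $ i, y $ j, v $ i, v $ j)"
      using xk by (simp add: y_def)
    then have "v \<in> param_direction (segment_form A B) i j k ` {p. fst p > 0}" using t(1) by (intro image_eqI) auto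
    then show "v \<in> (\<Union>(i,j,k)\<in>?I. param_direction (segment_form A B) i j k ` {p. fst p > 0})" by blast
  qed
  moreover have "negligible (\<Union>(i,j,k)\<in>?I. param_direction (segment_form A B) i j k ` {p. fst p > 0})"
    by (rule negligible_Union) (auto intro: neg)
  ultimately show ?thesis using negligible_subset by blast
qed

text \<open>A direct segment between two smooth quartics may meet the discriminant. Instead both are joined to a generic perturbation
  of one of them.\<close>

theorem card_bitangents_constant:
  assumes "smooth_quartic A" "smooth_quartic B"
  shows "finite {L. bitangent_line A L} \<and> card {L. bitangent_line A L} = card {L. bitangent_line B L}"
proof -
  interpret A: smooth_quartic A by fact
  interpret B: smooth_quartic B by fact
  have "negligible (singular_directions A A \<union> singular_directions B A)"
    by (intro negligible_Un negligible_singular_directions A.quartic_form_axioms B.quartic_form_axioms)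
  then have "singular_directions A A \<union> singular_directions B A \<noteq> UNIV" using non_negligible_UNIV by metis
  then obtain v where v: "v \<notin> singular_directions A A" "v \<notin> singular_directions B A" by blast
  define G where "G x y z w = A x y z w + perturbation v x y z w" for x y z w
  have G: "quartic_form G" unfolding G_def by (intro quartic_form_add A.quartic_form_axioms quartic_form_perturbation)
  have seg: "smooth_segment C G" if C: "smooth_quartic C" "v \<notin> singular_directions C A" for C
  proof -
    interpret C: smooth_quartic C by fact
    show ?thesis
    proof (intro smooth_segment.intro smooth_segment_axioms.intro C.quartic_form_axioms G)
      fix t :: real and x :: "complex^3" assume t: "t \<in> {0..1}" and x: "x \<noteq> 0"
      have e: "segment_form C G t x x x w = segment_form C A t x x x w + of_real t * perturbation v x x x w" for w
        by (simp add: segment_form_def G_def algebra_simps)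
      show "\<exists>w. segment_form C G t x x x w \<noteq> 0"
      proof (cases "t = 0")
        case True then show ?thesis using C.smooth[OF x] by (simp add: segment_form_def)
      next
        case False
        then have "t > 0" using t by simp
        then show ?thesis using C(2) x unfolding e singular_directions_def by blast
      qed
    qed
  qed
  show ?thesis
    using smooth_segment.card_bitangents_segment[OF seg[OF assms(1) v(1)]]
      smooth_segment.card_bitangents_segment[OF seg[OF assms(2) v(2)]] by simp
qed

section \<open>The Fermat quartic has 28 bitangents\<close>

definition fermat :: complex_form where
  "fermat x y z w = (\<Sum>i\<in>UNIV. x $ i * y $ i * z $ i * w $ i)"

lemma smooth_quartic_fermat: "smooth_quartic fermat"
proof
  fix x :: "complex^3" assume "x \<noteq> 0"
  then obtain k where k: "x $ k \<noteq> 0" by (auto simp: vec_eq_iff)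
  have "fermat x x x (axis k 1) = x $ k ^ 3"
    by (simp add: fermat_def axis_def if_distrib power3_eq_cube cong: if_cong)
  then show "\<exists>w. fermat x x x w \<noteq> 0" using k by (intro exI[of _ "axis k 1"]) simp
qed (simp_all add: fermat_def sum_distrib_left sum.distrib[symmetric] algebra_simps)

lemma square_coefficients:
  assumes "\<And>x y :: complex. c0 * x ^ 4 + c1 * x ^ 3 * y + c2 * x\<^sup>2 * y\<^sup>2 + c3 * x * y ^ 3 + c4 * y ^ 4 = binary_quadratic (p, q, r) x y ^ 2"
  shows "c0 = p\<^sup>2" "c1 = 2 * p * q" "c2 = q\<^sup>2 + 2 * p * r" "c3 = 2 * q * r" "c4 = r\<^sup>2"
proof -
  have "(c4 - r\<^sup>2) + (c3 - 2 * q * r) * t + (c2 - (q\<^sup>2 + 2 * p * r)) * t ^ 2 + (c1 - 2 * p * q) * t ^ 3 + (c0 - p\<^sup>2) * t ^ 4 = 0" for t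
  proof -
    have "binary_quadratic (p, q, r) t 1 ^ 2 = p\<^sup>2 * t ^ 4 + 2 * p * q * t ^ 3 + (q\<^sup>2 + 2 * p * r) * t\<^sup>2 + 2 * q * r * t + r\<^sup>2"
      by (simp add: binary_quadratic_def power2_eq_square power3_eq_cube power4_eq_xxxx algebra_simps)
    then show ?thesis using assms[of t 1] by (simp add: algebra_simps)
  qed
  from quartic_poly_zero[OF this]
  show "c0 = p\<^sup>2" "c1 = 2 * p * q" "c2 = q\<^sup>2 + 2 * p * r" "c3 = 2 * q * r" "c4 = r\<^sup>2" by simp_all
qed

lemma square_of_coefficients:
  assumes "c0 = p\<^sup>2" "c1 = 2 * p * q" "c2 = q\<^sup>2 + 2 * p * r" "c3 = 2 * q * r" "c4 = r\<^sup>2"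
  shows "c0 * x ^ 4 + c1 * x ^ 3 * y + c2 * x\<^sup>2 * y\<^sup>2 + c3 * x * y ^ 3 + c4 * y ^ 4 = binary_quadratic (p, q, r) x y ^ 2"
  unfolding assms by (simp add: binary_quadratic_def power2_eq_square power3_eq_cube power4_eq_xxxx algebra_simps)

text \<open>On the line \<open>z = a x + b y\<close> the Fermat quartic is \<open>x\<^sup>4 + y\<^sup>4 + (a x + b y)\<^sup>4\<close>. Comparing coefficients shows for which \<open>(a, b)\<close> this
  is a square: the solutions with \<open>a b = 0\<close> are hyperflexes, the others are the 16 lines whose coefficients are fourth roots of unity.\<close>

lemma fermat_square_condition:
  "(\<exists>p q r :: complex. 1 + a ^ 4 = p\<^sup>2 \<and> 4 * a ^ 3 * b = 2 * p * q \<and> 6 * a\<^sup>2 * b\<^sup>2 = q\<^sup>2 + 2 * p * r \<and> 4 * a * b ^ 3 = 2 * q * r \<and> 1 + b ^ 4 = r\<^sup>2)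
    \<longleftrightarrow> a = 0 \<and> b ^ 4 = -1 \<or> a ^ 4 = -1 \<and> b = 0 \<or> a ^ 4 = 1 \<and> b ^ 4 = 1"
proof
  assume "\<exists>p q r. 1 + a ^ 4 = p\<^sup>2 \<and> 4 * a ^ 3 * b = 2 * p * q \<and> 6 * a\<^sup>2 * b\<^sup>2 = q\<^sup>2 + 2 * p * r \<and> 4 * a * b ^ 3 = 2 * q * r \<and> 1 + b ^ 4 = r\<^sup>2"
  then obtain p q r where e: "1 + a ^ 4 = p\<^sup>2" "4 * a ^ 3 * b = 2 * p * q" "6 * a\<^sup>2 * b\<^sup>2 = q\<^sup>2 + 2 * p * r"
    "4 * a * b ^ 3 = 2 * q * r" "1 + b ^ 4 = r\<^sup>2" by blast
  show "a = 0 \<and> b ^ 4 = -1 \<or> a ^ 4 = -1 \<and> b = 0 \<or> a ^ 4 = 1 \<and> b ^ 4 = 1"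
  proof (cases "a = 0 \<or> b = 0")
    case True
    then show ?thesis
    proof
      assume a: "a = 0"
      then have "p \<noteq> 0" using e(1) by auto
      then have "q = 0" using e(2) a by simp
      then have "r = 0" using e(3) a \<open>p \<noteq> 0\<close> by simp
      then show ?thesis using a e(5) by (simp add: eq_neg_iff_add_eq_0 add.commute)
    next
      assume b: "b = 0"
      then have "r \<noteq> 0" using e(5) by auto
      then have "q = 0" using e(4) b by simp
      then have "p = 0" using e(3) b \<open>r \<noteq> 0\<close> by simp
      then show ?thesis using b e(1) by (simp add: eq_neg_iff_add_eq_0 add.commute)
    qed
  next
    case False
    then have ab: "a \<noteq> 0" "b \<noteq> 0" by auto
    have pq: "p * q = 2 * a ^ 3 * b" and qr: "q * r = 2 * a * b ^ 3"
    proof -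
      have "p * q = (2 * p * q) / 2" "q * r = (2 * q * r) / 2" by simp_all
      then show "p * q = 2 * a ^ 3 * b" "q * r = 2 * a * b ^ 3" unfolding e(2,4)[symmetric] by simp_all
    qed
    \<comment> \<open>Multiplying the third equation by \<open>q\<^sup>2\<close> and inserting \<open>p q\<close> and \<open>q r\<close> gives a quadratic equation for \<open>q\<^sup>2\<close>.\<close>
    define w where "w = q\<^sup>2"
    have q0: "q \<noteq> 0" using pq ab by auto
    have "w * (6 * a\<^sup>2 * b\<^sup>2) = w * w + 2 * (p * q) * (q * r)"
      unfolding e(3) w_def by (simp add: algebra_simps power2_eq_square)
    then have "w * (6 * a\<^sup>2 * b\<^sup>2) = w * w + 8 * a ^ 4 * b ^ 4" unfolding pq qr by (simp add: eval_nat_numeral algebra_simps)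
    then have "(w - 2 * a\<^sup>2 * b\<^sup>2) * (w - 4 * a\<^sup>2 * b\<^sup>2) = 0" by (simp add: power2_eq_square power4_eq_xxxx algebra_simps)
    moreover have wp: "w * (1 + a ^ 4) = 4 * a ^ 6 * b\<^sup>2"
    proof -
      have "w * (1 + a ^ 4) = (p * q) * (p * q)" unfolding e(1) w_def by (simp add: algebra_simps power2_eq_square)
      then show ?thesis unfolding pq by (simp add: eval_nat_numeral algebra_simps)
    qed
    moreover have wr: "w * (1 + b ^ 4) = 4 * a\<^sup>2 * b ^ 6"
    proof -
      have "w * (1 + b ^ 4) = (q * r) * (q * r)" unfolding e(5) w_def by (simp add: algebra_simps power2_eq_square)
      then show ?thesis unfolding qr by (simp add: eval_nat_numeral algebra_simps)
    qed
    moreover have "w \<noteq> 4 * a\<^sup>2 * b\<^sup>2"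
    proof
      assume "w = 4 * a\<^sup>2 * b\<^sup>2"
      with wp have "4 * a\<^sup>2 * b\<^sup>2 * (1 + a ^ 4) = 4 * a\<^sup>2 * b\<^sup>2 * a ^ 4" by (simp add: eval_nat_numeral algebra_simps)
      then show False using ab by simp
    qed
    ultimately have w: "w = 2 * a\<^sup>2 * b\<^sup>2" by simp
    have "2 * a\<^sup>2 * b\<^sup>2 * (1 + a ^ 4) = 2 * a\<^sup>2 * b\<^sup>2 * (2 * a ^ 4)" using wp unfolding w by (simp add: eval_nat_numeral algebra_simps)
    then have "a ^ 4 = 1" using ab by simp
    moreover have "2 * a\<^sup>2 * b\<^sup>2 * (1 - b ^ 4) = 0" using wr unfolding w by (simp add: eval_nat_numeral algebra_simps)
    then have "b ^ 4 = 1" using ab by simp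
    ultimately show ?thesis by simp
  qed
next
  assume "a = 0 \<and> b ^ 4 = -1 \<or> a ^ 4 = -1 \<and> b = 0 \<or> a ^ 4 = 1 \<and> b ^ 4 = 1"
  then consider "a = 0" "b ^ 4 = -1" | "a ^ 4 = -1" "b = 0" | "a ^ 4 = 1" "b ^ 4 = 1" by blast
  then show "\<exists>p q r. 1 + a ^ 4 = p\<^sup>2 \<and> 4 * a ^ 3 * b = 2 * p * q \<and> 6 * a\<^sup>2 * b\<^sup>2 = q\<^sup>2 + 2 * p * r \<and> 4 * a * b ^ 3 = 2 * q * r \<and> 1 + b ^ 4 = r\<^sup>2"
  proof cases
    case 1 then show ?thesis apply - by (rule exI[of _ 1], rule exI[of _ 0], rule exI[of _ 0], simp)
  next
    case 2 then show ?thesis apply - by (rule exI[of _ 0], rule exI[of _ 0], rule exI[of _ 1], simp)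
  next
    case 3
    define s where "s = complex_of_real (sqrt 2)"
    have s: "s\<^sup>2 = 2" by (simp add: s_def flip: of_real_power)
    have ss: "s * s * z = 2 * z" for z using s by (simp add: power2_eq_square)
    show ?thesis
    proof (rule exI[of _ "s * a\<^sup>2"], rule exI[of _ "s * a * b"], rule exI[of _ "s * b\<^sup>2"], intro conjI)
      show "1 + a ^ 4 = (s * a\<^sup>2)\<^sup>2" using 3 by (simp add: power_mult_distrib s flip: power_mult)
      show "1 + b ^ 4 = (s * b\<^sup>2)\<^sup>2" using 3 by (simp add: power_mult_distrib s flip: power_mult)
      show "4 * a ^ 3 * b = 2 * (s * a\<^sup>2) * (s * a * b)" using ss[of "a ^ 3 * b"] by (simp add: power2_eq_square power3_eq_cube algebra_simps)
      show "4 * a * b ^ 3 = 2 * (s * a * b) * (s * b\<^sup>2)" using ss[of "a * b ^ 3"] by (simp add: power2_eq_square power3_eq_cube algebra_simps)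
      show "6 * a\<^sup>2 * b\<^sup>2 = (s * a * b)\<^sup>2 + 2 * (s * a\<^sup>2) * (s * b\<^sup>2)" using ss[of "a\<^sup>2 * b\<^sup>2"] by (simp add: power2_eq_square algebra_simps)
    qed
  qed
qed

definition vec3 :: "'a \<Rightarrow> 'a \<Rightarrow> 'a \<Rightarrow> 'a^3" where
  "vec3 a b c = (\<chi> m. if m = 1 then a else if m = 2 then b else c)"

lemma vec3_nth [simp]: "vec3 a b c $ 1 = a" "vec3 a b c $ 2 = b" "vec3 a b c $ 3 = c"
  by (simp_all add: vec3_def)

lemma linear_form_vec3: "linear_form l w = l $ 1 * w $ 1 + l $ 2 * w $ 2 + l $ 3 * w $ 3"
  by (simp add: linear_form_def sum_3)

lemma square_on_fermat:
  "square_on fermat (vec3 1 0 a) (vec3 0 1 b) (p, q, r) \<longleftrightarrow>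
     1 + a ^ 4 = p\<^sup>2 \<and> 4 * a ^ 3 * b = 2 * p * q \<and> 6 * a\<^sup>2 * b\<^sup>2 = q\<^sup>2 + 2 * p * r \<and> 4 * a * b ^ 3 = 2 * q * r \<and> 1 + b ^ 4 = r\<^sup>2"
proof -
  have e: "fermat (x *s vec3 1 0 a + y *s vec3 0 1 b) (x *s vec3 1 0 a + y *s vec3 0 1 b) (x *s vec3 1 0 a + y *s vec3 0 1 b) (x *s vec3 1 0 a + y *s vec3 0 1 b)
     = (1 + a ^ 4) * x ^ 4 + (4 * a ^ 3 * b) * x ^ 3 * y + (6 * a\<^sup>2 * b\<^sup>2) * x\<^sup>2 * y\<^sup>2 + (4 * a * b ^ 3) * x * y ^ 3 + (1 + b ^ 4) * y ^ 4" for x y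
    by (simp add: fermat_def sum_3 power2_eq_square power3_eq_cube power4_eq_xxxx algebra_simps)
  show ?thesis unfolding square_on_def e
    using square_coefficients[of "1 + a ^ 4" "4 * a ^ 3 * b" "6 * a\<^sup>2 * b\<^sup>2" "4 * a * b ^ 3" "1 + b ^ 4" p q r]
      square_of_coefficients[of "1 + a ^ 4" p "4 * a ^ 3 * b" q "6 * a\<^sup>2 * b\<^sup>2" r "4 * a * b ^ 3" "1 + b ^ 4"] by blast
qed

lemma square_on_fermat_infinite:
  "square_on fermat (vec3 1 a 0) (vec3 0 0 1) (p, q, r) \<longleftrightarrow> 1 + a ^ 4 = p\<^sup>2 \<and> 0 = 2 * p * q \<and> 0 = q\<^sup>2 + 2 * p * r \<and> 0 = 2 * q * r \<and> 1 = r\<^sup>2"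
proof -
  have e: "fermat (x *s vec3 1 a 0 + y *s vec3 0 0 1) (x *s vec3 1 a 0 + y *s vec3 0 0 1) (x *s vec3 1 a 0 + y *s vec3 0 0 1) (x *s vec3 1 a 0 + y *s vec3 0 0 1)
     = (1 + a ^ 4) * x ^ 4 + 0 * x ^ 3 * y + 0 * x\<^sup>2 * y\<^sup>2 + 0 * x * y ^ 3 + 1 * y ^ 4" for x y
    by (simp add: fermat_def sum_3 power2_eq_square power3_eq_cube power4_eq_xxxx algebra_simps)
  show ?thesis unfolding square_on_def e
    using square_coefficients[of "1 + a ^ 4" 0 0 0 1 p q r] square_of_coefficients[of "1 + a ^ 4" p 0 q 0 r 0 1] by blast
qed


lemma indep2_vec3: "indep2 (vec3 1 0 a) (vec3 0 1 (b :: 'a::field))" "indep2 (vec3 1 a 0) (vec3 0 0 (1 :: 'a::field))"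
  by (auto simp: indep2_def vec_eq_iff forall_3)

lemma bitangent_line_fermat:
  assumes l3: "homvec L $ 3 \<noteq> 0"
  shows "bitangent_line fermat L \<longleftrightarrow> (let a = - (homvec L $ 1 / homvec L $ 3); b = - (homvec L $ 2 / homvec L $ 3) in
     a = 0 \<and> b ^ 4 = -1 \<or> a ^ 4 = -1 \<and> b = 0 \<or> a ^ 4 = 1 \<and> b ^ 4 = 1)"
proof -
  define a where "a = - (homvec L $ 1 / homvec L $ 3)"
  define b where "b = - (homvec L $ 2 / homvec L $ 3)"
  have k: "linear_form (homvec L) (vec3 1 0 a) = 0" "linear_form (homvec L) (vec3 0 1 b) = 0"
    using l3 by (simp_all add: linear_form_vec3 a_def b_def)
  have "bitangent_line fermat L \<longleftrightarrow> (\<exists>q. square_on fermat (vec3 1 0 a) (vec3 0 1 b) q)"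
    using bitangent_line_square_on[OF _ k] k indep2_vec3(1)[of a b] unfolding bitangent_line_def by blast
  then show ?thesis unfolding Let_def a_def[symmetric] b_def[symmetric] fermat_square_condition[symmetric]
    by (simp add: square_on_fermat)
qed

lemma bitangent_line_fermat_infinite:
  assumes l3: "homvec L $ 3 = 0"
  shows "bitangent_line fermat L \<longleftrightarrow> homvec L $ 2 \<noteq> 0 \<and> (homvec L $ 1 / homvec L $ 2) ^ 4 = -1"
proof (cases "homvec L $ 2 = 0")
  case True
  then have k: "linear_form (homvec L) (vec3 0 1 0) = 0" "linear_form (homvec L) (vec3 0 0 1) = 0"
    using l3 by (simp_all add: linear_form_vec3)
  have "\<not> bitangent_line fermat L"
  proof
    assume "bitangent_line fermat L"
    then obtain q where "square_on fermat (vec3 0 1 0) (vec3 0 0 1) q" using bitangent_line_square_on[OF _ k] by blast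
    then obtain p r s where "square_on fermat (vec3 0 1 0) (vec3 0 0 1) (p, r, s)" by (cases q) auto
    moreover have "fermat (x *s vec3 0 1 0 + y *s vec3 0 0 1) (x *s vec3 0 1 0 + y *s vec3 0 0 1) (x *s vec3 0 1 0 + y *s vec3 0 0 1) (x *s vec3 0 1 0 + y *s vec3 0 0 1)
      = 1 * x ^ 4 + 0 * x ^ 3 * y + 0 * x\<^sup>2 * y\<^sup>2 + 0 * x * y ^ 3 + 1 * y ^ 4" for x y
      by (simp add: fermat_def sum_3 power2_eq_square power3_eq_cube power4_eq_xxxx algebra_simps)
    ultimately have *: "1 * x ^ 4 + 0 * x ^ 3 * y + 0 * x\<^sup>2 * y\<^sup>2 + 0 * x * y ^ 3 + 1 * y ^ 4 = binary_quadratic (p, r, s) x y ^ 2" for x y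
      unfolding square_on_def by metis
    from square_coefficients[OF *] show False by auto
  qed
  then show ?thesis using True by simp
next
  case False
  define a where "a = - (homvec L $ 1 / homvec L $ 2)"
  have k: "linear_form (homvec L) (vec3 1 a 0) = 0" "linear_form (homvec L) (vec3 0 0 1) = 0"
    using l3 False by (simp_all add: linear_form_vec3 a_def)
  have "bitangent_line fermat L \<longleftrightarrow> (\<exists>q. square_on fermat (vec3 1 a 0) (vec3 0 0 1) q)"
    using bitangent_line_square_on[OF _ k] k indep2_vec3(2)[of a] unfolding bitangent_line_def by blast
  also have "\<dots> \<longleftrightarrow> (\<exists>p q r. 1 + a ^ 4 = p\<^sup>2 \<and> 0 = 2 * p * q \<and> 0 = q\<^sup>2 + 2 * p * r \<and> 0 = 2 * q * r \<and> 1 = r\<^sup>2)"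
    by (simp add: square_on_fermat_infinite)
  also have "\<dots> \<longleftrightarrow> a ^ 4 = -1"
  proof
    assume "\<exists>p q r. 1 + a ^ 4 = p\<^sup>2 \<and> 0 = 2 * p * q \<and> 0 = q\<^sup>2 + 2 * p * r \<and> 0 = 2 * q * r \<and> 1 = r\<^sup>2"
    then obtain p q r where e: "1 + a ^ 4 = p\<^sup>2" "0 = 2 * p * q" "0 = q\<^sup>2 + 2 * p * r" "0 = 2 * q * r" "1 = r\<^sup>2" by blast
    have "r \<noteq> 0" using e(5) by auto
    then have "q = 0" using e(4) by simp
    then have "p = 0" using e(3) \<open>r \<noteq> 0\<close> by simp
    then show "a ^ 4 = -1" using e(1) by (simp add: eq_neg_iff_add_eq_0 add.commute)
  next
    assume "a ^ 4 = -1"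
    then show "\<exists>p q r. 1 + a ^ 4 = p\<^sup>2 \<and> 0 = 2 * p * q \<and> 0 = q\<^sup>2 + 2 * p * r \<and> 0 = 2 * q * r \<and> 1 = r\<^sup>2"
      apply - by (rule exI[of _ 0], rule exI[of _ 0], rule exI[of _ 1], simp)
  qed
  finally show ?thesis using False by (simp add: a_def)
qed

lemma card_fourth_roots: "card {z :: complex. z ^ 4 = 1} = 4" "card {z :: complex. z ^ 4 = -1} = 4"
  using card_nth_roots[of "1::complex" 4] card_nth_roots[of "-1::complex" 4] by simp_all

text \<open>Besides the \<open>4 + 4 + 16\<close> lines of \<open>fermat_square_condition\<close> there are 4 hyperflexes through the point \<open>[0 : 0 : 1]\<close>.\<close>

theorem card_bitangents_fermat: "card {L. bitangent_line fermat L} = 28"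
proof -
  define R where "R c = {z :: complex. z ^ 4 = c}" for c
  have R: "finite (R 1)" "finite (R (-1))" "card (R 1) = 4" "card (R (-1)) = 4"
    using card_fourth_roots card_ge_0_finite[of "R 1"] card_ge_0_finite[of "R (-1)"] by (simp_all add: R_def)
  define S where "S = {0} \<times> R (-1) \<union> R (-1) \<times> {0} \<union> R 1 \<times> R 1"
  have "card S = 24" unfolding S_def
    by (subst card_Un_disjoint; (subst card_Un_disjoint)?) (use R in \<open>auto simp: R_def card_cartesian_product\<close>)
  define f where "f = (\<lambda>(a, b). proj_point (vec3 a b (-1 :: complex)))"
  define g where "g a = proj_point (vec3 a 1 (0 :: complex))" for a
  have v0: "vec3 a b (-1) \<noteq> 0" "vec3 a 1 0 \<noteq> 0" for a b :: complex by (auto simp: vec_eq_iff forall_3)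
  have fh: "homvec (f (a, b)) $ 3 \<noteq> 0" "- (homvec (f (a, b)) $ 1 / homvec (f (a, b)) $ 3) = a" "- (homvec (f (a, b)) $ 2 / homvec (f (a, b)) $ 3) = b" for a b
    unfolding f_def prod.case by (rule homvec_proj_point[OF v0(1)[of a b]]; simp)+
  have gh: "homvec (g a) $ 3 = 0" "homvec (g a) $ 2 \<noteq> 0" "homvec (g a) $ 1 / homvec (g a) $ 2 = a" for a
    unfolding g_def by (rule homvec_proj_point[OF v0(2)[of a]]; simp)+
  have fL: "L = f (- (homvec L $ 1 / homvec L $ 3), - (homvec L $ 2 / homvec L $ 3))" if "homvec L $ 3 \<noteq> 0" for L
  proof -
    let ?v = "vec3 (- (homvec L $ 1 / homvec L $ 3)) (- (homvec L $ 2 / homvec L $ 3)) (-1)"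
    have "homvec L = (- homvec L $ 3) *s ?v" using that by (simp add: vec_eq_iff forall_3)
    then have "L = proj_point ((- homvec L $ 3) *s ?v)" using homvec(2)[of L] by metis
    also have "\<dots> = proj_point ?v" using that by (intro proj_point_scale v0) simp
    finally show ?thesis by (simp add: f_def)
  qed
  have gL: "L = g (homvec L $ 1 / homvec L $ 2)" if "homvec L $ 3 = 0" "homvec L $ 2 \<noteq> 0" for L
  proof -
    let ?v = "vec3 (homvec L $ 1 / homvec L $ 2) 1 0"
    have "homvec L = (homvec L $ 2) *s ?v" using that by (simp add: vec_eq_iff forall_3)
    then have "L = proj_point ((homvec L $ 2) *s ?v)" using homvec(2)[of L] by metis
    also have "\<dots> = proj_point ?v" using that by (intro proj_point_scale v0) simp
    finally show ?thesis by (simp add: g_def)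
  qed
  have "{L. bitangent_line fermat L} = f ` S \<union> g ` R (-1)"
  proof (intro equalityI subsetI)
    fix L assume "L \<in> {L. bitangent_line fermat L}"
    then have L: "bitangent_line fermat L" by simp
    show "L \<in> f ` S \<union> g ` R (-1)"
    proof (cases "homvec L $ 3 = 0")
      case True
      then have "homvec L $ 2 \<noteq> 0" "homvec L $ 1 / homvec L $ 2 \<in> R (-1)"
        using L bitangent_line_fermat_infinite[OF True] by (auto simp: R_def)
      then show ?thesis using gL[OF True] by blast
    next
      case False
      have "(- (homvec L $ 1 / homvec L $ 3), - (homvec L $ 2 / homvec L $ 3)) \<in> S"
        using L unfolding bitangent_line_fermat[OF False] Let_def S_def R_def by blast
      then show ?thesis using fL[OF False] by blast
    qed
  next
    fix L assume "L \<in> f ` S \<union> g ` R (-1)"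
    then show "L \<in> {L. bitangent_line fermat L}"
    proof
      assume "L \<in> f ` S"
      then obtain a b where "(a, b) \<in> S" "L = f (a, b)" by auto
      then show ?thesis using bitangent_line_fermat[OF fh(1)[of a b]] unfolding fh Let_def S_def R_def by blast
    next
      assume "L \<in> g ` R (-1)"
      then obtain a where "a ^ 4 = -1" "L = g a" by (auto simp: R_def)
      then show ?thesis using bitangent_line_fermat_infinite[OF gh(1)[of a]] gh[of a] by simp
    qed
  qed
  moreover have "inj_on f S" by (rule inj_onI) (metis fh(2,3) surj_pair)
  moreover have "inj_on g (R (-1))" by (rule inj_onI) (metis gh(3))
  moreover have "f ` S \<inter> g ` R (-1) = {}"
  proof -
    have "f p \<noteq> g a" for p a using fh(1)[of "fst p" "snd p"] gh(1)[of a] by auto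
    then show ?thesis by blast
  qed
  moreover have "finite S" using R by (simp add: S_def)
  ultimately show ?thesis using R \<open>card S = 24\<close> by (simp add: card_Un_disjoint card_image)
qed

theorem card_bitangents_smooth_quartic:
  assumes "smooth_quartic \<Phi>" shows "card {L. bitangent_line \<Phi> L} = 28"
  using card_bitangents_constant[OF assms smooth_quartic_fermat] card_bitangents_fermat by simp

section \<open>Ternary quartics and their symmetric four-linear forms\<close>

text \<open>The average of \<open>x\<^sub>i y\<^sub>j z\<^sub>k w\<^sub>l\<close> over all 24 permutations of the indices, grouped by the position of each index.\<close>

definition sym_monomial :: "3 \<Rightarrow> 3 \<Rightarrow> 3 \<Rightarrow> 3 \<Rightarrow> complex^3 \<Rightarrow> complex^3 \<Rightarrow> complex^3 \<Rightarrow> complex^3 \<Rightarrow> complex" where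
  "sym_monomial i j k l x y z w = (let U = (\<lambda>i j. z $ i * w $ j + z $ j * w $ i);
      T = (\<lambda>i j k. y $ i * U j k + y $ j * U i k + y $ k * U i j)
    in (x $ i * T j k l + x $ j * T i k l + x $ k * T i j l + x $ l * T i j k) / 24)"

lemma quartic_form_sym_monomial: "quartic_form (sym_monomial i j k l)"
  by unfold_locales (simp_all add: sym_monomial_def Let_def field_simps)

lemma sym_monomial_diagonal: "sym_monomial i j k l x x x x = x $ i * x $ j * x $ k * x $ l"
  by (simp add: sym_monomial_def Let_def field_simps)

lemma cnj_sym_monomial:
  "cnj (sym_monomial i j k l x y z w) = sym_monomial i j k l (map_vec3 cnj x) (map_vec3 cnj y) (map_vec3 cnj z) (map_vec3 cnj w)"
  by (simp add: sym_monomial_def Let_def map_vec3_def)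

lemma monomial_of_degree_4:
  fixes e :: "nat^3"
  assumes "(\<Sum>i\<in>UNIV. e $ i) = 4"
  shows "\<exists>i j k l. \<forall>x :: complex^3. (\<Prod>i\<in>UNIV. x $ i ^ e $ i) = x $ i * x $ j * x $ k * x $ l"
proof -
  define xs where "xs = replicate (e $ 1) (1::3) @ replicate (e $ 2) 2 @ replicate (e $ 3) 3"
  have "length xs = 4" using assms by (simp add: xs_def sum_3)
  moreover have "ys = [ys ! 0, ys ! 1, ys ! 2, ys ! 3]" if "length ys = 4" for ys :: "3 list"
    by (rule nth_equalityI) (use that in \<open>auto simp: numeral_eq_Suc less_Suc_eq\<close>)
  ultimately obtain i j k l where ijkl: "xs = [i, j, k, l]" by blast
  have "(\<Prod>i\<in>UNIV. x $ i ^ e $ i) = prod_list (map (\<lambda>i. x $ i) xs)" for x :: "complex^3"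
    unfolding UNIV_3 xs_def by (simp add: prod_list_replicate mult.assoc)
  then have "(\<Prod>i\<in>UNIV. x $ i ^ e $ i) = x $ i * x $ j * x $ k * x $ l" for x :: "complex^3"
    unfolding ijkl by (simp add: mult.assoc)
  then show ?thesis by blast
qed

definition real_form :: "complex_form \<Rightarrow> bool" where
  "real_form \<Phi> \<longleftrightarrow> (\<forall>x y z w. cnj (\<Phi> x y z w) = \<Phi> (map_vec3 cnj x) (map_vec3 cnj y) (map_vec3 cnj z) (map_vec3 cnj w))"

lemma quartic_form_sum:
  fixes \<Psi> :: "'e \<Rightarrow> 'a::real_normed_field^3 \<Rightarrow> 'a^3 \<Rightarrow> 'a^3 \<Rightarrow> 'a^3 \<Rightarrow> 'a"
  assumes "finite K" "\<And>e. e \<in> K \<Longrightarrow> quartic_form (\<Psi> e)"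
  shows "quartic_form (\<lambda>x y z w. \<Sum>e\<in>K. c e * \<Psi> e x y z w)"
proof
  fix x y z w x' :: "'a^3" and d
  show "(\<Sum>e\<in>K. c e * \<Psi> e x y z w) = (\<Sum>e\<in>K. c e * \<Psi> e y x z w)"
    by (intro sum.cong refl) (metis assms(2) quartic_form.swap12)
  show "(\<Sum>e\<in>K. c e * \<Psi> e x y z w) = (\<Sum>e\<in>K. c e * \<Psi> e x z y w)"
    by (intro sum.cong refl) (metis assms(2) quartic_form.swap23)
  show "(\<Sum>e\<in>K. c e * \<Psi> e x y z w) = (\<Sum>e\<in>K. c e * \<Psi> e x y w z)"
    by (intro sum.cong refl) (metis assms(2) quartic_form.swap34)
  show "(\<Sum>e\<in>K. c e * \<Psi> e (x + x') y z w) = (\<Sum>e\<in>K. c e * \<Psi> e x y z w) + (\<Sum>e\<in>K. c e * \<Psi> e x' y z w)"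
    unfolding sum.distrib[symmetric] by (intro sum.cong refl) (simp add: quartic_form.add1[OF assms(2)] distrib_left)
  show "(\<Sum>e\<in>K. c e * \<Psi> e (d *s x) y z w) = d * (\<Sum>e\<in>K. c e * \<Psi> e x y z w)"
    unfolding sum_distrib_left by (intro sum.cong refl) (simp add: quartic_form.scale1[OF assms(2)])
qed

theorem quartic_polarization:
  fixes f :: ternary
  assumes "homogeneous 4 f"
  obtains \<Phi> where "quartic_form \<Phi>" "real_form \<Phi>" "\<And>x. poly_eval complex_of_real f x = \<Phi> x x x x"
proof -
  let ?K = "Poly_Mapping.keys f"
  have "\<forall>e\<in>?K. \<exists>\<Psi>. quartic_form \<Psi> \<and> real_form \<Psi> \<and> (\<forall>x :: complex^3. (\<Prod>i\<in>UNIV. x $ i ^ e $ i) = \<Psi> x x x x)"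
  proof
    fix e assume "e \<in> ?K"
    then have "(\<Sum>i\<in>UNIV. e $ i) = 4" using assms by (simp add: homogeneous_def)
    from monomial_of_degree_4[OF this] obtain i j k l where
      "\<And>x :: complex^3. (\<Prod>i\<in>UNIV. x $ i ^ e $ i) = x $ i * x $ j * x $ k * x $ l" by blast
    then show "\<exists>\<Psi>. quartic_form \<Psi> \<and> real_form \<Psi> \<and> (\<forall>x :: complex^3. (\<Prod>i\<in>UNIV. x $ i ^ e $ i) = \<Psi> x x x x)"
      by (intro exI[of _ "sym_monomial i j k l"] conjI allI quartic_form_sym_monomial)
         (simp_all only: real_form_def cnj_sym_monomial sym_monomial_diagonal simp_thms)
  qed
  then obtain \<Psi> where \<Psi>: "\<And>e. e \<in> ?K \<Longrightarrow> quartic_form (\<Psi> e)" "\<And>e. e \<in> ?K \<Longrightarrow> real_form (\<Psi> e)"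
    "\<And>e x. e \<in> ?K \<Longrightarrow> (\<Prod>i\<in>UNIV. x $ i ^ e $ i) = \<Psi> e x x x x" by metis
  define \<Phi> where "\<Phi> x y z w = (\<Sum>e\<in>?K. complex_of_real (Poly_Mapping.lookup f e) * \<Psi> e x y z w)" for x y z w
  show ?thesis
  proof
    show "quartic_form \<Phi>" unfolding \<Phi>_def by (rule quartic_form_sum) (use \<Psi>(1) in auto)
    show "real_form \<Phi>" unfolding real_form_def \<Phi>_def cnj_sum
      by (intro allI sum.cong refl) (use \<Psi>(2) in \<open>simp add: real_form_def\<close>)
    show "poly_eval complex_of_real f x = \<Phi> x x x x" for x
      unfolding poly_eval_def \<Phi>_def by (intro sum.cong refl) (simp add: \<Psi>(3))
  qed
qed

lemma poly_pullback_to_line: "poly (pullback_to_line f v w) t = poly_eval of_real f (v + t *s w)"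
  unfolding pullback_to_line_def poly_eval_def poly_sum
  by (intro sum.cong refl) (simp add: poly_prod)

locale ternary_quartic = quartic_form \<Phi> for \<Phi> :: complex_form +
  fixes f :: ternary
  assumes eval: "poly_eval complex_of_real f x = \<Phi> x x x x"
begin

lemma has_derivative_poly_eval:
  "(poly_eval complex_of_real f has_derivative (\<lambda>w. 4 * \<Phi> x x x w)) (at x)"
proof -
  have id: "((\<lambda>x. x) has_derivative (\<lambda>d. d)) (at x)" by (rule has_derivative_ident)
  have "((\<lambda>x. \<Phi> x x x x) has_derivative (\<lambda>d. \<Phi> d x x x + \<Phi> x d x x + \<Phi> x x d x + \<Phi> x x x d)) (at x)"
    by (rule has_derivative_form[OF id id id id])
  moreover have "(\<lambda>d. \<Phi> d x x x + \<Phi> x d x x + \<Phi> x x d x + \<Phi> x x x d) = (\<lambda>w. 4 * \<Phi> x x x w)"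
  proof
    fix d
    have "\<Phi> d x x x = \<Phi> x x x d" "\<Phi> x d x x = \<Phi> x x x d" "\<Phi> x x d x = \<Phi> x x x d" by (rule swap14, rule swap24, rule swap34)
    then show "\<Phi> d x x x + \<Phi> x d x x + \<Phi> x x d x + \<Phi> x x x d = 4 * \<Phi> x x x d" by simp
  qed
  moreover have "poly_eval complex_of_real f = (\<lambda>x. \<Phi> x x x x)" using eval by blast
  ultimately show ?thesis by simp
qed

lemma on_curve_proj_point:
  assumes "v \<noteq> 0" shows "on_curve f (proj_point v :: complex proj_plane) \<longleftrightarrow> \<Phi> v v v v = 0"
  unfolding on_curve_def eval by (rule homvec_proj_point[OF assms]) (simp add: quartic_scale)

lemma smooth_quartic_of_smooth_curve:
  assumes "smooth_plane_curve 4 f" shows "smooth_quartic \<Phi>"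
proof
  fix x :: "complex^3" assume x: "x \<noteq> 0"
  show "\<exists>w. \<Phi> x x x w \<noteq> 0"
  proof (rule ccontr)
    assume "\<not> ?thesis"
    then have z: "\<Phi> x x x w = 0" for w by blast
    obtain c where c: "c \<noteq> 0" "homvec (proj_point x) = c *s x" using homvec_proj_point[OF x] .
    have "(poly_eval complex_of_real f has_derivative (\<lambda>_. 0)) (at (homvec (proj_point x)))"
      using has_derivative_poly_eval[of "homvec (proj_point x)"] by (simp add: c(2) multilinear z)
    moreover have "on_curve f (proj_point x)" using on_curve_proj_point[OF x] z by simp
    ultimately show False using assms unfolding smooth_plane_curve_def by blast
  qed
qed

end

section \<open>Bitangents and their tangency divisors\<close>

lemma on_line_proj_point:
  assumes "v \<noteq> 0" shows "on_line (proj_point v) L \<longleftrightarrow> linear_form (homvec L) v = 0"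
  unfolding on_line_def by (rule homvec_proj_point[OF assms]) simp

lemma indep2_of_distinct_points:
  assumes "p \<noteq> q" shows "indep2 (homvec p) (homvec q)"
  unfolding indep2_def
proof (intro allI impI, rule ccontr)
  fix x y assume z: "x *s homvec p + y *s homvec q = 0" and n: "\<not> (x = 0 \<and> y = 0)"
  have xy: "x \<noteq> 0 \<and> y \<noteq> 0"
  proof (rule ccontr)
    assume "\<not> (x \<noteq> 0 \<and> y \<noteq> 0)"
    then consider "x = 0" "y \<noteq> 0" | "y = 0" "x \<noteq> 0" using n by blast
    then show False by cases (use z homvec(1) in auto)
  qed
  have "homvec q = (- (x / y)) *s homvec p"
  proof -
    have "x * homvec p $ m + y * homvec q $ m = 0" for m using arg_cong[OF z, of "\<lambda>v. v $ m"] by simp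
    then have "homvec q $ m = - (x / y) * homvec p $ m" for m using xy by (simp add: field_simps eq_neg_iff_add_eq_0)
    then show ?thesis by (simp add: vec_eq_iff)
  qed
  then have "proj_point (homvec q) = proj_point (homvec p)" using xy by (metis proj_point_scale homvec(1) divide_eq_0_iff neg_equal_0_iff_equal)
  then show False using assms by (simp add: homvec(2))
qed

lemma indep2_nonzero: "indep2 u v \<Longrightarrow> (x, y) \<noteq> (0, 0) \<Longrightarrow> x *s u + y *s v \<noteq> 0"
  by (auto simp: indep2_def)

lemma indep2_coords_eq:
  assumes "indep2 u v" "x *s u + y *s v = x' *s u + y' *s v" shows "x = x' \<and> y = y'"
proof -
  have "(x - x') *s u + (y - y') *s v = 0" using assms(2) by (simp add: vec_eq_iff algebra_simps)
  then show ?thesis using assms(1) unfolding indep2_def by fastforce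
qed

lemma proj_point_eq_iff_coords:
  assumes uv: "indep2 u v" and n: "(x, y) \<noteq> (0, 0)" "(x', y') \<noteq> (0, 0)"
  shows "proj_point (x *s u + y *s v) = proj_point (x' *s u + y' *s v) \<longleftrightarrow> x * y' = y * x'"
proof
  have nz: "x *s u + y *s v \<noteq> 0" "x' *s u + y' *s v \<noteq> 0" using indep2_nonzero[OF uv] n by auto
  assume "proj_point (x *s u + y *s v) = proj_point (x' *s u + y' *s v)"
  then obtain c d where cd: "c \<noteq> 0" "d \<noteq> 0" "c *s (x *s u + y *s v) = d *s (x' *s u + y' *s v)"
    using homvec_proj_point[OF nz(1)] homvec_proj_point[OF nz(2)] by metis
  have "(c * x) *s u + (c * y) *s v = (d * x') *s u + (d * y') *s v"
    using cd(3) by (simp add: vec_eq_iff algebra_simps)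
  from indep2_coords_eq[OF uv this] have "c * x = d * x'" "c * y = d * y'" by auto
  have "c * d * (x * y') = (c * x) * (d * y')" by (simp add: algebra_simps)
  also have "\<dots> = c * d * (y * x')" unfolding \<open>c * x = d * x'\<close> \<open>c * y = d * y'\<close>[symmetric] by (simp add: algebra_simps)
  finally have "c * d * (x * y') = c * d * (y * x')" .
  then show "x * y' = y * x'" using cd by simp
next
  have nz: "x' *s u + y' *s v \<noteq> 0" using indep2_nonzero[OF uv n(2)] .
  assume e: "x * y' = y * x'"
  obtain c where "c \<noteq> 0" "x = c * x'" "y = c * y'"
  proof (cases "x' = 0")
    case True
    then show ?thesis using that[of "y / y'"] e n by auto
  next
    case False
    moreover have "x \<noteq> 0" using e n False by auto
    ultimately show ?thesis using that[of "x / x'"] e by (simp add: field_simps)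
  qed
  then have "x *s u + y *s v = c *s (x' *s u + y' *s v)" by (simp add: vec_eq_iff algebra_simps)
  then show "proj_point (x *s u + y *s v) = proj_point (x' *s u + y' *s v)"
    using proj_point_scale[OF \<open>c \<noteq> 0\<close> nz] by simp
qed

lemma order_linear:
  assumes "[:a, b:] \<noteq> (0 :: 'a::idom poly)" shows "order 0 [:a, b:] = (if a = 0 then 1 else 0)"
proof (cases "a = 0")
  case True
  then have "[:a, b:] = smult b ([:- 0, 1:] ^ 1)" "b \<noteq> 0" using assms by auto
  then show ?thesis using True by (metis order_smult order_power_n_n)
next
  case False
  then show ?thesis by (simp add: order_0I)
qed

text \<open>A second point on a line, as picked by the definition of the intersection multiplicity.\<close>

lemma other_point_on_line:
  assumes "on_line p L"
  defines "q \<equiv> SOME q. on_line q L \<and> q \<noteq> p"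
  shows "on_line q L" "q \<noteq> p"
proof -
  obtain i j k where ijk: "(UNIV :: 3 set) = {i, j, k}" "i \<noteq> j" "i \<noteq> k" "j \<noteq> k" and lk: "homvec L $ k \<noteq> 0"
    using index3_with_nonzero[OF homvec(1)[of L]] .
  define u where "u = axis i 1 + (- (homvec L $ i / homvec L $ k)) *s axis k 1"
  define v where "v = axis j 1 + (- (homvec L $ j / homvec L $ k)) *s axis k 1"
  have uv: "indep2 u v" unfolding u_def v_def by (rule indep2_chart[OF ijk(2-4)])
  have nz: "u \<noteq> 0" "v \<noteq> 0" using indep2_nonzero[OF uv, of 1 0] indep2_nonzero[OF uv, of 0 1] by simp_all
  have "on_line (proj_point u) L" "on_line (proj_point v) L"
    using chart_in_kernel[OF ijk lk] nz by (simp_all add: on_line_proj_point u_def v_def del: linear_form_add linear_form_scale)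
  moreover have "proj_point u \<noteq> proj_point v" using proj_point_eq_iff_coords[OF uv, of 1 0 0 1] by simp
  ultimately have "\<exists>q. on_line q L \<and> q \<noteq> p" by metis
  from someI_ex[OF this] show "on_line q L" "q \<noteq> p" unfolding q_def by blast+
qed

context ternary_quartic begin

text \<open>The pullback of the quartic along a parametrization at any point of the line is the square of the pullback of a product of
  two linear forms, so its order at \<open>0\<close> is twice the number of factors vanishing there.\<close>

lemma tangency_divisor_of_square:
  assumes uv: "indep2 u v" "linear_form (homvec L) u = 0" "linear_form (homvec L) v = 0"
    and q: "\<And>x y. quartic_at \<Phi> (x *s u + y *s v) = ((\<alpha> * x + \<beta> * y) * (\<gamma> * x + \<delta> * y)) ^ 2"
    and nz: "(\<alpha>, \<beta>) \<noteq> (0, 0)" "(\<gamma>, \<delta>) \<noteq> (0, 0)"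
  shows "tangency_divisor f L {# proj_point ((- \<beta>) *s u + \<alpha> *s v), proj_point ((- \<delta>) *s u + \<gamma> *s v) #}" (is "tangency_divisor f L ?Z")
  unfolding tangency_divisor_def
proof (intro conjI allI)
  have online: "on_line (proj_point (x *s u + y *s v)) L" if "(x, y) \<noteq> (0, 0)" for x y
    using indep2_nonzero[OF uv(1) that] uv(2,3) by (simp add: on_line_proj_point)
  show "\<exists>p. on_line p L \<and> \<not> on_curve f p"
  proof -
    have "[:\<alpha>, \<beta>:] \<noteq> 0" "[:\<gamma>, \<delta>:] \<noteq> 0" using nz by auto
    then have "[:\<alpha>, \<beta>:] * [:\<gamma>, \<delta>:] \<noteq> 0" by (simp only: mult_eq_0_iff simp_thms)
    then obtain t where "poly ([:\<alpha>, \<beta>:] * [:\<gamma>, \<delta>:]) t \<noteq> 0" using poly_all_0_iff_0 by blast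
    then have "((\<alpha> * 1 + \<beta> * t) * (\<gamma> * 1 + \<delta> * t)) ^ 2 \<noteq> 0" by (simp add: algebra_simps)
    then have "quartic_at \<Phi> (1 *s u + t *s v) \<noteq> 0" unfolding q .
    moreover have "1 *s u + t *s v \<noteq> 0" using indep2_nonzero[OF uv(1), of 1 t] by simp
    ultimately have "\<not> on_curve f (proj_point (1 *s u + t *s v))"
      using on_curve_proj_point[of "1 *s u + t *s v"] by blast
    moreover have "on_line (proj_point (1 *s u + t *s v)) L" by (rule online) simp
    ultimately show ?thesis by blast
  qed
  show "size ?Z = 2" by simp
  fix p
  show "intersection_mult f L p = 2 * count ?Z p"
  proof (cases "on_line p L")
    case False
    have "proj_point ((- \<beta>) *s u + \<alpha> *s v) \<noteq> p" "proj_point ((- \<delta>) *s u + \<gamma> *s v) \<noteq> p"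
      using False online[of "- \<beta>" \<alpha>] online[of "- \<delta>" \<gamma>] nz by auto
    then show ?thesis using False by (simp add: intersection_mult_def)
  next
    case True
    define p' where "p' = (SOME q. on_line q L \<and> q \<noteq> p)"
    have p': "on_line p' L" "p' \<noteq> p" unfolding p'_def by (rule other_point_on_line[OF True])+
    obtain x0 y0 where v0: "homvec p = x0 *s u + y0 *s v"
      using kernel_span[OF uv(1) homvec(1) uv(2,3)] True unfolding on_line_def by blast
    obtain x1 y1 where v1: "homvec p' = x1 *s u + y1 *s v"
      using kernel_span[OF uv(1) homvec(1) uv(2,3)] p'(1) unfolding on_line_def by blast
    have n0: "(x0, y0) \<noteq> (0, 0)" "(x1, y1) \<noteq> (0, 0)" using homvec(1)[of p] homvec(1)[of p'] v0 v1 by auto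
    have pe: "p = proj_point (x0 *s u + y0 *s v)" "p' = proj_point (x1 *s u + y1 *s v)" using homvec(2) v0 v1 by metis+
    have det: "x0 * y1 \<noteq> y0 * x1" using p'(2) proj_point_eq_iff_coords[OF uv(1) n0] pe by metis
    define A where "A = [:\<alpha> * x0 + \<beta> * y0, \<alpha> * x1 + \<beta> * y1:]"
    define C where "C = [:\<gamma> * x0 + \<delta> * y0, \<gamma> * x1 + \<delta> * y1:]"
    have "poly (pullback_to_line f (homvec p) (homvec p')) t = poly ((A * C) ^ 2) t" for t
    proof -
      have "homvec p + t *s homvec p' = (x0 + t * x1) *s u + (y0 + t * y1) *s v"
        unfolding v0 v1 by (simp add: vec_eq_iff algebra_simps)
      then show ?thesis unfolding poly_pullback_to_line eval by (simp only: q) (simp add: A_def C_def algebra_simps)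
    qed
    then have P: "pullback_to_line f (homvec p) (homvec p') = (A * C) ^ 2" by (simp add: poly_eq_poly_eq_iff[symmetric] fun_eq_iff)
    have lin: "[:a * x0 + b * y0, a * x1 + b * y1:] \<noteq> 0" if "(a, b) \<noteq> (0, 0)" for a b
    proof
      assume "[:a * x0 + b * y0, a * x1 + b * y1:] = 0"
      then have e: "a * x0 + b * y0 = 0" "a * x1 + b * y1 = 0" by simp_all
      have "a * (x0 * y1 - y0 * x1) = y1 * (a * x0 + b * y0) - y0 * (a * x1 + b * y1)" by (simp add: algebra_simps)
      moreover have "b * (x0 * y1 - y0 * x1) = x0 * (a * x1 + b * y1) - x1 * (a * x0 + b * y0)" by (simp add: algebra_simps)
      ultimately show False using det that unfolding e by auto
    qed
    have AC: "A \<noteq> 0" "C \<noteq> 0" unfolding A_def C_def using lin nz by blast+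
    have "order 0 ((A * C) ^ 2) = 2 * (order 0 A + order 0 C)"
      using AC by (simp add: power2_eq_square order_mult)
    also have "order 0 A = count {# proj_point ((- \<beta>) *s u + \<alpha> *s v) #} p"
    proof -
      have "p = proj_point ((- \<beta>) *s u + \<alpha> *s v) \<longleftrightarrow> \<alpha> * x0 + \<beta> * y0 = 0"
        unfolding pe(1) using proj_point_eq_iff_coords[OF uv(1) n0(1), of "- \<beta>" \<alpha>] nz(1)
        by (auto simp: eq_neg_iff_add_eq_0 mult.commute)
      then show ?thesis unfolding A_def order_linear[OF lin[OF nz(1)]] by auto
    qed
    also have "order 0 C = count {# proj_point ((- \<delta>) *s u + \<gamma> *s v) #} p"
    proof -
      have "p = proj_point ((- \<delta>) *s u + \<gamma> *s v) \<longleftrightarrow> \<gamma> * x0 + \<delta> * y0 = 0"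
        unfolding pe(1) using proj_point_eq_iff_coords[OF uv(1) n0(1), of "- \<delta>" \<gamma>] nz(2)
        by (auto simp: eq_neg_iff_add_eq_0 mult.commute)
      then show ?thesis unfolding C_def order_linear[OF lin[OF nz(2)]] by auto
    qed
    finally show ?thesis using True by (simp add: intersection_mult_def p'_def[symmetric] P)
  qed
qed

lemma pullback_coeffs:
  "pullback_to_line f u w = [:\<Phi> u u u u, 4 * \<Phi> u u u w, 6 * \<Phi> u u w w, 4 * \<Phi> u w w w, \<Phi> w w w w:]"
proof -
  have "poly (pullback_to_line f u w) t = poly [:\<Phi> u u u u, 4 * \<Phi> u u u w, 6 * \<Phi> u u w w, 4 * \<Phi> u w w w, \<Phi> w w w w:] t" for t
    using quartic_on_line[of 1 u t w] by (simp add: poly_pullback_to_line eval algebra_simps eval_nat_numeral)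
  then show ?thesis by (simp add: poly_eq_poly_eq_iff[symmetric] fun_eq_iff)
qed

text \<open>If \<open>Z\<close> is a hyperflex \<open>2 p\<close>, then in a basis starting at \<open>p\<close> only the fourth power survives in the restricted quartic. If \<open>Z = p + p'\<close>,
  then in the basis \<open>p, p'\<close> the restricted quartic is a multiple of \<open>x\<^sup>2 y\<^sup>2\<close>.\<close>

lemma bitangent_imp_bitangent_line:
  assumes "bitangent f L" shows "bitangent_line \<Phi> L"
proof -
  obtain Z where Z: "tangency_divisor f L Z" using assms unfolding bitangent_def by blast
  then have mult: "\<And>p. intersection_mult f L p = 2 * count Z p" and "size Z = 2" by (auto simp: tangency_divisor_def)
  obtain p1 Z' where Z1: "Z = add_mset p1 Z'" "size Z' = 1" using size_eq_Suc_imp_eq_union[of Z 1] \<open>size Z = 2\<close> by auto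
  then obtain p2 where Zp: "Z = {# p1, p2 #}" using size_1_singleton_mset by metis
  have on: "on_line p L" if "p \<in># Z" for p
  proof (rule ccontr)
    assume "\<not> on_line p L"
    then have "count Z p = 0" using mult[of p] by (simp add: intersection_mult_def)
    then show False using that by (simp add: count_eq_zero_iff)
  qed
  have k: "linear_form (homvec L) (homvec p) = 0" if "on_line p L" for p using that by (simp add: on_line_def)
  define oth where "oth p = (SOME q. on_line q L \<and> q \<noteq> p)" for p
  have oth: "on_line (oth p) L" "oth p \<noteq> p" if "on_line p L" for p unfolding oth_def by (rule other_point_on_line[OF that])+
  have ord: "order 0 (pullback_to_line f (homvec p) (homvec (oth p))) = 2 * count Z p" if "on_line p L" for p
    using mult[of p] that by (simp add: intersection_mult_def oth_def)
  have dv: "[:0, 1:] ^ (2 * count Z p) dvd pullback_to_line f (homvec p) (homvec (oth p))" if "on_line p L" for p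
    using order_1[of 0 "pullback_to_line f (homvec p) (homvec (oth p))"] ord[OF that] by simp
  show ?thesis
  proof (cases "p1 = p2")
    case False
    have half: "quartic_at \<Phi> (homvec p) = 0 \<and> polar_at \<Phi> (homvec p) (homvec p') = 0"
      if p: "p \<in># Z" "p' \<in># Z" "p \<noteq> p'" "count Z p = 1" for p p'
    proof -
      let ?u = "homvec p" and ?w = "homvec (oth p)"
      have "[:0, 1:] ^ 2 dvd pullback_to_line f ?u ?w" using dv[OF on[OF p(1)]] p(4) by simp
      then obtain r where r: "pullback_to_line f ?u ?w = [:0, 1:] ^ 2 * r" by (auto elim: dvdE)
      have c: "\<Phi> ?u ?u ?u ?u = 0" "\<Phi> ?u ?u ?u ?w = 0"
        using arg_cong[OF r, of "\<lambda>P. coeff P 0"] arg_cong[OF r, of "\<lambda>P. coeff P 1"]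
        by (simp_all add: pullback_coeffs power2_eq_square)
      have ind: "indep2 ?u ?w" using indep2_of_distinct_points oth(2)[OF on[OF p(1)]] by metis
      obtain a b where "homvec p' = a *s ?u + b *s ?w"
        using kernel_span[OF ind homvec(1) k[OF on[OF p(1)]] k[OF oth(1)[OF on[OF p(1)]]] k[OF on[OF p(2)]]] by blast
      then show ?thesis using c by (simp add: multilinear)
    qed
    let ?u = "homvec p1" and ?v = "homvec p2"
    have "count Z p1 = 1" "count Z p2 = 1" using False by (simp_all add: Zp)
    then have h: "\<Phi> ?u ?u ?u ?u = 0" "\<Phi> ?u ?u ?u ?v = 0" "\<Phi> ?v ?v ?v ?v = 0" "\<Phi> ?v ?v ?v ?u = 0"
      using half[of p1 p2] half[of p2 p1] False by (simp_all add: Zp)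
    have h': "\<Phi> ?u ?v ?v ?v = 0" using h(4) swap14 by metis
    have "square_on \<Phi> ?u ?v (0, csqrt (6 * \<Phi> ?u ?u ?v ?v), 0)"
      unfolding square_on_def quartic_on_line h h' by (simp add: binary_quadratic_def power_mult_distrib)
    then show ?thesis using indep2_of_distinct_points[OF False] k on Zp unfolding bitangent_line_def
      by (metis (no_types, lifting) add_mset_remove_trivial_eq multi_member_last union_single_eq_member add_mset_commute)
  next
    case True
    let ?u = "homvec p1" and ?w = "homvec (oth p1)"
    have p1: "on_line p1 L" using on Zp by simp
    have "count Z p1 = 2" by (simp add: Zp True)
    then have "[:0, 1:] ^ 4 dvd pullback_to_line f ?u ?w" using dv[OF p1] by simp
    then obtain r where r: "pullback_to_line f ?u ?w = [:0, 1:] ^ 4 * r" by (auto elim: dvdE)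
    have c: "\<Phi> ?u ?u ?u ?u = 0" "\<Phi> ?u ?u ?u ?w = 0" "\<Phi> ?u ?u ?w ?w = 0" "\<Phi> ?u ?w ?w ?w = 0"
      using arg_cong[OF r, of "\<lambda>P. coeff P 0"] arg_cong[OF r, of "\<lambda>P. coeff P 1"] arg_cong[OF r, of "\<lambda>P. coeff P 2"] arg_cong[OF r, of "\<lambda>P. coeff P 3"]
      by (simp_all add: pullback_coeffs power4_eq_xxxx eval_nat_numeral)
    have "square_on \<Phi> ?u ?w (0, 0, csqrt (\<Phi> ?w ?w ?w ?w))"
      unfolding square_on_def quartic_on_line c by (simp add: binary_quadratic_def power_mult_distrib flip: power_mult)
    moreover have "indep2 ?u ?w" using indep2_of_distinct_points oth(2)[OF p1] by metis
    ultimately show ?thesis using k[OF p1] k[OF oth(1)[OF p1]] unfolding bitangent_line_def by blast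
  qed
qed

end

lemma (in smooth_quartic) square_on_line_nonzero:
  assumes uv: "indep2 u v" "linear_form l u = 0" "linear_form l v = 0" "l \<noteq> 0" and q: "square_on \<Phi> u v q"
  shows "q \<noteq> 0"
proof -
  obtain k where "linear_form l (axis k 1) \<noteq> 0" using uv(4) by (auto simp: vec_eq_iff linear_form_axis)
  from square_on_nonzero[OF basis3_of_kernel[OF uv(1-3) this] q] show ?thesis .
qed

locale smooth_ternary_quartic = ternary_quartic \<Phi> f + smooth_quartic \<Phi> for \<Phi> f
begin

lemma bitangent_iff: "bitangent f L \<longleftrightarrow> bitangent_line \<Phi> L"
proof
  assume "bitangent_line \<Phi> L"
  then obtain u v q where uv: "indep2 u v" "linear_form (homvec L) u = 0" "linear_form (homvec L) v = 0" and q: "square_on \<Phi> u v q"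
    unfolding bitangent_line_def by blast
  obtain \<alpha> \<beta> \<gamma> \<delta> where fac: "\<And>x y. binary_quadratic q x y = (\<alpha> * x + \<beta> * y) * (\<gamma> * x + \<delta> * y)"
    using binary_quadratic_factor[of q] by blast
  have "q \<noteq> 0" by (rule square_on_line_nonzero[OF uv homvec(1) q])
  then have "\<not> (\<forall>x y. binary_quadratic q x y = 0)" using binary_quadratic_mult_zero[of q q] by auto
  then have nz: "(\<alpha>, \<beta>) \<noteq> (0, 0)" "(\<gamma>, \<delta>) \<noteq> (0, 0)" by (auto simp: fac)
  show "bitangent f L" unfolding bitangent_def
    using tangency_divisor_of_square[OF uv _ nz] q unfolding square_on_def fac by blast
qed (rule bitangent_imp_bitangent_line)

end

section \<open>Winding of periodic functions\<close>

definition nonzero_loop :: "(real \<Rightarrow> complex) \<Rightarrow> bool" where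
  "nonzero_loop \<phi> \<longleftrightarrow> continuous_on UNIV \<phi> \<and> (\<forall>\<theta>. \<phi> (\<theta> + 2 * pi) = \<phi> \<theta>) \<and> (\<forall>\<theta>. \<phi> \<theta> \<noteq> 0)"

text \<open>The number of turns of a periodic function around \<open>0\<close>. The values are complex numbers because those of \<open>winding_number\<close> are.\<close>

definition turns :: "(real \<Rightarrow> complex) \<Rightarrow> complex" where
  "turns \<phi> = winding_number (\<lambda>t. \<phi> (2 * pi * t)) 0"

lemma nonzero_loop_path:
  assumes "nonzero_loop \<phi>"
  shows "path (\<lambda>t. \<phi> (2 * pi * t))" "0 \<notin> path_image (\<lambda>t. \<phi> (2 * pi * t))"
    "pathfinish (\<lambda>t. \<phi> (2 * pi * t)) = pathstart (\<lambda>t. \<phi> (2 * pi * t))"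
proof -
  have c: "continuous_on UNIV \<phi>" and p: "\<phi> (0 + 2 * pi) = \<phi> 0" and n: "\<And>\<theta>. \<phi> \<theta> \<noteq> 0"
    using assms unfolding nonzero_loop_def by blast+
  have "continuous_on {0..1} (\<phi> \<circ> (\<lambda>t. 2 * pi * t))"
    by (intro continuous_on_compose continuous_on_subset[OF c] continuous_intros) auto
  then show "path (\<lambda>t. \<phi> (2 * pi * t))" by (simp add: path_def o_def)
  show "0 \<notin> path_image (\<lambda>t. \<phi> (2 * pi * t))" using n unfolding path_image_def by (metis (no_types, lifting) imageE)
  show "pathfinish (\<lambda>t. \<phi> (2 * pi * t)) = pathstart (\<lambda>t. \<phi> (2 * pi * t))"
    using p by (simp add: pathfinish_def pathstart_def)
qed

lemma turns_log:
  assumes "nonzero_loop \<phi>"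
  obtains q where "path q" "pathfinish q - pathstart q = 2 * of_real pi * \<i> * turns \<phi>" "\<And>t. t \<in> {0..1} \<Longrightarrow> \<phi> (2 * pi * t) = exp (q t)"
  using winding_number_as_continuous_log[OF nonzero_loop_path(1,2)[OF assms]] unfolding turns_def by (metis add_0)

lemma turns_of_log:
  assumes "path q" "\<And>t. t \<in> {0..1} \<Longrightarrow> \<phi> (2 * pi * t) = exp (q t)"
  shows "turns \<phi> = (pathfinish q - pathstart q) / (2 * of_real pi * \<i>)"
proof -
  have "turns \<phi> = winding_number (exp \<circ> q) 0" unfolding turns_def
    by (rule winding_number_cong) (use assms(2) in simp)
  then show ?thesis using winding_number_compose_exp[OF assms(1)] by simp
qed

lemma nonzero_loop_mult: "nonzero_loop \<phi> \<Longrightarrow> nonzero_loop \<psi> \<Longrightarrow> nonzero_loop (\<lambda>\<theta>. \<phi> \<theta> * \<psi> \<theta>)"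
  by (auto simp: nonzero_loop_def intro!: continuous_intros)

lemma nonzero_loop_inverse: "nonzero_loop \<phi> \<Longrightarrow> nonzero_loop (\<lambda>\<theta>. inverse (\<phi> \<theta>))"
  by (auto simp: nonzero_loop_def intro!: continuous_intros)

lemma nonzero_loop_const: "c \<noteq> 0 \<Longrightarrow> nonzero_loop (\<lambda>_. c)"
  by (simp add: nonzero_loop_def)

lemma nonzero_loop_power: "nonzero_loop \<phi> \<Longrightarrow> nonzero_loop (\<lambda>\<theta>. \<phi> \<theta> ^ n)"
  by (auto simp: nonzero_loop_def intro!: continuous_intros)

lemma turns_mult:
  assumes "nonzero_loop \<phi>" "nonzero_loop \<psi>"
  shows "turns (\<lambda>\<theta>. \<phi> \<theta> * \<psi> \<theta>) = turns \<phi> + turns \<psi>"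
proof -
  obtain p where p: "path p" "pathfinish p - pathstart p = 2 * of_real pi * \<i> * turns \<phi>" "\<And>t. t \<in> {0..1} \<Longrightarrow> \<phi> (2 * pi * t) = exp (p t)"
    using turns_log[OF assms(1)] by blast
  obtain q where q: "path q" "pathfinish q - pathstart q = 2 * of_real pi * \<i> * turns \<psi>" "\<And>t. t \<in> {0..1} \<Longrightarrow> \<psi> (2 * pi * t) = exp (q t)"
    using turns_log[OF assms(2)] by blast
  have "turns (\<lambda>\<theta>. \<phi> \<theta> * \<psi> \<theta>) = (pathfinish (\<lambda>t. p t + q t) - pathstart (\<lambda>t. p t + q t)) / (2 * of_real pi * \<i>)"
    by (rule turns_of_log) (use p q in \<open>auto simp: path_def exp_add intro!: continuous_on_add\<close>)
  also have "\<dots> = ((pathfinish p - pathstart p) + (pathfinish q - pathstart q)) / (2 * of_real pi * \<i>)"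
    by (simp add: pathfinish_def pathstart_def)
  also have "\<dots> = turns \<phi> + turns \<psi>" unfolding p(2) q(2) by (simp add: field_simps)
  finally show ?thesis .
qed

lemma turns_const: "c \<noteq> 0 \<Longrightarrow> turns (\<lambda>_. c) = 0"
  using turns_of_log[of "\<lambda>_. Ln c" "\<lambda>_. c"] by (simp add: path_def pathfinish_def pathstart_def)

lemma turns_inverse:
  assumes "nonzero_loop \<phi>" shows "turns (\<lambda>\<theta>. inverse (\<phi> \<theta>)) = - turns \<phi>"
proof -
  have "(\<lambda>\<theta>. \<phi> \<theta> * inverse (\<phi> \<theta>)) = (\<lambda>_. 1)" using assms by (auto simp: nonzero_loop_def)
  then have "turns \<phi> + turns (\<lambda>\<theta>. inverse (\<phi> \<theta>)) = 0"
    using turns_mult[OF assms nonzero_loop_inverse[OF assms]] turns_const[of 1] by simp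
  then show ?thesis by (simp add: add_eq_0_iff)
qed

lemma turns_power:
  assumes "nonzero_loop \<phi>" shows "turns (\<lambda>\<theta>. \<phi> \<theta> ^ n) = of_nat n * turns \<phi>"
proof (induction n)
  case (Suc n)
  then show ?case using turns_mult[OF assms nonzero_loop_power[OF assms, of n]] by (simp add: algebra_simps)
qed (simp add: turns_const)

lemma turns_cnj:
  assumes "nonzero_loop \<phi>" shows "turns (\<lambda>\<theta>. cnj (\<phi> \<theta>)) = - turns \<phi>"
proof -
  obtain p where p: "path p" "pathfinish p - pathstart p = 2 * of_real pi * \<i> * turns \<phi>" "\<And>t. t \<in> {0..1} \<Longrightarrow> \<phi> (2 * pi * t) = exp (p t)"
    using turns_log[OF assms] by blast
  have "turns (\<lambda>\<theta>. cnj (\<phi> \<theta>)) = (pathfinish (\<lambda>t. cnj (p t)) - pathstart (\<lambda>t. cnj (p t))) / (2 * of_real pi * \<i>)"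
    by (rule turns_of_log) (use p in \<open>auto simp: path_def exp_cnj intro!: continuous_intros\<close>)
  also have "\<dots> = cnj (pathfinish p - pathstart p) / (2 * of_real pi * \<i>)"
    by (simp add: pathfinish_def pathstart_def)
  also have "\<dots> = - cnj (turns \<phi>)" unfolding p(2) by (simp add: field_simps)
  also have "turns \<phi> \<in> \<int>" unfolding turns_def by (intro integer_winding_number nonzero_loop_path assms)
  then have "cnj (turns \<phi>) = turns \<phi>" by (auto elim!: Ints_cases)
  finally show ?thesis .
qed

lemma nonzero_loop_cnj: "nonzero_loop \<phi> \<Longrightarrow> nonzero_loop (\<lambda>\<theta>. cnj (\<phi> \<theta>))"
  by (auto simp: nonzero_loop_def intro!: continuous_intros)

lemma turns_homotopy:
  assumes c: "continuous_on (UNIV \<times> {0..1}) (\<lambda>(\<theta>, s). H \<theta> s)"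
    and p: "\<And>\<theta> s. s \<in> {0..1} \<Longrightarrow> H (\<theta> + 2 * pi) s = H \<theta> s" and n: "\<And>\<theta> s. s \<in> {0..1} \<Longrightarrow> H \<theta> s \<noteq> (0::complex)"
  shows "turns (\<lambda>\<theta>. H \<theta> (0::real)) = turns (\<lambda>\<theta>. H \<theta> 1)"
  unfolding turns_def
proof (rule winding_number_homotopic_loops)
  have "continuous_on ({0..1} \<times> {0..1}) ((\<lambda>(\<theta>, s). H \<theta> s) \<circ> (\<lambda>(s, t). (2 * pi * t, s)))"
    unfolding case_prod_beta
    by (intro continuous_on_compose continuous_on_subset[OF c[unfolded case_prod_beta]] continuous_intros) auto
  then have cc: "continuous_on ({0..1} \<times> {0..1}) (\<lambda>(s, t). H (2 * pi * t) s)" by (simp add: o_def case_prod_beta)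
  show "homotopic_loops (- {0}) (\<lambda>t. H (2 * pi * t) 0) (\<lambda>t. H (2 * pi * t) 1)"
    unfolding homotopic_loops
  proof (intro exI[of _ "\<lambda>(s, t). H (2 * pi * t) s"] conjI cc)
    show "\<forall>t\<in>{0..1}. pathfinish ((\<lambda>(s, t). H (2 * pi * t) s) \<circ> Pair t) = pathstart ((\<lambda>(s, t). H (2 * pi * t) s) \<circ> Pair t)"
      using p[of _ 0] by (auto simp: pathfinish_def pathstart_def)
  qed (use n in auto)
qed

text \<open>Rouche's principle: the straight homotopy avoids \<open>0\<close>.\<close>

lemma turns_segment:
  assumes "nonzero_loop \<phi>" "nonzero_loop \<psi>" "\<And>\<theta> s. 0 \<le> s \<Longrightarrow> s \<le> 1 \<Longrightarrow> of_real (1 - s) * \<phi> \<theta> + of_real s * \<psi> \<theta> \<noteq> 0"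
  shows "turns \<phi> = turns \<psi>"
proof -
  have c: "continuous_on (UNIV \<times> {0..1}) (\<lambda>z. \<phi> (fst z))" "continuous_on (UNIV \<times> {0..1::real}) (\<lambda>z. \<psi> (fst z))"
    using assms(1,2) unfolding nonzero_loop_def
    by (auto intro!: continuous_on_compose2[of UNIV _ _ fst] continuous_on_fst continuous_on_id)
  have "turns (\<lambda>\<theta>. of_real (1 - 0) * \<phi> \<theta> + of_real 0 * \<psi> \<theta>) = turns (\<lambda>\<theta>. of_real (1 - 1) * \<phi> \<theta> + of_real 1 * \<psi> \<theta>)"
  proof (rule turns_homotopy[of "\<lambda>\<theta> s. of_real (1 - s) * \<phi> \<theta> + of_real s * \<psi> \<theta>"])
    show "continuous_on (UNIV \<times> {0..1}) (\<lambda>(\<theta>, s). of_real (1 - s) * \<phi> \<theta> + of_real s * \<psi> \<theta>)"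
      unfolding case_prod_beta by (intro continuous_intros c)
  qed (use assms in \<open>auto simp: nonzero_loop_def\<close>)
  then show ?thesis by simp
qed

lemma turns_shift:
  assumes "nonzero_loop \<phi>" shows "turns (\<lambda>\<theta>. \<phi> (\<theta> + a)) = turns \<phi>"
proof -
  have c: "continuous_on UNIV \<phi>" using assms by (simp add: nonzero_loop_def)
  have "turns (\<lambda>\<theta>. \<phi> (\<theta> + 0 * a)) = turns (\<lambda>\<theta>. \<phi> (\<theta> + 1 * a))"
  proof (rule turns_homotopy[of "\<lambda>\<theta> s. \<phi> (\<theta> + s * a)"])
    show "continuous_on (UNIV \<times> {0..1}) (\<lambda>(\<theta>, s). \<phi> (\<theta> + s * a))"
      unfolding case_prod_beta by (intro continuous_on_compose2[OF c] continuous_intros) auto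
    show "\<phi> (\<theta> + 2 * pi + s * a) = \<phi> (\<theta> + s * a)" for \<theta> s
      using assms unfolding nonzero_loop_def by (metis (no_types, opaque_lifting) add.assoc add.commute)
  qed (use assms in \<open>auto simp: nonzero_loop_def\<close>)
  then show ?thesis by simp
qed

lemma nonzero_loop_shift:
  assumes "nonzero_loop \<phi>" shows "nonzero_loop (\<lambda>\<theta>. \<phi> (\<theta> + a))"
  unfolding nonzero_loop_def
proof (intro conjI allI)
  have c: "continuous_on UNIV \<phi>" and p: "\<And>\<theta>. \<phi> (\<theta> + 2 * pi) = \<phi> \<theta>" using assms by (auto simp: nonzero_loop_def)
  show "continuous_on UNIV (\<lambda>\<theta>. \<phi> (\<theta> + a))" by (intro continuous_on_compose2[OF c] continuous_intros) auto
  show "\<phi> (\<theta> + 2 * pi + a) = \<phi> (\<theta> + a)" for \<theta> using p[of "\<theta> + a"] by (simp add: algebra_simps)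
  show "\<phi> (\<theta> + a) \<noteq> 0" for \<theta> using assms by (simp add: nonzero_loop_def)
qed

lemma nonzero_loop_cis: "c \<noteq> 0 \<Longrightarrow> nonzero_loop (\<lambda>\<theta>. c * cis \<theta>)"
  by (auto simp: nonzero_loop_def cis_mult[symmetric] intro!: continuous_intros)

lemma turns_cis: "turns cis = 1"
  using turns_of_log[of "\<lambda>t. \<i> * of_real (2 * pi * t)" cis]
  by (simp add: path_def pathfinish_def pathstart_def cis_conv_exp continuous_intros)

section \<open>Degree of a planar map on an annulus\<close>

text \<open>A zero at which the map looks like \<open>\<alpha> (w - z)\<close> (index \<open>1\<close>) or \<open>\<alpha> cnj (w - z)\<close> (index \<open>-1\<close>), up to a relative error \<open>\<kappa> < 1\<close>.
  With this tolerance one model for each index is enough: any invertible real derivative \<open>h \<mapsto> A h + C cnj h\<close> is dominated by one of its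
  two terms.\<close>

definition local_factor :: "int \<Rightarrow> complex \<Rightarrow> complex" where
  "local_factor s h = (if s = 1 then h else cnj h)"

definition simple_zero :: "(complex \<Rightarrow> complex) \<Rightarrow> complex \<Rightarrow> int \<Rightarrow> bool" where
  "simple_zero G z s \<longleftrightarrow> (\<exists>\<alpha> \<kappa>. \<alpha> \<noteq> 0 \<and> \<kappa> < 1 \<and> 
      (\<forall>\<^sub>F w in at z. norm (G w - \<alpha> * local_factor s (w - z)) \<le> \<kappa> * norm \<alpha> * norm (w - z)))"

lemma norm_local_factor [simp]: "norm (local_factor s h) = norm h"
  by (simp add: local_factor_def)

lemma local_factor_eq_0 [simp]: "local_factor s h = 0 \<longleftrightarrow> h = 0"
  by (simp add: local_factor_def)

lemma simple_zero_divide: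
  assumes z: "simple_zero G z s" and m: "isCont m z" "m z \<noteq> 0"
    and H: "\<forall>\<^sub>F w in at z. H w = G w / m w"
  shows "simple_zero H z s"
proof -
  obtain \<alpha> \<kappa> where a: "\<alpha> \<noteq> 0" "\<kappa> < 1" and e: "\<forall>\<^sub>F w in at z. norm (G w - \<alpha> * local_factor s (w - z)) \<le> \<kappa> * norm \<alpha> * norm (w - z)"
    using z unfolding simple_zero_def by blast
  define \<kappa>' where "\<kappa>' = (1 + \<kappa>) / 2"
  have lim: "(m \<longlongrightarrow> m z) (at z)" using m(1) by (simp add: isCont_def)
  have "((\<lambda>w. \<kappa> * norm (m z / m w) + norm (m z / m w - 1)) \<longlongrightarrow> \<kappa> * norm (m z / m z) + norm (m z / m z - 1)) (at z)"
    by (intro tendsto_intros lim m(2))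
  moreover have "\<kappa> * norm (m z / m z) + norm (m z / m z - 1) < \<kappa>'" using m(2) a(2) by (simp add: \<kappa>'_def)
  ultimately have e2: "\<forall>\<^sub>F w in at z. \<kappa> * norm (m z / m w) + norm (m z / m w - 1) < \<kappa>'"
    by (rule order_tendstoD(2))
  have e3: "\<forall>\<^sub>F w in at z. m w \<noteq> 0" by (rule tendsto_imp_eventually_ne[OF lim m(2)])
  have "\<forall>\<^sub>F w in at z. norm (H w - \<alpha> / m z * local_factor s (w - z)) \<le> \<kappa>' * norm (\<alpha> / m z) * norm (w - z)"
    using e e2 e3 H
  proof eventually_elim
    case (elim w)
    let ?h = "local_factor s (w - z)"
    have eq: "H w - \<alpha> / m z * ?h = (G w - \<alpha> * ?h) / m w + \<alpha> / m z * ?h * (m z / m w - 1)"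
      using elim(3,4) m(2) by (simp add: field_simps)
    have "norm (H w - \<alpha> / m z * ?h) \<le> norm (G w - \<alpha> * ?h) / norm (m w) + norm (\<alpha> / m z) * norm (w - z) * norm (m z / m w - 1)"
      unfolding eq by (rule order_trans[OF norm_triangle_ineq]) (simp add: norm_mult norm_divide)
    also have "\<dots> \<le> (\<kappa> * norm \<alpha> * norm (w - z)) / norm (m w) + norm (\<alpha> / m z) * norm (w - z) * norm (m z / m w - 1)"
      using elim(1) by (intro add_right_mono divide_right_mono) auto
    also have "\<dots> = (\<kappa> * norm (m z / m w) + norm (m z / m w - 1)) * (norm (\<alpha> / m z) * norm (w - z))"
      using m(2) elim(3) by (simp add: norm_divide field_simps)
    also have "\<dots> \<le> \<kappa>' * (norm (\<alpha> / m z) * norm (w - z))"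
      using elim(2) by (intro mult_right_mono) auto
    finally show ?case by (simp add: mult.assoc)
  qed
  then show ?thesis unfolding simple_zero_def using a m(2)
    by (intro exI[of _ "\<alpha> / m z"] exI[of _ \<kappa>'] conjI) (simp_all add: \<kappa>'_def)
qed

text \<open>The sign of the Jacobian determinant \<open>|A|\<^sup>2 - |C|\<^sup>2\<close> decides which of the two terms dominates.\<close>

lemma simple_zero_of_derivative:
  assumes D: "(G has_derivative (\<lambda>h. A * h + C * cnj h)) (at z)" and z: "G z = 0" and ne: "norm A \<noteq> norm C"
  shows "simple_zero G z (if norm C < norm A then 1 else -1)"
proof -
  define s where "s = (if norm C < norm A then 1 else -1 :: int)"
  define \<alpha> \<beta> where "\<alpha> = (if norm C < norm A then A else C)" and "\<beta> = (if norm C < norm A then C else A)"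
  have ab: "norm \<beta> < norm \<alpha>" using ne by (auto simp: \<alpha>_def \<beta>_def)
  define \<epsilon> where "\<epsilon> = (norm \<alpha> - norm \<beta>) / 2"
  have e: "\<epsilon> > 0" using ab by (simp add: \<epsilon>_def)
  have "\<forall>\<^sub>F w in at z. norm (G w - G z - (A * (w - z) + C * cnj (w - z))) \<le> \<epsilon> * norm (w - z)"
    using D e unfolding has_derivative_within_alt2 by simp
  then have "\<forall>\<^sub>F w in at z. norm (G w - \<alpha> * local_factor s (w - z)) \<le> ((norm \<beta> + \<epsilon>) / norm \<alpha>) * norm \<alpha> * norm (w - z)"
  proof eventually_elim
    case (elim w)
    define \<beta>h where "\<beta>h = (if norm C < norm A then C * cnj (w - z) else A * (w - z))"
    have "norm \<beta>h = norm \<beta> * norm (w - z)" by (simp add: \<beta>h_def \<beta>_def norm_mult flip: complex_cnj_diff)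
    have eq: "G w - \<alpha> * local_factor s (w - z) = (G w - G z - (A * (w - z) + C * cnj (w - z))) + \<beta>h"
      using z by (simp add: \<alpha>_def \<beta>h_def local_factor_def s_def)
    have "norm (G w - \<alpha> * local_factor s (w - z)) \<le> \<epsilon> * norm (w - z) + norm \<beta> * norm (w - z)"
      unfolding eq using norm_triangle_ineq[of "G w - G z - (A * (w - z) + C * cnj (w - z))" \<beta>h] elim \<open>norm \<beta>h = _\<close> by linarith
    moreover have "norm \<alpha> \<noteq> 0" using ab norm_ge_zero[of \<beta>] by linarith
    then have "(norm \<beta> + \<epsilon>) / norm \<alpha> * norm \<alpha> = norm \<beta> + \<epsilon>" by simp
    ultimately show ?case by (simp only:) (simp add: algebra_simps)
  qed
  moreover have "\<alpha> \<noteq> 0" using ab by auto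
  moreover have "(norm \<beta> + \<epsilon>) / norm \<alpha> < 1" using ab \<open>\<alpha> \<noteq> 0\<close> by (simp add: \<epsilon>_def field_simps)
  ultimately show ?thesis unfolding simple_zero_def s_def[symmetric] by blast
qed

text \<open>The point \<open>z\<close> can be moved to the center of the circle without meeting the circle.\<close>

lemma turns_circle_outside:
  assumes "norm z < b" "s = 1 \<or> s = -1" shows "nonzero_loop (\<lambda>\<theta>. local_factor s (of_real b * cis \<theta> - z))" "turns (\<lambda>\<theta>. local_factor s (of_real b * cis \<theta> - z)) = of_int s"
proof -
  have b: "b > 0" using assms norm_ge_zero[of z] by linarith
  have nz: "of_real b * cis \<theta> - of_real c * z \<noteq> 0" if "0 \<le> c" "c \<le> 1" for \<theta> c :: real
  proof
    assume "of_real b * cis \<theta> - of_real c * z = 0"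
    then have "of_real b * cis \<theta> = of_real c * z" by simp
    then have "norm (of_real b * cis \<theta>) = norm (of_real c * z)" by (simp only:)
    then have "b = c * norm z" using b that by (simp add: norm_mult)
    also have "\<dots> \<le> norm z" using that by (simp add: mult_left_le_one_le)
    finally show False using assms by simp
  qed
  have 1: "nonzero_loop (\<lambda>\<theta>. of_real b * cis \<theta> - z)"
    using nz[of 1] by (auto simp: nonzero_loop_def cis_mult[symmetric] intro!: continuous_intros)
  have 2: "nonzero_loop (\<lambda>\<theta>. of_real b * cis \<theta>)" using b by (intro nonzero_loop_cis) simp
  have "turns (\<lambda>\<theta>. of_real b * cis \<theta>) = turns (\<lambda>\<theta>. of_real b * cis \<theta> - z)"
  proof (rule turns_segment[OF 2 1])
    fix \<theta> s :: real assume "0 \<le> s" "s \<le> 1"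
    from nz[OF this, of \<theta>] show "of_real (1 - s) * (of_real b * cis \<theta>) + of_real s * (of_real b * cis \<theta> - z) \<noteq> 0"
      by (simp add: algebra_simps)
  qed
  moreover have "turns (\<lambda>\<theta>. of_real b * cis \<theta>) = 1"
    using turns_mult[OF nonzero_loop_const[of "of_real b"] nonzero_loop_cis[of 1]] b by (simp add: turns_const turns_cis)
  ultimately have t: "turns (\<lambda>\<theta>. of_real b * cis \<theta> - z) = 1" by simp
  show "nonzero_loop (\<lambda>\<theta>. local_factor s (of_real b * cis \<theta> - z))"
    unfolding local_factor_def using 1 nonzero_loop_cnj[OF 1] by (cases "s = 1") simp_all
  show "turns (\<lambda>\<theta>. local_factor s (of_real b * cis \<theta> - z)) = of_int s"
    unfolding local_factor_def using assms(2) t turns_cnj[OF 1] by auto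
qed

text \<open>The circle can be contracted to its center without meeting \<open>z\<close>.\<close>

lemma turns_circle_inside:
  assumes "a < norm z" "a > 0" "s = 1 \<or> s = -1" shows "nonzero_loop (\<lambda>\<theta>. local_factor s (of_real a * cis \<theta> - z))" "turns (\<lambda>\<theta>. local_factor s (of_real a * cis \<theta> - z)) = 0"
proof -
  have nz: "of_real c * (of_real a * cis \<theta>) - z \<noteq> 0" if "0 \<le> c" "c \<le> 1" for \<theta> c :: real
  proof
    assume "of_real c * (of_real a * cis \<theta>) - z = 0"
    then have "of_real c * (of_real a * cis \<theta>) = z" by simp
    then have "norm (of_real c * (of_real a * cis \<theta>)) = norm z" by (simp only:)
    then have "norm z = c * a" using that assms by (simp add: norm_mult)
    also have "\<dots> \<le> a" using that assms by (simp add: mult_left_le_one_le)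
    finally show False using assms by simp
  qed
  have 1: "nonzero_loop (\<lambda>\<theta>. of_real a * cis \<theta> - z)"
    using nz[of 1] by (auto simp: nonzero_loop_def cis_mult[symmetric] intro!: continuous_intros)
  have z: "- z \<noteq> 0" using assms by auto
  have 2: "nonzero_loop (\<lambda>\<theta>. - z)" by (rule nonzero_loop_const[OF z])
  have "turns (\<lambda>\<theta>. - z) = turns (\<lambda>\<theta>. of_real a * cis \<theta> - z)"
  proof (rule turns_segment[OF 2 1])
    fix \<theta> s :: real assume "0 \<le> s" "s \<le> 1"
    from nz[OF this, of \<theta>] show "of_real (1 - s) * (- z) + of_real s * (of_real a * cis \<theta> - z) \<noteq> 0"
      by (simp add: algebra_simps)
  qed
  then have t: "turns (\<lambda>\<theta>. of_real a * cis \<theta> - z) = 0" using turns_const[OF z] by simp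
  show "nonzero_loop (\<lambda>\<theta>. local_factor s (of_real a * cis \<theta> - z))"
    unfolding local_factor_def using 1 nonzero_loop_cnj[OF 1] by (cases "s = 1") simp_all
  show "turns (\<lambda>\<theta>. local_factor s (of_real a * cis \<theta> - z)) = 0"
    unfolding local_factor_def using assms(3) t turns_cnj[OF 1] by auto
qed

text \<open>The argument principle, by induction on the number of zeros. Without zeros the concentric circles give a homotopy. Otherwise
  one zero is removed by dividing through its local factor, which turns once on the outer circle and not at all on
  the inner one.\<close>

theorem annulus_degree:
  fixes G :: "complex \<Rightarrow> complex" and \<sigma> :: "complex \<Rightarrow> int"
  assumes ab: "0 < a" "a < b" and fin: "finite Z" and Z: "\<And>z. z \<in> Z \<Longrightarrow> a < norm z \<and> norm z < b"
    and c: "continuous_on {w. a \<le> norm w \<and> norm w \<le> b} G"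
    and zero: "\<And>w. a \<le> norm w \<Longrightarrow> norm w \<le> b \<Longrightarrow> G w = 0 \<longleftrightarrow> w \<in> Z"
    and s: "\<And>z. z \<in> Z \<Longrightarrow> (\<sigma> z = 1 \<or> \<sigma> z = -1) \<and> simple_zero G z (\<sigma> z)"
  shows "turns (\<lambda>\<theta>. G (of_real b * cis \<theta>)) - turns (\<lambda>\<theta>. G (of_real a * cis \<theta>)) = of_int (\<Sum>z\<in>Z. \<sigma> z)"
  using fin Z c zero s
proof (induction Z arbitrary: G rule: finite_induct)
  case empty
  have nz: "G (of_real r * cis \<theta>) \<noteq> 0" if "a \<le> r" "r \<le> b" for r \<theta>
    using empty.prems(3)[of "of_real r * cis \<theta>"] that ab by (simp add: norm_mult)
  have "turns (\<lambda>\<theta>. G (of_real (a + 0 * (b - a)) * cis \<theta>)) = turns (\<lambda>\<theta>. G (of_real (a + 1 * (b - a)) * cis \<theta>))"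
  proof (rule turns_homotopy[of "\<lambda>\<theta> s. G (of_real (a + s * (b - a)) * cis \<theta>)"])
    have r: "a \<le> a + s * (b - a) \<and> a + s * (b - a) \<le> b" if "s \<in> {0..1}" for s
    proof -
      have "s * (b - a) \<le> 1 * (b - a)" using that ab by (intro mult_right_mono) auto
      moreover have "0 \<le> s * (b - a)" using that ab by simp
      ultimately show ?thesis by (intro conjI; simp)
    qed
    show "continuous_on (UNIV \<times> {0..1}) (\<lambda>(\<theta>, s). G (of_real (a + s * (b - a)) * cis \<theta>))"
      unfolding case_prod_beta
    proof (rule continuous_on_compose2[OF empty.prems(2)])
      show "continuous_on (UNIV \<times> {0..1}) (\<lambda>z. complex_of_real (a + snd z * (b - a)) * cis (fst z))"
        by (intro continuous_intros)
      show "(\<lambda>z. complex_of_real (a + snd z * (b - a)) * cis (fst z)) ` (UNIV \<times> {0..1}) \<subseteq> {w. a \<le> norm w \<and> norm w \<le> b}"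
      proof clarify
        fix \<theta> s :: real assume s: "s \<in> {0..1}"
        have "norm (complex_of_real (a + s * (b - a)) * cis \<theta>) = a + s * (b - a)"
          using r[OF s] ab by (simp only: norm_mult norm_cis norm_of_real) simp
        then show "a \<le> norm (complex_of_real (a + snd (\<theta>, s) * (b - a)) * cis (fst (\<theta>, s))) \<and> norm (complex_of_real (a + snd (\<theta>, s) * (b - a)) * cis (fst (\<theta>, s))) \<le> b"
          using r[OF s] by simp
      qed
    qed
    show "G (of_real (a + s * (b - a)) * cis (\<theta> + 2 * pi)) = G (of_real (a + s * (b - a)) * cis \<theta>)" for \<theta> s
      by (simp add: cis_mult[symmetric])
    show "G (of_real (a + s * (b - a)) * cis \<theta>) \<noteq> 0" if "s \<in> {0..1}" for \<theta> s
      using r[OF that] by (intro nz) auto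
  qed
  then show ?case by simp
next
  case (insert z1 Z)
  note sz = insert.prems(4)
  let ?A = "{w :: complex. a \<le> norm w \<and> norm w \<le> b}"
  define s1 where "s1 = \<sigma> z1"
  have s1: "s1 = 1 \<or> s1 = -1" using sz[of z1] by (simp add: s1_def)
  have z1: "a < norm z1" "norm z1 < b" using insert.prems(1)[of z1] by auto
  obtain \<alpha> \<kappa> where a: "\<alpha> \<noteq> 0" "\<kappa> < 1" and e: "\<forall>\<^sub>F w in at z1. norm (G w - \<alpha> * local_factor s1 (w - z1)) \<le> \<kappa> * norm \<alpha> * norm (w - z1)"
    using sz[of z1] unfolding simple_zero_def s1_def by auto
  obtain \<epsilon>0 where e0: "\<epsilon>0 > 0" "\<And>w. w \<noteq> z1 \<Longrightarrow> dist w z1 < \<epsilon>0 \<Longrightarrow> norm (G w - \<alpha> * local_factor s1 (w - z1)) \<le> \<kappa> * norm \<alpha> * norm (w - z1)"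
    using e unfolding eventually_at by auto
  obtain \<delta> where d0: "\<delta> > 0" "\<forall>z\<in>Z. z \<noteq> z1 \<longrightarrow> \<delta> \<le> dist z1 z"
    using finite_set_avoid[OF insert.hyps(1), of z1] by blast
  have d: "\<delta> > 0" "\<And>z. z \<in> Z \<Longrightarrow> \<delta> \<le> dist z1 z" using d0 insert.hyps(2) by auto
  define \<epsilon> where "\<epsilon> = Min {\<epsilon>0, \<delta> / 2, norm z1 - a, b - norm z1}"
  have ep: "\<epsilon> > 0" "\<epsilon> \<le> \<epsilon>0" "\<epsilon> \<le> \<delta> / 2" "\<epsilon> \<le> norm z1 - a" "\<epsilon> \<le> b - norm z1"
    subgoal using e0(1) d(1) z1 by (simp add: \<epsilon>_def)
    by (simp_all only: \<epsilon>_def) (rule Min_le; simp)+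
  \<comment> \<open>The quotient \<open>G / m\<close> need not have a limit at \<open>z1\<close>. Near \<open>z1\<close> it stays in a disc around \<open>\<alpha>\<close> that avoids \<open>0\<close>, and the
  cut-off function \<open>\<mu>\<close> contracts it to the center of the disc, which yields a continuous function without zeros there.\<close>
  define m where "m w = local_factor s1 (w - z1)" for w
  define \<mu> where "\<mu> w = min 1 (norm (w - z1) / \<epsilon>)" for w
  define H where "H w = \<alpha> + of_real (\<mu> w) * (G w / m w - \<alpha>)" for w
  have m0: "m w = 0 \<longleftrightarrow> w = z1" for w by (simp add: m_def)
  have far: "H w = G w / m w" if "norm (w - z1) \<ge> \<epsilon>" for w
    using that ep(1) by (simp add: H_def \<mu>_def)
  have near: "norm (G w / m w - \<alpha>) \<le> \<kappa> * norm \<alpha>" if "w \<noteq> z1" "norm (w - z1) < \<epsilon>" for w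
  proof -
    have "norm (G w - \<alpha> * m w) \<le> \<kappa> * norm \<alpha> * norm (m w)"
      using e0(2)[OF that(1)] that(2) ep(2) by (simp add: m_def dist_norm)
    moreover have "G w / m w - \<alpha> = (G w - \<alpha> * m w) / m w" using that(1) m0 by (simp add: field_simps)
    ultimately show ?thesis using that(1) m0 by (simp add: norm_divide field_simps)
  qed
  have chi: "0 \<le> \<mu> w" "\<mu> w \<le> 1" for w using ep(1) by (simp_all add: \<mu>_def)
  have near0: "norm (H w - \<alpha>) \<le> \<mu> w * (\<kappa> * norm \<alpha>)" if "norm (w - z1) < \<epsilon>" "w \<noteq> z1" for w
  proof -
    have "norm (H w - \<alpha>) = \<mu> w * norm (G w / m w - \<alpha>)" using chi[of w] by (simp add: H_def norm_mult)
    then show ?thesis using near[OF that(2,1)] chi(1)[of w] by (simp add: mult_left_mono)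
  qed
  have Hz1: "H z1 = \<alpha>" by (simp add: H_def \<mu>_def)
  have kpos: "0 \<le> \<kappa> * norm \<alpha>"
  proof -
    have "z1 + of_real (\<epsilon> / 2) \<noteq> z1" "norm (z1 + of_real (\<epsilon> / 2) - z1) < \<epsilon>" using ep(1) by simp_all
    from near[OF this] show ?thesis using norm_ge_zero order_trans by blast
  qed
  have Hzero: "H w = 0 \<longleftrightarrow> w \<in> Z" if w: "a \<le> norm w" "norm w \<le> b" for w
  proof (cases "norm (w - z1) < \<epsilon>")
    case True
    have "H w \<noteq> 0"
    proof (cases "w = z1")
      case True then show ?thesis using Hz1 a by simp
    next
      case False
      have "norm (H w - \<alpha>) \<le> \<kappa> * norm \<alpha>"
        using near0[OF True False] mult_right_mono[OF chi(2)[of w] kpos] by simp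
      also have "\<dots> < norm \<alpha>" using a by simp
      finally show ?thesis by auto
    qed
    moreover have "w \<notin> Z" using True d(2)[of w] ep(3) d(1) by (auto simp: dist_norm norm_minus_commute)
    ultimately show ?thesis by simp
  next
    case False
    then have "w \<noteq> z1" using ep(1) by auto
    then show ?thesis using far[of w] False insert.prems(3)[OF w] m0[of w] by simp
  qed
  have Hcont: "continuous_on ?A H"
    unfolding continuous_on_eq_continuous_within
  proof
    fix w assume w: "w \<in> ?A"
    show "continuous (at w within ?A) H"
    proof (cases "w = z1")
      case False
      have "continuous (at w within ?A) G" using insert.prems(2) w by (simp add: continuous_on_eq_continuous_within)
      moreover have "isCont m w" unfolding m_def local_factor_def by (cases "s1 = 1") (auto intro!: continuous_intros)
      then have "continuous (at w within ?A) m" by (rule continuous_at_imp_continuous_at_within)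
      moreover have "isCont \<mu> w" unfolding \<mu>_def using ep(1) by (auto intro!: continuous_intros)
      then have "continuous (at w within ?A) \<mu>" by (rule continuous_at_imp_continuous_at_within)
      ultimately show ?thesis unfolding H_def using False m0 by (auto intro!: continuous_intros)
    next
      case True
      have "((\<lambda>w. H w - \<alpha>) \<longlongrightarrow> 0) (at z1)"
      proof (rule Lim_null_comparison)
        have "\<forall>\<^sub>F w in at z1. w \<noteq> z1 \<and> norm (w - z1) < \<epsilon>"
          unfolding eventually_at by (rule exI[of _ \<epsilon>]) (use ep(1) in \<open>auto simp: dist_norm\<close>)
        then show "\<forall>\<^sub>F w in at z1. norm (H w - \<alpha>) \<le> \<mu> w * (\<kappa> * norm \<alpha>)"
          by eventually_elim (use near0 in auto)
        have "isCont \<mu> z1" unfolding \<mu>_def using ep(1) by (auto intro!: continuous_intros)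
        then have "(\<mu> \<longlongrightarrow> \<mu> z1) (at z1)" by (simp add: isCont_def)
        then have "((\<lambda>w. \<mu> w * (\<kappa> * norm \<alpha>)) \<longlongrightarrow> \<mu> z1 * (\<kappa> * norm \<alpha>)) (at z1)" by (intro tendsto_intros)
        then show "((\<lambda>w. \<mu> w * (\<kappa> * norm \<alpha>)) \<longlongrightarrow> 0) (at z1)" by (simp add: \<mu>_def)
      qed
      then have "(H \<longlongrightarrow> \<alpha>) (at z1)" using LIM_zero_iff by blast
      then have "isCont H z1" by (simp add: isCont_def Hz1)
      then show ?thesis unfolding True by (rule continuous_at_imp_continuous_at_within)
    qed
  qed
  have Hsimple: "simple_zero H z (\<sigma> z)" if "z \<in> Z" for z
  proof (rule simple_zero_divide)
    show "simple_zero G z (\<sigma> z)" using sz[of z] that by simp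
    show "isCont m z" unfolding m_def local_factor_def by (cases "s1 = 1") (auto intro!: continuous_intros)
    show "m z \<noteq> 0" using m0 insert.hyps(2) that by auto
    show "\<forall>\<^sub>F w in at z. H w = G w / m w"
      unfolding eventually_at
    proof (intro exI[of _ \<epsilon>] conjI ballI impI ep(1))
      fix w assume "w \<noteq> z \<and> dist w z < \<epsilon>"
      moreover have "dist z1 z \<le> dist z1 w + dist w z" by (rule dist_triangle)
      moreover have "2 * \<epsilon> \<le> dist z1 z" using d(2)[OF that] ep(3) by simp
      ultimately have "\<epsilon> \<le> dist z1 w" by linarith
      then show "H w = G w / m w" by (intro far) (simp add: dist_norm norm_minus_commute)
    qed
  qed
  have IH: "turns (\<lambda>\<theta>. H (of_real b * cis \<theta>)) - turns (\<lambda>\<theta>. H (of_real a * cis \<theta>)) = of_int (\<Sum>z\<in>Z. \<sigma> z)"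
    by (rule insert.IH) (use insert.prems(1) Hcont Hzero Hsimple sz in auto)
  have circ: "G (of_real r * cis \<theta>) = H (of_real r * cis \<theta>) * m (of_real r * cis \<theta>)"
    and Hl: "H (of_real r * cis \<theta>) \<noteq> 0" if "r = a \<or> r = b" for r \<theta>
  proof -
    let ?w = "of_real r * cis \<theta>"
    have nw: "norm ?w = r" using that ab by (auto simp: norm_mult)
    have "\<bar>norm ?w - norm z1\<bar> \<le> norm (?w - z1)" by (rule norm_triangle_ineq3)
    then have ge: "norm (?w - z1) \<ge> \<epsilon>" unfolding nw using that ep z1 by auto
    then have "m ?w \<noteq> 0" using ep(1) m0 by auto
    then show "G ?w = H ?w * m ?w" using far[OF ge] by simp
    have "?w \<notin> Z" using insert.prems(1)[of ?w] nw that by auto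
    then show "H ?w \<noteq> 0" using Hzero[of ?w] nw that ab by auto
  qed
  have Hloop: "nonzero_loop (\<lambda>\<theta>. H (of_real r * cis \<theta>))" if "r = a \<or> r = b" for r
    unfolding nonzero_loop_def
  proof (intro conjI allI Hl that)
    show "continuous_on UNIV (\<lambda>\<theta>. H (of_real r * cis \<theta>))"
      by (rule continuous_on_compose2[OF Hcont]) (use that ab in \<open>auto simp: norm_mult intro!: continuous_intros\<close>)
  qed (simp add: cis_mult[symmetric])
  have "turns (\<lambda>\<theta>. G (of_real b * cis \<theta>)) = turns (\<lambda>\<theta>. H (of_real b * cis \<theta>)) + of_int s1"
    unfolding circ[OF disjI2[OF refl]] m_def
    using turns_mult[OF Hloop turns_circle_outside(1)[OF z1(2) s1]] turns_circle_outside(2)[OF z1(2) s1] by simp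
  moreover have "turns (\<lambda>\<theta>. G (of_real a * cis \<theta>)) = turns (\<lambda>\<theta>. H (of_real a * cis \<theta>))"
    unfolding circ[OF disjI1[OF refl]] m_def
    using turns_mult[OF Hloop turns_circle_inside(1)[OF z1(1) ab(1) s1]] turns_circle_inside(2)[OF z1(1) ab(1) s1] by simp
  ultimately show ?case using IH insert.hyps by (simp add: s1_def)
qed

section \<open>The defect of a real quartic polynomial from being a square\<close>

text \<open>With \<open>p = a\<^sub>3 / 2\<close> and \<open>q = root_q a\<^sub>3 a\<^sub>2\<close>, the square of \<open>t\<^sup>2 + p t + q\<close> agrees with \<open>t\<^sup>4 + a\<^sub>3 t\<^sup>3 + a\<^sub>2 t\<^sup>2 + a\<^sub>1 t + a\<^sub>0\<close>
  up to a linear remainder \<open>G\<^sub>1 t + G\<^sub>0\<close>, which \<open>sqrt_defect\<close> encodes as the complex number \<open>G\<^sub>0 + \<i> G\<^sub>1\<close>.\<close>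

definition root_q :: "real \<Rightarrow> real \<Rightarrow> real" where "root_q a3 a2 = (a2 - (a3 / 2)\<^sup>2) / 2"

definition rem1 :: "real \<Rightarrow> real \<Rightarrow> real \<Rightarrow> real" where "rem1 a3 a2 a1 = a1 - a3 * root_q a3 a2"

definition rem0 :: "real \<Rightarrow> real \<Rightarrow> real \<Rightarrow> real" where "rem0 a3 a2 a0 = a0 - (root_q a3 a2)\<^sup>2"

definition sqrt_defect :: "real \<Rightarrow> real \<Rightarrow> real \<Rightarrow> real \<Rightarrow> complex" where
  "sqrt_defect a3 a2 a1 a0 = Complex (rem0 a3 a2 a0) (rem1 a3 a2 a1)"

lemma sqrt_defect_eq_0_iff:
  "sqrt_defect a3 a2 a1 a0 = 0 \<longleftrightarrow> a1 = a3 * root_q a3 a2 \<and> a0 = (root_q a3 a2)\<^sup>2"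
  by (auto simp: sqrt_defect_def rem0_def rem1_def complex_eq_iff)

lemma sqrt_defect_reflect: "sqrt_defect (- a3) a2 (- a1) a0 = cnj (sqrt_defect a3 a2 a1 a0)"
  by (simp add: sqrt_defect_def rem0_def rem1_def root_q_def complex_eq_iff)

lemma sqrt_defect_scale:
  "rem1 (r * a3) (r ^ 2 * a2) (r ^ 3 * a1) = r ^ 3 * rem1 a3 a2 a1"
  "rem0 (r * a3) (r ^ 2 * a2) (r ^ 4 * a0) = r ^ 4 * rem0 a3 a2 a0"
proof -
  have q: "root_q (r * a3) (r ^ 2 * a2) = r ^ 2 * root_q a3 a2"
    by (simp add: root_q_def power2_eq_square algebra_simps)
  show "rem1 (r * a3) (r ^ 2 * a2) (r ^ 3 * a1) = r ^ 3 * rem1 a3 a2 a1"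
    unfolding rem1_def q by (simp add: algebra_simps power2_eq_square power3_eq_cube)
  show "rem0 (r * a3) (r ^ 2 * a2) (r ^ 4 * a0) = r ^ 4 * rem0 a3 a2 a0"
    unfolding rem0_def q by (simp add: algebra_simps power2_eq_square power4_eq_xxxx)
qed

text \<open>The first order expansion of the defect along \<open>a + \<epsilon> b\<close>.\<close>

lemma sqrt_defect_perturb:
  fixes a3 a2 a1 a0 b3 b2 b1 b0 \<epsilon> :: real
  defines "q1 \<equiv> (b2 - a3 * b3 / 2 - \<epsilon> * (b3 / 2)\<^sup>2) / 2"
  shows "rem1 (a3 + \<epsilon> * b3) (a2 + \<epsilon> * b2) (a1 + \<epsilon> * b1) = rem1 a3 a2 a1 + \<epsilon> * (b1 - a3 * q1 - b3 * root_q a3 a2 - \<epsilon> * b3 * q1)"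
    and "rem0 (a3 + \<epsilon> * b3) (a2 + \<epsilon> * b2) (a0 + \<epsilon> * b0) = rem0 a3 a2 a0 + \<epsilon> * (b0 - 2 * root_q a3 a2 * q1 - \<epsilon> * q1\<^sup>2)"
proof -
  have q: "root_q (a3 + \<epsilon> * b3) (a2 + \<epsilon> * b2) = root_q a3 a2 + \<epsilon> * q1"
    by (simp add: root_q_def q1_def power2_eq_square algebra_simps add_divide_distrib diff_divide_distrib)
  show "rem1 (a3 + \<epsilon> * b3) (a2 + \<epsilon> * b2) (a1 + \<epsilon> * b1) = rem1 a3 a2 a1 + \<epsilon> * (b1 - a3 * q1 - b3 * root_q a3 a2 - \<epsilon> * b3 * q1)"
    by (simp add: rem1_def q algebra_simps)
  show "rem0 (a3 + \<epsilon> * b3) (a2 + \<epsilon> * b2) (a0 + \<epsilon> * b0) = rem0 a3 a2 a0 + \<epsilon> * (b0 - 2 * root_q a3 a2 * q1 - \<epsilon> * q1\<^sup>2)"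
    by (simp add: rem0_def q algebra_simps power2_eq_square)
qed

lemma square_on_iff_sqrt_defect:
  assumes c: "c4 \<noteq> (0::real)"
    and F: "\<And>x y :: complex. H x y = of_real c4 * x ^ 4 + of_real c3 * x ^ 3 * y + of_real c2 * x\<^sup>2 * y\<^sup>2 + of_real c1 * x * y ^ 3 + of_real c0 * y ^ 4"
  shows "(\<exists>q. \<forall>x y. H x y = binary_quadratic q x y ^ 2) \<longleftrightarrow> sqrt_defect (c3 / c4) (c2 / c4) (c1 / c4) (c0 / c4) = 0"
proof
  assume "\<exists>q. \<forall>x y. H x y = binary_quadratic q x y ^ 2"
  then obtain p q r where "\<And>x y. H x y = binary_quadratic (p, q, r) x y ^ 2" by (metis surj_pair)
  then have "of_real c4 * x ^ 4 + of_real c3 * x ^ 3 * y + of_real c2 * x\<^sup>2 * y\<^sup>2 + of_real c1 * x * y ^ 3 + of_real c0 * y ^ 4 = binary_quadratic (p, q, r) x y ^ 2" for x y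
    using F by metis
  note e = square_coefficients[OF this]
  have p: "p \<noteq> 0" using e(1) c by auto
  have d: "complex_of_real (c3 / c4) = 2 * q / p" "complex_of_real (c2 / c4) = (q\<^sup>2 + 2 * p * r) / p\<^sup>2"
     "complex_of_real (c1 / c4) = 2 * q * r / p\<^sup>2" "complex_of_real (c0 / c4) = r\<^sup>2 / p\<^sup>2"
    using p by (simp_all add: e power2_eq_square)
  have rq: "complex_of_real (root_q (c3 / c4) (c2 / c4)) = r / p"
  proof -
    have "complex_of_real (root_q (c3 / c4) (c2 / c4)) = (complex_of_real (c2 / c4) - (complex_of_real (c3 / c4) / 2)\<^sup>2) / 2"
      by (simp add: root_q_def)
    also have "\<dots> = r / p" unfolding d using p by (simp add: field_simps power2_eq_square)
    finally show ?thesis .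
  qed
  have "complex_of_real (c1 / c4) = complex_of_real (c3 / c4) * complex_of_real (root_q (c3 / c4) (c2 / c4))"
    unfolding d rq using p by (simp add: field_simps power2_eq_square)
  moreover have "complex_of_real (c0 / c4) = (complex_of_real (root_q (c3 / c4) (c2 / c4)))\<^sup>2"
    unfolding d rq using p by (simp add: field_simps power2_eq_square)
  ultimately show "sqrt_defect (c3 / c4) (c2 / c4) (c1 / c4) (c0 / c4) = 0"
    unfolding sqrt_defect_eq_0_iff by (metis of_real_eq_iff of_real_mult of_real_power)
next
  assume "sqrt_defect (c3 / c4) (c2 / c4) (c1 / c4) (c0 / c4) = 0"
  then have e: "c1 / c4 = c3 / c4 * root_q (c3 / c4) (c2 / c4)" "c0 / c4 = (root_q (c3 / c4) (c2 / c4))\<^sup>2"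
    unfolding sqrt_defect_eq_0_iff by auto
  define p q s where "p = c3 / c4 / 2" and "q = root_q (c3 / c4) (c2 / c4)" and "s = csqrt (of_real c4)"
  have s: "s\<^sup>2 = of_real c4" by (simp add: s_def)
  have c3: "c3 = 2 * p * c4" "c2 = (p\<^sup>2 + 2 * q) * c4" "c1 = 2 * p * q * c4" "c0 = q\<^sup>2 * c4"
  proof -
    show "c3 = 2 * p * c4" using c by (simp add: p_def)
    have "2 * q = c2 / c4 - p\<^sup>2" by (simp add: p_def q_def root_q_def)
    then have "c2 / c4 = p\<^sup>2 + 2 * q" by simp
    then show "c2 = (p\<^sup>2 + 2 * q) * c4" using c by (simp add: field_simps)
    have "c1 / c4 = 2 * p * q" using e(1) by (simp add: p_def q_def)
    then show "c1 = 2 * p * q * c4" using c by (simp add: field_simps)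
    have "c0 / c4 = q\<^sup>2" using e(2) by (simp add: q_def)
    then show "c0 = q\<^sup>2 * c4" using c by (simp add: field_simps)
  qed
  have "H x y = binary_quadratic (s, s * of_real p, s * of_real q) x y ^ 2" for x y
  proof -
    have "binary_quadratic (s, s * of_real p, s * of_real q) x y ^ 2 = s\<^sup>2 * (x\<^sup>2 + of_real p * x * y + of_real q * y\<^sup>2)\<^sup>2"
      by (simp add: binary_quadratic_def power2_eq_square algebra_simps)
    also have "\<dots> = H x y" unfolding F c3 s
      by (simp add: power2_eq_square power3_eq_cube power4_eq_xxxx algebra_simps)
    finally show ?thesis by simp
  qed
  then show "\<exists>q. \<forall>x y. H x y = binary_quadratic q x y ^ 2" by blast
qed

text \<open>The defect of the monic quartic with the roots \<open>x\<^sub>0 \<plusminus> \<i> y\<^sub>0\<close> and \<open>x\<^sub>1 \<plusminus> \<i> y\<^sub>1\<close>.\<close>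

lemma rem_of_roots:
  fixes x0 y0 x1 y1 :: real
  defines "a3 \<equiv> - 2 * (x0 + x1)" and "a2 \<equiv> x0\<^sup>2 + y0\<^sup>2 + x1\<^sup>2 + y1\<^sup>2 + 4 * x0 * x1"
    and "a1 \<equiv> - 2 * (x0 * (x1\<^sup>2 + y1\<^sup>2) + x1 * (x0\<^sup>2 + y0\<^sup>2))" and "a0 \<equiv> (x0\<^sup>2 + y0\<^sup>2) * (x1\<^sup>2 + y1\<^sup>2)"
    and "x \<equiv> (x0 - x1) / 2" and "e \<equiv> y0 - y1" and "s \<equiv> y0 + y1"
  shows "rem1 a3 a2 a1 = 2 * x * e * s"
    and "rem0 a3 a2 a0 + rem1 a3 a2 a1 * (x0 + x1) / 2 = x\<^sup>2 * s\<^sup>2 - s\<^sup>2 * e\<^sup>2 / 4 + x\<^sup>2 * e\<^sup>2"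
proof -
  show 1: "rem1 a3 a2 a1 = 2 * x * e * s"
    unfolding rem1_def root_q_def assms by (simp add: power2_eq_square field_simps)
  have "4 * (rem0 a3 a2 a0 + (2 * x * e * s) * (x0 + x1) / 2) = 4 * (x\<^sup>2 * s\<^sup>2 - s\<^sup>2 * e\<^sup>2 / 4 + x\<^sup>2 * e\<^sup>2)"
    unfolding rem0_def root_q_def assms by (simp add: power2_eq_square field_simps)
  then show "rem0 a3 a2 a0 + rem1 a3 a2 a1 * (x0 + x1) / 2 = x\<^sup>2 * s\<^sup>2 - s\<^sup>2 * e\<^sup>2 / 4 + x\<^sup>2 * e\<^sup>2"
    unfolding 1 by simp
qed

text \<open>For two distinct roots in the upper half plane, the defect can be deformed linearly to the square of their difference without
  passing through \<open>0\<close>: the imaginary parts of the defect and of the square have the same sign, and where they vanish, the real parts are not zero and have the same sign.\<close>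

lemma sqrt_defect_roots_segment:
  fixes x0 y0 x1 y1 t :: real
  assumes y: "y0 > 0" "y1 > 0" and t: "0 \<le> t" "t \<le> 1" and ne: "Complex x0 y0 \<noteq> Complex x1 y1"
  shows "of_real (1 - t) * sqrt_defect (- 2 * (x0 + x1)) (x0\<^sup>2 + y0\<^sup>2 + x1\<^sup>2 + y1\<^sup>2 + 4 * x0 * x1)
      (- 2 * (x0 * (x1\<^sup>2 + y1\<^sup>2) + x1 * (x0\<^sup>2 + y0\<^sup>2))) ((x0\<^sup>2 + y0\<^sup>2) * (x1\<^sup>2 + y1\<^sup>2))
     + of_real t * (Complex x0 y0 - Complex x1 y1)\<^sup>2 \<noteq> 0" (is "of_real (1 - t) * ?D + _ \<noteq> 0")
proof
  define x e s where "x = (x0 - x1) / 2" and "e = y0 - y1" and "s = y0 + y1"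
  have s: "s > 0" using y by (simp add: s_def)
  note r = rem_of_roots[of x0 x1 y0 y1, folded x_def e_def s_def]
  assume z: "of_real (1 - t) * ?D + of_real t * (Complex x0 y0 - Complex x1 y1)\<^sup>2 = 0"
  have sq: "(Complex x0 y0 - Complex x1 y1)\<^sup>2 = Complex (4 * x\<^sup>2 - e\<^sup>2) (4 * x * e)"
    by (simp add: complex_eq_iff power2_eq_square x_def e_def field_simps)
  have im: "(1 - t) * (2 * x * e * s) + t * (4 * x * e) = 0" and re: "(1 - t) * Re ?D + t * (4 * x\<^sup>2 - e\<^sup>2) = 0"
    using arg_cong[OF z, of Im] arg_cong[OF z, of Re] unfolding sq sqrt_defect_def r(1) by simp_all
  have "x * e * (2 * (1 - t) * s + 4 * t) = 0" using im by (simp add: algebra_simps)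
  moreover have pos: "2 * (1 - t) * s + 4 * t > 0"
    using s t by (cases "t = 0") (auto intro!: add_nonneg_pos)
  ultimately have xe: "x = 0 \<or> e = 0" by auto
  have D: "Re ?D = x\<^sup>2 * s\<^sup>2 - s\<^sup>2 * e\<^sup>2 / 4 + x\<^sup>2 * e\<^sup>2"
    using r(2) xe unfolding r(1) sqrt_defect_def by auto
  have p2: "(1 - t) * s\<^sup>2 + 4 * t > 0"
    using s t by (cases "t = 0") (auto intro!: add_nonneg_pos)
  from xe have "x = 0 \<and> e = 0"
  proof
    assume x: "x = 0"
    have "e\<^sup>2 * ((1 - t) * s\<^sup>2 + 4 * t) = 0" using re unfolding D x by (simp add: field_simps)
    then show ?thesis using p2 x by simp
  next
    assume e: "e = 0"
    have "x\<^sup>2 * ((1 - t) * s\<^sup>2 + 4 * t) = 0" using re unfolding D e by (simp add: field_simps)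
    then show ?thesis using p2 e by simp
  qed
  then show False using ne by (simp add: x_def e_def)
qed

lemma sqrt_defect_double_root:
  "sqrt_defect (- 2 * (x0 + x0)) (x0\<^sup>2 + y0\<^sup>2 + x0\<^sup>2 + y0\<^sup>2 + 4 * x0 * x0)
      (- 2 * (x0 * (x0\<^sup>2 + y0\<^sup>2) + x0 * (x0\<^sup>2 + y0\<^sup>2))) ((x0\<^sup>2 + y0\<^sup>2) * (x0\<^sup>2 + y0\<^sup>2)) = 0"
  unfolding sqrt_defect_eq_0_iff root_q_def by (simp add: power2_eq_square field_simps)

text \<open>The derivative of the defect at a zero is the variation of the quartic reduced modulo \<open>t\<^sup>2 + p t + q\<close>. When the line moves by \<open>u\<close> in
  the normal direction and is rotated by the angle \<open>v\<close>, the variation is \<open>(u + v t) n(t)\<close> minus a multiple of the derivative of the square, where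
  \<open>n\<close> is the normal derivative of the quartic with coefficients \<open>n\<^sub>0, \<dots>, n\<^sub>3\<close>. Only the reduction \<open>N\<^sub>0 + N\<^sub>1 t\<close> of \<open>n\<close> remains.\<close>

lemma defect_derivative_algebra:
  fixes c p q r n0 n1 n2 n3 u v :: real
  assumes c: "c \<noteq> 0"
  defines "h3 \<equiv> 2 * p * c" and "h2 \<equiv> (p\<^sup>2 + 2 * q) * c" and "h1 \<equiv> 2 * p * q * c" and "h0 \<equiv> q\<^sup>2 * c"
  defines "d0 \<equiv> n0 * u - r * h1 * v" and "d1 \<equiv> n1 * u + n0 * v - 2 * r * h2 * v" and "d2 \<equiv> n2 * u + n1 * v - 3 * r * h3 * v"
    and "d3 \<equiv> n3 * u + n2 * v - 4 * r * c * v" and "d4 \<equiv> n3 * v"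
  defines "a3 \<equiv> (d3 - 2 * p * d4) / c" and "a2 \<equiv> (d2 - (p\<^sup>2 + 2 * q) * d4) / c" and "a1 \<equiv> (d1 - 2 * p * q * d4) / c" and "a0 \<equiv> (d0 - q\<^sup>2 * d4) / c"
  defines "dq \<equiv> (a2 - p * a3) / 2"
  defines "N1 \<equiv> n1 - p * n2 + (p\<^sup>2 - q) * n3" and "N0 \<equiv> n0 - q * n2 + p * q * n3"
  shows "a1 - a3 * q - 2 * p * dq = (N1 * u + (N0 - p * N1) * v) / c" and "a0 - 2 * q * dq = (N0 * u - q * N1 * v) / c"
  unfolding assms(2-) using c by (simp_all add: field_simps power2_eq_square)

section \<open>Real lines in the affine plane\<close>

abbreviation cv :: "real^3 \<Rightarrow> complex^3" where "cv \<equiv> map_vec3 complex_of_real"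

lemma cv_add: "cv (x + y) = cv x + cv y"
  by (simp add: map_vec3_def vec_eq_iff)
lemma cv_scale: "cv (c *s x) = of_real c *s cv x"
  by (simp add: map_vec3_def vec_eq_iff)
lemma cnj_cv: "map_vec3 cnj (cv x) = cv x"
  by (simp add: map_vec3_def vec_eq_iff)

lemma has_derivative_rem1:
  assumes "(f3 has_derivative f3') (at a)" "(f2 has_derivative f2') (at a)" "(f1 has_derivative f1') (at a)"
  shows "((\<lambda>x. rem1 (f3 x) (f2 x) (f1 x)) has_derivative
     (\<lambda>d. f1' d - f3' d * root_q (f3 a) (f2 a) - f3 a * ((f2' d - f3 a / 2 * f3' d) / 2))) (at a)"
  unfolding rem1_def root_q_def
  by (rule has_derivative_eq_rhs, (rule derivative_intros assms | simp)+) (simp add: fun_eq_iff field_simps power2_eq_square)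

lemma has_derivative_rem0:
  assumes "(f3 has_derivative f3') (at a)" "(f2 has_derivative f2') (at a)" "(f0 has_derivative f0') (at a)"
  shows "((\<lambda>x. rem0 (f3 x) (f2 x) (f0 x)) has_derivative
     (\<lambda>d. f0' d - 2 * root_q (f3 a) (f2 a) * ((f2' d - f3 a / 2 * f3' d) / 2))) (at a)"
  unfolding rem0_def root_q_def
  by (rule has_derivative_eq_rhs, (rule derivative_intros assms | simp)+) (simp add: fun_eq_iff field_simps power2_eq_square)

lemma has_derivative_quotient:
  fixes f g :: "'a::real_normed_vector \<Rightarrow> real"
  assumes "(f has_derivative f') (at a)" "(g has_derivative g') (at a)" "g a \<noteq> 0"
  shows "((\<lambda>x. f x / g x) has_derivative (\<lambda>d. (f' d - f a / g a * g' d) / g a)) (at a)"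
  by (rule has_derivative_eq_rhs[OF has_derivative_divide'[OF assms]]) (use assms(3) in \<open>simp add: fun_eq_iff field_simps\<close>)

lemma has_derivative_Complex:
  assumes "(f has_derivative f') F" "(g has_derivative g') F"
  shows "((\<lambda>x. Complex (f x) (g x)) has_derivative (\<lambda>d. Complex (f' d) (g' d))) F"
  unfolding Complex_eq by (intro derivative_intros assms)

lemma continuous_on_Complex:
  assumes "continuous_on S f" "continuous_on S g" shows "continuous_on S (\<lambda>x. Complex (f x) (g x))"
  unfolding Complex_eq by (intro continuous_intros assms)

lemma continuous_on_sqrt_defect:
  assumes "continuous_on S a" "continuous_on S b" "continuous_on S c" "continuous_on S d"
  shows "continuous_on S (\<lambda>x. sqrt_defect (a x) (b x) (c x) (d x))"
  unfolding sqrt_defect_def rem0_def rem1_def root_q_def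
  by (intro continuous_on_Complex continuous_intros assms) auto

lemma has_derivative_smult:
  "(f has_derivative f') F \<Longrightarrow> ((\<lambda>x. f x *s (v :: real^3)) has_derivative (\<lambda>d. f' d *s v)) F"
  unfolding scalar_mult_eq_scaleR by (intro derivative_intros)

lemma continuous_on_smult:
  "continuous_on S f \<Longrightarrow> continuous_on S g \<Longrightarrow> continuous_on S (\<lambda>x. f x *s (g x :: real^3))"
  unfolding scalar_mult_eq_scaleR by (intro continuous_intros)

text \<open>The resultant of \<open>t\<^sup>2 + p t + q\<close> and the cubic with coefficients \<open>n\<^sub>0, \<dots>, n\<^sub>3\<close>: the product of the values of the cubic at the two roots,
  computed from its reduction modulo the quadratic.\<close>

definition resultant_quad :: "real \<Rightarrow> real \<Rightarrow> real \<Rightarrow> real \<Rightarrow> real \<Rightarrow> real \<Rightarrow> real" where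
  "resultant_quad p q n0 n1 n2 n3 = (let N1 = n1 - p * n2 + (p\<^sup>2 - q) * n3; N0 = n0 - q * n2 + p * q * n3 in
     N0\<^sup>2 - p * N0 * N1 + q * N1\<^sup>2)"

lemma resultant_quad_eq:
  fixes s1 s2 :: complex and n0 n1 n2 n3 :: real
  assumes s: "s1 + s2 = - of_real p" "s1 * s2 = of_real q"
  defines "f \<equiv> \<lambda>s. of_real n0 + of_real n1 * s + of_real n2 * s\<^sup>2 + of_real n3 * s ^ 3"
  shows "of_real (resultant_quad p q n0 n1 n2 n3) = f s1 * f s2"
proof -
  define N1 where "N1 = n1 - p * n2 + (p\<^sup>2 - q) * n3"
  define N0 where "N0 = n0 - q * n2 + p * q * n3"
  have red: "f s = of_real N0 + of_real N1 * s" if "s\<^sup>2 = - of_real p * s - of_real q" for s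
  proof -
    have "s ^ 3 = s * s\<^sup>2" by (simp add: power3_eq_cube power2_eq_square)
    also have "\<dots> = s * (- of_real p * s - of_real q)" by (simp only: that)
    also have "\<dots> = - of_real p * s\<^sup>2 - of_real q * s" by (simp add: algebra_simps power2_eq_square)
    also have "\<dots> = - of_real p * (- of_real p * s - of_real q) - of_real q * s" by (simp only: that)
    also have "\<dots> = ((of_real p)\<^sup>2 - of_real q) * s + of_real p * of_real q" by (simp add: algebra_simps power2_eq_square)
    finally have s3: "s ^ 3 = ((of_real p)\<^sup>2 - of_real q) * s + of_real p * of_real q" .
    show ?thesis unfolding f_def s3 that N0_def N1_def by (simp add: algebra_simps)
  qed
  have s2: "s2 = - of_real p - s1" using s(1) by (simp add: algebra_simps add_eq_0_iff eq_diff_eq)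
  have s1: "s1 = - of_real p - s2" using s2 by simp
  have q2: "s2\<^sup>2 = - of_real p * s2 - of_real q"
  proof -
    have "s2\<^sup>2 = s2 * (- of_real p - s1)" using s2 by (simp add: power2_eq_square)
    also have "\<dots> = - of_real p * s2 - s1 * s2" by (simp add: algebra_simps)
    finally show ?thesis unfolding s(2) .
  qed
  have q1: "s1\<^sup>2 = - of_real p * s1 - of_real q"
  proof -
    have "s1\<^sup>2 = s1 * (- of_real p - s2)" using s1 by (simp add: power2_eq_square)
    also have "\<dots> = - of_real p * s1 - s1 * s2" by (simp add: algebra_simps)
    finally show ?thesis unfolding s(2) .
  qed
  have "f s1 * f s2 = (of_real N0)\<^sup>2 + of_real N0 * of_real N1 * (s1 + s2) + (of_real N1)\<^sup>2 * (s1 * s2)"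
    unfolding red[OF q1] red[OF q2] by (simp add: algebra_simps power2_eq_square)
  also have "\<dots> = of_real (resultant_quad p q n0 n1 n2 n3)"
    unfolding s resultant_quad_def Let_def N0_def[symmetric] N1_def[symmetric] by (simp add: algebra_simps)
  finally show ?thesis by simp
qed

text \<open>A smooth real quartic in affine coordinates: \<open>e1\<close> and \<open>e2\<close> span the line at infinity, on which there is no real point of the
  quartic, and \<open>e3\<close> is the origin of the affine plane.\<close>

locale affine_quartic = smooth_quartic \<Phi> for \<Phi> +
  fixes e1 e2 e3 :: "real^3"
  assumes real: "real_form \<Phi>"
    and basis: "\<exists>a b c. w = a *s cv e1 + b *s cv e2 + c *s cv e3"
    and independent: "a *s cv e1 + b *s cv e2 + c *s cv e3 = 0 \<Longrightarrow> a = 0 \<and> b = 0 \<and> c = 0"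
    and no_real_point: "(x, y) \<noteq> (0, 0) \<Longrightarrow> quartic_at \<Phi> (cv (x *s e1 + y *s e2)) \<noteq> 0"
begin

definition \<phi> :: "real^3 \<Rightarrow> real^3 \<Rightarrow> real^3 \<Rightarrow> real^3 \<Rightarrow> real" where
  "\<phi> x y z w = Re (\<Phi> (cv x) (cv y) (cv z) (cv w))"

lemma form_cv: "\<Phi> (cv x) (cv y) (cv z) (cv w) = of_real (\<phi> x y z w)"
proof -
  have "cnj (\<Phi> (cv x) (cv y) (cv z) (cv w)) = \<Phi> (cv x) (cv y) (cv z) (cv w)"
    using real unfolding real_form_def by (simp add: cnj_cv)
  then show ?thesis by (simp add: \<phi>_def complex_eq_iff)
qed

sublocale R: quartic_form \<phi>
proof
  fix x y z w x' c
  show "\<phi> x y z w = \<phi> y x z w" unfolding \<phi>_def by (metis swap12)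
  show "\<phi> x y z w = \<phi> x z y w" unfolding \<phi>_def by (metis swap23)
  show "\<phi> x y z w = \<phi> x y w z" unfolding \<phi>_def by (metis swap34)
  show "\<phi> (x + x') y z w = \<phi> x y z w + \<phi> x' y z w" by (simp add: \<phi>_def cv_add add1)
  show "\<phi> (c *s x) y z w = c * \<phi> x y z w" by (simp add: \<phi>_def cv_scale scale1)
qed

text \<open>The direction \<open>dir e\<close> at infinity, for a unit complex number \<open>e\<close>, and the foot \<open>foot e r\<close> of the line with
  direction \<open>dir e\<close> at signed distance \<open>r\<close> from the origin \<open>e\<^sub>3\<close>.\<close>

definition dir :: "complex \<Rightarrow> real^3" where "dir e = Re e *s e1 + Im e *s e2"

definition foot :: "complex \<Rightarrow> real \<Rightarrow> real^3" where "foot e r = r *s dir (\<i> * e) + e3"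

lemma dir_minus: "dir (- e) = (-1) *s dir e"
  by (simp add: dir_def vec_eq_iff)

lemma foot_minus: "foot (- e) (- r) = foot e r"
  by (simp add: foot_def dir_def vec_eq_iff)

definition lead :: "real^3 \<Rightarrow> real" where "lead E = \<phi> E E E E"

text \<open>The defect of the quartic restricted to the line through \<open>P\<close> with direction \<open>E\<close>, as a polynomial in \<open>t\<close> at the point \<open>t E + P\<close>.\<close>

definition defect_of :: "real^3 \<Rightarrow> real^3 \<Rightarrow> complex" where
  "defect_of E P = sqrt_defect (4 * \<phi> E E E P / lead E) (6 * \<phi> E E P P / lead E) (4 * \<phi> E P P P / lead E) (\<phi> P P P P / lead E)"

definition line_defect :: "complex \<Rightarrow> real \<Rightarrow> complex" where
  "line_defect e r = defect_of (dir e) (foot e r)"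

lemma lead_dir_nonzero: "e \<noteq> 0 \<Longrightarrow> lead (dir e) \<noteq> 0"
  using no_real_point[of "Re e" "Im e"] form_cv[of "dir e" "dir e" "dir e" "dir e"]
  by (auto simp: lead_def dir_def complex_eq_iff)

lemma square_on_iff_defect_of:
  assumes "lead E \<noteq> 0" shows "(\<exists>q. square_on \<Phi> (cv E) (cv P) q) \<longleftrightarrow> defect_of E P = 0"
  unfolding square_on_def defect_of_def
  by (rule square_on_iff_sqrt_defect[OF assms]) (simp add: quartic_on_line form_cv lead_def)

lemma continuous_on_dir [continuous_intros]: "continuous_on S f \<Longrightarrow> continuous_on S (\<lambda>x. dir (f x))"
  unfolding dir_def by (intro continuous_intros continuous_on_smult)

lemma continuous_on_defect_of:
  assumes "continuous_on S f" "continuous_on S g" "\<And>x. x \<in> S \<Longrightarrow> lead (f x) \<noteq> 0"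
  shows "continuous_on S (\<lambda>x. defect_of (f x) (g x))"
proof -
  have l: "continuous_on S (\<lambda>x. lead (f x))" unfolding lead_def by (intro R.continuous_on_form assms)
  show ?thesis unfolding defect_of_def
    by (intro continuous_on_sqrt_defect continuous_on_divide l continuous_on_mult continuous_on_const R.continuous_on_form assms ballI)
qed

lemma continuous_on_line_defect:
  assumes "continuous_on S f" "continuous_on S g" "\<And>x. x \<in> S \<Longrightarrow> f x \<noteq> 0"
  shows "continuous_on S (\<lambda>x. line_defect (f x) (g x))"
  unfolding line_defect_def foot_def
  by (intro continuous_on_defect_of continuous_intros continuous_on_smult assms lead_dir_nonzero)

text \<open>The two orientations of a line differ by the substitution of \<open>- t\<close> for \<open>t\<close>, which changes the sign of the linear coefficient of the remainder.\<close>

lemma line_defect_minus: "line_defect (- e) (- r) = cnj (line_defect e r)"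
proof -
  have "lead (dir (- e)) = lead (dir e)" unfolding lead_def dir_minus R.multilinear by simp
  then show ?thesis unfolding line_defect_def foot_minus defect_of_def sqrt_defect_reflect[symmetric]
    unfolding dir_minus R.multilinear by simp
qed

text \<open>The product of the normal derivatives of the quartic at the two zeros of the quadratic \<open>t\<^sup>2 + p t + q\<close> on the line, hence at the
  two tangency points of a bitangent.\<close>

definition jacobian :: "complex \<Rightarrow> real \<Rightarrow> real" where
  "jacobian e r = (let E = dir e; P = foot e r; N = dir (\<i> * e) in
     resultant_quad (2 * \<phi> E E E P / lead E) (root_q (4 * \<phi> E E E P / lead E) (6 * \<phi> E E P P / lead E))
       (4 * \<phi> N P P P) (12 * \<phi> E N P P) (12 * \<phi> E E N P) (4 * \<phi> E E E N))"

lemma has_derivative_dir_cis: "((\<lambda>\<zeta>. dir (cis (Im \<zeta>))) has_derivative (\<lambda>d. Im d *s dir (\<i> * cis (Im \<zeta>)))) (at \<zeta>)"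
proof -
  have "((\<lambda>\<zeta>. cos (Im \<zeta>) *s e1 + sin (Im \<zeta>) *s e2) has_derivative (\<lambda>d. (- sin (Im \<zeta>) * Im d) *s e1 + (cos (Im \<zeta>) * Im d) *s e2)) (at \<zeta>)"
    by (intro has_derivative_add has_derivative_smult)
       (auto intro!: derivative_eq_intros simp: fun_eq_iff)
  moreover have "(\<lambda>d. (- sin (Im \<zeta>) * Im d) *s e1 + (cos (Im \<zeta>) * Im d) *s e2) = (\<lambda>d. Im d *s dir (\<i> * cis (Im \<zeta>)))"
    by (simp add: fun_eq_iff dir_def vec_eq_iff algebra_simps)
  ultimately show ?thesis by (simp add: dir_def)
qed

lemma has_derivative_foot_cis:
  "((\<lambda>\<zeta>. foot (cis (Im \<zeta>)) (Re \<zeta>)) has_derivative (\<lambda>d. Re d *s dir (\<i> * cis (Im \<zeta>)) + (- (Re \<zeta> * Im d)) *s dir (cis (Im \<zeta>)))) (at \<zeta>)"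
proof -
  have a: "((\<lambda>\<zeta>. - Re \<zeta> * sin (Im \<zeta>)) has_derivative (\<lambda>d. - Re d * sin (Im \<zeta>) - Re \<zeta> * (cos (Im \<zeta>) * Im d))) (at \<zeta>)"
    by (auto intro!: derivative_eq_intros simp: fun_eq_iff algebra_simps)
  have b: "((\<lambda>\<zeta>. Re \<zeta> * cos (Im \<zeta>)) has_derivative (\<lambda>d. Re d * cos (Im \<zeta>) - Re \<zeta> * (sin (Im \<zeta>) * Im d))) (at \<zeta>)"
    by (auto intro!: derivative_eq_intros simp: fun_eq_iff algebra_simps)
  have D: "((\<lambda>\<zeta>. (- Re \<zeta> * sin (Im \<zeta>)) *s e1 + (Re \<zeta> * cos (Im \<zeta>)) *s e2 + e3) has_derivative
     (\<lambda>d. (- Re d * sin (Im \<zeta>) - Re \<zeta> * (cos (Im \<zeta>) * Im d)) *s e1 + (Re d * cos (Im \<zeta>) - Re \<zeta> * (sin (Im \<zeta>) * Im d)) *s e2)) (at \<zeta>)"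
    using has_derivative_add[OF has_derivative_add[OF has_derivative_smult[OF a, of e1] has_derivative_smult[OF b, of e2]] has_derivative_const[of e3]]
    by simp
  moreover have "(\<lambda>d. (- Re d * sin (Im \<zeta>) - Re \<zeta> * (cos (Im \<zeta>) * Im d)) *s e1 + (Re d * cos (Im \<zeta>) - Re \<zeta> * (sin (Im \<zeta>) * Im d)) *s e2)
     = (\<lambda>d. Re d *s dir (\<i> * cis (Im \<zeta>)) + (- (Re \<zeta> * Im d)) *s dir (cis (Im \<zeta>)))"
    by (simp add: fun_eq_iff dir_def vec_eq_iff algebra_simps)
  moreover have "(\<lambda>\<zeta>. (- Re \<zeta> * sin (Im \<zeta>)) *s e1 + (Re \<zeta> * cos (Im \<zeta>)) *s e2 + e3) = (\<lambda>\<zeta>. foot (cis (Im \<zeta>)) (Re \<zeta>))"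
    by (simp add: fun_eq_iff foot_def dir_def vec_eq_iff algebra_simps)
  ultimately show ?thesis by simp
qed

text \<open>The determinant of the linear map of \<open>defect_derivative_algebra\<close> is \<open>N\<^sub>0 (N\<^sub>0 - p N\<^sub>1) + q N\<^sub>1\<^sup>2\<close>, the resultant. In complex
  notation the determinant of \<open>d \<mapsto> A d + C cnj d\<close> is \<open>|A|\<^sup>2 - |C|\<^sup>2\<close>.\<close>

lemma has_derivative_line_defect:
  fixes \<zeta> :: complex
  assumes z: "line_defect (cis (Im \<zeta>)) (Re \<zeta>) = 0"
  obtains A C where "((\<lambda>\<zeta>. line_defect (cis (Im \<zeta>)) (Re \<zeta>)) has_derivative (\<lambda>d. A * d + C * cnj d)) (at \<zeta>)"
    "(norm A)\<^sup>2 - (norm C)\<^sup>2 = jacobian (cis (Im \<zeta>)) (Re \<zeta>) / (lead (dir (cis (Im \<zeta>))))\<^sup>2"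
proof -
  define e r E P N c where "e = cis (Im \<zeta>)" and "r = Re \<zeta>" and "E = dir e" and "P = foot e r" and "N = dir (\<i> * e)" and "c = lead E"
  have c: "c \<noteq> 0" unfolding c_def E_def e_def by (rule lead_dir_nonzero) simp
  let ?E = "\<lambda>\<zeta>. dir (cis (Im \<zeta>))" and ?P = "\<lambda>\<zeta>. foot (cis (Im \<zeta>)) (Re \<zeta>)"
  have dE: "(?E has_derivative (\<lambda>d. Im d *s N)) (at \<zeta>)" unfolding N_def e_def by (rule has_derivative_dir_cis)
  have dP: "(?P has_derivative (\<lambda>d. Re d *s N + (- (r * Im d)) *s E)) (at \<zeta>)" unfolding N_def e_def r_def E_def by (rule has_derivative_foot_cis)
  define n0 n1 n2 n3 where "n0 = 4 * \<phi> N P P P" and "n1 = 12 * \<phi> E N P P" and "n2 = 12 * \<phi> E E N P" and "n3 = 4 * \<phi> E E E N"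
  define h3 h2 h1 h0 where "h3 = 4 * \<phi> E E E P" and "h2 = 6 * \<phi> E E P P" and "h1 = 4 * \<phi> E P P P" and "h0 = \<phi> P P P P"
  note sw = R.swap12 R.swap23 R.swap34
  have s1: "\<phi> N E E E = \<phi> E E E N" "\<phi> E N E E = \<phi> E E E N" "\<phi> E E N E = \<phi> E E E N" by (metis sw)+
  have s2: "\<phi> N E E P = \<phi> E E N P" "\<phi> E N E P = \<phi> E E N P" by (metis sw)+
  have s3: "\<phi> N E P P = \<phi> E N P P" "\<phi> E E P N = \<phi> E E N P" "\<phi> E E P E = \<phi> E E E P" by (metis sw)+
  have s4: "\<phi> E P N P = \<phi> E N P P" "\<phi> E P P N = \<phi> E N P P" "\<phi> E P E P = \<phi> E E P P" "\<phi> E P P E = \<phi> E E P P" by (metis sw)+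
  have s5: "\<phi> P N P P = \<phi> N P P P" "\<phi> P P N P = \<phi> N P P P" "\<phi> P P P N = \<phi> N P P P"
     "\<phi> P E P P = \<phi> E P P P" "\<phi> P P E P = \<phi> E P P P" "\<phi> P P P E = \<phi> E P P P" by (metis sw)+
  have at: "?E \<zeta> = E" "?P \<zeta> = P" by (simp_all add: E_def P_def e_def r_def)
  have d4: "((\<lambda>\<zeta>. lead (?E \<zeta>)) has_derivative (\<lambda>d. n3 * Im d)) (at \<zeta>)"
    unfolding lead_def
    by (rule has_derivative_eq_rhs[OF R.has_derivative_form[OF dE dE dE dE]], unfold at R.multilinear)
       (simp add: fun_eq_iff s1 n3_def algebra_simps)
  have d3: "((\<lambda>\<zeta>. 4 * polar_at \<phi> (?E \<zeta>) (?P \<zeta>)) has_derivative (\<lambda>d. n3 * Re d + n2 * Im d - 4 * r * c * Im d)) (at \<zeta>)"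
    by (rule has_derivative_eq_rhs[OF has_derivative_mult_right[OF R.has_derivative_form[OF dE dE dE dP]]], unfold at R.multilinear)
       (simp add: fun_eq_iff s2 n3_def n2_def c_def lead_def algebra_simps)
  have d2: "((\<lambda>\<zeta>. 6 * \<phi> (?E \<zeta>) (?E \<zeta>) (?P \<zeta>) (?P \<zeta>)) has_derivative (\<lambda>d. n2 * Re d + n1 * Im d - 3 * r * h3 * Im d)) (at \<zeta>)"
    by (rule has_derivative_eq_rhs[OF has_derivative_mult_right[OF R.has_derivative_form[OF dE dE dP dP]]], unfold at R.multilinear)
       (simp add: fun_eq_iff s3 n1_def n2_def h3_def algebra_simps)
  have d1: "((\<lambda>\<zeta>. 4 * \<phi> (?E \<zeta>) (?P \<zeta>) (?P \<zeta>) (?P \<zeta>)) has_derivative (\<lambda>d. n1 * Re d + n0 * Im d - 2 * r * h2 * Im d)) (at \<zeta>)"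
    by (rule has_derivative_eq_rhs[OF has_derivative_mult_right[OF R.has_derivative_form[OF dE dP dP dP]]], unfold at R.multilinear)
       (simp add: fun_eq_iff s4 n1_def n0_def h2_def algebra_simps)
  have d0: "((\<lambda>\<zeta>. quartic_at \<phi> (?P \<zeta>)) has_derivative (\<lambda>d. n0 * Re d - r * h1 * Im d)) (at \<zeta>)"
    by (rule has_derivative_eq_rhs[OF R.has_derivative_form[OF dP dP dP dP]], unfold at R.multilinear)
       (simp add: fun_eq_iff s5 n0_def h1_def algebra_simps)
  define p q where "p = h3 / c / 2" and "q = root_q (h3 / c) (h2 / c)"
  have zero: "h1 / c = h3 / c * q" "h0 / c = q\<^sup>2"
    using z unfolding line_defect_def defect_of_def e_def[symmetric] r_def[symmetric] E_def[symmetric] P_def[symmetric]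
      c_def[symmetric] h3_def[symmetric] h2_def[symmetric] h1_def[symmetric] h0_def[symmetric] sqrt_defect_eq_0_iff q_def by auto
  have h3: "h3 = 2 * p * c" using c by (simp add: p_def)
  have h2: "h2 = (p\<^sup>2 + 2 * q) * c"
  proof -
    have "2 * q = h2 / c - p\<^sup>2" by (simp add: q_def p_def root_q_def)
    then have "h2 / c = p\<^sup>2 + 2 * q" by simp
    then show ?thesis using c by (simp add: field_simps)
  qed
  have h1: "h1 = 2 * p * q * c" using zero(1) c by (simp add: h3 field_simps)
  have h0: "h0 = q\<^sup>2 * c" using zero(2) c by (simp add: field_simps)
  have hc: "h3 / c = 2 * p" "h2 / c = p\<^sup>2 + 2 * q" "h1 / c = 2 * p * q" "h0 / c = q\<^sup>2" using c by (simp_all add: h3 h2 h1 h0)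
  have rq: "root_q (2 * p) (p\<^sup>2 + 2 * q) = q" by (simp add: root_q_def)
  have pp: "2 * p / 2 = p" by simp
  have l0: "lead (?E \<zeta>) \<noteq> 0" using c by (simp add: at c_def)
  note Q = has_derivative_quotient[OF _ d4 l0]
  note q3 = Q[OF d3] and q2 = Q[OF d2] and q1 = Q[OF d1] and q0 = Q[OF d0]
  define N1 where "N1 = n1 - p * n2 + (p\<^sup>2 - q) * n3"
  define N0 where "N0 = n0 - q * n2 + p * q * n3"
  have R1: "((\<lambda>\<zeta>. rem1 (4 * polar_at \<phi> (?E \<zeta>) (?P \<zeta>) / lead (?E \<zeta>)) (6 * \<phi> (?E \<zeta>) (?E \<zeta>) (?P \<zeta>) (?P \<zeta>) / lead (?E \<zeta>))
       (4 * \<phi> (?E \<zeta>) (?P \<zeta>) (?P \<zeta>) (?P \<zeta>) / lead (?E \<zeta>))) has_derivative (\<lambda>d. (N1 * Re d + (N0 - p * N1) * Im d) / c)) (at \<zeta>)"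
    by (rule has_derivative_eq_rhs[OF has_derivative_rem1[OF q3 q2 q1]],
        unfold at h3_def[symmetric] h2_def[symmetric] h1_def[symmetric] c_def[symmetric], unfold hc, unfold rq pp,
        unfold h3 h2 h1 N1_def N0_def, rule ext, rule defect_derivative_algebra(1)[OF c])
  have R0: "((\<lambda>\<zeta>. rem0 (4 * polar_at \<phi> (?E \<zeta>) (?P \<zeta>) / lead (?E \<zeta>)) (6 * \<phi> (?E \<zeta>) (?E \<zeta>) (?P \<zeta>) (?P \<zeta>) / lead (?E \<zeta>))
       (quartic_at \<phi> (?P \<zeta>) / lead (?E \<zeta>))) has_derivative (\<lambda>d. (N0 * Re d - q * N1 * Im d) / c)) (at \<zeta>)"
    by (rule has_derivative_eq_rhs[OF has_derivative_rem0[OF q3 q2 q0]],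
        unfold at h3_def[symmetric] h2_def[symmetric] h0_def[symmetric] c_def[symmetric], unfold hc, unfold rq pp,
        unfold h3 h2 h1 N1_def N0_def, rule ext, rule defect_derivative_algebra(2)[OF c])
  have D: "((\<lambda>\<zeta>. line_defect (cis (Im \<zeta>)) (Re \<zeta>)) has_derivative
      (\<lambda>d. Complex ((N0 * Re d - q * N1 * Im d) / c) ((N1 * Re d + (N0 - p * N1) * Im d) / c))) (at \<zeta>)"
    unfolding line_defect_def defect_of_def sqrt_defect_def by (rule has_derivative_Complex[OF R0 R1])
  \<comment> \<open>The partial derivatives \<open>X\<close> and \<open>Y\<close> in the coordinates \<open>Re d\<close> and \<open>Im d\<close> combine to the Wirtinger derivatives \<open>A\<close> and \<open>C\<close>.\<close>
  define X Y where "X = Complex (N0 / c) (N1 / c)" and "Y = Complex (- q * N1 / c) ((N0 - p * N1) / c)"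
  define A C where "A = (X - \<i> * Y) / 2" and "C = (X + \<i> * Y) / 2"
  have "(\<lambda>d. Complex ((N0 * Re d - q * N1 * Im d) / c) ((N1 * Re d + (N0 - p * N1) * Im d) / c)) = (\<lambda>d. A * d + C * cnj d)"
  proof
    fix d
    have "A * d + C * cnj d = X * of_real (Re d) + Y * of_real (Im d)"
      unfolding A_def C_def by (simp add: complex_eq_iff field_simps)
    also have "\<dots> = Complex ((N0 * Re d - q * N1 * Im d) / c) ((N1 * Re d + (N0 - p * N1) * Im d) / c)"
      unfolding X_def Y_def by (simp add: complex_eq_iff add_divide_distrib diff_divide_distrib left_diff_distrib)
    finally show "Complex ((N0 * Re d - q * N1 * Im d) / c) ((N1 * Re d + (N0 - p * N1) * Im d) / c) = A * d + C * cnj d" by simp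
  qed
  moreover have "(norm A)\<^sup>2 - (norm C)\<^sup>2 = jacobian (cis (Im \<zeta>)) (Re \<zeta>) / (lead (dir (cis (Im \<zeta>))))\<^sup>2"
  proof -
    have "(norm A)\<^sup>2 - (norm C)\<^sup>2 = Re X * Im Y - Im X * Re Y"
      unfolding A_def C_def cmod_power2 by (simp add: field_simps power2_eq_square)
    also have "\<dots> = (N0\<^sup>2 - p * N0 * N1 + q * N1\<^sup>2) / c\<^sup>2"
      unfolding X_def Y_def using c by (simp add: field_simps power2_eq_square)
    also have "N0\<^sup>2 - p * N0 * N1 + q * N1\<^sup>2 = jacobian e r"
    proof -
      have "2 * \<phi> E E E P / lead E = p" by (simp add: p_def h3_def c_def)
      then show ?thesis
        unfolding jacobian_def Let_def resultant_quad_def E_def[symmetric] P_def[symmetric] N_def[symmetric]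
        by (simp add: N0_def N1_def n0_def n1_def n2_def n3_def q_def h3_def h2_def c_def)
    qed
    finally show ?thesis by (simp add: c_def E_def e_def r_def)
  qed
  ultimately show ?thesis using that D by simp
qed

text \<open>The punctured plane as the space of oriented lines: \<open>w\<close> is the line of direction \<open>w / |w|\<close> at signed distance \<open>ln |w|\<close>. The chart \<open>ln w\<close>
  of the punctured plane is holomorphic, so that indices may be computed in the coordinates \<open>r + \<i> \<theta>\<close>.\<close>

definition plane_defect :: "complex \<Rightarrow> complex" where
  "plane_defect w = line_defect (sgn w) (ln (norm w))"

lemma plane_defect_polar: "plane_defect (of_real (exp r) * cis \<theta>) = line_defect (cis \<theta>) r"
proof -
  have "sgn (of_real (exp r) * cis \<theta>) = cis \<theta>" by (simp add: sgn_mult sgn_of_real)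
  then show ?thesis by (simp add: plane_defect_def norm_mult)
qed

lemma plane_defect_simple_zero:
  assumes w0: "w0 \<noteq> 0" and z: "plane_defect w0 = 0" and J: "jacobian (sgn w0) (ln (norm w0)) \<noteq> 0"
  shows "simple_zero plane_defect w0 (if jacobian (sgn w0) (ln (norm w0)) > 0 then 1 else -1)"
proof -
  define \<zeta>0 where "\<zeta>0 = Complex (ln (norm w0)) (Arg w0)"
  have cis0: "cis (Arg w0) = sgn w0" using cis_Arg[OF w0] .
  have z0: "line_defect (cis (Im \<zeta>0)) (Re \<zeta>0) = 0" using z by (simp add: \<zeta>0_def cis0 plane_defect_def)
  obtain A C where D: "((\<lambda>\<zeta>. line_defect (cis (Im \<zeta>)) (Re \<zeta>)) has_derivative (\<lambda>d. A * d + C * cnj d)) (at \<zeta>0)"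
    and AC: "(norm A)\<^sup>2 - (norm C)\<^sup>2 = jacobian (sgn w0) (ln (norm w0)) / (lead (dir (sgn w0)))\<^sup>2"
    using has_derivative_line_defect[OF z0] by (auto simp: \<zeta>0_def cis0)
  have polar: "plane_defect w = line_defect (cis (Im (\<zeta>0 + Ln (w / w0)))) (Re (\<zeta>0 + Ln (w / w0)))" if "w \<noteq> 0" for w
  proof -
    have ww: "w / w0 \<noteq> 0" using that w0 by simp
    have "of_real (exp (Re (\<zeta>0 + Ln (w / w0)))) * cis (Im (\<zeta>0 + Ln (w / w0))) = exp (\<zeta>0 + Ln (w / w0))"
      by (simp add: exp_eq_polar)
    also have "\<dots> = exp \<zeta>0 * (w / w0)" by (simp add: exp_add exp_Ln[OF ww])
    also have "exp \<zeta>0 = w0" using w0 by (simp add: exp_eq_polar \<zeta>0_def cis0 sgn_div_norm scaleR_conv_of_real)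
    finally have "of_real (exp (Re (\<zeta>0 + Ln (w / w0)))) * cis (Im (\<zeta>0 + Ln (w / w0))) = w" using w0 by simp
    then show ?thesis using plane_defect_polar by metis
  qed
  have "((\<lambda>w. \<zeta>0 + Ln (w / w0)) has_field_derivative (1 / w0)) (at w0)"
    using w0 by (auto intro!: derivative_eq_intros)
  then have L: "((\<lambda>w. \<zeta>0 + Ln (w / w0)) has_derivative (\<lambda>h. 1 / w0 * h)) (at w0)" unfolding has_field_derivative_def .
  have "((\<lambda>w. line_defect (cis (Im (\<zeta>0 + Ln (w / w0)))) (Re (\<zeta>0 + Ln (w / w0)))) has_derivative (\<lambda>h. A * (1 / w0 * h) + C * cnj (1 / w0 * h))) (at w0)"
    by (rule has_derivative_compose[OF L]) (use D w0 in simp)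
  then have "(plane_defect has_derivative (\<lambda>h. A * (1 / w0 * h) + C * cnj (1 / w0 * h))) (at w0)"
    by (rule has_derivative_transform_within_open[of _ _ _ _ "- {0}"]) (use w0 polar in auto)
  then have "(plane_defect has_derivative (\<lambda>h. (A / w0) * h + (C / cnj w0) * cnj h)) (at w0)" by simp
  moreover have "norm (A / w0) \<noteq> norm (C / cnj w0)" "norm (C / cnj w0) < norm (A / w0) \<longleftrightarrow> jacobian (sgn w0) (ln (norm w0)) > 0"
  proof -
    have l: "(lead (dir (sgn w0)))\<^sup>2 > 0" using lead_dir_nonzero[of "sgn w0"] w0 by (simp add: sgn_zero_iff)
    have "(norm A)\<^sup>2 \<noteq> (norm C)\<^sup>2" using AC J l by auto
    then show "norm (A / w0) \<noteq> norm (C / cnj w0)" using w0 by (auto simp: norm_divide)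
    have "norm (C / cnj w0) < norm (A / w0) \<longleftrightarrow> norm C < norm A" using w0 by (simp add: norm_divide divide_strict_right_mono divide_less_cancel)
    also have "\<dots> \<longleftrightarrow> (norm C)\<^sup>2 < (norm A)\<^sup>2" by (auto intro: power_strict_mono dest: power_less_imp_less_base)
    also have "\<dots> \<longleftrightarrow> jacobian (sgn w0) (ln (norm w0)) > 0" using AC l by (metis diff_gt_0_iff_gt zero_less_divide_iff not_less_iff_gr_or_eq)
    finally show "norm (C / cnj w0) < norm (A / w0) \<longleftrightarrow> jacobian (sgn w0) (ln (norm w0)) > 0" .
  qed
  ultimately show ?thesis using simple_zero_of_derivative[where G = plane_defect and z = w0 and A = "A / w0" and C = "C / cnj w0"] z by simp
qed

text \<open>On the circles of radius \<open>exp B\<close> and \<open>exp (- B)\<close> the lines are the same with opposite orientations, so that the inner winding number is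
  the negative of the outer one.\<close>

theorem sum_of_indices:
  assumes fin: "finite Z" and Z: "Z = {w. w \<noteq> 0 \<and> plane_defect w = 0}"
    and B: "B > 0" "\<And>w. w \<in> Z \<Longrightarrow> \<bar>ln (norm w)\<bar> < B"
    and J: "\<And>w. w \<in> Z \<Longrightarrow> jacobian (sgn w) (ln (norm w)) \<noteq> 0"
  shows "of_int (\<Sum>w\<in>Z. if jacobian (sgn w) (ln (norm w)) > 0 then 1 else -1) = 2 * turns (\<lambda>\<theta>. line_defect (cis \<theta>) B)"
proof -
  have nz: "line_defect (cis \<theta>) r \<noteq> 0" if "\<bar>r\<bar> = B" for \<theta> r
  proof
    assume "line_defect (cis \<theta>) r = 0"
    then have "of_real (exp r) * cis \<theta> \<in> Z" using plane_defect_polar[of r \<theta>] by (simp add: Z)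
    from B(2)[OF this] that show False by (simp add: norm_mult)
  qed
  have loop: "nonzero_loop (\<lambda>\<theta>. line_defect (cis \<theta>) r)" if "\<bar>r\<bar> = B" for r
    unfolding nonzero_loop_def
    by (intro conjI allI nz that continuous_on_line_defect continuous_intros) (simp_all add: cis_mult[symmetric])
  have lnb: "exp (-B) < norm w \<and> norm w < exp B" if "w \<in> Z" for w
  proof -
    have w: "norm w > 0" using that by (simp add: Z)
    have "-B < ln (norm w)" "ln (norm w) < B" using B(2)[OF that] by auto
    then show ?thesis using w by (metis exp_less_cancel_iff exp_ln)
  qed
  have "turns (\<lambda>\<theta>. plane_defect (of_real (exp B) * cis \<theta>)) - turns (\<lambda>\<theta>. plane_defect (of_real (exp (-B)) * cis \<theta>)) =
     of_int (\<Sum>w\<in>Z. if jacobian (sgn w) (ln (norm w)) > 0 then 1 else -1)"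
  proof (rule annulus_degree[OF _ _ fin lnb])
    show "continuous_on {w. exp (- B) \<le> norm w \<and> norm w \<le> exp B} plane_defect"
      unfolding plane_defect_def
    proof (rule continuous_on_line_defect)
      have p: "norm w > 0" if "w \<in> {w. exp (- B) \<le> norm w \<and> norm w \<le> exp B}" for w :: complex
        using that less_le_trans[OF exp_gt_zero] by auto
      then show "sgn w \<noteq> 0" if "w \<in> {w. exp (- B) \<le> norm w \<and> norm w \<le> exp B}" for w :: complex
        using that by (auto simp: sgn_zero_iff)
      show "continuous_on {w. exp (- B) \<le> norm w \<and> norm w \<le> exp B} (sgn :: complex \<Rightarrow> complex)"
        using p by (intro continuous_on_sgn continuous_on_id) auto
      show "continuous_on {w :: complex. exp (- B) \<le> norm w \<and> norm w \<le> exp B} (\<lambda>w. ln (norm w))"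
        using p by (intro continuous_on_ln continuous_on_norm continuous_on_id) force
    qed
    show "plane_defect w = 0 \<longleftrightarrow> w \<in> Z" if "exp (- B) \<le> norm w" "norm w \<le> exp B" for w
      using that less_le_trans[OF exp_gt_zero that(1)] by (auto simp: Z)
    show "((if jacobian (sgn z) (ln (norm z)) > 0 then 1 else -1) = (1::int) \<or> (if jacobian (sgn z) (ln (norm z)) > 0 then 1 else -1) = (-1::int)) \<and>
       simple_zero plane_defect z (if jacobian (sgn z) (ln (norm z)) > 0 then 1 else -1)" if "z \<in> Z" for z
      using plane_defect_simple_zero[of z] J[OF that] that by (auto simp: Z)
  qed (use B in auto)
  moreover have "turns (\<lambda>\<theta>. line_defect (cis \<theta>) (-B)) = - turns (\<lambda>\<theta>. line_defect (cis \<theta>) B)"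
  proof -
    have "line_defect (cis \<theta>) (-B) = cnj (line_defect (cis (\<theta> + pi)) B)" for \<theta>
      using line_defect_minus[of "cis (\<theta> + pi)" B] by (simp add: cis_mult[symmetric])
    then have "turns (\<lambda>\<theta>. line_defect (cis \<theta>) (-B)) = turns (\<lambda>\<theta>. cnj (line_defect (cis (\<theta> + pi)) B))" by simp
    also have "\<dots> = - turns (\<lambda>\<theta>. line_defect (cis (\<theta> + pi)) B)"
      by (rule turns_cnj[OF nonzero_loop_shift[OF loop]]) (use B(1) in simp)
    also have "turns (\<lambda>\<theta>. line_defect (cis (\<theta> + pi)) B) = turns (\<lambda>\<theta>. line_defect (cis \<theta>) B)"
      using turns_shift[OF loop[of B], of pi] B(1) by simp
    finally show ?thesis .
  qed
  ultimately show ?thesis unfolding plane_defect_polar by simp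
qed

end

section \<open>Winding of the defect near the line at infinity\<close>

text \<open>Roots of a real polynomial come in conjugate pairs.\<close>

lemma real_quartic_without_real_roots:
  fixes a3 a2 a1 a0 :: real
  assumes nr: "\<And>t. t ^ 4 + a3 * t ^ 3 + a2 * t\<^sup>2 + a1 * t + a0 \<noteq> 0"
  obtains x0 y0 x1 y1 where "y0 > 0" "y1 > 0" "a3 = - 2 * (x0 + x1)" "a2 = x0\<^sup>2 + y0\<^sup>2 + x1\<^sup>2 + y1\<^sup>2 + 4 * x0 * x1"
    "a1 = - 2 * (x0 * (x1\<^sup>2 + y1\<^sup>2) + x1 * (x0\<^sup>2 + y0\<^sup>2))" "a0 = (x0\<^sup>2 + y0\<^sup>2) * (x1\<^sup>2 + y1\<^sup>2)"
proof -
  define P where "P = [:complex_of_real a0, of_real a1, of_real a2, of_real a3, 1:]"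
  have "coeff P 4 \<noteq> 0" by (simp add: P_def eval_nat_numeral)
  then have "\<exists>i\<in>{1..4::nat}. coeff P i \<noteq> 0" by (intro bexI[of _ 4]) auto
  then obtain z where z: "(\<Sum>i\<le>4. coeff P i * z ^ i) = 0"
    using fundamental_theorem_of_algebra[of "coeff P" 4] by blast
  have pz: "z ^ 4 + of_real a3 * z ^ 3 + of_real a2 * z\<^sup>2 + of_real a1 * z + of_real a0 = 0"
    using z by (simp add: P_def eval_nat_numeral algebra_simps)
  define x0 y0 m0 where "x0 = Re z" and "y0 = \<bar>Im z\<bar>" and "m0 = x0\<^sup>2 + y0\<^sup>2"
  have imz: "Im z \<noteq> 0"
  proof
    assume "Im z = 0"
    then have zr: "z = of_real x0" by (simp add: complex_eq_iff x0_def)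
    have "complex_of_real (x0 ^ 4 + a3 * x0 ^ 3 + a2 * x0\<^sup>2 + a1 * x0 + a0) = 0" using pz unfolding zr by simp
    then show False using nr[of x0] by (metis of_real_eq_0_iff)
  qed
  have zq: "z\<^sup>2 = of_real (2 * x0) * z - of_real m0"
    by (simp add: complex_eq_iff x0_def y0_def m0_def power2_eq_square algebra_simps abs_mult_self_eq)
  define b c where "b = a3 + 2 * x0" and "c = a2 - m0 + 2 * x0 * b"
  define r1 r0 where "r1 = a1 - b * m0 + 2 * x0 * c" and "r0 = a0 - m0 * c"
  have div: "t ^ 4 + of_real a3 * t ^ 3 + of_real a2 * t\<^sup>2 + of_real a1 * t + of_real a0 =
     (t\<^sup>2 - of_real (2 * x0) * t + of_real m0) * (t\<^sup>2 + of_real b * t + of_real c) + of_real r1 * t + of_real r0" for t :: "'z::real_field"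
    unfolding r1_def r0_def c_def b_def by (simp add: power2_eq_square power3_eq_cube power4_eq_xxxx algebra_simps)
  have zq0: "z\<^sup>2 - of_real (2 * x0) * z + of_real m0 = 0" using zq by simp
  have "of_real r1 * z + of_real r0 = 0" using pz unfolding div[of z] zq0 by simp
  then have "r1 * Im z = 0" "r1 * Re z + r0 = 0" by (auto simp: complex_eq_iff)
  then have r: "r1 = 0" "r0 = 0" using imz by auto
  have disc: "4 * c - b\<^sup>2 > 0"
  proof (rule ccontr)
    assume "\<not> ?thesis"
    then have d: "b\<^sup>2 - 4 * c \<ge> 0" by simp
    define t where "t = (- b + sqrt (b\<^sup>2 - 4 * c)) / 2"
    have "2 * t + b = sqrt (b\<^sup>2 - 4 * c)" by (simp add: t_def field_simps)
    then have "(2 * t + b)\<^sup>2 = b\<^sup>2 - 4 * c" using d by simp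
    then have "t\<^sup>2 + b * t + c = 0" by (simp add: power2_eq_square algebra_simps)
    then have "t ^ 4 + a3 * t ^ 3 + a2 * t\<^sup>2 + a1 * t + a0 = 0" using div[of t] r by simp
    then show False using nr by blast
  qed
  define x1 y1 where "x1 = - b / 2" and "y1 = sqrt (4 * c - b\<^sup>2) / 2"
  have m1: "x1\<^sup>2 + y1\<^sup>2 = c" using disc by (simp add: x1_def y1_def power_divide field_simps)
  have bx: "b = - 2 * x1" by (simp add: x1_def)
  show ?thesis
  proof
    show "y0 > 0" using imz by (simp add: y0_def)
    show "y1 > 0" using disc by (simp add: y1_def)
    show "a3 = - 2 * (x0 + x1)" using bx by (simp add: b_def)
    show "a2 = x0\<^sup>2 + y0\<^sup>2 + x1\<^sup>2 + y1\<^sup>2 + 4 * x0 * x1" using m1 bx by (simp add: c_def m0_def)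
    show "a1 = - 2 * (x0 * (x1\<^sup>2 + y1\<^sup>2) + x1 * (x0\<^sup>2 + y0\<^sup>2))"
      using r(1) unfolding m1 m0_def[symmetric] r1_def bx by simp
    show "a0 = (x0\<^sup>2 + y0\<^sup>2) * (x1\<^sup>2 + y1\<^sup>2)" using r(2) unfolding m1 m0_def[symmetric] r0_def by simp
  qed
qed

lemma unit_nonzero: "norm (e :: complex) = 1 \<Longrightarrow> e \<noteq> 0"
  by (metis norm_zero zero_neq_one)

text \<open>Rotation of the line at infinity acts on its complex points by Moebius transformations.\<close>

definition rot_denom :: "complex \<Rightarrow> complex \<Rightarrow> complex" where "rot_denom z e = of_real (Re e) - z * of_real (Im e)"

definition rotated :: "complex \<Rightarrow> complex \<Rightarrow> complex" where "rotated z e = (of_real (Im e) + z * of_real (Re e)) / rot_denom z e"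

lemma rot_denom_nonzero:
  assumes "Im z > 0" "e \<noteq> 0" shows "rot_denom z e \<noteq> 0"
proof
  assume "rot_denom z e = 0"
  then have "Im z * Im e = 0" "Re e = Re z * Im e" by (auto simp: rot_denom_def complex_eq_iff)
  then show False using assms by (auto simp: complex_eq_iff)
qed

lemma Im_rotated:
  assumes "Im z > 0" "norm e = 1" shows "Im (rotated z e) > 0"
proof -
  have e: "(Re e)\<^sup>2 + (Im e)\<^sup>2 = 1" using assms(2) by (simp add: cmod_power2[symmetric])
  have nz: "rot_denom z e \<noteq> 0" by (rule rot_denom_nonzero[OF assms(1) unit_nonzero[OF assms(2)]])
  have "rotated z e = (of_real (Im e) + z * of_real (Re e)) * cnj (rot_denom z e) / of_real ((norm (rot_denom z e))\<^sup>2)"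
    unfolding rotated_def by (subst complex_div_cnj) simp
  then have "Im (rotated z e) = Im ((of_real (Im e) + z * of_real (Re e)) * cnj (rot_denom z e)) / (norm (rot_denom z e))\<^sup>2"
    by (simp only: Im_divide_of_real)
  also have "Im ((of_real (Im e) + z * of_real (Re e)) * cnj (rot_denom z e)) = Im z * ((Re e)\<^sup>2 + (Im e)\<^sup>2)"
    by (simp add: rot_denom_def algebra_simps power2_eq_square)
  finally show ?thesis using assms(1) nz unfolding e by simp
qed

lemma rotated_diff:
  assumes "Im z0 > 0" "Im z1 > 0" "norm e = 1"
  shows "rotated z0 e - rotated z1 e = (z0 - z1) * inverse (rot_denom z0 e) * inverse (rot_denom z1 e)"
proof -
  have e: "complex_of_real (Re e) * of_real (Re e) + of_real (Im e) * of_real (Im e) = 1"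
    using assms(3) by (simp add: cmod_def power2_eq_square flip: of_real_mult of_real_add)
  have nz: "rot_denom z0 e \<noteq> 0" "rot_denom z1 e \<noteq> 0" using rot_denom_nonzero[OF _ unit_nonzero[OF assms(3)]] assms by blast+
  have "(of_real (Im e) + z0 * of_real (Re e)) * rot_denom z1 e - (of_real (Im e) + z1 * of_real (Re e)) * rot_denom z0 e
     = (z0 - z1) * (of_real (Re e) * of_real (Re e) + of_real (Im e) * of_real (Im e))"
    by (simp add: rot_denom_def algebra_simps)
  then have k: "(of_real (Im e) + z0 * of_real (Re e)) * rot_denom z1 e - (of_real (Im e) + z1 * of_real (Re e)) * rot_denom z0 e = z0 - z1"
    unfolding e by simp
  have "rotated z0 e - rotated z1 e = ((of_real (Im e) + z0 * of_real (Re e)) * rot_denom z1 e - (of_real (Im e) + z1 * of_real (Re e)) * rot_denom z0 e) / (rot_denom z0 e * rot_denom z1 e)"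
    unfolding rotated_def using nz by (simp add: field_simps)
  then show ?thesis unfolding k by (simp add: divide_inverse)
qed

text \<open>On the circle \<open>e = cis \<theta>\<close> the function \<open>cos \<theta> - z sin \<theta>\<close> deforms to \<open>cos \<theta> - \<i> sin \<theta>\<close>, as the upper half plane is convex.\<close>

lemma turns_rot_denom:
  assumes "Im z > 0"
  shows "nonzero_loop (\<lambda>\<theta>. rot_denom z (cis \<theta>))" "turns (\<lambda>\<theta>. rot_denom z (cis \<theta>)) = -1"
proof -
  show l: "nonzero_loop (\<lambda>\<theta>. rot_denom z (cis \<theta>))"
    unfolding nonzero_loop_def using rot_denom_nonzero[OF assms, of "cis _"]
    by (auto simp: rot_denom_def intro!: continuous_intros)
  have c: "nonzero_loop cis" using nonzero_loop_cis[of 1] by simp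
  have "turns (\<lambda>\<theta>. cnj (cis \<theta>)) = turns (\<lambda>\<theta>. rot_denom z (cis \<theta>))"
  proof (rule turns_segment[OF nonzero_loop_cnj[OF c] l])
    fix \<theta> s :: real assume s: "0 \<le> s" "s \<le> 1"
    show "of_real (1 - s) * cnj (cis \<theta>) + of_real s * rot_denom z (cis \<theta>) \<noteq> 0"
    proof
      assume z: "of_real (1 - s) * cnj (cis \<theta>) + of_real s * rot_denom z (cis \<theta>) = 0"
      have re: "(1 - s) * cos \<theta> + s * (cos \<theta> - Re z * sin \<theta>) = 0"
        using arg_cong[OF z, of Re] by (simp add: rot_denom_def)
      have "sin \<theta> * ((1 - s) + s * Im z) = - Im (of_real (1 - s) * cnj (cis \<theta>) + of_real s * rot_denom z (cis \<theta>))"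
        by (simp add: rot_denom_def algebra_simps)
      also have "\<dots> = 0" unfolding z by simp
      finally have "sin \<theta> * ((1 - s) + s * Im z) = 0" .
      moreover have "(1 - s) + s * Im z > 0" using s assms by (cases "s = 0") (auto intro!: add_nonneg_pos)
      ultimately have "sin \<theta> = 0" by auto
      then show False using re sin_cos_squared_add[of \<theta>] by (simp add: algebra_simps)
    qed
  qed
  then show "turns (\<lambda>\<theta>. rot_denom z (cis \<theta>)) = -1" using turns_cnj[OF c] turns_cis by simp
qed

context affine_quartic begin

text \<open>The defect for distance \<open>1 / \<epsilon>\<close> in the coordinate \<open>\<epsilon> t\<close>, which extends to \<open>\<epsilon> = 0\<close>, that is, to the line at infinity.\<close>

definition scaled_defect :: "complex \<Rightarrow> real \<Rightarrow> complex" where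
  "scaled_defect e \<epsilon> = defect_of (dir e) (dir (\<i> * e) + \<epsilon> *s e3)"

lemma line_defect_scaled:
  assumes "r > 0"
  shows "line_defect e r = Complex (r ^ 4 * Re (scaled_defect e (1 / r))) (r ^ 3 * Im (scaled_defect e (1 / r)))"
proof -
  have f: "foot e r = r *s (dir (\<i> * e) + (1 / r) *s e3)" using assms by (simp add: foot_def vec_eq_iff algebra_simps)
  let ?E = "dir e" and ?Q = "dir (\<i> * e) + (1 / r) *s e3"
  have "line_defect e r = sqrt_defect (r * (4 * \<phi> ?E ?E ?E ?Q / lead ?E)) (r ^ 2 * (6 * \<phi> ?E ?E ?Q ?Q / lead ?E))
     (r ^ 3 * (4 * \<phi> ?E ?Q ?Q ?Q / lead ?E)) (r ^ 4 * (\<phi> ?Q ?Q ?Q ?Q / lead ?E))"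
    unfolding line_defect_def f defect_of_def R.scale1 R.scale2 R.scale3 R.scale4
    by (simp add: power2_eq_square power3_eq_cube power4_eq_xxxx mult_ac)
  then show ?thesis unfolding sqrt_defect_def sqrt_defect_scale scaled_defect_def defect_of_def by simp
qed

lemma continuous_on_scaled_defect:
  assumes "continuous_on S f" "continuous_on S g" "\<And>x. x \<in> S \<Longrightarrow> f x \<noteq> 0"
  shows "continuous_on S (\<lambda>x. scaled_defect (f x) (g x))"
  unfolding scaled_defect_def
  by (intro continuous_on_defect_of continuous_intros continuous_on_smult assms lead_dir_nonzero)

lemma scaled_defect_periodic: "scaled_defect (cis (\<theta> + 2 * pi)) \<epsilon> = scaled_defect (cis \<theta>) \<epsilon>"
  by (simp add: cis_mult[symmetric])

text \<open>Real and imaginary parts scale by different positive factors, which does not change the number of turns.\<close>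

lemma turns_line_defect_scaled:
  assumes B: "B > 0" and nz: "\<And>\<theta>. line_defect (cis \<theta>) B \<noteq> 0"
  shows "nonzero_loop (\<lambda>\<theta>. scaled_defect (cis \<theta>) (1 / B))" "turns (\<lambda>\<theta>. line_defect (cis \<theta>) B) = turns (\<lambda>\<theta>. scaled_defect (cis \<theta>) (1 / B))"
proof -
  have l: "nonzero_loop (\<lambda>\<theta>. line_defect (cis \<theta>) B)"
    unfolding nonzero_loop_def
    by (intro conjI allI nz continuous_on_line_defect continuous_intros) (simp_all add: cis_mult[symmetric])
  have nz': "scaled_defect (cis \<theta>) (1 / B) \<noteq> 0" for \<theta>
    using nz[of \<theta>] line_defect_scaled[OF B, of "cis \<theta>"] by (auto simp: complex_eq_iff)
  show l': "nonzero_loop (\<lambda>\<theta>. scaled_defect (cis \<theta>) (1 / B))"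
    unfolding nonzero_loop_def
    by (intro conjI allI nz' scaled_defect_periodic continuous_on_scaled_defect continuous_intros) simp_all
  show "turns (\<lambda>\<theta>. line_defect (cis \<theta>) B) = turns (\<lambda>\<theta>. scaled_defect (cis \<theta>) (1 / B))"
  proof (rule turns_segment[OF l l'])
    fix \<theta> s :: real assume s: "0 \<le> s" "s \<le> 1"
    let ?D = "scaled_defect (cis \<theta>) (1 / B)"
    have p: "(1 - s) * B ^ n + s > 0" for n
      using s B by (cases "s = 0") (auto intro!: add_nonneg_pos)
    have "of_real (1 - s) * line_defect (cis \<theta>) B + of_real s * ?D =
       Complex (((1 - s) * B ^ 4 + s) * Re ?D) (((1 - s) * B ^ 3 + s) * Im ?D)"
      unfolding line_defect_scaled[OF B] by (simp add: complex_eq_iff algebra_simps)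
    then show "of_real (1 - s) * line_defect (cis \<theta>) B + of_real s * ?D \<noteq> 0"
      using p[of 4] p[of 3] nz'[of \<theta>] by (auto simp: complex_eq_iff)
  qed
qed

lemma scaled_defect_nonzero:
  assumes "\<And>\<theta> r. r \<ge> B \<Longrightarrow> line_defect (cis \<theta>) r \<noteq> 0" "B > 0" "0 < \<epsilon>" "\<epsilon> \<le> 1 / B"
  shows "scaled_defect (cis \<theta>) \<epsilon> \<noteq> 0"
proof
  assume z: "scaled_defect (cis \<theta>) \<epsilon> = 0"
  have "1 / \<epsilon> \<ge> B" using assms(2-4) by (simp add: field_simps)
  then have "line_defect (cis \<theta>) (1 / \<epsilon>) \<noteq> 0" by (rule assms(1))
  moreover have "line_defect (cis \<theta>) (1 / \<epsilon>) = 0"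
    using line_defect_scaled[of "1 / \<epsilon>" "cis \<theta>"] assms(3) z by (simp add: complex_eq_iff)
  ultimately show False by simp
qed

text \<open>The two roots of the quartic at infinity in the upper half plane, in the coordinate \<open>x / y\<close> of the point \<open>x e1 + y e2\<close>.\<close>

definition inf_roots :: "complex \<Rightarrow> complex \<Rightarrow> bool" where
  "inf_roots z0 z1 \<longleftrightarrow> Im z0 > 0 \<and> Im z1 > 0 \<and> (\<forall>x y. lead (x *s e1 + y *s e2) =
      lead e1 * ((x - Re z0 * y)\<^sup>2 + (Im z0 * y)\<^sup>2) * ((x - Re z1 * y)\<^sup>2 + (Im z1 * y)\<^sup>2))"

lemma lead_e1_nonzero: "lead e1 \<noteq> 0"
  using lead_dir_nonzero[of 1] by (simp add: dir_def)

lemma inf_roots_exist: "\<exists>z0 z1. inf_roots z0 z1"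
proof -
  define a3 a2 a1 a0 where "a3 = 4 * \<phi> e1 e1 e1 e2 / lead e1" and "a2 = 6 * \<phi> e1 e1 e2 e2 / lead e1"
    and "a1 = 4 * \<phi> e1 e2 e2 e2 / lead e1" and "a0 = \<phi> e2 e2 e2 e2 / lead e1"
  have H: "lead (x *s e1 + y *s e2) = lead e1 * (x ^ 4 + a3 * x ^ 3 * y + a2 * x\<^sup>2 * y\<^sup>2 + a1 * x * y ^ 3 + a0 * y ^ 4)" for x y
    unfolding lead_def[of "x *s e1 + y *s e2"] R.quartic_on_line a3_def a2_def a1_def a0_def using lead_e1_nonzero
    by (simp add: lead_def[symmetric] field_simps)
  have nr: "t ^ 4 + a3 * t ^ 3 + a2 * t\<^sup>2 + a1 * t + a0 \<noteq> 0" for t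
    using H[of t 1] lead_dir_nonzero[of "Complex t 1"] by (auto simp: dir_def complex_eq_iff)
  obtain x0 y0 x1 y1 where *: "y0 > 0" "y1 > 0" "a3 = - 2 * (x0 + x1)" "a2 = x0\<^sup>2 + y0\<^sup>2 + x1\<^sup>2 + y1\<^sup>2 + 4 * x0 * x1"
    "a1 = - 2 * (x0 * (x1\<^sup>2 + y1\<^sup>2) + x1 * (x0\<^sup>2 + y0\<^sup>2))" "a0 = (x0\<^sup>2 + y0\<^sup>2) * (x1\<^sup>2 + y1\<^sup>2)"
    by (rule real_quartic_without_real_roots[OF nr]) (rule that)
  have "inf_roots (Complex x0 y0) (Complex x1 y1)"
    unfolding inf_roots_def H *(3-6) using *(1,2)
    by (simp add: power2_eq_square power3_eq_cube power4_eq_xxxx algebra_simps)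
  then show ?thesis by blast
qed

lemma lead_along_rotated:
  assumes z: "inf_roots z0 z1" and e: "norm e = 1"
  shows "lead (u *s dir e + dir (\<i> * e)) = lead e1 * (norm (rot_denom z0 e))\<^sup>2 * (norm (rot_denom z1 e))\<^sup>2 *
     ((u - Re (rotated z0 e))\<^sup>2 + (Im (rotated z0 e))\<^sup>2) * ((u - Re (rotated z1 e))\<^sup>2 + (Im (rotated z1 e))\<^sup>2)"
proof -
  have E: "u *s dir e + dir (\<i> * e) = (u * Re e - Im e) *s e1 + (u * Im e + Re e) *s e2"
    by (simp add: dir_def vec_eq_iff algebra_simps)
  have f: "((u * Re e - Im e) - Re z * (u * Im e + Re e))\<^sup>2 + (Im z * (u * Im e + Re e))\<^sup>2 =
     (norm (rot_denom z e))\<^sup>2 * ((u - Re (rotated z e))\<^sup>2 + (Im (rotated z e))\<^sup>2)" if "Im z > 0" for z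
  proof -
    have nz: "rot_denom z e \<noteq> 0" by (rule rot_denom_nonzero[OF that unit_nonzero[OF e]])
    have k: "of_real (u * Re e - Im e) - z * of_real (u * Im e + Re e) = rot_denom z e * (of_real u - rotated z e)"
      unfolding rotated_def using nz by (simp add: field_simps) (simp add: rot_denom_def algebra_simps)
    have "(norm (of_real (u * Re e - Im e) - z * of_real (u * Im e + Re e)))\<^sup>2 = (norm (rot_denom z e))\<^sup>2 * (norm (of_real u - rotated z e))\<^sup>2"
      unfolding k by (simp add: norm_mult power_mult_distrib)
    then show ?thesis unfolding cmod_power2[of "of_real u - rotated z e"] cmod_power2[of "of_real (u * Re e - Im e) - z * of_real (u * Im e + Re e)"]
      by simp
  qed
  have i: "Im z0 > 0" "Im z1 > 0" using z by (auto simp: inf_roots_def)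
  have L: "lead (x *s e1 + y *s e2) = lead e1 * ((x - Re z0 * y)\<^sup>2 + (Im z0 * y)\<^sup>2) * ((x - Re z1 * y)\<^sup>2 + (Im z1 * y)\<^sup>2)" for x y
    using z unfolding inf_roots_def by blast
  show ?thesis unfolding E L f[OF i(1)] f[OF i(2)] by (simp only: mult_ac)
qed

lemma scaled_defect_at_infinity:
  assumes z: "inf_roots z0 z1" and e: "norm e = 1"
  defines "x0 \<equiv> Re (rotated z0 e)" and "y0 \<equiv> Im (rotated z0 e)" and "x1 \<equiv> Re (rotated z1 e)" and "y1 \<equiv> Im (rotated z1 e)"
  defines "E \<equiv> dir e" and "N \<equiv> dir (\<i> * e)"
  shows "4 * \<phi> E E E N / lead E = - 2 * (x0 + x1)" "6 * \<phi> E E N N / lead E = x0\<^sup>2 + y0\<^sup>2 + x1\<^sup>2 + y1\<^sup>2 + 4 * x0 * x1"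
    "4 * \<phi> E N N N / lead E = - 2 * (x0 * (x1\<^sup>2 + y1\<^sup>2) + x1 * (x0\<^sup>2 + y0\<^sup>2))" "\<phi> N N N N / lead E = (x0\<^sup>2 + y0\<^sup>2) * (x1\<^sup>2 + y1\<^sup>2)"
    "lead E = lead e1 * (norm (rot_denom z0 e))\<^sup>2 * (norm (rot_denom z1 e))\<^sup>2"
proof -
  define k where "k = lead e1 * (norm (rot_denom z0 e))\<^sup>2 * (norm (rot_denom z1 e))\<^sup>2"
  have "(\<phi> N N N N - k * ((x0\<^sup>2 + y0\<^sup>2) * (x1\<^sup>2 + y1\<^sup>2))) + (4 * \<phi> E N N N - k * (- 2 * (x0 * (x1\<^sup>2 + y1\<^sup>2) + x1 * (x0\<^sup>2 + y0\<^sup>2)))) * u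
     + (6 * \<phi> E E N N - k * (x0\<^sup>2 + y0\<^sup>2 + x1\<^sup>2 + y1\<^sup>2 + 4 * x0 * x1)) * u\<^sup>2 + (4 * \<phi> E E E N - k * (- 2 * (x0 + x1))) * u ^ 3 + (lead E - k) * u ^ 4 = 0" for u
  proof -
    have "lead (u *s E + 1 *s N) = k * ((u - x0)\<^sup>2 + y0\<^sup>2) * ((u - x1)\<^sup>2 + y1\<^sup>2)"
      using lead_along_rotated[OF z e, of u] by (simp add: E_def N_def k_def x0_def y0_def x1_def y1_def)
    then have "lead E * u ^ 4 + 4 * \<phi> E E E N * u ^ 3 + 6 * \<phi> E E N N * u\<^sup>2 + 4 * \<phi> E N N N * u + \<phi> N N N N
      = k * ((u - x0)\<^sup>2 + y0\<^sup>2) * ((u - x1)\<^sup>2 + y1\<^sup>2)"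
      unfolding lead_def R.quartic_on_line by simp
    also have "\<dots> = k * (u ^ 4 - 2 * (x0 + x1) * u ^ 3 + (x0\<^sup>2 + y0\<^sup>2 + x1\<^sup>2 + y1\<^sup>2 + 4 * x0 * x1) * u\<^sup>2
       - 2 * (x0 * (x1\<^sup>2 + y1\<^sup>2) + x1 * (x0\<^sup>2 + y0\<^sup>2)) * u + (x0\<^sup>2 + y0\<^sup>2) * (x1\<^sup>2 + y1\<^sup>2))"
      by (simp add: power2_eq_square power3_eq_cube power4_eq_xxxx algebra_simps)
    finally show ?thesis by (simp add: algebra_simps)
  qed
  note q = quartic_poly_zero[OF this]
  have k: "lead E = k" using q(5) by simp
  have "e \<noteq> 0" using e by auto
  then have k0: "k \<noteq> 0" using lead_dir_nonzero[of e] k by (simp add: E_def)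
  show "lead E = lead e1 * (norm (rot_denom z0 e))\<^sup>2 * (norm (rot_denom z1 e))\<^sup>2" using k by (simp add: k_def)
  have "4 * \<phi> E E E N = k * (- 2 * (x0 + x1))" "6 * \<phi> E E N N = k * (x0\<^sup>2 + y0\<^sup>2 + x1\<^sup>2 + y1\<^sup>2 + 4 * x0 * x1)"
     "4 * \<phi> E N N N = k * (- 2 * (x0 * (x1\<^sup>2 + y1\<^sup>2) + x1 * (x0\<^sup>2 + y0\<^sup>2)))" "\<phi> N N N N = k * ((x0\<^sup>2 + y0\<^sup>2) * (x1\<^sup>2 + y1\<^sup>2))"
    using q by simp_all
  then show "4 * \<phi> E E E N / lead E = - 2 * (x0 + x1)" "6 * \<phi> E E N N / lead E = x0\<^sup>2 + y0\<^sup>2 + x1\<^sup>2 + y1\<^sup>2 + 4 * x0 * x1"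
    "4 * \<phi> E N N N / lead E = - 2 * (x0 * (x1\<^sup>2 + y1\<^sup>2) + x1 * (x0\<^sup>2 + y0\<^sup>2))" "\<phi> N N N N / lead E = (x0\<^sup>2 + y0\<^sup>2) * (x1\<^sup>2 + y1\<^sup>2)"
    unfolding k using k0 by simp_all
qed

lemma scaled_defect_0_segment:
  assumes z: "inf_roots z0 z1" "z0 \<noteq> z1" and e: "norm e = 1" and t: "0 \<le> t" "t \<le> 1"
  shows "of_real (1 - t) * scaled_defect e 0 + of_real t * (rotated z0 e - rotated z1 e)\<^sup>2 \<noteq> 0"
proof -
  have i: "Im z0 > 0" "Im z1 > 0" using z(1) by (auto simp: inf_roots_def)
  have "rotated z0 e \<noteq> rotated z1 e"
  proof
    assume "rotated z0 e = rotated z1 e"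
    then have "(z0 - z1) * inverse (rot_denom z0 e) * inverse (rot_denom z1 e) = 0" using rotated_diff[OF i e] by simp
    then show False using z(2) rot_denom_nonzero[OF i(1) unit_nonzero[OF e]] rot_denom_nonzero[OF i(2) unit_nonzero[OF e]] by simp
  qed
  then have ne: "Complex (Re (rotated z0 e)) (Im (rotated z0 e)) \<noteq> Complex (Re (rotated z1 e)) (Im (rotated z1 e))" by simp
  have "scaled_defect e 0 = defect_of (dir e) (dir (\<i> * e))" by (simp add: scaled_defect_def)
  then have sd: "scaled_defect e 0 = sqrt_defect (- 2 * (Re (rotated z0 e) + Re (rotated z1 e)))
      ((Re (rotated z0 e))\<^sup>2 + (Im (rotated z0 e))\<^sup>2 + (Re (rotated z1 e))\<^sup>2 + (Im (rotated z1 e))\<^sup>2 + 4 * Re (rotated z0 e) * Re (rotated z1 e))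
      (- 2 * (Re (rotated z0 e) * ((Re (rotated z1 e))\<^sup>2 + (Im (rotated z1 e))\<^sup>2) + Re (rotated z1 e) * ((Re (rotated z0 e))\<^sup>2 + (Im (rotated z0 e))\<^sup>2)))
      (((Re (rotated z0 e))\<^sup>2 + (Im (rotated z0 e))\<^sup>2) * ((Re (rotated z1 e))\<^sup>2 + (Im (rotated z1 e))\<^sup>2))"
    unfolding defect_of_def scaled_defect_at_infinity(1-4)[OF z(1) e] .
  show ?thesis
    unfolding sd by (rule sqrt_defect_roots_segment[OF Im_rotated[OF i(1) e] Im_rotated[OF i(2) e] t ne, unfolded complex_surj])
qed

text \<open>By \<open>rotated_diff\<close>, the square of the difference of the rotated roots is a constant divided by the square of a product of two functions
  that turn \<open>-1\<close> times.\<close>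

lemma turns_scaled_defect_0:
  assumes z: "inf_roots z0 z1" "z0 \<noteq> z1"
  shows "turns (\<lambda>\<theta>. scaled_defect (cis \<theta>) 0) = 4"
proof -
  have i: "Im z0 > 0" "Im z1 > 0" using z(1) by (auto simp: inf_roots_def)
  note r0 = turns_rot_denom[OF i(1)] and r1 = turns_rot_denom[OF i(2)]
  define \<psi> where "\<psi> \<theta> = ((z0 - z1) * inverse (rot_denom z0 (cis \<theta>)) * inverse (rot_denom z1 (cis \<theta>))) ^ 2" for \<theta>
  have c: "nonzero_loop (\<lambda>_. z0 - z1)" by (rule nonzero_loop_const) (use z(2) in simp)
  note l1 = nonzero_loop_mult[OF c nonzero_loop_inverse[OF r0(1)]]
  note l2 = nonzero_loop_mult[OF l1 nonzero_loop_inverse[OF r1(1)]]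
  have l: "nonzero_loop \<psi>" unfolding \<psi>_def by (rule nonzero_loop_power[OF l2])
  have "turns \<psi> = 4"
    unfolding \<psi>_def turns_power[OF l2] turns_mult[OF l1 nonzero_loop_inverse[OF r1(1)]] turns_mult[OF c nonzero_loop_inverse[OF r0(1)]]
      turns_inverse[OF r0(1)] turns_inverse[OF r1(1)] r0(2) r1(2) using z(2) by (simp add: turns_const)
  have seg: "of_real (1 - t) * scaled_defect (cis \<theta>) 0 + of_real t * \<psi> \<theta> \<noteq> 0" if "0 \<le> t" "t \<le> 1" for t \<theta>
    using scaled_defect_0_segment[OF z _ that, of "cis \<theta>"] rotated_diff[OF i, of "cis \<theta>"] by (simp add: \<psi>_def)
  have "turns (\<lambda>\<theta>. scaled_defect (cis \<theta>) 0) = turns \<psi>"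
  proof (rule turns_segment[OF _ l seg])
    show "nonzero_loop (\<lambda>\<theta>. scaled_defect (cis \<theta>) 0)"
      unfolding nonzero_loop_def
      using seg[of 0] by (intro conjI allI scaled_defect_periodic continuous_on_scaled_defect continuous_intros) simp_all
  qed
  then show ?thesis using \<open>turns \<psi> = 4\<close> by simp
qed

text \<open>The difference quotient of \<open>scaled_defect\<close> between \<open>0\<close> and \<open>\<epsilon>\<close> as a polynomial in \<open>\<epsilon>\<close>, so that it is also defined for \<open>\<epsilon> = 0\<close>. The formula
  comes from \<open>sqrt_defect_perturb\<close>.\<close>

definition defect_slope :: "complex \<Rightarrow> real \<Rightarrow> complex" where
  "defect_slope e \<epsilon> = (let E = dir e; N = dir (\<i> * e); c = lead E; a3 = 4 * \<phi> E E E N / c; rq = root_q a3 (6 * \<phi> E E N N / c);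
      b3 = 4 * \<phi> E E E e3 / c; b2 = (12 * \<phi> E E N e3 + \<epsilon> * (6 * \<phi> E E e3 e3)) / c;
      b1 = (12 * \<phi> E N N e3 + \<epsilon> * (12 * \<phi> E N e3 e3) + \<epsilon>\<^sup>2 * (4 * \<phi> E e3 e3 e3)) / c;
      b0 = (4 * \<phi> N N N e3 + \<epsilon> * (6 * \<phi> N N e3 e3) + \<epsilon>\<^sup>2 * (4 * \<phi> N e3 e3 e3) + \<epsilon> ^ 3 * \<phi> e3 e3 e3 e3) / c;
      q1 = (b2 - a3 * b3 / 2 - \<epsilon> * (b3 / 2)\<^sup>2) / 2
    in Complex (b0 - 2 * rq * q1 - \<epsilon> * q1\<^sup>2) (b1 - a3 * q1 - b3 * rq - \<epsilon> * b3 * q1))"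

lemma scaled_defect_expand:
  "scaled_defect e \<epsilon> = scaled_defect e 0 + of_real \<epsilon> * defect_slope e \<epsilon>"
proof -
  define E N c where "E = dir e" and "N = dir (\<i> * e)" and "c = lead E"
  note sw = R.swap12 R.swap23 R.swap34
  have s: "\<phi> E E e3 N = \<phi> E E N e3" "\<phi> E e3 N N = \<phi> E N N e3" "\<phi> E N e3 N = \<phi> E N N e3"
    "\<phi> E e3 e3 N = \<phi> E N e3 e3" "\<phi> E e3 N e3 = \<phi> E N e3 e3" by (metis sw)+
  have 3: "4 * \<phi> E E E (N + \<epsilon> *s e3) / c = 4 * \<phi> E E E N / c + \<epsilon> * (4 * \<phi> E E E e3 / c)"
    unfolding R.multilinear by (simp add: add_divide_distrib algebra_simps)
  have 2: "6 * \<phi> E E (N + \<epsilon> *s e3) (N + \<epsilon> *s e3) / c = 6 * \<phi> E E N N / c + \<epsilon> * ((12 * \<phi> E E N e3 + \<epsilon> * (6 * \<phi> E E e3 e3)) / c)"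
    unfolding R.multilinear s by (simp add: add_divide_distrib algebra_simps)
  have 1: "4 * \<phi> E (N + \<epsilon> *s e3) (N + \<epsilon> *s e3) (N + \<epsilon> *s e3) / c = 4 * \<phi> E N N N / c
     + \<epsilon> * ((12 * \<phi> E N N e3 + \<epsilon> * (12 * \<phi> E N e3 e3) + \<epsilon>\<^sup>2 * (4 * \<phi> E e3 e3 e3)) / c)"
    unfolding R.multilinear s by (simp add: add_divide_distrib algebra_simps power2_eq_square)
  have 0: "quartic_at \<phi> (N + \<epsilon> *s e3) / c = \<phi> N N N N / c
     + \<epsilon> * ((4 * \<phi> N N N e3 + \<epsilon> * (6 * \<phi> N N e3 e3) + \<epsilon>\<^sup>2 * (4 * \<phi> N e3 e3 e3) + \<epsilon> ^ 3 * \<phi> e3 e3 e3 e3) / c)"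
    using R.quartic_on_line[of 1 N \<epsilon> e3] by (simp add: add_divide_distrib algebra_simps power2_eq_square power3_eq_cube power4_eq_xxxx)
  have "scaled_defect e 0 = defect_of E N" by (simp add: scaled_defect_def E_def N_def)
  then show ?thesis
    unfolding scaled_defect_def[of e \<epsilon>] E_def[symmetric] N_def[symmetric] defect_of_def c_def[symmetric] 3 2 1 0
    unfolding sqrt_defect_def sqrt_defect_perturb defect_slope_def Let_def E_def[symmetric] N_def[symmetric] c_def[symmetric]
    by (simp add: complex_eq_iff)
qed

lemma continuous_on_defect_slope:
  assumes "continuous_on S f" "continuous_on S g" "\<And>x. x \<in> S \<Longrightarrow> f x \<noteq> 0"
  shows "continuous_on S (\<lambda>x. defect_slope (f x) (g x))"
proof -
  have l: "continuous_on S (\<lambda>x. lead (dir (f x)))" unfolding lead_def by (intro R.continuous_on_form continuous_intros assms)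
  show ?thesis unfolding defect_slope_def Let_def root_q_def
    by (intro continuous_on_Complex continuous_on_add continuous_on_diff continuous_on_mult continuous_on_divide continuous_on_power continuous_on_const
       R.continuous_on_form continuous_on_dir assms l ballI lead_dir_nonzero) simp_all
qed

text \<open>Two conjugate pairs of roots form a square exactly if the pairs coincide.\<close>

lemma square_at_infinity_iff:
  assumes z: "inf_roots z0 z1" shows "(\<exists>q. square_on \<Phi> (cv e1) (cv e2) q) \<longleftrightarrow> z0 = z1"
proof -
  have i: "Im z0 > 0" "Im z1 > 0" using z by (auto simp: inf_roots_def)
  have d: "dir 1 = e1" "dir (\<i> * 1) = e2" by (simp_all add: dir_def)
  have s: "defect_of e1 e2 = scaled_defect 1 0" unfolding scaled_defect_def d by simp
  have "defect_of e1 e2 = 0 \<longleftrightarrow> z0 = z1"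
  proof
    assume "defect_of e1 e2 = 0"
    then show "z0 = z1" using scaled_defect_0_segment[OF z, of 1 0] unfolding s by auto
  next
    assume eq: "z0 = z1"
    show "defect_of e1 e2 = 0"
      unfolding defect_of_def scaled_defect_at_infinity(1-4)[OF z norm_one, unfolded d] eq by (rule sqrt_defect_double_root)
  qed
  then show ?thesis using square_on_iff_defect_of[OF lead_e1_nonzero] by simp
qed

lemma basis3_e: "basis3 (cv e1) (cv e2) (cv e3)"
  unfolding basis3_def indep2_def
proof (intro conjI allI impI)
  fix x y assume "x *s cv e1 + y *s cv e2 = 0"
  then show "x = 0" "y = 0" using independent[of x y 0] by auto
qed (use basis in blast)

text \<open>If the line at infinity is bitangent, then the first order term of the remainder \<open>G\<^sub>1 t + G\<^sub>0\<close> is the cubic part of the affine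
  equation reduced modulo the quadratic with the rotated root \<open>m\<close>; its value at \<open>t = m\<close> is the value of the cubic part at the
  tangency point \<open>\<xi>\<close>, up to the normalization of coordinates.\<close>

lemma defect_slope_at_root:
  assumes z: "inf_roots z z" and e: "norm e = 1"
  defines "\<xi> \<equiv> z *s cv e1 + cv e2"
  shows "of_real (Re (defect_slope e 0)) + rotated z e * of_real (Im (defect_slope e 0)) =
     4 * \<Phi> \<xi> \<xi> \<xi> (cv e3) / (of_real (lead (dir e)) * rot_denom z e ^ 3)"
proof -
  have i: "Im z > 0" using z by (auto simp: inf_roots_def)
  define E N c m where "E = dir e" and "N = dir (\<i> * e)" and "c = lead E" and "m = rotated z e"
  have e0: "e \<noteq> 0" using e by auto
  have c: "c \<noteq> 0" using lead_dir_nonzero[OF e0] by (simp add: c_def E_def)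
  note inf = scaled_defect_at_infinity[OF z e, folded m_def E_def N_def c_def]
  define a3 rq b3 b2 b1 b0 where "a3 = 4 * \<phi> E E E N / c" and "rq = root_q a3 (6 * \<phi> E E N N / c)"
    and "b3 = 4 * \<phi> E E E e3 / c" and "b2 = 12 * \<phi> E E N e3 / c" and "b1 = 12 * \<phi> E N N e3 / c" and "b0 = 4 * \<phi> N N N e3 / c"
  define q1 where "q1 = (b2 - a3 * b3 / 2) / 2"
  have slope: "defect_slope e 0 = Complex (b0 - 2 * rq * q1) (b1 - a3 * q1 - b3 * rq)"
    unfolding defect_slope_def Let_def E_def[symmetric] N_def[symmetric] c_def[symmetric]
    by (simp add: a3_def rq_def b3_def b2_def b1_def b0_def q1_def)
  have a3: "a3 = - 4 * Re m" unfolding a3_def using inf(1) by simp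
  have rq: "rq = (Re m)\<^sup>2 + (Im m)\<^sup>2" unfolding rq_def a3 inf(2) root_q_def by (simp add: power2_eq_square field_simps)
  have root: "m\<^sup>2 + of_real (a3 / 2) * m + of_real rq = 0"
    unfolding a3 rq by (simp add: complex_eq_iff power2_eq_square algebra_simps)
  have "of_real (b0 - 2 * rq * q1) + m * of_real (b1 - a3 * q1 - b3 * rq) =
     of_real b3 * m ^ 3 + of_real b2 * m\<^sup>2 + of_real b1 * m + of_real b0
      - (m\<^sup>2 + of_real (a3 / 2) * m + of_real rq) * (of_real b3 * m + 2 * of_real q1)"
    unfolding q1_def by (simp add: power2_eq_square power3_eq_cube field_simps)
  also have "\<dots> = of_real b3 * m ^ 3 + of_real b2 * m\<^sup>2 + of_real b1 * m + of_real b0" unfolding root by simp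
  also have "\<dots> = 4 / of_real c * polar_at \<Phi> (m *s cv E + 1 *s cv N) (cv e3)"
    unfolding cubic_on_line form_cv b3_def b2_def b1_def b0_def using c by (simp add: field_simps)
  also have "m *s cv E + 1 *s cv N = inverse (rot_denom z e) *s \<xi>"
  proof -
    have nz: "rot_denom z e \<noteq> 0" by (rule rot_denom_nonzero[OF i e0])
    have ee: "complex_of_real (Re e) * of_real (Re e) + of_real (Im e) * of_real (Im e) = 1"
      using e by (simp add: cmod_def power2_eq_square flip: of_real_mult of_real_add)
    have mm: "m * rot_denom z e = of_real (Im e) + z * of_real (Re e)" using nz by (simp add: m_def rotated_def)
    have 1: "m * of_real (Re e) - of_real (Im e) = z * inverse (rot_denom z e)"
    proof -
      have "(m * of_real (Re e) - of_real (Im e)) * rot_denom z e = (m * rot_denom z e) * of_real (Re e) - of_real (Im e) * rot_denom z e"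
        by (simp add: algebra_simps)
      also have "\<dots> = z * (of_real (Re e) * of_real (Re e) + of_real (Im e) * of_real (Im e))"
        unfolding mm by (simp add: rot_denom_def algebra_simps)
      finally show ?thesis unfolding ee using nz by (simp add: field_simps)
    qed
    have 2: "m * of_real (Im e) + of_real (Re e) = inverse (rot_denom z e)"
    proof -
      have "(m * of_real (Im e) + of_real (Re e)) * rot_denom z e = (m * rot_denom z e) * of_real (Im e) + of_real (Re e) * rot_denom z e"
        by (simp add: algebra_simps)
      also have "\<dots> = of_real (Re e) * of_real (Re e) + of_real (Im e) * of_real (Im e)"
        unfolding mm by (simp add: rot_denom_def algebra_simps)
      finally show ?thesis unfolding ee using nz by (simp add: field_simps)
    qed
    have "m *s cv E + 1 *s cv N = (m * of_real (Re e) - of_real (Im e)) *s cv e1 + (m * of_real (Im e) + of_real (Re e)) *s cv e2"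
      unfolding E_def N_def dir_def by (simp add: map_vec3_def vec_eq_iff algebra_simps)
    then show ?thesis unfolding 1 2 \<xi>_def by (simp add: vec_eq_iff algebra_simps)
  qed
  finally show ?thesis unfolding slope E_def[symmetric] c_def[symmetric] m_def[symmetric] scale1 scale2 scale3
    by (simp add: field_simps power3_eq_cube)
qed

text \<open>The tangency point at infinity is a smooth point of the quartic.\<close>

lemma cubic_part_nonzero:
  assumes z: "inf_roots z z"
  shows "polar_at \<Phi> (z *s cv e1 + cv e2) (cv e3) \<noteq> 0"
proof -
  obtain q where q: "square_on \<Phi> (cv e1) (cv e2) q" using square_at_infinity_iff[OF z] by blast
  have d: "dir 1 = e1" "dir (\<i> * 1) = e2" by (simp_all add: dir_def)
  have i: "Im z > 0" using z by (auto simp: inf_roots_def)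
  have r1: "rotated z 1 = z" by (simp add: rotated_def rot_denom_def)
  note inf = scaled_defect_at_infinity[OF z norm_one, unfolded d r1]
  define x y where "x = Re z" and "y = Im z"
  have root: "z\<^sup>2 - of_real (2 * x) * z + of_real (x\<^sup>2 + y\<^sup>2) = 0"
    by (simp add: x_def y_def complex_eq_iff power2_eq_square algebra_simps)
  have mul: "a = lead e1 * b" if "a / lead e1 = b" for a b using that lead_e1_nonzero by (simp add: field_simps)
  note c = inf(1-4)[unfolded x_def[symmetric] y_def[symmetric], THEN mul]
  have "quartic_at \<Phi> (z *s cv e1 + 1 *s cv e2) =
      of_real (lead e1) * z ^ 4 + of_real (4 * \<phi> e1 e1 e1 e2) * z ^ 3 + of_real (6 * \<phi> e1 e1 e2 e2) * z\<^sup>2 + of_real (4 * \<phi> e1 e2 e2 e2) * z + of_real (\<phi> e2 e2 e2 e2)"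
    unfolding quartic_on_line form_cv by (simp add: lead_def)
  also have "\<dots> = of_real (lead e1) * (z\<^sup>2 - of_real (2 * x) * z + of_real (x\<^sup>2 + y\<^sup>2))\<^sup>2"
    unfolding c by (simp add: power2_eq_square power3_eq_cube power4_eq_xxxx algebra_simps)
  also have "\<dots> = 0" unfolding root by simp
  finally have "binary_quadratic q z 1 = 0" using q unfolding square_on_def by (metis power_eq_0_iff)
  then show ?thesis using polar_nonzero_at_tangency[OF basis3_e q, of z 1] by simp
qed

text \<open>For \<open>Im m > 0\<close> the real-linear map \<open>G\<^sub>0 + \<i> G\<^sub>1 \<mapsto> G\<^sub>0 + m G\<^sub>1\<close> deforms to the identity through invertible maps. Its value is, up to a positive factor,
  a constant divided by the cube of a function that turns \<open>-1\<close> times.\<close>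

lemma turns_defect_slope_0:
  assumes z: "inf_roots z z"
  shows "nonzero_loop (\<lambda>\<theta>. defect_slope (cis \<theta>) 0)" "turns (\<lambda>\<theta>. defect_slope (cis \<theta>) 0) = 3"
proof -
  have i: "Im z > 0" using z by (auto simp: inf_roots_def)
  define \<xi> where "\<xi> = z *s cv e1 + cv e2"
  define K where "K = 4 * \<Phi> \<xi> \<xi> \<xi> (cv e3) / of_real (lead e1)"
  have K: "K \<noteq> 0" using cubic_part_nonzero[OF z] lead_e1_nonzero by (simp add: K_def \<xi>_def)
  note r = turns_rot_denom[OF i]
  have at_root: "of_real (Re (defect_slope (cis \<theta>) 0)) + rotated z (cis \<theta>) * of_real (Im (defect_slope (cis \<theta>) 0)) =
      of_real (inverse (norm (rot_denom z (cis \<theta>)) ^ 4)) * (K * inverse (rot_denom z (cis \<theta>)) ^ 3)" for \<theta>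
  proof -
    have "norm (cis \<theta>) = 1" by simp
    note * = defect_slope_at_root[OF z this] scaled_defect_at_infinity(5)[OF z this]
    have nz: "rot_denom z (cis \<theta>) \<noteq> 0" using rot_denom_nonzero[OF i, of "cis \<theta>"] by simp
    show ?thesis unfolding *(1) *(2) K_def \<xi>_def using nz lead_e1_nonzero
      by (simp add: field_simps power2_eq_square power4_eq_xxxx)
  qed
  have im: "Im (rotated z (cis \<theta>)) > 0" for \<theta> by (rule Im_rotated[OF i]) simp
  define \<psi> where "\<psi> \<theta> = K * inverse (rot_denom z (cis \<theta>)) ^ 3" for \<theta>
  have lc: "nonzero_loop (\<lambda>_. K)" by (rule nonzero_loop_const[OF K])
  have lp: "nonzero_loop (\<lambda>\<theta>. inverse (rot_denom z (cis \<theta>)) ^ 3)" by (rule nonzero_loop_power[OF nonzero_loop_inverse[OF r(1)]])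
  have l: "nonzero_loop \<psi>" unfolding \<psi>_def by (rule nonzero_loop_mult[OF lc lp])
  have t: "turns \<psi> = 3" unfolding \<psi>_def turns_mult[OF lc lp] turns_power[OF nonzero_loop_inverse[OF r(1)]] turns_inverse[OF r(1)] r(2)
    by (simp add: turns_const[OF K])
  have seg: "of_real (1 - s) * defect_slope (cis \<theta>) 0 + of_real s * \<psi> \<theta> \<noteq> 0" if s: "0 \<le> s" "s \<le> 1" for s \<theta>
  proof
    define D m k where "D = defect_slope (cis \<theta>) 0" and "m = rotated z (cis \<theta>)" and "k = norm (rot_denom z (cis \<theta>)) ^ 4"
    have k: "k > 0" using rot_denom_nonzero[OF i, of "cis \<theta>"] by (simp add: k_def)
    have "of_real (Re D) + m * of_real (Im D) = of_real (inverse k) * \<psi> \<theta>" using at_root[of \<theta>] by (simp add: D_def m_def k_def \<psi>_def)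
    then have psi: "\<psi> \<theta> = of_real k * (of_real (Re D) + m * of_real (Im D))" using k by (simp add: field_simps)
    assume "of_real (1 - s) * defect_slope (cis \<theta>) 0 + of_real s * \<psi> \<theta> = 0"
    then have eq: "of_real (1 - s) * D + of_real s * (of_real k * (of_real (Re D) + m * of_real (Im D))) = 0" unfolding psi D_def .
    have "(1 - s) * Im D + s * (k * (Im m * Im D)) = 0" using arg_cong[OF eq, of Im] by simp
    then have "Im D * ((1 - s) + s * (k * Im m)) = 0" by (simp add: algebra_simps)
    moreover have "(1 - s) + s * (k * Im m) > 0" using s k im[of \<theta>] by (cases "s = 0") (auto simp: m_def intro!: add_nonneg_pos mult_pos_pos)
    ultimately have ID: "Im D = 0" by auto
    then have "(1 - s) * Re D + s * (k * Re D) = 0" using arg_cong[OF eq, of Re] by simp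
    then have "Re D * ((1 - s) + s * k) = 0" by (simp add: algebra_simps)
    moreover have "(1 - s) + s * k > 0" using s k by (cases "s = 0") (auto intro!: add_nonneg_pos mult_pos_pos)
    ultimately have "Re D = 0" by auto
    then have "\<psi> \<theta> = 0" using ID psi by simp
    then show False using l by (simp add: nonzero_loop_def)
  qed
  show l': "nonzero_loop (\<lambda>\<theta>. defect_slope (cis \<theta>) 0)"
    unfolding nonzero_loop_def using seg[of 0]
    by (intro conjI allI continuous_on_defect_slope continuous_intros) (simp_all add: cis_mult[symmetric])
  show "turns (\<lambda>\<theta>. defect_slope (cis \<theta>) 0) = 3" using turns_segment[OF l' l seg] t by simp
qed

text \<open>The scaled defect deforms to its limit at \<open>\<epsilon> = 0\<close>, or, if this limit is zero, its quotient by \<open>\<epsilon>\<close> does.\<close>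

theorem turns_at_infinity:
  assumes B: "B > 0" and nz: "\<And>\<theta> r. r \<ge> B \<Longrightarrow> line_defect (cis \<theta>) r \<noteq> 0"
  shows "turns (\<lambda>\<theta>. line_defect (cis \<theta>) B) = (if \<exists>q. square_on \<Phi> (cv e1) (cv e2) q then 3 else 4)"
proof -
  obtain z0 z1 where z: "inf_roots z0 z1" using inf_roots_exist by blast
  have i: "Im z0 > 0" "Im z1 > 0" using z by (auto simp: inf_roots_def)
  note sc = turns_line_defect_scaled[OF B nz[OF order_refl]]
  have pos: "s / B \<le> 1 / B" if "s \<in> {0..1}" for s using that B by (simp add: divide_right_mono)
  show ?thesis
  proof (cases "z0 = z1")
    case False
    have nz0: "scaled_defect (cis \<theta>) 0 \<noteq> 0" for \<theta> using scaled_defect_0_segment[OF z False, of "cis \<theta>" 0] by simp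
    have "turns (\<lambda>\<theta>. scaled_defect (cis \<theta>) (0 / B)) = turns (\<lambda>\<theta>. scaled_defect (cis \<theta>) (1 / B))"
    proof (rule turns_homotopy[of "\<lambda>\<theta> s. scaled_defect (cis \<theta>) (s / B)"])
      show "continuous_on (UNIV \<times> {0..1}) (\<lambda>(\<theta>, s). scaled_defect (cis \<theta>) (s / B))"
        unfolding case_prod_beta using B by (intro continuous_on_scaled_defect continuous_intros) auto
      show "scaled_defect (cis \<theta>) (s / B) \<noteq> 0" if s: "s \<in> {0..1}" for \<theta> s
        using nz0 scaled_defect_nonzero[OF nz B _ pos[OF s]] s B by (cases "s = 0") auto
    qed (rule scaled_defect_periodic)
    then show ?thesis using sc(2) turns_scaled_defect_0[OF z False] square_at_infinity_iff[OF z] False by simp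
  next
    case True
    note z = z[folded True]
    have s0: "scaled_defect (cis \<theta>) 0 = 0" for \<theta>
      unfolding scaled_defect_def defect_of_def using scaled_defect_at_infinity(1-4)[OF z, of "cis \<theta>"] sqrt_defect_double_root by simp
    have ex: "scaled_defect (cis \<theta>) \<epsilon> = of_real \<epsilon> * defect_slope (cis \<theta>) \<epsilon>" for \<theta> \<epsilon> using scaled_defect_expand[of "cis \<theta>" \<epsilon>] s0 by simp
    note sl = turns_defect_slope_0[OF z]
    have nzs: "defect_slope (cis \<theta>) (s / B) \<noteq> 0" if s: "s \<in> {0..1}" for \<theta> s
    proof (cases "s = 0")
      case True then show ?thesis using sl(1) by (simp add: nonzero_loop_def)
    next
      case False
      then have "scaled_defect (cis \<theta>) (s / B) \<noteq> 0" using scaled_defect_nonzero[OF nz B _ pos[OF s]] s B by auto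
      then show ?thesis unfolding ex by auto
    qed
    have "turns (\<lambda>\<theta>. defect_slope (cis \<theta>) (0 / B)) = turns (\<lambda>\<theta>. defect_slope (cis \<theta>) (1 / B))"
    proof (rule turns_homotopy[of "\<lambda>\<theta> s. defect_slope (cis \<theta>) (s / B)"])
      show "continuous_on (UNIV \<times> {0..1}) (\<lambda>(\<theta>, s). defect_slope (cis \<theta>) (s / B))"
        unfolding case_prod_beta using B by (intro continuous_on_defect_slope continuous_intros) auto
    qed (simp_all add: nzs cis_mult[symmetric])
    moreover have "turns (\<lambda>\<theta>. scaled_defect (cis \<theta>) (1 / B)) = turns (\<lambda>\<theta>. defect_slope (cis \<theta>) (1 / B))"
    proof -
      have lc: "nonzero_loop (\<lambda>_. complex_of_real (1 / B))" by (rule nonzero_loop_const) (use B in simp)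
      have ls: "nonzero_loop (\<lambda>\<theta>. defect_slope (cis \<theta>) (1 / B))"
        unfolding nonzero_loop_def using nzs[of 1]
        by (intro conjI allI continuous_on_defect_slope continuous_intros) (simp_all add: cis_mult[symmetric])
      show ?thesis unfolding ex turns_mult[OF lc ls] using B by (simp add: turns_const)
    qed
    ultimately show ?thesis using sc(2) sl(2) square_at_infinity_iff[OF z] by simp
  qed
qed

end

section \<open>Types of bitangents\<close>

lemma linear_form_cv: "linear_form (cv l) (cv u) = of_real (linear_form l u)"
  by (simp add: linear_form_def map_vec3_def)

lemma cv_nonzero: "l \<noteq> 0 \<Longrightarrow> cv l \<noteq> 0"
  by (auto simp: map_vec3_def vec_eq_iff)

lemma base_change_of_real: "base_change of_real L = proj_point (cv (homvec L))"
  by (simp add: base_change_def)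

lemma base_change_proj_point:
  assumes "v \<noteq> 0" shows "base_change of_real (proj_point v) = proj_point (cv v)"
proof -
  obtain c where c: "c \<noteq> 0" "homvec (proj_point v) = c *s v" using homvec_proj_point[OF assms] .
  show ?thesis unfolding base_change_of_real c(2) cv_scale
    by (rule proj_point_scale) (use c(1) cv_nonzero[OF assms] in auto)
qed

lemma linear_form_has_derivative: "(linear_form (l :: complex^3) has_derivative linear_form l) (at x)"
proof -
  have "linear_form l = (\<lambda>x. \<Sum>i\<in>UNIV. l $ i * x $ i)" by (simp add: linear_form_def fun_eq_iff)
  moreover have "bounded_linear (\<lambda>x :: complex^3. \<Sum>i\<in>UNIV. l $ i * x $ i)"
    by (intro bounded_linear_sum bounded_linear_mult_right bounded_linear_compose[OF bounded_linear_mult_right bounded_linear_vec_nth])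
  ultimately show ?thesis using bounded_linear_imp_has_derivative by simp
qed

context ternary_quartic begin

text \<open>At a point \<open>z\<close> of the quartic, the differential of \<open>f / m\<^sup>4\<close> is \<open>4 polar_at \<Phi> z / m(z)\<^sup>4\<close>, and that of \<open>l / m\<close> is \<open>l / m(z)\<close> if \<open>l(z) = 0\<close>.
  Both vanish on the kernel of \<open>l\<close>, so that they can be compared on a single vector \<open>n\<close> outside.\<close>

lemma tangent_scalar_eq:
  assumes z: "linear_form l z = 0" "linear_form m z \<noteq> 0" "\<Phi> z z z z = 0" and n: "linear_form l n \<noteq> 0"
    and ker: "\<And>w. linear_form l w = 0 \<Longrightarrow> \<Phi> z z z w = 0"
  shows "tangent_scalar f m l z = 4 * \<Phi> z z z n / (linear_form l n * linear_form m z ^ 3)"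
proof -
  define c where "c = 4 * \<Phi> z z z n / (linear_form l n * linear_form m z ^ 3)"
  define D where "D w = 4 * \<Phi> z z z w / linear_form m z ^ 4" for w
  define E where "E w = linear_form l w / linear_form m z" for w
  note dm = linear_form_has_derivative[of m z] and dl = linear_form_has_derivative[of l z]
  have "((\<lambda>x. linear_form m x ^ 4) has_derivative (\<lambda>h. of_nat 4 * linear_form m h * linear_form m z ^ (4 - 1))) (at z)"
    by (rule has_derivative_power[OF dm])
  note D0 = has_derivative_divide'[OF has_derivative_poly_eval this]
  have D: "((\<lambda>x. poly_eval complex_of_real f x / linear_form m x ^ 4) has_derivative D) (at z)"
  proof (rule has_derivative_eq_rhs[OF D0], goal_cases)
    case 2
    show ?case
      by (rule ext, simp only: eval z(3) mult_zero_left diff_zero D_def, rule nonzero_mult_divide_mult_cancel_right) (use z(2) in simp)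
  qed (use z(2) in simp)
  from has_derivative_divide'[OF dl dm z(2)]
  have E: "((\<lambda>x. linear_form l x / linear_form m x) has_derivative E) (at z)"
    unfolding E_def z(1) using z(2) by (simp add: field_simps)
  have DE: "D w = c * E w" for w
  proof -
    define k where "k = linear_form l w / linear_form l n"
    have "linear_form l (w - k *s n) = 0" using n by (simp add: k_def)
    then have "\<Phi> z z z (w - k *s n) = 0" by (rule ker)
    moreover have "\<Phi> z z z w = \<Phi> z z z (w - k *s n) + k * \<Phi> z z z n"
      using add4[of z z z "w - k *s n" "k *s n"] by (simp add: scale4)
    ultimately have "\<Phi> z z z w = k * \<Phi> z z z n" by simp
    then show ?thesis using n z(2) by (simp add: D_def E_def c_def k_def field_simps eval_nat_numeral)
  qed
  have "(THE c. \<exists>D E. ((\<lambda>x. poly_eval complex_of_real f x / linear_form m x ^ 4) has_derivative D) (at z) \<and>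
     ((\<lambda>x. linear_form l x / linear_form m x) has_derivative E) (at z) \<and> (\<forall>w. D w = c * E w)) = c"
  proof (rule the_equality)
    show "\<exists>D E. ((\<lambda>x. poly_eval complex_of_real f x / linear_form m x ^ 4) has_derivative D) (at z) \<and>
     ((\<lambda>x. linear_form l x / linear_form m x) has_derivative E) (at z) \<and> (\<forall>w. D w = c * E w)"
      using D E DE by blast
    fix c' assume "\<exists>D E. ((\<lambda>x. poly_eval complex_of_real f x / linear_form m x ^ 4) has_derivative D) (at z) \<and>
     ((\<lambda>x. linear_form l x / linear_form m x) has_derivative E) (at z) \<and> (\<forall>w. D w = c' * E w)"
    then have "D n = c' * E n" using has_derivative_unique[OF D] has_derivative_unique[OF E] by metis
    moreover have "E n \<noteq> 0" using n z(2) by (simp add: E_def)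
    ultimately show "c' = c" using DE[of n] by simp
  qed
  then show ?thesis unfolding tangent_scalar_def c_def .
qed

text \<open>Both sides are invariant under scaling of \<open>z\<close>, so any homogeneous coordinates of the tangency point may be used.\<close>

lemma tangent_scalar_proj_point:
  assumes z: "linear_form l z = 0" "linear_form m z \<noteq> 0" "\<Phi> z z z z = 0" and n: "linear_form l n \<noteq> 0"
    and ker: "\<And>w. linear_form l w = 0 \<Longrightarrow> \<Phi> z z z w = 0"
  shows "tangent_scalar f m l (homvec (proj_point z)) = 4 * \<Phi> z z z n / (linear_form l n * linear_form m z ^ 3)"
proof -
  have "z \<noteq> 0" using z(2) by auto
  then obtain c where c: "c \<noteq> 0" "homvec (proj_point z) = c *s z" using homvec_proj_point by blast
  have "tangent_scalar f m l (c *s z) = 4 * polar_at \<Phi> (c *s z) n / (linear_form l n * linear_form m (c *s z) ^ 3)"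
    by (rule tangent_scalar_eq) (use z n ker c(1) in \<open>simp_all add: multilinear\<close>)
  then show ?thesis unfolding c(2) multilinear using c(1) n z(2) by (simp add: power_mult_distrib field_simps power3_eq_cube)
qed

lemma tangency_eq: "tangency_divisor f L Z \<Longrightarrow> tangency f L = Z"
  unfolding tangency_def using tangency_divisor_unique by blast

end

context smooth_ternary_quartic begin

text \<open>The hypotheses of \<open>tangent_scalar_proj_point\<close> at a tangency point, and the fact which makes the scalar nonzero.\<close>

lemma tangency_data:
  assumes uv: "indep2 u v" "linear_form (homvec L) u = 0" "linear_form (homvec L) v = 0"
    and q: "square_on \<Phi> u v q" and r: "binary_quadratic q x y = 0" "(x, y) \<noteq> (0, 0)"
  defines "z \<equiv> x *s u + y *s v"
  shows "linear_form (homvec L) z = 0" "\<Phi> z z z z = 0" "\<And>w. linear_form (homvec L) w = 0 \<Longrightarrow> \<Phi> z z z w = 0"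
    "linear_form (homvec L) n \<noteq> 0 \<Longrightarrow> \<Phi> z z z n \<noteq> 0"
proof -
  have q': "\<And>x y. quartic_at \<Phi> (x *s u + y *s v) = binary_quadratic q x y ^ 2"
    using q by (simp add: square_on_def)
  note g = gradient_at_square_root[OF q' r(1), folded z_def]
  show "linear_form (homvec L) z = 0" using uv by (simp add: z_def)
  show "\<Phi> z z z z = 0" using q'[of x y] r(1) by (simp add: z_def)
  show ker: "\<Phi> z z z w = 0" if w: "linear_form (homvec L) w = 0" for w
  proof -
    obtain a b where "w = a *s u + b *s v" using kernel_span[OF uv(1) homvec(1) uv(2,3) w] by blast
    then show ?thesis using g by (simp add: multilinear)
  qed
  show "\<Phi> z z z n \<noteq> 0" if "linear_form (homvec L) n \<noteq> 0"
    unfolding z_def by (rule polar_nonzero_at_tangency[OF basis3_of_kernel[OF uv that] q r])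
qed

lemma tangency_factored:
  assumes uv: "indep2 u v" "linear_form (homvec L) u = 0" "linear_form (homvec L) v = 0" and q: "square_on \<Phi> u v q"
    and fac: "\<And>x y. binary_quadratic q x y = (\<alpha> * x + \<beta> * y) * (\<gamma> * x + \<delta> * y)"
  shows "tangency f L = {# proj_point ((- \<beta>) *s u + \<alpha> *s v), proj_point ((- \<delta>) *s u + \<gamma> *s v) #}"
    "(\<alpha>, \<beta>) \<noteq> (0, 0)" "(\<gamma>, \<delta>) \<noteq> (0, 0)"
proof -
  have "q \<noteq> 0" by (rule square_on_line_nonzero[OF uv homvec(1) q])
  then have "\<not> (\<forall>x y. binary_quadratic q x y = 0)" using binary_quadratic_mult_zero[of q q] by auto
  then show nz: "(\<alpha>, \<beta>) \<noteq> (0, 0)" "(\<gamma>, \<delta>) \<noteq> (0, 0)" by (auto simp: fac)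
  show "tangency f L = {# proj_point ((- \<beta>) *s u + \<alpha> *s v), proj_point ((- \<delta>) *s u + \<gamma> *s v) #}"
    by (rule tangency_eq, rule tangency_divisor_of_square[OF uv _ nz]) (use q in \<open>simp add: square_on_def fac\<close>)
qed

text \<open>The scalars at the tangency points are nonzero, and all nonzero complex numbers define the same form of rank one.\<close>

lemma Qtype_complex:
  assumes "bitangent f L" shows "Qtype id f Linf L = \<langle>1\<rangle>"
proof -
  have bc: "base_change id L = L" by (simp add: base_change_def map_vec3_def homvec(2))
  have mv: "map_vec3 id (homvec L) = homvec L" by (simp add: map_vec3_def)
  have inv: "the_inv id (a :: complex) = a" for a using the_inv_f_f[of "id :: complex \<Rightarrow> complex" a] by simp
  obtain u v q where uv: "indep2 u v" "linear_form (homvec L) u = 0" "linear_form (homvec L) v = 0" and q: "square_on \<Phi> u v q"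
    using assms unfolding bitangent_iff bitangent_line_def by blast
  obtain \<alpha> \<beta> \<gamma> \<delta> where fac: "\<And>x y. binary_quadratic q x y = (\<alpha> * x + \<beta> * y) * (\<gamma> * x + \<delta> * y)"
    using binary_quadratic_factor[of q] by blast
  note T = tangency_factored[OF uv q fac]
  let ?m = "cv (homvec Linf)"
  obtain k where n: "linear_form (homvec L) (axis k 1) \<noteq> 0" using homvec(1)[of L] by (auto simp: vec_eq_iff linear_form_axis)
  have ts: "tangent_scalar f ?m (homvec L) (homvec (proj_point (x *s u + y *s v))) \<noteq> 0"
    if r: "binary_quadratic q x y = 0" "(x, y) \<noteq> (0, 0)" and nl: "\<not> on_line (proj_point (x *s u + y *s v)) (base_change of_real Linf)" for x y
  proof -
    let ?z = "x *s u + y *s v"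
    note d = tangency_data[OF uv q r]
    have z0: "?z \<noteq> 0" by (rule indep2_nonzero[OF uv(1) r(2)])
    have "linear_form ?m ?z \<noteq> 0"
      using nl unfolding on_line_proj_point[OF z0] base_change_of_real linear_form_homvec_proj_point[OF cv_nonzero[OF homvec(1)]] .
    then show ?thesis using tangent_scalar_proj_point[OF d(1) _ d(2) n d(3), of ?m] d(4)[OF n] n by simp
  qed
  let ?p1 = "proj_point ((- \<beta>) *s u + \<alpha> *s v)" and ?p2 = "proj_point ((- \<delta>) *s u + \<gamma> *s v)"
  show ?thesis
  proof (cases "\<forall>z\<in>#tangency f L. \<not> on_line z (base_change of_real Linf)")
    case True
    then have nl: "\<not> on_line ?p1 (base_change of_real Linf)" "\<not> on_line ?p2 (base_change of_real Linf)" by (simp_all add: T(1))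
    have "(\<Prod>z\<in>#tangency f L. tangent_scalar f ?m (homvec L) (homvec z)) \<noteq> 0"
      using ts[OF _ _ nl(1)] ts[OF _ _ nl(2)] T(2,3) unfolding T(1) by (auto simp: fac simp del: minus_mult_left minus_mult_right)
    then show ?thesis unfolding Qtype_def Let_def bc mv if_P[OF True] inv by (rule gw_rank1_complex)
  next
    case False
    then show ?thesis unfolding Qtype_def Let_def bc by auto
  qed
qed

text \<open>The tangency points lie on the bitangent itself, so the convention for tangency points at infinity applies.\<close>

lemma Qtype_at_infinity:
  assumes "bitangent f (base_change of_real Linf)" shows "Qtype of_real f Linf Linf = \<langle>1\<rangle>"
proof -
  let ?L = "base_change of_real Linf :: complex proj_plane"
  obtain Z where Z: "tangency_divisor f ?L Z" using assms unfolding bitangent_def by blast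
  then have mult: "\<And>p. intersection_mult f ?L p = 2 * count Z p" and s: "size Z = 2" by (auto simp: tangency_divisor_def)
  have "Z \<noteq> {#}" using s by auto
  then obtain z where z: "z \<in># Z" by blast
  have "on_line z ?L"
  proof (rule ccontr)
    assume "\<not> on_line z ?L"
    then have "count Z z = 0" using mult[of z] by (simp add: intersection_mult_def)
    then show False using z by (simp add: count_eq_zero_iff)
  qed
  then show ?thesis unfolding Qtype_def Let_def tangency_eq[OF Z] using z by auto
qed

end

lemma gw_rank1_sign:
  assumes "(a::real) \<noteq> 0" shows "\<langle>a\<rangle> = (if a > 0 then \<langle>1\<rangle> else \<langle>-1\<rangle>)"
proof (cases "a > 0")
  case True
  have "\<langle>a\<rangle> = \<langle>(sqrt a)\<^sup>2 * 1\<rangle>" using True by simp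
  also have "\<dots> = \<langle>1\<rangle>" by (rule gw_rank1_square) (use True in auto)
  finally show ?thesis using True by simp
next
  case False
  have "\<langle>a\<rangle> = \<langle>(sqrt (- a))\<^sup>2 * (-1)\<rangle>" using False by simp
  also have "\<dots> = \<langle>-1\<rangle>" by (rule gw_rank1_square) (use False assms in auto)
  finally show ?thesis using False by simp
qed

text \<open>The affine coordinates of \<open>affine_quartic\<close> with \<open>Linf\<close> as line at infinity; the linear forms \<open>f1\<close>, \<open>f2\<close> and \<open>homvec Linf\<close> are dual to \<open>e1\<close>, \<open>e2\<close>, \<open>e3\<close>.\<close>

locale quartic_with_line = smooth_ternary_quartic \<Phi> f + affine_quartic \<Phi> e1 e2 e3 for \<Phi> f e1 e2 e3 +
  fixes Linf :: "real proj_plane" and f1 f2 :: "real^3"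
  assumes dual: "linear_form f1 e1 = 1" "linear_form f1 e2 = 0" "linear_form f1 e3 = 0"
     "linear_form f2 e1 = 0" "linear_form f2 e2 = 1" "linear_form f2 e3 = 0"
     "linear_form (homvec Linf) e1 = 0" "linear_form (homvec Linf) e2 = 0" "linear_form (homvec Linf) e3 = 1"
  and dual_expand: "l = linear_form l e1 *s f1 + linear_form l e2 *s f2 + linear_form l e3 *s homvec Linf"
begin

text \<open>In the affine coordinates \<open>(x, y)\<close> with \<open>e = (cos \<theta>, sin \<theta>)\<close>, this is the equation \<open>- x sin \<theta> + y cos \<theta> = r\<close>.\<close>

definition line_form :: "complex \<Rightarrow> real \<Rightarrow> real^3" where
  "line_form e r = (- Im e) *s f1 + Re e *s f2 + (- r) *s homvec Linf"

definition line :: "complex \<Rightarrow> real \<Rightarrow> real proj_plane" where "line e r = proj_point (line_form e r)"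

lemma line_form_e: "linear_form (line_form e r) e1 = - Im e" "linear_form (line_form e r) e2 = Re e" "linear_form (line_form e r) e3 = - r"
  unfolding line_form_def by (simp_all only: linear_form_add_left linear_form_scale_left dual)

lemma line_form_values:
  "linear_form (line_form e r) (dir e) = 0"
  "linear_form (line_form e r) (dir (\<i> * e)) = (norm e)\<^sup>2"
  "norm e = 1 \<Longrightarrow> linear_form (line_form e r) (foot e r) = 0"
proof -
  show "linear_form (line_form e r) (dir e) = 0" by (simp add: dir_def line_form_e)
  show n: "linear_form (line_form e r) (dir (\<i> * e)) = (norm e)\<^sup>2"
    unfolding cmod_power2 by (simp add: dir_def line_form_e power2_eq_square)
  show "norm e = 1 \<Longrightarrow> linear_form (line_form e r) (foot e r) = 0"
    using n by (simp add: foot_def line_form_e)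
qed

end

context quartic_with_line begin

lemma line_form_nonzero: "e \<noteq> 0 \<Longrightarrow> line_form e r \<noteq> 0"
  using line_form_e(1,2)[of e r] by (auto simp: linear_form_def complex_eq_iff)

lemma indep2_line:
  assumes "e \<noteq> 0" shows "indep2 (cv (dir e)) (cv (foot e r))"
  unfolding indep2_def
proof (intro allI impI)
  fix a b assume "a *s cv (dir e) + b *s cv (foot e r) = 0"
  moreover have "a *s cv (dir e) + b *s cv (foot e r) =
      (a * of_real (Re e) + b * of_real (r * Re (\<i> * e))) *s cv e1 + (a * of_real (Im e) + b * of_real (r * Im (\<i> * e))) *s cv e2 + b *s cv e3"
    by (simp add: foot_def dir_def cv_add cv_scale vec_eq_iff algebra_simps map_vec3_def)
  ultimately have "b = 0" "a * of_real (Re e) + b * of_real (r * Re (\<i> * e)) = 0" "a * of_real (Im e) + b * of_real (r * Im (\<i> * e)) = 0"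
    using independent by metis+
  then show "a = 0 \<and> b = 0" using assms by (auto simp: complex_eq_iff)
qed

lemma base_change_line: "e \<noteq> 0 \<Longrightarrow> base_change of_real (line e r) = proj_point (cv (line_form e r))"
  unfolding line_def by (rule base_change_proj_point[OF line_form_nonzero])

lemma bitangent_line_iff_defect:
  assumes e: "norm e = 1" shows "bitangent f (base_change of_real (line e r)) \<longleftrightarrow> line_defect e r = 0"
proof -
  have e0: "e \<noteq> 0" by (rule unit_nonzero[OF e])
  let ?l = "cv (line_form e r)" and ?u = "cv (dir e)" and ?v = "cv (foot e r)"
  have l: "?l \<noteq> 0" by (rule cv_nonzero[OF line_form_nonzero[OF e0]])
  have k: "linear_form ?l ?u = 0" "linear_form ?l ?v = 0" using line_form_values(1,3)[of e r] e by (simp_all add: linear_form_cv)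
  have "bitangent_line \<Phi> (proj_point ?l) \<longleftrightarrow> (\<exists>q. square_on \<Phi> ?u ?v q)"
  proof
    assume b: "bitangent_line \<Phi> (proj_point ?l)"
    show "\<exists>q. square_on \<Phi> ?u ?v q"
      by (rule bitangent_line_square_on[OF b]) (simp_all add: linear_form_homvec_proj_point[OF l] k)
  next
    assume "\<exists>q. square_on \<Phi> ?u ?v q"
    then show "bitangent_line \<Phi> (proj_point ?l)" using bitangent_line_proj_point[OF l indep2_line[OF e0] k] by blast
  qed
  then show ?thesis unfolding bitangent_iff base_change_line[OF e0] line_defect_def
    using square_on_iff_defect_of[OF lead_dir_nonzero[OF e0]] by simp
qed

lemma bitangent_at_infinity_iff:
  "bitangent f (base_change of_real Linf) \<longleftrightarrow> (\<exists>q. square_on \<Phi> (cv e1) (cv e2) q)"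
proof -
  let ?l = "cv (homvec Linf)"
  have l: "?l \<noteq> 0" by (rule cv_nonzero[OF homvec(1)])
  have k: "linear_form ?l (cv e1) = 0" "linear_form ?l (cv e2) = 0" by (simp_all add: linear_form_cv dual)
  have i: "indep2 (cv e1) (cv e2)" using basis3_e by (simp add: basis3_def)
  have "bitangent_line \<Phi> (proj_point ?l) \<longleftrightarrow> (\<exists>q. square_on \<Phi> (cv e1) (cv e2) q)"
  proof
    assume b: "bitangent_line \<Phi> (proj_point ?l)"
    show "\<exists>q. square_on \<Phi> (cv e1) (cv e2) q"
      by (rule bitangent_line_square_on[OF b]) (simp_all add: linear_form_homvec_proj_point[OF l] k)
  next
    assume "\<exists>q. square_on \<Phi> (cv e1) (cv e2) q"
    then show "bitangent_line \<Phi> (proj_point ?l)" using bitangent_line_proj_point[OF l i k] by blast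
  qed
  then show ?thesis unfolding bitangent_iff base_change_of_real .
qed

lemma line_cases:
  assumes "L \<noteq> Linf" obtains e r where "norm e = 1" "L = line e r"
proof -
  define l \<alpha> \<beta> \<gamma> where "l = homvec L" and "\<alpha> = linear_form l e1" and "\<beta> = linear_form l e2" and "\<gamma> = linear_form l e3"
  define \<rho> where "\<rho> = norm (Complex \<alpha> \<beta>)"
  have l: "l = \<alpha> *s f1 + \<beta> *s f2 + \<gamma> *s homvec Linf" unfolding \<alpha>_def \<beta>_def \<gamma>_def by (rule dual_expand)
  have "\<rho> \<noteq> 0"
  proof
    assume "\<rho> = 0"
    then have "\<alpha> = 0" "\<beta> = 0" by (simp_all add: \<rho>_def complex_eq_iff)
    then have "l = \<gamma> *s homvec Linf" using l by simp
    moreover from this have "\<gamma> \<noteq> 0" using homvec(1)[of L] by (auto simp: l_def)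
    ultimately have "proj_point l = Linf" using proj_point_scale[OF _ homvec(1)] homvec(2) by metis
    then show False using assms by (simp add: l_def homvec(2))
  qed
  define e where "e = Complex (\<beta> / \<rho>) (- (\<alpha> / \<rho>))"
  have "(norm e)\<^sup>2 = (\<alpha>\<^sup>2 + \<beta>\<^sup>2) / \<rho>\<^sup>2" by (simp add: e_def cmod_power2 power_divide add_divide_distrib)
  also have "\<alpha>\<^sup>2 + \<beta>\<^sup>2 = \<rho>\<^sup>2" by (simp add: \<rho>_def cmod_power2)
  also have "\<rho>\<^sup>2 / \<rho>\<^sup>2 = 1" using \<open>\<rho> \<noteq> 0\<close> by simp
  finally have e: "norm e = 1" by (simp add: power2_eq_1_iff) (metis norm_ge_zero not_one_le_zero neg_0_le_iff_le order_trans zero_le_one)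
  have "line_form e (- (\<gamma> / \<rho>)) = (1 / \<rho>) *s l"
    unfolding line_form_def e_def l by (simp add: vec_eq_iff algebra_simps add_divide_distrib)
  then have "line e (- (\<gamma> / \<rho>)) = proj_point l"
    unfolding line_def using proj_point_scale[of "1 / \<rho>" l] \<open>\<rho> \<noteq> 0\<close> homvec(1)[of L] by (simp add: l_def)
  then show ?thesis using that[OF e, of "- (\<gamma> / \<rho>)"] by (simp add: l_def homvec(2))
qed

lemma line_neq_infinity:
  assumes "e \<noteq> 0" shows "line e r \<noteq> Linf"
proof
  assume "line e r = Linf"
  then obtain c where c: "c \<noteq> 0" "homvec Linf = c *s line_form e r"
    using homvec_proj_point[OF line_form_nonzero[OF assms, of r]] unfolding line_def by metis
  have "c * Im e = 0" "c * Re e = 0" using dual(7,8) unfolding c(2) by (simp_all add: line_form_e)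
  then show False using c(1) assms by (simp add: complex_eq_iff)
qed

text \<open>A line has two orientations.\<close>

lemma line_eq_iff:
  assumes e: "norm e = 1" "norm e' = 1"
  shows "line e r = line e' r' \<longleftrightarrow> e' = e \<and> r' = r \<or> e' = - e \<and> r' = - r"
proof
  have e0: "e \<noteq> 0" "e' \<noteq> 0" using unit_nonzero e by auto
  assume "line e r = line e' r'"
  then obtain c d where cd: "c \<noteq> 0" "d \<noteq> 0" "c *s line_form e r = d *s line_form e' r'"
    using homvec_proj_point[OF line_form_nonzero[OF e0(1), of r]] homvec_proj_point[OF line_form_nonzero[OF e0(2), of r']]
    unfolding line_def by metis
  have "c * Im e = d * Im e'" "c * Re e = d * Re e'" and r: "c * r = d * r'"
    using arg_cong[OF cd(3), of "\<lambda>l. linear_form l e1"] arg_cong[OF cd(3), of "\<lambda>l. linear_form l e2"] arg_cong[OF cd(3), of "\<lambda>l. linear_form l e3"]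
    by (simp_all add: line_form_e)
  then have ee: "of_real c * e = of_real d * e'" by (simp add: complex_eq_iff)
  then have "\<bar>c\<bar> = \<bar>d\<bar>" using e by (metis norm_mult norm_of_real mult.right_neutral)
  then consider "c = d" | "c = - d" by linarith
  then show "e' = e \<and> r' = r \<or> e' = - e \<and> r' = - r"
  proof cases
    case 1 then show ?thesis using ee r cd(2) by simp
  next
    case 2
    have "of_real d * e' = of_real d * (- e)" "d * r' = d * (- r)" using ee r 2 by simp_all
    then have "e' = - e" "r' = - r" using cd(2) by (simp_all only: mult_cancel_left of_real_eq_0_iff) auto
    then show ?thesis by simp
  qed
next
  have "line_form (- e) (- r) = (-1) *s line_form e r" by (simp add: line_form_def vec_eq_iff algebra_simps)
  then have "line (- e) (- r) = line e r"
    unfolding line_def using proj_point_scale[of "-1" "line_form e r"] line_form_nonzero[OF unit_nonzero[OF e(1)]] by simp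
  moreover assume "e' = e \<and> r' = r \<or> e' = - e \<and> r' = - r"
  ultimately show "line e r = line e' r'" by auto
qed

text \<open>If the defect vanishes, then the restricted quartic is its leading coefficient times \<open>(x\<^sup>2 + p x y + q y\<^sup>2)\<^sup>2\<close>; the square root of
  the leading coefficient need not be real.\<close>

lemma square_root_of_defect:
  assumes "lead E \<noteq> 0" "defect_of E P = 0"
  defines "p \<equiv> 2 * \<phi> E E E P / lead E" and "q \<equiv> root_q (4 * \<phi> E E E P / lead E) (6 * \<phi> E E P P / lead E)"
  shows "square_on \<Phi> (cv E) (cv P) (csqrt (of_real (lead E)), csqrt (of_real (lead E)) * of_real p, csqrt (of_real (lead E)) * of_real q)"
  unfolding square_on_def
proof (intro allI)
  fix x y
  define c \<sigma> where "c = lead E" and "\<sigma> = csqrt (of_real (lead E))"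
  have s: "\<sigma>\<^sup>2 = of_real c" by (simp add: \<sigma>_def c_def)
  have c0: "c \<noteq> 0" using assms(1) by (simp add: c_def)
  have "4 * \<phi> E P P P / c = 2 * p * q" "\<phi> P P P P / c = q\<^sup>2"
    using assms(2)[unfolded defect_of_def sqrt_defect_eq_0_iff, folded q_def c_def] by (simp_all add: p_def c_def)
  then have h1: "4 * \<phi> E P P P = c * (2 * p * q)" and h0: "\<phi> P P P P = c * q\<^sup>2" using c0 by (simp_all add: field_simps)
  have h3: "4 * \<phi> E E E P = c * (2 * p)" using c0 by (simp add: p_def c_def)
  have p2: "4 * \<phi> E E E P / lead E / 2 = p" by (simp add: p_def)
  have "2 * q + p\<^sup>2 = 6 * \<phi> E E P P / c" unfolding q_def root_q_def p2 by (simp add: c_def diff_divide_distrib)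
  then have h2: "6 * \<phi> E E P P = c * (2 * q + p\<^sup>2)" using c0 by simp
  have "quartic_at \<Phi> (x *s cv E + y *s cv P)
      = of_real (\<phi> E E E E) * x ^ 4 + of_real (4 * \<phi> E E E P) * x ^ 3 * y + of_real (6 * \<phi> E E P P) * x\<^sup>2 * y\<^sup>2
        + of_real (4 * \<phi> E P P P) * x * y ^ 3 + of_real (\<phi> P P P P) * y ^ 4"
    unfolding quartic_on_line form_cv by simp
  also have "\<dots> = of_real c * (x\<^sup>2 + of_real p * x * y + of_real q * y\<^sup>2)\<^sup>2"
    unfolding h1 h0 h3 h2 lead_def[of E, symmetric] c_def[symmetric]
    by (simp add: algebra_simps power2_eq_square power3_eq_cube power4_eq_xxxx)
  also have "\<dots> = (binary_quadratic (\<sigma>, \<sigma> * of_real p, \<sigma> * of_real q) x y)\<^sup>2"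
    unfolding s[symmetric] power_mult_distrib[symmetric] binary_quadratic_def by (simp add: algebra_simps)
  finally show "quartic_at \<Phi> (x *s cv E + y *s cv P)
      = (binary_quadratic (csqrt (of_real (lead E)), csqrt (of_real (lead E)) * of_real p, csqrt (of_real (lead E)) * of_real q) x y)\<^sup>2"
    unfolding \<sigma>_def .
qed

lemma monic_quadratic_roots:
  fixes p q :: complex obtains s1 s2 where "s1 + s2 = - p" "s1 * s2 = q"
proof -
  define d where "d = csqrt (p\<^sup>2 - 4 * q)"
  have d: "d * d = p * p - 4 * q" unfolding d_def by (metis power2_csqrt power2_eq_square)
  show ?thesis
  proof
    show "(- p + d) / 2 + (- p - d) / 2 = - p" by (simp add: field_simps)
    show "(- p + d) / 2 * ((- p - d) / 2) = q" by (simp add: field_simps d)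
  qed
qed

text \<open>The tangency points are \<open>z\<^sub>i = s\<^sub>i E + P\<close> with the roots \<open>s\<^sub>i\<close> of \<open>t\<^sup>2 + p t + q\<close>. In these coordinates the linear form of \<open>Linf\<close> takes
  the value \<open>1\<close> at \<open>z\<^sub>i\<close>, and the chosen equation of the line takes the value \<open>\<kappa>\<close> at the normal vector \<open>N\<close>. So \<open>\<partial>\<^sub>L f(z\<^sub>i)\<close> is the normal
  derivative of the quartic at \<open>z\<^sub>i\<close> divided by \<open>\<kappa>\<close>, and the product over both points is the Jacobian divided by \<open>\<kappa>\<^sup>2\<close>.\<close>

lemma Qtype_line:
  assumes e: "norm e = 1" and z: "line_defect e r = 0"
  shows "jacobian e r \<noteq> 0" "Qtype of_real f Linf (line e r) = (if jacobian e r > 0 then \<langle>1\<rangle> else \<langle>-1\<rangle>)"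
proof -
  define E P N where "E = dir e" and "P = foot e r" and "N = dir (\<i> * e)"
  define L where "L = line e r"
  define L' where "L' = (base_change of_real L :: complex proj_plane)"
  have e0: "e \<noteq> 0" by (rule unit_nonzero[OF e])
  have c0: "lead E \<noteq> 0" unfolding E_def by (rule lead_dir_nonzero[OF e0])
  define \<sigma> where "\<sigma> = csqrt (of_real (lead E))"
  have s0: "\<sigma> \<noteq> 0" using c0 by (simp add: \<sigma>_def)
  define p q where "p = 2 * \<phi> E E E P / lead E" and "q = root_q (4 * \<phi> E E E P / lead E) (6 * \<phi> E E P P / lead E)"
  have sq: "square_on \<Phi> (cv E) (cv P) (\<sigma>, \<sigma> * of_real p, \<sigma> * of_real q)"
    unfolding \<sigma>_def p_def q_def by (rule square_root_of_defect[OF c0]) (use z in \<open>simp add: line_defect_def E_def P_def\<close>)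
  obtain s1 s2 :: complex where s: "s1 + s2 = - of_real p" "s1 * s2 = of_real q" by (rule monic_quadratic_roots)
  obtain \<kappa> where \<kappa>: "\<kappa> \<noteq> 0" "homvec L = \<kappa> *s line_form e r"
    unfolding L_def line_def by (rule homvec_proj_point[OF line_form_nonzero[OF e0]])
  have lf: "linear_form (homvec L) E = 0" "linear_form (homvec L) P = 0" "linear_form (homvec L) N = \<kappa>"
    using line_form_values[of e r] e unfolding \<kappa>(2) E_def P_def N_def by simp_all
  have cl: "cv (homvec L) \<noteq> 0" by (rule cv_nonzero[OF homvec(1)])
  have kerL: "linear_form (homvec L') w = 0 \<longleftrightarrow> linear_form (cv (homvec L)) w = 0" for w
    unfolding L'_def base_change_of_real by (rule linear_form_homvec_proj_point[OF cl])
  have uv: "indep2 (cv E) (cv P)" "linear_form (homvec L') (cv E) = 0" "linear_form (homvec L') (cv P) = 0"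
    unfolding kerL by (simp_all add: E_def P_def indep2_line[OF e0] linear_form_cv lf[unfolded E_def P_def])
  have m: "linear_form (cv (homvec Linf)) (cv E) = 0" "linear_form (cv (homvec Linf)) (cv P) = 1"
    by (simp_all add: linear_form_cv E_def P_def foot_def dir_def dual)
  have fac: "binary_quadratic (\<sigma>, \<sigma> * of_real p, \<sigma> * of_real q) x y = (\<sigma> * x + (- (\<sigma> * s1)) * y) * (1 * x + (- s2) * y)" for x y
  proof -
    have p': "of_real p = - (s1 + s2)" using s(1) by simp
    show ?thesis unfolding binary_quadratic_def s(2)[symmetric] p' by (simp add: algebra_simps power2_eq_square)
  qed
  define Nn where "Nn s = of_real (4 * \<phi> N P P P) + of_real (12 * \<phi> E N P P) * s + of_real (12 * \<phi> E E N P) * s\<^sup>2 + of_real (4 * \<phi> E E E N) * s ^ 3" for s :: complex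
  have prodN: "of_real (jacobian e r) = Nn s1 * Nn s2"
    unfolding jacobian_def Let_def Nn_def
    using resultant_quad_eq[OF s, of "4 * \<phi> N P P P" "12 * \<phi> E N P P" "12 * \<phi> E E N P" "4 * \<phi> E E E N"] by (simp add: p_def q_def E_def P_def N_def)
  have sw: "\<phi> E E P N = \<phi> E E N P" "\<phi> E P P N = \<phi> E N P P" "\<phi> P P P N = \<phi> N P P P" by (metis R.swap12 R.swap23 R.swap34)+
  have ts: "tangent_scalar f (cv (homvec Linf)) (cv (homvec L)) (homvec (proj_point ((s * y) *s cv E + y *s cv P))) = Nn s / of_real \<kappa>"
    and nz: "Nn s \<noteq> 0" and off: "\<not> on_line (proj_point ((s * y) *s cv E + y *s cv P)) (base_change of_real Linf)"
    if y: "y \<noteq> 0" and root: "s = s1 \<or> s = s2" for s y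
  proof -
    let ?z = "(s * y) *s cv E + y *s cv P"
    have r: "binary_quadratic (\<sigma>, \<sigma> * of_real p, \<sigma> * of_real q) (s * y) y = 0" "(s * y, y) \<noteq> (0, 0)"
      unfolding fac using y root by (auto simp: algebra_simps)
    note d = tangency_data[OF uv sq r]
    have mz: "linear_form (cv (homvec Linf)) ?z = y" by (simp add: m)
    have nl: "linear_form (cv (homvec L)) (cv N) = of_real \<kappa>" by (simp add: linear_form_cv lf)
    have nl0: "linear_form (cv (homvec L)) (cv N) \<noteq> 0" using nl \<kappa>(1) by simp
    have "4 * \<Phi> ?z ?z ?z (cv N) = y ^ 3 * Nn s"
      unfolding cubic_on_line form_cv Nn_def sw by (simp add: algebra_simps power2_eq_square power3_eq_cube)
    then have v: "4 * \<Phi> ?z ?z ?z (cv N) = y ^ 3 * Nn s" .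
    have "tangent_scalar f (cv (homvec Linf)) (cv (homvec L)) (homvec (proj_point ?z)) = 4 * \<Phi> ?z ?z ?z (cv N) / (of_real \<kappa> * y ^ 3)"
      using tangent_scalar_proj_point[of "cv (homvec L)" ?z "cv (homvec Linf)" "cv N"] d(1-3) y nl0 unfolding mz nl kerL by blast
    then show "tangent_scalar f (cv (homvec Linf)) (cv (homvec L)) (homvec (proj_point ?z)) = Nn s / of_real \<kappa>"
      unfolding v using y by simp
    show "Nn s \<noteq> 0" using d(4)[of "cv N"] nl0 v unfolding kerL by auto
    have z0: "?z \<noteq> 0" by (rule indep2_nonzero[OF uv(1) r(2)])
    show "\<not> on_line (proj_point ?z) (base_change of_real Linf)"
      unfolding on_line_proj_point[OF z0] base_change_of_real linear_form_homvec_proj_point[OF cv_nonzero[OF homvec(1)]] mz using y .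
  qed
  show J: "jacobian e r \<noteq> 0" using prodN nz[of 1 s1] nz[of 1 s2] by auto
  have T: "tangency f L' = {# proj_point ((s1 * \<sigma>) *s cv E + \<sigma> *s cv P), proj_point ((s2 * 1) *s cv E + 1 *s cv P) #}"
    using tangency_factored(1)[OF uv sq fac] by (simp add: mult.commute)
  have "(\<Prod>z\<in>#tangency f L'. tangent_scalar f (cv (homvec Linf)) (cv (homvec L)) (homvec z)) = (Nn s1 / of_real \<kappa>) * (Nn s2 / of_real \<kappa>)"
    unfolding T using ts[OF s0, of s1] ts[OF one_neq_zero, of s2] by simp
  also have "\<dots> = complex_of_real (jacobian e r / \<kappa>\<^sup>2)" using prodN by (simp add: power2_eq_square)
  finally have prod: "(\<Prod>z\<in>#tangency f L'. tangent_scalar f (cv (homvec Linf)) (cv (homvec L)) (homvec z)) = complex_of_real (jacobian e r / \<kappa>\<^sup>2)" .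
  have "the_inv complex_of_real (complex_of_real a) = a" for a by (rule the_inv_f_f) (simp add: inj_on_def)
  note inv = this
  have "\<forall>z\<in>#tangency f L'. \<not> on_line z (base_change of_real Linf)"
    using off[OF s0, of s1] off[OF one_neq_zero, of s2] unfolding T by simp
  then have "Qtype of_real f Linf L = \<langle>jacobian e r / \<kappa>\<^sup>2\<rangle>"
    unfolding Qtype_def Let_def L'_def[symmetric] prod inv by (rule if_P)
  also have "\<dots> = (if jacobian e r > 0 then \<langle>1\<rangle> else \<langle>-1\<rangle>)"
    using gw_rank1_sign[of "jacobian e r / \<kappa>\<^sup>2"] J \<kappa>(1) by (simp add: zero_less_divide_iff)
  finally show "Qtype of_real f Linf (line e r) = (if jacobian e r > 0 then \<langle>1\<rangle> else \<langle>-1\<rangle>)" unfolding L_def .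
qed

end

section \<open>The Grothendieck-Witt ring of the real numbers\<close>

lemma det_nonzero_of_inverse:
  assumes "P \<in> carrier_mat n n" "Q \<in> carrier_mat n n" "P * Q = 1\<^sub>m n"
  shows "Determinant.det (P :: 'a::field Matrix.mat) \<noteq> 0"
proof -
  have "Determinant.det P * Determinant.det Q = 1" using det_mult[OF assms(1,2)] assms(3) by simp
  then show ?thesis by auto
qed

text \<open>The sign of the determinant of a Gram matrix: a change of basis multiplies the determinant by a square. As it is multiplicative and never zero,
  it survives the cancellation in the Grothendieck-Witt group and separates \<open>\<langle>1\<rangle>\<close> from \<open>\<langle>-1\<rangle>\<close>.\<close>

lift_definition discriminant_sign :: "real form_class \<Rightarrow> real" is "\<lambda>A. sgn (Determinant.det A)"
proof -
  fix A B :: "real Matrix.mat" assume "isometric A B"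
  from isometricE[OF this] obtain n P Q where *:
    "A \<in> carrier_mat n n" "B \<in> carrier_mat n n" "P \<in> carrier_mat n n" "Q \<in> carrier_mat n n"
    "P * Q = 1\<^sub>m n" "A = transpose_mat P * B * P" by metis
  have "Determinant.det A = (Determinant.det P)\<^sup>2 * Determinant.det B"
    using *(2,3) det_mult[of "transpose_mat P" n B] det_mult[of "transpose_mat P * B" n P] det_transpose[OF *(3)]
    unfolding *(6) by (simp add: power2_eq_square)
  moreover have "sgn ((Determinant.det P)\<^sup>2) = 1" unfolding sgn_1_pos using det_nonzero_of_inverse[OF *(3,4,5)] by simp
  ultimately show "sgn (Determinant.det A) = sgn (Determinant.det B)" by (simp only: sgn_mult mult_1_left)
qed

lemma discriminant_sign_add: "discriminant_sign (a + b) = discriminant_sign a * discriminant_sign b"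
proof (transfer, goal_cases)
  case (1 A B)
  from nondeg_carrierE[OF isometric_nondeg(1)[OF 1(1)]] obtain n where a: "A \<in> carrier_mat n n" .
  from nondeg_carrierE[OF isometric_nondeg(1)[OF 1(2)]] obtain m where b: "B \<in> carrier_mat m m" .
  have "Determinant.det (osum A B) = Determinant.det A * Determinant.det B"
    unfolding osum_def by (rule det_four_block_mat_upper_right_zero[OF a _ _ b]) (use a b in auto)
  then show ?case by (simp add: sgn_mult)
qed

lemma discriminant_sign_nonzero: "discriminant_sign a \<noteq> 0"
proof (transfer, goal_cases)
  case (1 A)
  from nondeg_formE[OF isometric_nondeg(1)[OF 1]] obtain n B where "A \<in> carrier_mat n n" "B \<in> carrier_mat n n" "A * B = 1\<^sub>m n" .
  from det_nonzero_of_inverse[OF this] show ?case by (simp add: sgn_zero_iff)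
qed

lemma discriminant_sign_diag1: "a \<noteq> 0 \<Longrightarrow> discriminant_sign (form_of_mat (diag1 a)) = sgn a"
  by transfer (simp add: nondeg_diag1, simp add: diag1_def det_single)

lemma gw_rank1_real_distinct: "\<langle>1\<rangle> \<noteq> (\<langle>-1\<rangle> :: real gw)"
proof
  assume "\<langle>1\<rangle> = (\<langle>-1\<rangle> :: real gw)"
  then have "gw_rel (form_of_mat (diag1 1), 0) (form_of_mat (diag1 (-1 :: real)), 0)"
    unfolding gw_rank1_def gw_of_form_def gw.abs_eq_iff .
  then obtain c where "form_of_mat (diag1 1) + c = form_of_mat (diag1 (-1 :: real)) + c" by (auto simp: gw_rel_def)
  from arg_cong[OF this, of discriminant_sign] show False
    using discriminant_sign_nonzero[of c] by (simp add: discriminant_sign_add discriminant_sign_diag1)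
qed

text \<open>In the basis \<open>1, \<i>\<close> the trace form of \<open>\<langle>1\<rangle>\<close> has the Gram matrix with diagonal entries \<open>2\<close> and \<open>-2\<close>.\<close>

lemma gw_transfer_one: "gw_transfer \<langle>1\<rangle> = \<langle>1\<rangle> + \<langle>-1\<rangle>"
proof -
  have m: "m div 2 = 0" "m mod 2 = m" if "m < (2::nat)" for m using that by auto
  have T: "trace_form (diag1 1) = osum (diag1 2) (diag1 (-2))"
    by (rule eq_matI) (auto simp: trace_form_def diag1_def osum_def field_trace_eq real_basis_def m less_2_cases_iff)
  have "trace_class (form_of_mat (diag1 1)) = form_of_mat (diag1 2) + form_of_mat (diag1 (-2))"
    by (transfer, simp add: nondeg_diag1 T isometric_refl nondeg_osum)
  moreover have "trace_form (0\<^sub>m 0 0) = 0\<^sub>m 0 0" by (rule eq_matI) (auto simp: trace_form_def)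
  then have "trace_class 0 = 0" by transfer (simp add: isometric_refl nondeg_zero)
  ultimately have "gw_transfer \<langle>1\<rangle> = \<langle>2\<rangle> + \<langle>-2\<rangle>"
    by (simp add: gw_rank1_def gw_of_form_def gw_transfer.abs_eq plus_gw.abs_eq)
  also have "\<dots> = \<langle>1\<rangle> + \<langle>-1\<rangle>" using gw_rank1_sign[of 2] gw_rank1_sign[of "-2"] by simp
  finally show ?thesis .
qed

section \<open>The signed count\<close>

text \<open>Proportional real vectors have a real factor of proportionality.\<close>

lemma base_change_of_real_inj:
  assumes "base_change complex_of_real L = base_change of_real L'" shows "L = L'"
proof -
  let ?l = "homvec L" and ?m = "homvec L'"
  obtain c d where cd: "c \<noteq> 0" "d \<noteq> 0" "c *s cv ?l = d *s cv ?m"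
    using homvec_proj_point[OF cv_nonzero[OF homvec(1)[of L]]] homvec_proj_point[OF cv_nonzero[OF homvec(1)[of L']]] assms
    unfolding base_change_of_real by metis
  have eq: "c * of_real (?l $ i) = d * of_real (?m $ i)" for i
    using arg_cong[OF cd(3), of "\<lambda>v. v $ i"] by (simp add: map_vec3_def)
  obtain k where k: "?m $ k \<noteq> 0" using homvec(1)[of L'] by (auto simp: vec_eq_iff)
  define t where "t = ?l $ k / ?m $ k"
  have lk: "?l $ k \<noteq> 0" using eq[of k] k cd(2) by auto
  have "d = c * of_real t" using eq[of k] k by (simp add: t_def field_simps)
  then have "c * of_real (?l $ i) = c * of_real (t * ?m $ i)" for i unfolding eq by simp
  then have "?l = t *s ?m" using cd(1) by (simp add: vec_eq_iff del: of_real_mult)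
  moreover have "t \<noteq> 0" using lk k by (simp add: t_def)
  ultimately show ?thesis by (metis proj_point_scale homvec)
qed

lemma norm_sgn_complex: "w \<noteq> 0 \<Longrightarrow> norm (sgn w :: complex) = 1" by (simp add: norm_sgn)

lemma polar_of_sgn: "w \<noteq> 0 \<Longrightarrow> w = of_real (exp (ln (norm w))) * sgn (w :: complex)"
  by (simp add: sgn_div_norm scaleR_conv_of_real)

lemma (in smooth_ternary_quartic) card_bitangents: "card {L. bitangent f L} = 28" "finite {L. bitangent f L}"
proof -
  show c: "card {L. bitangent f L} = 28"
    unfolding bitangent_iff by (rule card_bitangents_smooth_quartic) unfold_locales
  show "finite {L. bitangent f L}" by (rule card_ge_0_finite) (simp add: c)
qed

lemma (in smooth_ternary_quartic) finite_real_bitangents: "finite {L. bitangent f (base_change of_real L)}"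
proof (rule finite_imageD)
  show "finite (base_change complex_of_real ` {L. bitangent f (base_change of_real L)})"
    by (rule finite_subset[OF _ card_bitangents(2)]) auto
  show "inj_on (base_change complex_of_real) {L. bitangent f (base_change of_real L)}"
    by (rule inj_onI) (rule base_change_of_real_inj)
qed

context quartic_with_line begin

lemma Qtype_real_cases:
  assumes "bitangent f (base_change of_real L)" shows "Qtype of_real f Linf L = \<langle>1\<rangle> \<or> Qtype of_real f Linf L = \<langle>-1\<rangle>"
proof (cases "L = Linf")
  case True
  then show ?thesis using Qtype_at_infinity assms by simp
next
  case False
  then obtain e r where "norm e = 1" "L = line e r" by (rule line_cases)
  then show ?thesis using Qtype_line(2) bitangent_line_iff_defect assms by simp
qed

definition type_sign :: "real proj_plane \<Rightarrow> int" where
  "type_sign L = (if Qtype of_real f Linf L = \<langle>1\<rangle> then 1 else -1)"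

definition line_at :: "complex \<Rightarrow> real proj_plane" where "line_at w = line (sgn w) (ln (norm w))"

lemma line_at_fibre:
  assumes e: "norm e = 1"
  shows "w \<noteq> 0 \<and> line_at w = line e r \<longleftrightarrow> w \<in> {of_real (exp r) * e, - (of_real (exp (- r)) * e)}"
proof
  assume w: "w \<noteq> 0 \<and> line_at w = line e r"
  then have "sgn w = e \<and> ln (norm w) = r \<or> sgn w = - e \<and> ln (norm w) = - r"
    unfolding line_at_def using line_eq_iff[OF e norm_sgn_complex, of w r "ln (norm w)"] by metis
  moreover have "w = of_real (exp (ln (norm w))) * sgn w" using w polar_of_sgn by blast
  ultimately show "w \<in> {of_real (exp r) * e, - (of_real (exp (- r)) * e)}"
    by (metis insertCI mult_minus_right)
next
  have e0: "e \<noteq> 0" by (rule unit_nonzero[OF e])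
  have s: "sgn (of_real (exp t) * u) = u" "ln (norm (of_real (exp t) * u)) = t" if "norm u = 1" for t and u :: complex
    using that by (simp_all add: sgn_mult sgn_div_norm[of u] norm_mult sgn_of_real)
  assume "w \<in> {of_real (exp r) * e, - (of_real (exp (- r)) * e)}"
  then consider "w = of_real (exp r) * e" | "w = of_real (exp (- r)) * (- e)" by auto
  then show "w \<noteq> 0 \<and> line_at w = line e r"
  proof cases
    case 1
    then show ?thesis using s[OF e, of r] e0 by (simp add: line_at_def)
  next
    case 2
    have "norm (- e) = 1" using e by simp
    note s' = s[OF this, of "- r"]
    have "line (- e) (- r) = line e r" using line_eq_iff[OF e, of "- e" r "- r"] e by simp
    then show ?thesis using s' e0 unfolding line_at_def 2 by simp
  qed
qed

text \<open>The zeros of \<open>plane_defect\<close> are the oriented bitangents. Both orientations of a line have the index given by its type, which cancels the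
  factor \<open>2\<close> of \<open>sum_of_indices\<close>.\<close>

theorem signed_count: "(\<Sum>L | bitangent f (base_change of_real L). type_sign L) = 4"
proof -
  define RB where "RB = {L. bitangent f (base_change of_real L)}"
  define Z where "Z = {w. w \<noteq> 0 \<and> plane_defect w = 0}"
  have finRB: "finite RB" unfolding RB_def by (rule finite_real_bitangents)
  have Zw: "w \<in> Z \<longleftrightarrow> w \<noteq> 0 \<and> line_at w \<in> RB" for w
    unfolding Z_def RB_def line_at_def plane_defect_def using bitangent_line_iff_defect[OF norm_sgn_complex] by auto
  have fibre: "{w \<in> Z. line_at w = line e r} = {of_real (exp r) * e, - (of_real (exp (- r)) * e)}"
    if "norm e = 1" "line e r \<in> RB" for e r
  proof -
    have "{w \<in> Z. line_at w = line e r} = {w. w \<noteq> 0 \<and> line_at w = line e r}" using that(2) by (auto simp: Zw)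
    then show ?thesis unfolding line_at_fibre[OF that(1)] by auto
  qed
  have card2: "card {w \<in> Z. line_at w = L} = 2" if L: "L \<in> RB - {Linf}" for L
  proof -
    obtain e r where er: "norm e = 1" "L = line e r" using L line_cases by blast
    have "of_real (exp r) * e \<noteq> - (of_real (exp (- r)) * e)"
    proof
      assume "of_real (exp r) * e = - (of_real (exp (- r)) * e)"
      then have "of_real (exp r + exp (- r)) * e = 0" by (simp add: algebra_simps)
      then have "exp r + exp (- r) = 0" using unit_nonzero[OF er(1)] by (simp only: mult_eq_0_iff of_real_eq_0_iff) simp
      then show False by (metis add_pos_pos exp_gt_zero less_irrefl)
    qed
    then show ?thesis using fibre[OF er(1)] L er(2) by simp
  qed
  have img: "line_at ` Z = RB - {Linf}"
  proof (intro equalityI subsetI)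
    fix L assume "L \<in> line_at ` Z"
    then show "L \<in> RB - {Linf}" using line_neq_infinity[of "sgn _"] by (auto simp: Zw sgn_zero_iff line_at_def)
  next
    fix L assume "L \<in> RB - {Linf}"
    from card2[OF this] have "{w \<in> Z. line_at w = L} \<noteq> {}" by force
    then show "L \<in> line_at ` Z" by blast
  qed
  have finZ: "finite Z"
  proof -
    have "Z = (\<Union>L\<in>RB - {Linf}. {w \<in> Z. line_at w = L})" using img by blast
    moreover have "finite {w \<in> Z. line_at w = L}" if "L \<in> RB - {Linf}" for L
      by (rule card_ge_0_finite) (simp add: card2[OF that])
    ultimately show ?thesis using finRB by (metis (no_types, lifting) finite_Diff finite_UN_I)
  qed
  have type: "jacobian (sgn w) (ln (norm w)) \<noteq> 0" "(if jacobian (sgn w) (ln (norm w)) > 0 then 1 else -1) = type_sign (line_at w)" if "w \<in> Z" for w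
    using Qtype_line[OF norm_sgn_complex, of w "ln (norm w)"] that gw_rank1_real_distinct
    by (auto simp: Z_def plane_defect_def type_sign_def line_at_def)
  \<comment> \<open>Any bound for the distances of the real bitangents from the origin will do.\<close>
  define B where "B = 1 + (\<Sum>w\<in>Z. \<bar>ln (norm w)\<bar>)"
  have B: "B > 0" "\<And>w. w \<in> Z \<Longrightarrow> \<bar>ln (norm w)\<bar> < B"
  proof -
    show "B > 0" unfolding B_def by (intro add_pos_nonneg sum_nonneg) auto
    show "\<bar>ln (norm w)\<bar> < B" if "w \<in> Z" for w
      using member_le_sum[OF that, of "\<lambda>w. \<bar>ln (norm w)\<bar>"] finZ by (simp add: B_def)
  qed
  have nz: "line_defect (cis \<theta>) r \<noteq> 0" if "r \<ge> B" for \<theta> r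
  proof
    assume "line_defect (cis \<theta>) r = 0"
    then have "of_real (exp r) * cis \<theta> \<in> Z" using plane_defect_polar[of r \<theta>] by (simp add: Z_def)
    from B(2)[OF this] that show False by (simp add: norm_mult)
  qed
  have "(\<Sum>w\<in>Z. if jacobian (sgn w) (ln (norm w)) > 0 then 1 else -1) = (\<Sum>w\<in>Z. type_sign (line_at w))"
    by (rule sum.cong[OF refl]) (rule type(2))
  also have "\<dots> = (\<Sum>L\<in>line_at ` Z. \<Sum>w | w \<in> Z \<and> line_at w = L. type_sign (line_at w))" by (rule sum.image_gen[OF finZ])
  also have "\<dots> = (\<Sum>L\<in>RB - {Linf}. 2 * type_sign L)"
    unfolding img
  proof (rule sum.cong[OF refl])
    fix L assume "L \<in> RB - {Linf}"
    then show "(\<Sum>w | w \<in> Z \<and> line_at w = L. type_sign (line_at w)) = 2 * type_sign L" using card2 by simp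
  qed
  finally have S: "(\<Sum>w\<in>Z. if jacobian (sgn w) (ln (norm w)) > 0 then 1 else -1) = 2 * (\<Sum>L\<in>RB - {Linf}. type_sign L)"
    by (simp add: sum_distrib_left)
  have "2 * turns (\<lambda>\<theta>. line_defect (cis \<theta>) B) = of_int (2 * (\<Sum>L\<in>RB - {Linf}. type_sign L))"
    using sum_of_indices[OF finZ Z_def B type(1)] unfolding S by simp
  also have "turns (\<lambda>\<theta>. line_defect (cis \<theta>) B) = (if Linf \<in> RB then 3 else 4)"
    using turns_at_infinity[OF B(1) nz] unfolding RB_def mem_Collect_eq bitangent_at_infinity_iff .
  finally have T: "2 * (if Linf \<in> RB then 3 else 4) = complex_of_int (2 * (\<Sum>L\<in>RB - {Linf}. type_sign L))" .
  have "(\<Sum>L\<in>RB. type_sign L) = 4"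
  proof (cases "Linf \<in> RB")
    case True
    have "complex_of_int (2 * (\<Sum>L\<in>RB - {Linf}. type_sign L)) = of_int 6" unfolding T[symmetric] using True by simp
    then have "2 * (\<Sum>L\<in>RB - {Linf}. type_sign L) = 6" by (simp only: of_int_eq_iff)
    moreover have "type_sign Linf = 1" using Qtype_at_infinity True by (simp add: RB_def type_sign_def)
    ultimately show ?thesis unfolding sum.remove[OF finRB True] by simp
  next
    case False
    have "complex_of_int (2 * (\<Sum>L\<in>RB - {Linf}. type_sign L)) = of_int 8" unfolding T[symmetric] using False by simp
    then have "2 * (\<Sum>L\<in>RB - {Linf}. type_sign L) = 8" by (simp only: of_int_eq_iff)
    then show ?thesis using False by simp
  qed
  then show ?thesis unfolding RB_def .
qed

corollary signed_count_card:
  "int (card {L. bitangent f (base_change of_real L) \<and> Qtype of_real f Linf L = \<langle>1\<rangle>})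
     - int (card {L. bitangent f (base_change of_real L) \<and> Qtype of_real f Linf L = \<langle>-1\<rangle>}) = 4"
proof -
  define RB where "RB = {L. bitangent f (base_change of_real L)}"
  have fin: "finite RB" unfolding RB_def by (rule finite_real_bitangents)
  have "(\<Sum>L\<in>RB. type_sign L) = (\<Sum>L\<in>RB. (if Qtype of_real f Linf L = \<langle>1\<rangle> then 1 else 0) - (if Qtype of_real f Linf L = \<langle>-1\<rangle> then 1 else 0))"
    by (rule sum.cong[OF refl]) (use Qtype_real_cases gw_rank1_real_distinct in \<open>auto simp: RB_def type_sign_def\<close>)
  also have "\<dots> = int (card {L \<in> RB. Qtype of_real f Linf L = \<langle>1\<rangle>}) - int (card {L \<in> RB. Qtype of_real f Linf L = \<langle>-1\<rangle>})"
    unfolding sum_subtractf sum.inter_filter[OF fin, symmetric] by simp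
  finally show ?thesis using signed_count by (simp add: RB_def)
qed

end

section \<open>Conjugate bitangents and the enriched count\<close>

lemma map_vec3_cnj_cnj: "map_vec3 cnj (map_vec3 cnj v) = v"
  by (simp add: map_vec3_def vec_eq_iff)

lemma map_vec3_cnj_add: "map_vec3 cnj (u + v) = map_vec3 cnj u + map_vec3 cnj v"
  by (simp add: map_vec3_def vec_eq_iff)

lemma map_vec3_cnj_scale: "map_vec3 cnj (c *s v) = cnj c *s map_vec3 cnj v"
  by (simp add: map_vec3_def vec_eq_iff)

lemma map_vec3_cnj_eq_0: "map_vec3 cnj v = 0 \<longleftrightarrow> v = 0"
  by (auto simp: map_vec3_def vec_eq_iff)

lemma linear_form_cnj: "linear_form (map_vec3 cnj l) (map_vec3 cnj u) = cnj (linear_form l u)"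
  by (simp add: linear_form_def map_vec3_def)

lemma base_change_cnj_cnj: "base_change cnj (base_change cnj L) = L"
proof -
  have n: "map_vec3 cnj (homvec L) \<noteq> 0" using homvec(1) by (simp add: map_vec3_cnj_eq_0)
  obtain c where c: "c \<noteq> 0" "homvec (proj_point (map_vec3 cnj (homvec L))) = c *s map_vec3 cnj (homvec L)"
    using homvec_proj_point[OF n] .
  show ?thesis unfolding base_change_def c(2) map_vec3_cnj_scale map_vec3_cnj_cnj
    using c(1) homvec[of L] by (simp add: proj_point_scale)
qed

lemma (in smooth_quartic) bitangent_line_cnj:
  assumes real: "real_form \<Phi>" and b: "bitangent_line \<Phi> L" shows "bitangent_line \<Phi> (base_change cnj L)"
proof -
  obtain u v p q r where uv: "indep2 u v" "linear_form (homvec L) u = 0" "linear_form (homvec L) v = 0"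
    and sq: "square_on \<Phi> u v (p, q, r)" using b unfolding bitangent_line_def by (metis surj_pair)
  let ?l = "map_vec3 cnj (homvec L)" and ?u = "map_vec3 cnj u" and ?v = "map_vec3 cnj v"
  have "?l \<noteq> 0" using homvec(1) by (simp add: map_vec3_cnj_eq_0)
  moreover have "indep2 ?u ?v" unfolding indep2_def
  proof (intro allI impI)
    fix x y assume "x *s ?u + y *s ?v = 0"
    then have "map_vec3 cnj (x *s ?u + y *s ?v) = 0" by (simp add: map_vec3_cnj_eq_0)
    then have "cnj x *s u + cnj y *s v = 0" by (simp only: map_vec3_cnj_add map_vec3_cnj_scale map_vec3_cnj_cnj)
    then have "cnj x = 0 \<and> cnj y = 0" using uv(1) unfolding indep2_def by blast
    then show "x = 0 \<and> y = 0" by simp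
  qed
  moreover have "linear_form ?l ?u = 0" "linear_form ?l ?v = 0" unfolding linear_form_cnj uv(2,3) by simp_all
  moreover have "square_on \<Phi> ?u ?v (cnj p, cnj q, cnj r)" unfolding square_on_def
  proof (intro allI)
    fix x y
    have e: "x *s ?u + y *s ?v = map_vec3 cnj (cnj x *s u + cnj y *s v)" by (simp add: map_vec3_cnj_add map_vec3_cnj_scale)
    have "quartic_at \<Phi> (x *s ?u + y *s ?v) =
        cnj ((binary_quadratic (p, q, r) (cnj x) (cnj y))\<^sup>2)"
      using real sq unfolding e real_form_def square_on_def by metis
    then show "quartic_at \<Phi> (x *s ?u + y *s ?v) =
        (binary_quadratic (cnj p, cnj q, cnj r) x y)\<^sup>2" by (simp add: binary_quadratic_def)
  qed
  ultimately show ?thesis unfolding base_change_def by (rule bitangent_line_proj_point)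
qed

lemma transferred_Qtype_real:
  "transferred_Qtype f Linf (galois_orbit (base_change of_real L)) = Qtype of_real f Linf L"
proof -
  have g: "galois_orbit (base_change of_real L) = {base_change of_real L}" unfolding galois_orbit_singleton_iff by blast
  have "(THE L'. {base_change complex_of_real L} = {base_change of_real L'}) = L"
    by (rule the_equality) (auto dest: base_change_of_real_inj)
  then show ?thesis unfolding transferred_Qtype_def g by auto
qed

context quartic_with_line begin

lemma transferred_Qtype_nonreal:
  assumes L: "bitangent f L" "\<nexists>L0. L = base_change of_real L0"
  shows "transferred_Qtype f Linf (galois_orbit L) = \<langle>1\<rangle> + \<langle>-1\<rangle>"
proof -
  have n: "\<not> (\<exists>L0. galois_orbit L = {base_change of_real L0})" using L(2) by (auto simp: galois_orbit_def)
  have "(SOME L'. L' \<in> galois_orbit L) \<in> galois_orbit L" by (rule someI[of _ L]) (simp add: galois_orbit_def)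
  then have "bitangent f (SOME L'. L' \<in> galois_orbit L)"
    using L(1) bitangent_line_cnj[OF real] unfolding bitangent_iff by (auto simp: galois_orbit_def)
  then show ?thesis unfolding transferred_Qtype_def using n by (simp add: Qtype_complex gw_transfer_one)
qed

text \<open>Real bitangents are orbits of their own, the others form pairs of conjugate lines.\<close>

theorem enriched_count:
  "(\<Sum>x\<in>{galois_orbit L | L. bitangent f L}. transferred_Qtype f Linf x) = 16 * \<langle>1\<rangle> + 12 * \<langle>-1\<rangle>"
proof -
  define B R N where "B = {L. bitangent f L}" and "R = {L. bitangent f (base_change of_real L)}"
    and "N = {L. bitangent f L \<and> (\<nexists>L0. L = base_change of_real L0)}"
  define real_part where "real_part = base_change complex_of_real ` R"
  define np nm where "np = card {L \<in> R. Qtype of_real f Linf L = \<langle>1\<rangle>}" and "nm = card {L \<in> R. Qtype of_real f Linf L = \<langle>-1\<rangle>}"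
  have finR: "finite R" unfolding R_def by (rule finite_real_bitangents)
  have B: "B = real_part \<union> N" "real_part \<inter> N = {}" by (auto simp: B_def R_def N_def real_part_def)
  have fin: "finite B" "card B = 28" using card_bitangents by (simp_all add: B_def)
  then have finN: "finite N" using B by simp
  have cR: "card real_part = card R" unfolding real_part_def by (rule card_image, rule inj_onI, rule base_change_of_real_inj)
  have part: "R = {L \<in> R. Qtype of_real f Linf L = \<langle>1\<rangle>} \<union> {L \<in> R. Qtype of_real f Linf L = \<langle>-1\<rangle>}"
    "{L \<in> R. Qtype of_real f Linf L = \<langle>1\<rangle>} \<inter> {L \<in> R. Qtype of_real f Linf L = \<langle>-1\<rangle>} = {}"
    using Qtype_real_cases gw_rank1_real_distinct by (auto simp: R_def)
  have cnt: "card R = np + nm"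
    unfolding np_def nm_def using card_Un_disjoint[OF _ _ part(2)] part(1) finR by simp
  have "(\<Sum>L\<in>R. Qtype of_real f Linf L) = (\<Sum>L | L \<in> R \<and> Qtype of_real f Linf L = \<langle>1\<rangle>. Qtype of_real f Linf L) + (\<Sum>L | L \<in> R \<and> Qtype of_real f Linf L = \<langle>-1\<rangle>. Qtype of_real f Linf L)"
    using sum.union_disjoint[OF _ _ part(2), of "Qtype of_real f Linf"] part(1) finR by simp
  also have "\<dots> = of_nat np * \<langle>1\<rangle> + of_nat nm * \<langle>-1\<rangle>" by (simp add: np_def nm_def)
  finally have sumR: "(\<Sum>L\<in>R. Qtype of_real f Linf L) = of_nat np * \<langle>1\<rangle> + of_nat nm * \<langle>-1\<rangle>" .
  have inj: "inj_on (\<lambda>L. galois_orbit (base_change complex_of_real L)) R"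
  proof (rule inj_onI)
    fix L L' :: "real proj_plane"
    have "galois_orbit (base_change of_real M) = {base_change of_real M}" for M :: "real proj_plane" unfolding galois_orbit_singleton_iff by blast
    moreover assume "galois_orbit (base_change of_real L) = galois_orbit (base_change of_real L')"
    ultimately have "base_change complex_of_real L = base_change of_real L'" by simp
    then show "L = L'" by (rule base_change_of_real_inj)
  qed
  have real_sum: "(\<Sum>x\<in>galois_orbit ` real_part. transferred_Qtype f Linf x) = of_nat np * \<langle>1\<rangle> + of_nat nm * \<langle>-1\<rangle>"
    unfolding real_part_def image_image sum.reindex[OF inj] o_def transferred_Qtype_real sumR ..
  have nonreal_sum: "(\<Sum>x\<in>galois_orbit ` N. transferred_Qtype f Linf x) = of_nat (card (galois_orbit ` N)) * (\<langle>1\<rangle> + \<langle>-1\<rangle>)"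
  proof -
    have "(\<Sum>x\<in>galois_orbit ` N. transferred_Qtype f Linf x) = (\<Sum>x\<in>galois_orbit ` N. \<langle>1\<rangle> + \<langle>-1\<rangle>)"
      by (rule sum.cong[OF refl]) (auto simp: N_def transferred_Qtype_nonreal)
    then show ?thesis by simp
  qed
  have pairs: "card N = 2 * card (galois_orbit ` N)"
  proof -
    have f2: "card {L' \<in> N. galois_orbit L' = x} = 2" if x: "x \<in> galois_orbit ` N" for x
    proof -
      obtain L where L: "L \<in> N" "x = galois_orbit L" using x by blast
      have ne: "base_change cnj L \<noteq> L" using L(1) galois_orbit_singleton_iff[of L] by (auto simp: N_def galois_orbit_def)
      have "base_change cnj L \<in> N"
      proof -
        have "bitangent f (base_change cnj L)" using L(1) bitangent_line_cnj[OF real] unfolding bitangent_iff N_def by simp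
        moreover have "galois_orbit (base_change cnj L) \<noteq> {base_change cnj L}" using ne by (auto simp: galois_orbit_def base_change_cnj_cnj)
        ultimately show ?thesis unfolding N_def galois_orbit_singleton_iff by blast
      qed
      moreover have "galois_orbit (base_change cnj L) = galois_orbit L" by (auto simp: galois_orbit_def base_change_cnj_cnj)
      moreover have "L' \<in> {L, base_change cnj L}" if "galois_orbit L' = galois_orbit L" for L'
        using that by (auto simp: galois_orbit_def)
      ultimately have "{L' \<in> N. galois_orbit L' = x} = {L, base_change cnj L}" using L by auto
      then show ?thesis using ne by auto
    qed
    have "card N = (\<Sum>L\<in>N. 1)" by simp
    also have "\<dots> = (\<Sum>x\<in>galois_orbit ` N. \<Sum>L' | L' \<in> N \<and> galois_orbit L' = x. 1)" by (rule sum.image_gen[OF finN])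
    also have "\<dots> = (\<Sum>x\<in>galois_orbit ` N. 2)" by (rule sum.cong[OF refl]) (simp add: f2)
    finally show ?thesis by simp
  qed
  define m where "m = card (galois_orbit ` N)"
  have "card B = card real_part + card N" unfolding B(1) by (rule card_Un_disjoint) (use B fin in auto)
  then have total: "np + nm + 2 * m = 28" using cR cnt pairs fin(2) by (simp add: m_def)
  have diff: "int np - int nm = 4" using signed_count_card by (simp add: np_def nm_def R_def)
  have k: "np + m = 16" "nm + m = 12" using total diff by linarith+
  have X: "{galois_orbit L | L. bitangent f L} = galois_orbit ` real_part \<union> galois_orbit ` N"
    unfolding image_Un[symmetric] B(1)[symmetric] by (auto simp: B_def)
  have disj: "galois_orbit ` real_part \<inter> galois_orbit ` N = {}"
  proof -
    have "galois_orbit L \<noteq> galois_orbit M" if "L \<in> real_part" "M \<in> N" for L M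
    proof
      assume e: "galois_orbit L = galois_orbit M"
      have "galois_orbit L = {L}" unfolding galois_orbit_singleton_iff using that(1) by (auto simp: real_part_def)
      then have "M = L" using e by (auto simp: galois_orbit_def)
      then show False using that B(2) by blast
    qed
    then show ?thesis by blast
  qed
  have "(\<Sum>x\<in>{galois_orbit L | L. bitangent f L}. transferred_Qtype f Linf x)
     = (of_nat np * \<langle>1\<rangle> + of_nat nm * \<langle>-1\<rangle>) + of_nat m * (\<langle>1\<rangle> + \<langle>-1\<rangle>)"
    unfolding X m_def real_sum[symmetric] nonreal_sum[symmetric]
    by (rule sum.union_disjoint[OF _ _ disj]) (use B fin in auto)
  also have "\<dots> = of_nat (np + m) * \<langle>1\<rangle> + of_nat (nm + m) * \<langle>-1\<rangle>" by (simp add: algebra_simps)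
  finally show ?thesis unfolding k by simp
qed

end

lemma poly_eval_cv: "poly_eval complex_of_real f (cv x) = of_real (poly_eval of_real f x)"
  by (simp add: poly_eval_def map_vec3_def)

text \<open>It remains to choose affine coordinates adapted to \<open>Linf\<close>: two points on it and a point off it, scaled so that the linear form of \<open>Linf\<close> takes the value \<open>1\<close> there.\<close>

theorem theorem1:
  fixes f :: ternary and Linf :: "real proj_plane"
  assumes "smooth_plane_curve 4 f"
    and "\<not> (\<exists>p :: real proj_plane. on_curve f p \<and> on_line p Linf)"
  shows "int (card {L :: real proj_plane. bitangent f (base_change of_real L) \<and>
             Qtype of_real f Linf L = \<langle>1\<rangle>})
         - int (card {L :: real proj_plane. bitangent f (base_change of_real L) \<and>
             Qtype of_real f Linf L = \<langle>-1\<rangle>}) = 4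
       \<and> (\<Sum>x\<in>{galois_orbit L | L. bitangent f L}. transferred_Qtype f Linf x)
         = 16 * \<langle>1\<rangle> + 12 * \<langle>-1\<rangle>"
proof -
  have "homogeneous 4 f" using assms(1) by (simp add: smooth_plane_curve_def)
  then obtain \<Phi> where \<Phi>: "quartic_form \<Phi>" "real_form \<Phi>" "\<And>x. poly_eval complex_of_real f x = \<Phi> x x x x"
    by (rule quartic_polarization) blast
  interpret ternary_quartic \<Phi> f using \<Phi>(1,3) by (simp add: ternary_quartic_def ternary_quartic_axioms_def)
  let ?l = "homvec Linf"
  obtain i j k :: 3 where ijk: "(UNIV :: 3 set) = {i, j, k}" "i \<noteq> j" "i \<noteq> k" "j \<noteq> k" and lk: "?l $ k \<noteq> 0"
    using index3_with_nonzero[OF homvec(1)[of Linf]] .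
  define e1 e2 e3 where "e1 = axis i 1 + (- (?l $ i / ?l $ k)) *s axis k 1"
    and "e2 = axis j 1 + (- (?l $ j / ?l $ k)) *s axis k 1" and "e3 = (1 / ?l $ k) *s axis k (1 :: real)"
  have lf: "linear_form l e1 = l $ i - ?l $ i / ?l $ k * l $ k" "linear_form l e2 = l $ j - ?l $ j / ?l $ k * l $ k"
    "linear_form l e3 = l $ k / ?l $ k" for l
    unfolding e1_def e2_def e3_def by (simp_all only: linear_form_add linear_form_scale linear_form_axis) simp_all
  have comp: "u = v \<longleftrightarrow> u $ i = v $ i \<and> u $ j = v $ j \<and> u $ k = v $ k" for u v :: "'b^3"
  proof
    assume c: "u $ i = v $ i \<and> u $ j = v $ j \<and> u $ k = v $ k"
    have "u $ m = v $ m" for m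
    proof -
      have "m = i \<or> m = j \<or> m = k" using UNIV_I[of m] unfolding ijk(1) by simp
      then show ?thesis using c by auto
    qed
    then show "u = v" by (simp add: vec_eq_iff)
  qed simp
  have ec: "e1 $ i = 1" "e1 $ j = 0" "e1 $ k = - (?l $ i / ?l $ k)" "e2 $ i = 0" "e2 $ j = 1" "e2 $ k = - (?l $ j / ?l $ k)"
    "e3 $ i = 0" "e3 $ j = 0" "e3 $ k = 1 / ?l $ k"
    using ijk(2-4) by (auto simp: e1_def e2_def e3_def axis_def)
  have real_point: "quartic_at \<Phi> (cv v) \<noteq> 0" if v: "v \<noteq> 0" "linear_form ?l v = 0" for v
  proof
    assume 0: "quartic_at \<Phi> (cv v) = 0"
    obtain c where c: "homvec (proj_point v) = c *s v" using homvec_proj_point[OF v(1)] by blast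
    have "complex_of_real (poly_eval of_real f (homvec (proj_point v))) = 0"
      unfolding poly_eval_cv[symmetric] c \<Phi>(3) cv_scale quartic_scale 0 by simp
    then have "on_curve f (proj_point v)" by (simp add: on_curve_def)
    moreover have "on_line (proj_point v) Linf" unfolding on_line_proj_point[OF v(1)] by (rule v(2))
    ultimately show False using assms(2) by blast
  qed
  interpret quartic_with_line \<Phi> f e1 e2 e3 Linf "axis i 1" "axis j 1"
  proof
    show "\<exists>w. \<Phi> x x x w \<noteq> 0" if "x \<noteq> 0" for x
      using smooth_quartic.smooth[OF smooth_quartic_of_smooth_curve[OF assms(1)] that] .
    show "real_form \<Phi>" by (rule \<Phi>(2))
    show "\<exists>a b c. w = a *s cv e1 + b *s cv e2 + c *s cv e3" for w
      by (rule exI[of _ "w $ i"], rule exI[of _ "w $ j"], rule exI[of _ "linear_form (cv ?l) w"])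
         (use lk in \<open>simp add: comp map_vec3_def ec linear_form_expand[OF ijk] field_simps\<close>)
    show "a = 0 \<and> b = 0 \<and> c = 0" if "a *s cv e1 + b *s cv e2 + c *s cv e3 = 0" for a b c
      using that lk by (auto simp: comp map_vec3_def ec)
    show "quartic_at \<Phi> (cv (x *s e1 + y *s e2)) \<noteq> 0" if "(x, y) \<noteq> (0, 0)" for x y
    proof (rule real_point)
      show "x *s e1 + y *s e2 \<noteq> 0" using that by (auto simp: comp ec)
      show "linear_form ?l (x *s e1 + y *s e2) = 0" using lk by (simp add: lf)
    qed
    show "l = linear_form l e1 *s axis i 1 + linear_form l e2 *s axis j 1 + linear_form l e3 *s ?l" for l
      using lk ijk(2-4) by (auto simp: comp lf axis_def field_simps)
  qed (use lk ijk(2-4) in \<open>auto simp: linear_form_axis ec lf axis_def\<close>)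
  show ?thesis using signed_count_card enriched_count by blast
qed

end
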